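(* Let $\Phi$ be an irreducible simply-laced root system of rank $\geq 3$ and let $R$ be a commutative ring with identity. Let $g\in\mathrm{St}(\Phi,R[X])$ satisfy $g(0)=1\in\mathrm{St}(\Phi,R)$. Then $g$ is trivial in $\mathrm{St}(\Phi,R[X])$ if and only if for every maximal ideal $M\trianglelefteq R$ the image $\lambda_M^*(g)\in\mathrm{St}(\Phi,R_M[X])$ is trivial.
   Context: Commutators are $[x,y]=xyx^{-1}y^{-1}$. For a simply-laced root system $\Phi$ of rank $\geq 2$ and a commutative ring $A$ the Steinberg group $\mathrm{St}(\Phi,A)$ is the group with generators $x_\alpha(r)$, $\alpha\in\Phi$, $r\in A$, and relations: $x_\alpha(r)x_\alpha(s)=x_\alpha(r+s)$; $[x_\alpha(r),x_\beta(s)]=x_{\alpha+\beta}(N_{\alpha,\beta}\,rs)$ if $\alpha+\beta\in\Phi$; $[x_\alpha(r),x_\beta(s)]=1$ if $\alpha+\beta\notin\Phi\cup\{0\}$. Here $N_{\alpha,\beta}=\pm1$ are the structure constants of $\Phi$ (those of the corresponding simple complex Lie algebra with respect to a Chevalley basis). A ring homomorphism $f\colon A\to A'$ induces a homomorphism $f^*\colon\mathrm{St}(\Phi,A)\to\mathrm{St}(\Phi,A')$, $x_\alpha(r)\mapsto x_\alpha(f(r))$. The element $g(0)$ is the image of $g$ under the homomorphism induced by $R[X]\to R$, $X\mapsto 0$. For a maximal ideal $M$, $\lambda_M\colon R\to R_M$ is the localisation at $M$, and $\lambda_M^*\colon\mathrm{St}(\Phi,R[X])\to\mathrm{St}(\Phi,R_M[X])$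 is induced by the corresponding map $R[X]\to R_M[X]$. *)

theory Defs
  imports "HOL-Analysis.Euclidean_Space" "HOL-Algebra.UnivPoly" "HOL-Algebra.Ideal"
begin

unbundle inner_syntax

section \<open>Root systems\<close>

definition cartan_number :: "'v::euclidean_space \<Rightarrow> 'v \<Rightarrow> real" where
  "cartan_number \<beta> \<alpha> = 2 * (\<beta> \<bullet> \<alpha>) / (\<alpha> \<bullet> \<alpha>)"

text \<open>A root system spans its ambient space, so its rank is the dimension of that space.\<close>

definition root_system :: "'v::euclidean_space set \<Rightarrow> bool" where
  "root_system \<Phi> \<longleftrightarrow>
     finite \<Phi> \<and> span \<Phi> = UNIV \<and> 0 \<notin> \<Phi> \<and>
     (\<forall>\<alpha>\<in>\<Phi>. \<forall>\<beta>\<in>\<Phi>. \<beta> - cartan_number \<beta> \<alpha> *\<^sub>R \<alpha> \<in> \<Phi>) \<and>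
     (\<forall>\<alpha>\<in>\<Phi>. \<forall>\<beta>\<in>\<Phi>. cartan_number \<beta> \<alpha> \<in> \<int>) \<and>
     (\<forall>\<alpha>\<in>\<Phi>. \<forall>c. c *\<^sub>R \<alpha> \<in> \<Phi> \<longrightarrow> c = 1 \<or> c = -1)"

definition irreducible_root_system :: "'v::euclidean_space set \<Rightarrow> bool" where
  "irreducible_root_system \<Phi> \<longleftrightarrow>
     root_system \<Phi> \<and> \<Phi> \<noteq> {} \<and>
     (\<forall>\<Phi>1 \<Phi>2. \<Phi> = \<Phi>1 \<union> \<Phi>2 \<and> (\<forall>\<alpha>\<in>\<Phi>1. \<forall>\<beta>\<in>\<Phi>2. \<alpha> \<bullet> \<beta> = 0) \<longrightarrow> \<Phi>1 = {} \<or> \<Phi>2 = {})"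

text \<open>For irreducible root systems, simply-laced means that all roots have the same length.\<close>

definition simply_laced :: "'v::euclidean_space set \<Rightarrow> bool" where
  "simply_laced \<Phi> \<longleftrightarrow> (\<forall>\<alpha>\<in>\<Phi>. \<forall>\<beta>\<in>\<Phi>. norm \<alpha> = norm \<beta>)"


section \<open>Complex Lie algebras and Chevalley bases\<close>

locale complex_lie_algebra = vector_space scale
  for scale :: "complex \<Rightarrow> 'l::ab_group_add \<Rightarrow> 'l" +
  fixes br :: "'l \<Rightarrow> 'l \<Rightarrow> 'l"
  assumes br_add_left: "br (x + y) z = br x z + br y z"
    and br_add_right: "br x (y + z) = br x y + br x z"
    and br_scale_left: "br (scale c x) y = scale c (br x y)"
    and br_scale_right: "br x (scale c y) = scale c (br x y)"
    and br_self: "br x x = 0"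
    and jacobi: "br x (br y z) + br y (br z x) + br z (br x y) = 0"
begin

definition lie_ideal :: "'l set \<Rightarrow> bool" where
  "lie_ideal I \<longleftrightarrow> subspace I \<and> (\<forall>x. \<forall>y\<in>I. br x y \<in> I)"

definition simple_algebra :: bool where
  "simple_algebra \<longleftrightarrow> (\<exists>x y. br x y \<noteq> 0) \<and> (\<forall>I. lie_ideal I \<longrightarrow> I = {0} \<or> I = UNIV)"

definition finite_dimensional :: bool where
  "finite_dimensional \<longleftrightarrow> (\<exists>B. finite B \<and> span B = UNIV)"

fun lower_central :: "'l set \<Rightarrow> nat \<Rightarrow> 'l set" where
  "lower_central H 0 = H"
| "lower_central H (Suc n) = span {br x y |x y. x \<in> H \<and> y \<in> lower_central H n}"

text \<open>A Cartan subalgebra is a nilpotent subalgebra that is its own normaliser.\<close>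

definition cartan_subalgebra :: "'l set \<Rightarrow> bool" where
  "cartan_subalgebra H \<longleftrightarrow>
     subspace H \<and> (\<forall>x\<in>H. \<forall>y\<in>H. br x y \<in> H) \<and>
     (\<exists>n. lower_central H n = {0}) \<and>
     {x. \<forall>y\<in>H. br x y \<in> H} = H"

definition weight_space :: "'l set \<Rightarrow> ('l \<Rightarrow> complex) \<Rightarrow> 'l set" where
  "weight_space H \<mu> = {x. \<forall>h\<in>H. br h x = scale (\<mu> h) x}"

text \<open>Elements of the dual space of \<open>H\<close> are represented by functions that are
  \<open>undefined\<close> outside \<open>H\<close>.\<close>

definition roots :: "'l set \<Rightarrow> ('l \<Rightarrow> complex) set" where
  "roots H = {\<mu> \<in> extensional H.
     (\<forall>x\<in>H. \<forall>y\<in>H. \<mu> (x + y) = \<mu> x + \<mu> y) \<and> (\<forall>x\<in>H. \<forall>c. \<mu> (scale c x) = c * \<mu> x) \<and>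
     (\<exists>x\<in>H. \<mu> x \<noteq> 0) \<and> weight_space H \<mu> \<noteq> {0}}"

end

text \<open>
  The simple Lie algebra of type \<open>\<Phi>\<close>. The real-linear map \<open>rt\<close> sends \<open>v\<close> in the ambient space
  of \<open>\<Phi>\<close> to a functional on \<open>H\<close>; it identifies \<open>\<Phi>\<close> with the set of roots of the Lie algebra with
  respect to \<open>H\<close>, in such a way that Cartan numbers correspond: \<open>br (e \<alpha>) (e (-\<alpha>))\<close> is the coroot
  of \<open>\<alpha>\<close>. The Chevalley basis consists of the \<open>e \<alpha>\<close> and of the coroots of the simple roots; the
  choice of simple roots has no influence on the structure constants.
\<close>

locale chevalley_basis = complex_lie_algebra scale br
  for scale :: "complex \<Rightarrow> 'l::ab_group_add \<Rightarrow> 'l" and br :: "'l \<Rightarrow> 'l \<Rightarrow> 'l" +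
  fixes \<Phi> :: "'v::euclidean_space set"
    and H :: "'l set" and rt :: "'v \<Rightarrow> 'l \<Rightarrow> complex" and e :: "'v \<Rightarrow> 'l"
    and N :: "'v \<Rightarrow> 'v \<Rightarrow> int"
  assumes finite_dimensional: finite_dimensional
    and simple_algebra: simple_algebra
    and cartan_subalgebra: "cartan_subalgebra H"
    and rt_linear: "h \<in> H \<Longrightarrow> linear (\<lambda>v. rt v h)"
    and rt_roots: "(\<lambda>\<alpha>. restrict (rt \<alpha>) H) ` \<Phi> = roots H"
    and e_root_vector: "\<alpha> \<in> \<Phi> \<Longrightarrow> e \<alpha> \<in> weight_space H (rt \<alpha>) - {0}"
    and coroot_in: "\<alpha> \<in> \<Phi> \<Longrightarrow> br (e \<alpha>) (e (- \<alpha>)) \<in> H"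
    and rt_coroot: "\<lbrakk>\<alpha> \<in> \<Phi>; \<beta> \<in> \<Phi>\<rbrakk> \<Longrightarrow>
          rt \<beta> (br (e \<alpha>) (e (- \<alpha>))) = of_real (cartan_number \<beta> \<alpha>)"
    and structure_constants: "\<lbrakk>\<alpha> \<in> \<Phi>; \<beta> \<in> \<Phi>; \<alpha> + \<beta> \<in> \<Phi>\<rbrakk> \<Longrightarrow>
          br (e \<alpha>) (e \<beta>) = scale (of_int (N \<alpha> \<beta>)) (e (\<alpha> + \<beta>))"
    and structure_constants_minus: "\<lbrakk>\<alpha> \<in> \<Phi>; \<beta> \<in> \<Phi>; \<alpha> + \<beta> \<in> \<Phi>\<rbrakk> \<Longrightarrow>
          N (- \<alpha>) (- \<beta>) = - N \<alpha> \<beta>"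

theorem structure_constants_pm1:
  fixes \<Phi> :: "'v::euclidean_space set"
  assumes \<Phi>: "root_system \<Phi>" "simply_laced \<Phi>"
    and C: "chevalley_basis sc br \<Phi> H rt e N"
    and ab: "\<alpha> \<in> \<Phi>" "\<beta> \<in> \<Phi>" "\<alpha> + \<beta> \<in> \<Phi>"
  shows "N \<alpha> \<beta> = 1 \<or> N \<alpha> \<beta> = - 1"
proof -
  interpret chevalley_basis sc br \<Phi> H rt e N by (rule C)
  have H0: "subspace H" using cartan_subalgebra by (simp add: cartan_subalgebra_def)
  have skew: "br x y = - br y x" for x y
    using br_self[of "x + y"] br_self[of x] br_self[of y]
    by (simp add: br_add_left br_add_right eq_neg_iff_add_eq_0 add.commute)
  have br0: "br x 0 = 0" for x using br_scale_right[of x 0 0] by simp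
  have brm: "br x (- y) = - br x y" for x y
    using br_add_right[of x y "- y"] br0[of x] by (simp add: minus_unique)
  have nz: "\<alpha> \<noteq> 0" "\<beta> \<noteq> 0" "\<alpha> + \<beta> \<noteq> 0"
    using \<Phi> ab by (auto simp: root_system_def)
  have neg: "- \<gamma> \<in> \<Phi>" if "\<gamma> \<in> \<Phi>" for \<gamma>
  proof -
    have "\<gamma> - cartan_number \<gamma> \<gamma> *\<^sub>R \<gamma> \<in> \<Phi>" "\<gamma> \<noteq> 0"
      using \<Phi> that by (auto simp: root_system_def)
    then show ?thesis by (simp add: cartan_number_def scaleR_2)
  qed
  have "norm \<alpha> = norm \<beta>" "norm (\<alpha> + \<beta>) = norm \<beta>"
    using \<Phi>(2) ab unfolding simply_laced_def by blast+
  then have len: "\<alpha> \<bullet> \<alpha> = \<beta> \<bullet> \<beta>" "(\<alpha> + \<beta>) \<bullet> (\<alpha> + \<beta>) = \<beta> \<bullet> \<beta>"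
    by (simp_all add: norm_eq)
  then have ip: "2 * (\<alpha> \<bullet> \<beta>) = - (\<beta> \<bullet> \<beta>)"
    by (simp add: inner_simps inner_commute)
  then have cn: "cartan_number \<alpha> \<beta> = - 1"
    using nz by (simp add: cartan_number_def)
  have pos: "\<beta> \<bullet> \<beta> > 0" using nz by simp
  have diff: "\<alpha> - \<beta> \<notin> \<Phi>"
  proof
    assume "\<alpha> - \<beta> \<in> \<Phi>"
    then have "norm (\<alpha> - \<beta>) = norm \<beta>" using \<Phi>(2) ab unfolding simply_laced_def by blast
    then have "(\<alpha> - \<beta>) \<bullet> (\<alpha> - \<beta>) = \<beta> \<bullet> \<beta>" by (simp add: norm_eq)
    then show False using ip len pos by (simp add: inner_simps inner_commute)
  qed
  have rt0: "\<exists>h\<in>H. rt v h \<noteq> 0" if "v \<noteq> 0" for v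
  proof (rule ccontr)
    assume none: "\<not> (\<exists>h\<in>H. rt v h \<noteq> 0)"
    have eq: "rt w (br (e \<gamma>) (e (- \<gamma>))) = of_real (cartan_number w \<gamma>)" if "\<gamma> \<in> \<Phi>" for w \<gamma>
    proof (rule linear_eq_on_span[where B = \<Phi> and f = "\<lambda>w. rt w (br (e \<gamma>) (e (- \<gamma>)))"
          and g = "\<lambda>w. complex_of_real (cartan_number w \<gamma>)"])
      show "linear (\<lambda>w. rt w (br (e \<gamma>) (e (- \<gamma>))))" using coroot_in[OF that] by (rule rt_linear)
      show "linear (\<lambda>w. complex_of_real (cartan_number w \<gamma>))"
        by (rule linearI)
           (simp_all add: cartan_number_def inner_simps add_divide_distrib distrib_left scaleR_conv_of_real)
      show "w \<in> Real_Vector_Spaces.span \<Phi>" using \<Phi> by (simp add: root_system_def)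
    qed (simp add: rt_coroot that)
    have "v \<bullet> \<gamma> = 0" if "\<gamma> \<in> \<Phi>" for \<gamma>
      using eq[OF that, of v] none coroot_in[OF that] by (auto simp: cartan_number_def)
    moreover have "v \<in> Real_Vector_Spaces.span \<Phi>" using \<Phi> by (simp add: root_system_def)
    ultimately have "v \<bullet> v = 0"
      using linear_eq_on_span[where f = "\<lambda>x. v \<bullet> x" and g = "\<lambda>x. 0" and B = \<Phi> and x = v]
      by (simp add: linearI inner_simps)
    with that show False by simp
  qed
  have e_br: "br h (e \<gamma>) = sc (rt \<gamma> h) (e \<gamma>)" if "\<gamma> \<in> \<Phi>" "h \<in> H" for \<gamma> h
    using e_root_vector[OF that(1)] that(2) by (simp add: weight_space_def)
  have zero: "br (e \<alpha>) (e (- \<beta>)) = 0"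
  proof (rule ccontr)
    let ?x = "br (e \<alpha>) (e (- \<beta>))" and ?l = "restrict (rt (\<alpha> - \<beta>)) H"
    assume nx: "?x \<noteq> 0"
    have "br h ?x = sc (rt (\<alpha> - \<beta>) h) ?x" if h: "h \<in> H" for h
    proof -
      have "br h ?x = br (br h (e \<alpha>)) (e (- \<beta>)) + br (e \<alpha>) (br h (e (- \<beta>)))"
        using jacobi[of h "e \<alpha>" "e (- \<beta>)"] skew[of "e (- \<beta>)" "br h (e \<alpha>)"]
        unfolding skew[of "e (- \<beta>)" h] brm by (simp add: algebra_simps)
      also have "\<dots> = sc (rt \<alpha> h + rt (- \<beta>) h) ?x"
        using h ab neg by (simp add: e_br br_scale_left br_scale_right scale_left_distrib)
      also have "rt \<alpha> h + rt (- \<beta>) h = rt (\<alpha> - \<beta>) h"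
        using linear_add[OF rt_linear[OF h], of \<alpha> "- \<beta>"] by simp
      finally show ?thesis .
    qed
    then have x: "?x \<in> weight_space H ?l" by (simp add: weight_space_def)
    have l: "?l (y + z) = ?l y + ?l z \<and> ?l (sc c y) = c * ?l y"
      if "y \<in> H" "z \<in> H" for y z c
    proof -
      have yz: "y + z \<in> H" "sc c y \<in> H"
        using H0 that by (auto simp: subspace_add subspace_scale)
      have w: "br h ?x = sc (?l h) ?x" if "h \<in> H" for h using x that by (simp add: weight_space_def)
      have "sc (?l (y + z)) ?x = sc (?l y + ?l z) ?x"
        using w[OF yz(1)] w[OF that(1)] w[OF that(2)] by (simp add: br_add_left scale_left_distrib)
      moreover have "sc (?l (sc c y)) ?x = sc (c * ?l y) ?x"
        using w[OF yz(2)] w[OF that(1)] by (simp only: br_scale_left scale_scale)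
      ultimately show ?thesis using nx by (simp only: scale_cancel_right) blast
    qed
    have "\<alpha> \<noteq> \<beta>" using ip pos by auto
    then have "\<exists>h\<in>H. ?l h \<noteq> 0" using rt0[of "\<alpha> - \<beta>"] by auto
    with l x nx have "?l \<in> roots H" by (auto simp: roots_def simp del: restrict_apply)
    then obtain \<gamma> where \<gamma>: "\<gamma> \<in> \<Phi>" "?l = restrict (rt \<gamma>) H" unfolding rt_roots[symmetric] by (rule imageE) blast
    have "\<exists>h\<in>H. rt (\<alpha> - \<beta> - \<gamma>) h \<noteq> 0" using \<gamma>(1) diff by (intro rt0) auto
    moreover have "rt (\<alpha> - \<beta> - \<gamma>) h = rt (\<alpha> - \<beta>) h - rt \<gamma> h" if "h \<in> H" for h
      by (rule linear_diff[OF rt_linear[OF that]])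
    moreover have "rt (\<alpha> - \<beta>) h = rt \<gamma> h" if "h \<in> H" for h
      using fun_cong[OF \<gamma>(2), of h] that by simp
    ultimately show False by auto
  qed
  let ?n = "N \<alpha> \<beta>" and ?m = "N (\<alpha> + \<beta>) (- \<beta>)"
  have "br (e (- \<beta>)) (br (e \<alpha>) (e \<beta>)) = - sc (of_int (?n * ?m)) (e \<alpha>)"
    using structure_constants[OF ab] structure_constants[OF ab(3) neg[OF ab(2)]] ab(1)
      skew[of "e (- \<beta>)" "e (\<alpha> + \<beta>)"]
    by (simp add: br_scale_right)
  moreover have "br (e \<alpha>) (br (e \<beta>) (e (- \<beta>))) = e \<alpha>"
    using skew[of "e \<alpha>" "br (e \<beta>) (e (- \<beta>))"] e_br[OF ab(1) coroot_in[OF ab(2)]]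
      rt_coroot[OF ab(2) ab(1)] cn by simp
  moreover have "br (e \<beta>) (br (e (- \<beta>)) (e \<alpha>)) = 0"
    using zero skew[of "e (- \<beta>)" "e \<alpha>"] by (simp add: br0)
  ultimately have "sc 1 (e \<alpha>) = sc (of_int (?n * ?m)) (e \<alpha>)"
    using jacobi[of "e \<alpha>" "e \<beta>" "e (- \<beta>)"] by simp
  moreover have "e \<alpha> \<noteq> 0" using e_root_vector[OF ab(1)] by simp
  ultimately have "(of_int (?n * ?m) :: complex) = 1" by (metis scale_cancel_right)
  then have "?n * ?m = 1" using of_int_eq_1_iff by blast
  then show ?thesis by (auto simp: zmult_eq_1_iff)
qed


section \<open>Groups given by generators and relations\<close>

text \<open>A word is a list of letters; \<open>(a, True)\<close> stands for the generator \<open>a\<close> and \<open>(a, False)\<close>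
  for its inverse. A relation is a pair of words.\<close>

type_synonym 'g word = "('g \<times> bool) list"

definition words :: "'g set \<Rightarrow> 'g word set" where
  "words S = lists (S \<times> UNIV)"

inductive_set word_eq :: "'g set \<Rightarrow> ('g word \<times> 'g word) set \<Rightarrow> ('g word \<times> 'g word) set"
  for S :: "'g set" and Rel :: "('g word \<times> 'g word) set" where
  refl: "w \<in> words S \<Longrightarrow> (w, w) \<in> word_eq S Rel"
| sym: "(v, w) \<in> word_eq S Rel \<Longrightarrow> (w, v) \<in> word_eq S Rel"
| trans: "(u, v) \<in> word_eq S Rel \<Longrightarrow> (v, w) \<in> word_eq S Rel \<Longrightarrow> (u, w) \<in> word_eq S Rel"
| cancel: "u \<in> words S \<Longrightarrow> v \<in> words S \<Longrightarrow> a \<in> S \<Longrightarrow>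
    (u @ [(a, b), (a, \<not> b)] @ v, u @ v) \<in> word_eq S Rel"
| rel: "u \<in> words S \<Longrightarrow> v \<in> words S \<Longrightarrow> (l, r) \<in> Rel \<Longrightarrow> l \<in> words S \<Longrightarrow> r \<in> words S \<Longrightarrow>
    (u @ l @ v, u @ r @ v) \<in> word_eq S Rel"

definition presented_group :: "'g set \<Rightarrow> ('g word \<times> 'g word) set \<Rightarrow> 'g word set monoid" where
  "presented_group S Rel = \<lparr>
     carrier = words S // word_eq S Rel,
     mult = (\<lambda>P Q. \<Union>p\<in>P. \<Union>q\<in>Q. word_eq S Rel `` {p @ q}),
     one = word_eq S Rel `` {[]}\<rparr>"

lemma words_simps [simp]:
  "[] \<in> words S" "u @ v \<in> words S \<longleftrightarrow> u \<in> words S \<and> v \<in> words S"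
  "(a, b) # w \<in> words S \<longleftrightarrow> a \<in> S \<and> w \<in> words S"
  by (auto simp: words_def)

lemma word_eq_in_words: "(u, v) \<in> word_eq S Rel \<Longrightarrow> u \<in> words S \<and> v \<in> words S"
  by (induction rule: word_eq.induct) auto

lemma equiv_word_eq: "equiv (words S) (word_eq S Rel)"
  by (intro equivI refl_onI symI transI)
     (auto intro: word_eq.intros dest: word_eq_in_words)

lemma word_eq_append_left:
  "(u, v) \<in> word_eq S Rel \<Longrightarrow> w \<in> words S \<Longrightarrow> (w @ u, w @ v) \<in> word_eq S Rel"
proof (induction rule: word_eq.induct)
  case (cancel u v a b)
  then show ?case using word_eq.cancel[of "w @ u" S v a b Rel] by simp
next
  case (rel u v l r)
  then show ?case using word_eq.rel[of "w @ u" S v l r Rel] by simp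
qed (auto intro: word_eq.intros)

lemma word_eq_append_right:
  "(u, v) \<in> word_eq S Rel \<Longrightarrow> w \<in> words S \<Longrightarrow> (u @ w, v @ w) \<in> word_eq S Rel"
proof (induction rule: word_eq.induct)
  case (cancel u v a b)
  then show ?case using word_eq.cancel[of u S "v @ w" a b Rel] by simp
next
  case (rel u v l r)
  then show ?case using word_eq.rel[of u S "v @ w" l r Rel] by simp
qed (auto intro: word_eq.intros)

lemma word_eq_append:
  assumes "(u, u') \<in> word_eq S Rel" "(v, v') \<in> word_eq S Rel"
  shows "(u @ v, u' @ v') \<in> word_eq S Rel"
  using word_eq_append_left[OF assms(2), of u] word_eq_append_right[OF assms(1), of v']
    word_eq_in_words[OF assms(1)] word_eq_in_words[OF assms(2)]
  by (blast intro: word_eq.trans)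

lemma word_class_eq_iff:
  assumes "u \<in> words S" "v \<in> words S"
  shows "word_eq S Rel `` {u} = word_eq S Rel `` {v} \<longleftrightarrow> (u, v) \<in> word_eq S Rel"
  using eq_equiv_class_iff[OF equiv_word_eq assms] .

lemma presented_group_mult:
  assumes "u \<in> words S" "v \<in> words S"
  shows "word_eq S Rel `` {u} \<otimes>\<^bsub>presented_group S Rel\<^esub> word_eq S Rel `` {v}
    = word_eq S Rel `` {u @ v}"
proof -
  have "(\<lambda>p q. word_eq S Rel `` {p @ q}) respects2 word_eq S Rel"
    unfolding congruent2_def
    by (auto intro!: equiv_class_eq[OF equiv_word_eq] word_eq_append)
  from UN_equiv_class2[OF equiv_word_eq equiv_word_eq this assms]
  show ?thesis by (simp add: presented_group_def)
qed

lemma presented_group_carrierE: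
  assumes "P \<in> carrier (presented_group S Rel)"
  obtains u where "u \<in> words S" "P = word_eq S Rel `` {u}"
  using assms by (auto simp: presented_group_def elim: quotientE)

lemma presented_group_carrierI:
  "u \<in> words S \<Longrightarrow> word_eq S Rel `` {u} \<in> carrier (presented_group S Rel)"
  by (auto simp: presented_group_def intro: quotientI)

lemma presented_group_one: "\<one>\<^bsub>presented_group S Rel\<^esub> = word_eq S Rel `` {[]}"
  by (simp add: presented_group_def)

lemma word_inverse:
  "u \<in> words S \<Longrightarrow>
    rev (map (\<lambda>(a, b). (a, \<not> b)) u) \<in> words S \<and>
    (rev (map (\<lambda>(a, b). (a, \<not> b)) u) @ u, []) \<in> word_eq S Rel"
proof (induction u)
  case (Cons x u)
  obtain a b where x: "x = (a, b)" by (cases x)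
  let ?u = "rev (map (\<lambda>(a, b). (a, \<not> b)) u)"
  from Cons x have *: "a \<in> S" "u \<in> words S" "?u \<in> words S" "(?u @ u, []) \<in> word_eq S Rel"
    by auto
  then have "(?u @ [(a, \<not> b), (a, b)] @ u, ?u @ u) \<in> word_eq S Rel"
    using word_eq.cancel[of ?u S u a "\<not> b" Rel] by simp
  with * x show ?case by (auto intro: word_eq.trans)
qed (auto intro: word_eq.refl)

theorem group_presented_group: "group (presented_group S Rel)"
proof (rule groupI)
  fix x assume "x \<in> carrier (presented_group S Rel)"
  then obtain u where u: "u \<in> words S" "x = word_eq S Rel `` {u}"
    by (rule presented_group_carrierE)
  from word_inverse[OF u(1)] show "\<exists>y\<in>carrier (presented_group S Rel).
      y \<otimes>\<^bsub>presented_group S Rel\<^esub> x = \<one>\<^bsub>presented_group S Rel\<^esub>"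
    by (intro bexI[of _ "word_eq S Rel `` {rev (map (\<lambda>(a, b). (a, \<not> b)) u)}"])
       (auto simp: u presented_group_mult presented_group_one word_class_eq_iff
          intro: presented_group_carrierI)
qed (auto elim!: presented_group_carrierE
       simp: presented_group_mult presented_group_one intro!: presented_group_carrierI)


section \<open>Steinberg groups\<close>

definition comm_word :: "'g \<Rightarrow> 'g \<Rightarrow> 'g word" where
  "comm_word a b = [(a, True), (b, True), (a, False), (b, False)]"

definition steinberg_gens :: "'v set \<Rightarrow> ('a, 'm) ring_scheme \<Rightarrow> ('v \<times> 'a) set" where
  "steinberg_gens \<Phi> A = \<Phi> \<times> carrier A"

definition steinberg_rels ::
    "'v::euclidean_space set \<Rightarrow> ('v \<Rightarrow> 'v \<Rightarrow> int) \<Rightarrow> ('a, 'm) ring_scheme \<Rightarrow>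
     (('v \<times> 'a) word \<times> ('v \<times> 'a) word) set" where
  "steinberg_rels \<Phi> N A =
     {([((\<alpha>, r), True), ((\<alpha>, s), True)], [((\<alpha>, r \<oplus>\<^bsub>A\<^esub> s), True)]) | \<alpha> r s.
        \<alpha> \<in> \<Phi> \<and> r \<in> carrier A \<and> s \<in> carrier A} \<union>
     {(comm_word (\<alpha>, r) (\<beta>, s), [((\<alpha> + \<beta>, [N \<alpha> \<beta>] \<cdot>\<^bsub>A\<^esub> (r \<otimes>\<^bsub>A\<^esub> s)), True)]) | \<alpha> \<beta> r s.
        \<alpha> \<in> \<Phi> \<and> \<beta> \<in> \<Phi> \<and> \<alpha> + \<beta> \<in> \<Phi> \<and> r \<in> carrier A \<and> s \<in> carrier A} \<union>
     {(comm_word (\<alpha>, r) (\<beta>, s), []) | \<alpha> \<beta> r s.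
        \<alpha> \<in> \<Phi> \<and> \<beta> \<in> \<Phi> \<and> \<alpha> + \<beta> \<notin> \<Phi> \<union> {0} \<and> r \<in> carrier A \<and> s \<in> carrier A}"

definition steinberg_group ::
    "'v::euclidean_space set \<Rightarrow> ('v \<Rightarrow> 'v \<Rightarrow> int) \<Rightarrow> ('a, 'm) ring_scheme \<Rightarrow>
     ('v \<times> 'a) word set monoid" where
  "steinberg_group \<Phi> N A = presented_group (steinberg_gens \<Phi> A) (steinberg_rels \<Phi> N A)"

definition steinberg_elt ::
    "'v::euclidean_space set \<Rightarrow> ('v \<Rightarrow> 'v \<Rightarrow> int) \<Rightarrow> ('a, 'm) ring_scheme \<Rightarrow> 'v \<Rightarrow> 'a \<Rightarrow>
     ('v \<times> 'a) word set" where
  "steinberg_elt \<Phi> N A \<alpha> r =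
     word_eq (steinberg_gens \<Phi> A) (steinberg_rels \<Phi> N A) `` {[((\<alpha>, r), True)]}"

definition map_word :: "('a \<Rightarrow> 'b) \<Rightarrow> ('v \<times> 'a) word \<Rightarrow> ('v \<times> 'b) word" where
  "map_word f = map (\<lambda>((\<alpha>, r), b). ((\<alpha>, f r), b))"

text \<open>The homomorphism of Steinberg groups induced by a ring homomorphism
  (see \<open>steinberg_map_hom\<close> and \<open>steinberg_map_elt\<close> below).\<close>

definition steinberg_map ::
    "'v::euclidean_space set \<Rightarrow> ('v \<Rightarrow> 'v \<Rightarrow> int) \<Rightarrow> ('a, 'm) ring_scheme \<Rightarrow> ('b, 'n) ring_scheme \<Rightarrow>
     ('a \<Rightarrow> 'b) \<Rightarrow> ('v \<times> 'a) word set \<Rightarrow> ('v \<times> 'b) word set" where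
  "steinberg_map \<Phi> N A B f = (\<lambda>g \<in> carrier (steinberg_group \<Phi> N A).
     \<Union>w\<in>g. word_eq (steinberg_gens \<Phi> B) (steinberg_rels \<Phi> N B) `` {map_word f w})"

theorem group_steinberg_group: "group (steinberg_group \<Phi> N A)"
  by (simp add: steinberg_group_def group_presented_group)

lemma map_word_simps [simp]:
  "map_word f [] = []"
  "map_word f (((\<alpha>, r), b) # w) = ((\<alpha>, f r), b) # map_word f w"
  "map_word f (u @ v) = map_word f u @ map_word f v"
  by (simp_all add: map_word_def)

lemma steinberg_map_class:
  assumes A: "ring A" and B: "ring B" and f: "f \<in> ring_hom A B"
    and w: "w \<in> words (steinberg_gens \<Phi> A)"
  shows "map_word f w \<in> words (steinberg_gens \<Phi> B)"
    and "steinberg_map \<Phi> N A B f (word_eq (steinberg_gens \<Phi> A) (steinberg_rels \<Phi> N A) `` {w})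
      = word_eq (steinberg_gens \<Phi> B) (steinberg_rels \<Phi> N B) `` {map_word f w}"
proof -
  interpret ring_hom_ring A B f
    using A B f by (rule ring_hom_ringI2)
  let ?A = "word_eq (steinberg_gens \<Phi> A) (steinberg_rels \<Phi> N A)"
  let ?B = "word_eq (steinberg_gens \<Phi> B) (steinberg_rels \<Phi> N B)"
  have mw: "map_word f v \<in> words (steinberg_gens \<Phi> B)"
    if "v \<in> words (steinberg_gens \<Phi> A)" for v
    using that
    by (auto simp: words_def map_word_def steinberg_gens_def in_lists_conv_set)
  then show "map_word f w \<in> words (steinberg_gens \<Phi> B)" using w by blast
  have pow: "f ([n] \<cdot>\<^bsub>A\<^esub> a) = [n] \<cdot>\<^bsub>B\<^esub> f a" if "a \<in> carrier A" for n :: int and a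
    using group_hom.hom_int_pow[OF a_group_hom] that by (simp add: add_pow_def)
  have rels: "(map_word f l, map_word f r) \<in> steinberg_rels \<Phi> N B"
    if "(l, r) \<in> steinberg_rels \<Phi> N A" for l r
    using that
    unfolding steinberg_rels_def by (fastforce simp: map_word_def comm_word_def pow)
  have main: "(map_word f u, map_word f v) \<in> ?B" if "(u, v) \<in> ?A" for u v
    using that
  proof (induction rule: word_eq.induct)
    case (cancel u v a b)
    then show ?case
      using word_eq.cancel[OF mw[OF cancel(1)] mw[OF cancel(2)], of "(fst a, f (snd a))"]
      by (auto simp: map_word_def steinberg_gens_def split: prod.splits)
  next
    case (rel u v l r)
    then show ?case
      using word_eq.rel[OF mw[OF rel(1)] mw[OF rel(2)], of "map_word f l" "map_word f r"] mw rels
      by (auto simp: map_word_def)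
  qed (auto intro: word_eq.intros mw)
  have "(\<lambda>w. ?B `` {map_word f w}) respects ?A"
    unfolding congruent_def by (auto intro!: equiv_class_eq[OF equiv_word_eq] main)
  from UN_equiv_class[OF equiv_word_eq this w]
  show "steinberg_map \<Phi> N A B f (?A `` {w}) = ?B `` {map_word f w}"
    using presented_group_carrierI[OF w]
    by (simp add: steinberg_map_def steinberg_group_def)
qed

theorem steinberg_map_hom:
  assumes "ring A" "ring B" "f \<in> ring_hom A B"
  shows "steinberg_map \<Phi> N A B f \<in> hom (steinberg_group \<Phi> N A) (steinberg_group \<Phi> N B)"
proof (rule homI)
  fix x y
  assume "x \<in> carrier (steinberg_group \<Phi> N A)" "y \<in> carrier (steinberg_group \<Phi> N A)"
  then show "steinberg_map \<Phi> N A B f x \<in> carrier (steinberg_group \<Phi> N B)"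
    and "steinberg_map \<Phi> N A B f (x \<otimes>\<^bsub>steinberg_group \<Phi> N A\<^esub> y)
      = steinberg_map \<Phi> N A B f x \<otimes>\<^bsub>steinberg_group \<Phi> N B\<^esub> steinberg_map \<Phi> N A B f y"
    unfolding steinberg_group_def
    by (auto elim!: presented_group_carrierE
          simp: presented_group_mult steinberg_map_class[OF assms, folded steinberg_group_def]
          intro!: presented_group_carrierI)
qed

theorem steinberg_map_elt:
  assumes "ring A" "ring B" "f \<in> ring_hom A B" "\<alpha> \<in> \<Phi>" "r \<in> carrier A"
  shows "steinberg_map \<Phi> N A B f (steinberg_elt \<Phi> N A \<alpha> r) = steinberg_elt \<Phi> N B \<alpha> (f r)"
  using assms
  unfolding steinberg_elt_def
  by (subst steinberg_map_class) (auto simp: steinberg_gens_def)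


section \<open>Localisation\<close>

definition loc_rel :: "('a, 'm) ring_scheme \<Rightarrow> 'a set \<Rightarrow> (('a \<times> 'a) \<times> ('a \<times> 'a)) set" where
  "loc_rel R S = {((a, s), (b, t)). a \<in> carrier R \<and> b \<in> carrier R \<and> s \<in> S \<and> t \<in> S \<and>
     (\<exists>u\<in>S. u \<otimes>\<^bsub>R\<^esub> (t \<otimes>\<^bsub>R\<^esub> a) = u \<otimes>\<^bsub>R\<^esub> (s \<otimes>\<^bsub>R\<^esub> b))}"

definition loc_frac :: "('a, 'm) ring_scheme \<Rightarrow> 'a set \<Rightarrow> 'a \<Rightarrow> 'a \<Rightarrow> ('a \<times> 'a) set" where
  "loc_frac R S a s = loc_rel R S `` {(a, s)}"

definition loc_ring :: "('a, 'm) ring_scheme \<Rightarrow> 'a set \<Rightarrow> ('a \<times> 'a) set ring" where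
  "loc_ring R S = \<lparr>
     carrier = (carrier R \<times> S) // loc_rel R S,
     mult = (\<lambda>P Q. \<Union>(a, s)\<in>P. \<Union>(b, t)\<in>Q. loc_frac R S (a \<otimes>\<^bsub>R\<^esub> b) (s \<otimes>\<^bsub>R\<^esub> t)),
     one = loc_frac R S \<one>\<^bsub>R\<^esub> \<one>\<^bsub>R\<^esub>,
     zero = loc_frac R S \<zero>\<^bsub>R\<^esub> \<one>\<^bsub>R\<^esub>,
     add = (\<lambda>P Q. \<Union>(a, s)\<in>P. \<Union>(b, t)\<in>Q.
       loc_frac R S (t \<otimes>\<^bsub>R\<^esub> a \<oplus>\<^bsub>R\<^esub> s \<otimes>\<^bsub>R\<^esub> b) (s \<otimes>\<^bsub>R\<^esub> t))\<rparr>"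

definition localisation_at :: "('a, 'm) ring_scheme \<Rightarrow> 'a set \<Rightarrow> ('a \<times> 'a) set ring" where
  "localisation_at R M = loc_ring R (carrier R - M)"

definition localisation_map :: "('a, 'm) ring_scheme \<Rightarrow> 'a set \<Rightarrow> 'a \<Rightarrow> ('a \<times> 'a) set" where
  "localisation_map R M a = loc_frac R (carrier R - M) a \<one>\<^bsub>R\<^esub>"

definition up_map :: "('a, 'm) ring_scheme \<Rightarrow> ('a \<Rightarrow> 'b) \<Rightarrow> (nat \<Rightarrow> 'a) \<Rightarrow> (nat \<Rightarrow> 'b)" where
  "up_map R f = (\<lambda>p \<in> carrier (UP R). \<lambda>n. f (coeff (UP R) p n))"

context
  fixes R :: "('a, 'm) ring_scheme" (structure) and S
  assumes R: "cring R" and S: "S \<subseteq> carrier R" "\<one> \<in> S" "\<And>s t. s \<in> S \<Longrightarrow> t \<in> S \<Longrightarrow> s \<otimes> t \<in> S"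
begin

interpretation cring R by (rule R)

lemma equiv_loc_rel: "equiv (carrier R \<times> S) (loc_rel R S)"
proof (intro equivI refl_onI symI transI)
  show "loc_rel R S \<subseteq> (carrier R \<times> S) \<times> (carrier R \<times> S)" by (auto simp: loc_rel_def)
  fix x assume "x \<in> carrier R \<times> S" then show "(x, x) \<in> loc_rel R S"
    using S by (auto simp: loc_rel_def)
next
  fix x y assume "(x, y) \<in> loc_rel R S" then show "(y, x) \<in> loc_rel R S"
    using S by (auto simp: loc_rel_def) metis
next
  fix x y z assume xy: "(x, y) \<in> loc_rel R S" and yz: "(y, z) \<in> loc_rel R S"
  obtain a s b t c r where x: "x = (a, s)" "y = (b, t)" "z = (c, r)"
    by (metis surj_pair)
  from xy yz obtain u v where u: "u \<in> S" "u \<otimes> (t \<otimes> a) = u \<otimes> (s \<otimes> b)"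
    and v: "v \<in> S" "v \<otimes> (r \<otimes> b) = v \<otimes> (t \<otimes> c)"
    and c: "a \<in> carrier R" "b \<in> carrier R" "c \<in> carrier R" "s \<in> S" "t \<in> S" "r \<in> S"
    by (auto simp: loc_rel_def x)
  have C: "u \<in> carrier R" "v \<in> carrier R" "s \<in> carrier R" "t \<in> carrier R" "r \<in> carrier R"
    using c u v S by auto
  have "(u \<otimes> v \<otimes> t) \<otimes> (r \<otimes> a) = (v \<otimes> r) \<otimes> (u \<otimes> (t \<otimes> a))"
    using C c(1-3) by algebra
  also have "\<dots> = (u \<otimes> s) \<otimes> (v \<otimes> (r \<otimes> b))" unfolding u using C c(1-3) by algebra
  also have "\<dots> = (u \<otimes> v \<otimes> t) \<otimes> (s \<otimes> c)" unfolding v using C c(1-3) by algebra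
  finally show "(x, z) \<in> loc_rel R S" using u v c S(3) by (auto simp: loc_rel_def x)
qed

lemma loc_frac_eq_iff:
  assumes "a \<in> carrier R" "b \<in> carrier R" "s \<in> S" "t \<in> S"
  shows "loc_frac R S a s = loc_frac R S b t \<longleftrightarrow>
    (\<exists>u\<in>S. u \<otimes> (t \<otimes> a) = u \<otimes> (s \<otimes> b))"
  using assms unfolding loc_frac_def
  by (subst eq_equiv_class_iff[OF equiv_loc_rel]) (auto simp: loc_rel_def)

lemma loc_frac_mult:
  assumes "a \<in> carrier R" "b \<in> carrier R" "s \<in> S" "t \<in> S"
  shows "loc_frac R S a s \<otimes>\<^bsub>loc_ring R S\<^esub> loc_frac R S b t = loc_frac R S (a \<otimes> b) (s \<otimes> t)"
proof -
  have "(\<lambda>p q. loc_frac R S (fst p \<otimes> fst q) (snd p \<otimes> snd q)) respects2 loc_rel R S"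
    unfolding congruent2_def
  proof (intro allI impI ballI, clarify)
    fix a s a' s' b t b' t'
    assume "((a, s), (a', s')) \<in> loc_rel R S" "((b, t), (b', t')) \<in> loc_rel R S"
    then obtain u v where u: "u \<in> S" "u \<otimes> (s' \<otimes> a) = u \<otimes> (s \<otimes> a')"
      and v: "v \<in> S" "v \<otimes> (t' \<otimes> b) = v \<otimes> (t \<otimes> b')"
      and c: "a \<in> carrier R" "b \<in> carrier R" "a' \<in> carrier R" "b' \<in> carrier R"
      and d: "s \<in> S" "t \<in> S" "s' \<in> S" "t' \<in> S"
      by (auto simp: loc_rel_def)
    have C: "u \<in> carrier R" "v \<in> carrier R" "s \<in> carrier R" "t \<in> carrier R"
      "s' \<in> carrier R" "t' \<in> carrier R" using d u v S by auto
    have "(u \<otimes> v) \<otimes> ((s' \<otimes> t') \<otimes> (a \<otimes> b)) = (u \<otimes> (s' \<otimes> a)) \<otimes> (v \<otimes> (t' \<otimes> b))"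
      using C c by algebra
    also have "\<dots> = (u \<otimes> v) \<otimes> ((s \<otimes> t) \<otimes> (a' \<otimes> b'))" unfolding u v using C c by algebra
    finally show "loc_frac R S (fst (a, s) \<otimes> fst (b, t)) (snd (a, s) \<otimes> snd (b, t)) =
        loc_frac R S (fst (a', s') \<otimes> fst (b', t')) (snd (a', s') \<otimes> snd (b', t'))"
      using u v c d S(3) by (subst loc_frac_eq_iff) auto
  qed
  from UN_equiv_class2[OF equiv_loc_rel equiv_loc_rel this, of "(a, s)" "(b, t)"] assms
  show ?thesis by (simp add: loc_ring_def loc_frac_def split_def)
qed

lemma loc_frac_add:
  assumes "a \<in> carrier R" "b \<in> carrier R" "s \<in> S" "t \<in> S"
  shows "loc_frac R S a s \<oplus>\<^bsub>loc_ring R S\<^esub> loc_frac R S b t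
    = loc_frac R S (t \<otimes> a \<oplus> s \<otimes> b) (s \<otimes> t)"
proof -
  have "(\<lambda>p q. loc_frac R S (snd q \<otimes> fst p \<oplus> snd p \<otimes> fst q) (snd p \<otimes> snd q))
      respects2 loc_rel R S"
    unfolding congruent2_def
  proof (intro allI impI ballI, clarify)
    fix a s a' s' b t b' t'
    assume "((a, s), (a', s')) \<in> loc_rel R S" "((b, t), (b', t')) \<in> loc_rel R S"
    then obtain u v where u: "u \<in> S" "u \<otimes> (s' \<otimes> a) = u \<otimes> (s \<otimes> a')"
      and v: "v \<in> S" "v \<otimes> (t' \<otimes> b) = v \<otimes> (t \<otimes> b')"
      and c: "a \<in> carrier R" "b \<in> carrier R" "a' \<in> carrier R" "b' \<in> carrier R"
      and d: "s \<in> S" "t \<in> S" "s' \<in> S" "t' \<in> S"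
      by (auto simp: loc_rel_def)
    have C: "u \<in> carrier R" "v \<in> carrier R" "s \<in> carrier R" "t \<in> carrier R"
      "s' \<in> carrier R" "t' \<in> carrier R" using d u v S by auto
    have "(u \<otimes> v) \<otimes> ((s' \<otimes> t') \<otimes> (t \<otimes> a \<oplus> s \<otimes> b))
        = (v \<otimes> t \<otimes> t') \<otimes> (u \<otimes> (s' \<otimes> a)) \<oplus> (u \<otimes> s \<otimes> s') \<otimes> (v \<otimes> (t' \<otimes> b))"
      using C c by algebra
    also have "\<dots> = (u \<otimes> v) \<otimes> ((s \<otimes> t) \<otimes> (t' \<otimes> a' \<oplus> s' \<otimes> b'))"
      unfolding u v using C c by algebra
    finally show "loc_frac R S (snd (b, t) \<otimes> fst (a, s) \<oplus> snd (a, s) \<otimes> fst (b, t)) (snd (a, s) \<otimes> snd (b, t)) =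
        loc_frac R S (snd (b', t') \<otimes> fst (a', s') \<oplus> snd (a', s') \<otimes> fst (b', t')) (snd (a', s') \<otimes> snd (b', t'))"
      using u v c d C S(3) by (subst loc_frac_eq_iff) auto
  qed
  from UN_equiv_class2[OF equiv_loc_rel equiv_loc_rel this, of "(a, s)" "(b, t)"] assms
  show ?thesis by (simp add: loc_ring_def loc_frac_def split_def)
qed

lemma loc_ring_carrierE:
  assumes "x \<in> carrier (loc_ring R S)"
  obtains a s where "a \<in> carrier R" "s \<in> S" "x = loc_frac R S a s"
  using assms by (auto simp: loc_ring_def loc_frac_def elim: quotientE)

lemma loc_frac_in_carrier:
  "a \<in> carrier R \<Longrightarrow> s \<in> S \<Longrightarrow> loc_frac R S a s \<in> carrier (loc_ring R S)"
  by (auto simp: loc_ring_def loc_frac_def intro: quotientI)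

lemma loc_frac_eqI:
  assumes "a \<in> carrier R" "b \<in> carrier R" "s \<in> S" "t \<in> S" "t \<otimes> a = s \<otimes> b"
  shows "loc_frac R S a s = loc_frac R S b t"
  using assms S(2) by (subst loc_frac_eq_iff) auto

lemma loc_ring_zero: "\<zero>\<^bsub>loc_ring R S\<^esub> = loc_frac R S \<zero> \<one>"
  and loc_ring_one: "\<one>\<^bsub>loc_ring R S\<^esub> = loc_frac R S \<one> \<one>"
  by (simp_all add: loc_ring_def)

theorem cring_loc_ring: "cring (loc_ring R S)"
proof -
  note simps = loc_frac_mult loc_frac_add loc_ring_zero loc_ring_one loc_frac_in_carrier S
  have [simp]: "s \<in> S \<Longrightarrow> s \<in> carrier R" for s using S by blast
  note ac = m_assoc m_comm m_lcomm a_assoc a_comm a_lcomm l_distr r_distr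
  have neg: "\<exists>y\<in>carrier (loc_ring R S). y \<oplus>\<^bsub>loc_ring R S\<^esub> x = \<zero>\<^bsub>loc_ring R S\<^esub>"
    if "x \<in> carrier (loc_ring R S)" for x
  proof -
    from that obtain a s where x: "a \<in> carrier R" "s \<in> S" "x = loc_frac R S a s"
      by (rule loc_ring_carrierE)
    then have "loc_frac R S (\<ominus> a) s \<oplus>\<^bsub>loc_ring R S\<^esub> x = \<zero>\<^bsub>loc_ring R S\<^esub>"
      unfolding x(3) by (simp add: simps) (rule loc_frac_eqI, simp_all add: S r_minus l_neg)
    then show ?thesis using x by (meson loc_frac_in_carrier a_inv_closed)
  qed
  show ?thesis
  proof (intro cringI abelian_groupI comm_monoidI neg)
    fix x y z assume "x \<in> carrier (loc_ring R S)" "y \<in> carrier (loc_ring R S)" "z \<in> carrier (loc_ring R S)"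
    then obtain a s b t c r where
      c: "a \<in> carrier R" "s \<in> S" "b \<in> carrier R" "t \<in> S" "c \<in> carrier R" "r \<in> S"
      and x: "x = loc_frac R S a s" "y = loc_frac R S b t" "z = loc_frac R S c r"
      by (elim loc_ring_carrierE)
    show "(x \<oplus>\<^bsub>loc_ring R S\<^esub> y) \<otimes>\<^bsub>loc_ring R S\<^esub> z
        = x \<otimes>\<^bsub>loc_ring R S\<^esub> z \<oplus>\<^bsub>loc_ring R S\<^esub> y \<otimes>\<^bsub>loc_ring R S\<^esub> z"
      using c unfolding x by (simp add: simps) (rule loc_frac_eqI, simp_all add: S ac)
  qed (auto elim!: loc_ring_carrierE simp: simps ac)
qed

theorem loc_frac_ring_hom: "(\<lambda>a. loc_frac R S a \<one>) \<in> ring_hom R (loc_ring R S)"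
  by (rule ring_hom_memI)
     (simp_all add: loc_frac_mult loc_frac_add loc_ring_one loc_frac_in_carrier S)

end

theorem
  assumes "cring R" "maximalideal M R"
  shows cring_localisation_at: "cring (localisation_at R M)"
    and localisation_map_ring_hom: "localisation_map R M \<in> ring_hom R (localisation_at R M)"
proof -
  interpret primeideal M R by (rule cring.maximalideal_prime[OF assms])
  have "\<one>\<^bsub>R\<^esub> \<notin> M" using I_notcarr one_imp_carrier by blast
  then have *: "carrier R - M \<subseteq> carrier R" "\<one>\<^bsub>R\<^esub> \<in> carrier R - M"
    "\<And>s t. s \<in> carrier R - M \<Longrightarrow> t \<in> carrier R - M \<Longrightarrow> s \<otimes>\<^bsub>R\<^esub> t \<in> carrier R - M"
    using I_prime by auto
  show "cring (localisation_at R M)"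
    unfolding localisation_at_def by (rule cring_loc_ring[OF assms(1) *])
  show "localisation_map R M \<in> ring_hom R (localisation_at R M)"
    unfolding localisation_at_def localisation_map_def[abs_def]
    by (rule loc_frac_ring_hom[OF assms(1) *])
qed

theorem up_map_ring_hom:
  assumes "cring A" "cring B" "f \<in> ring_hom A B"
  shows "up_map A f \<in> ring_hom (UP A) (UP B)"
proof -
  interpret A: UP_cring A "UP A" using assms(1) by (rule UP_cring.intro)
  interpret B: UP_cring B "UP B" using assms(2) by (rule UP_cring.intro)
  interpret f: ring_hom_cring A B f
    using assms by (intro ring_hom_cringI)
  have up: "(\<lambda>n. f (p n)) \<in> up B" if "p \<in> up A" for p
  proof -
    from that obtain n where "\<And>m. n < m \<Longrightarrow> p m = \<zero>\<^bsub>A\<^esub>" "\<And>m. p m \<in> carrier A"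
      by (auto simp: up_def bound_def)
    then show ?thesis by (auto simp: up_def intro!: exI[of _ n] bound.intro)
  qed
  show ?thesis
  proof (rule ring_hom_memI)
    fix p q assume pq: "p \<in> carrier (UP A)" "q \<in> carrier (UP A)"
    then have pq': "p \<in> up A" "q \<in> up A" by (simp_all add: UP_def)
    then have c: "p n \<in> carrier A" "q n \<in> carrier A" for n by (auto simp: up_def)
    have sum: "f (\<Oplus>\<^bsub>A\<^esub>i\<in>{..n}. p i \<otimes>\<^bsub>A\<^esub> q (n - i))
        = (\<Oplus>\<^bsub>B\<^esub>i\<in>{..n}. f (p i) \<otimes>\<^bsub>B\<^esub> f (q (n - i)))" for n
      using c by (subst f.hom_finsum) (auto intro!: B.R.finsum_cong')
    have m: "p \<oplus>\<^bsub>UP A\<^esub> q \<in> carrier (UP A)" "p \<otimes>\<^bsub>UP A\<^esub> q \<in> carrier (UP A)"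
      using pq by simp_all
    show "up_map A f p \<in> carrier (UP B)" using up pq' by (simp add: up_map_def UP_def)
    show "up_map A f (p \<oplus>\<^bsub>UP A\<^esub> q) = up_map A f p \<oplus>\<^bsub>UP B\<^esub> up_map A f q"
      using m(1) pq' up c by (simp add: up_map_def UP_def)
    show "up_map A f (p \<otimes>\<^bsub>UP A\<^esub> q) = up_map A f p \<otimes>\<^bsub>UP B\<^esub> up_map A f q"
      using m(2) pq' up c by (simp add: up_map_def UP_def sum)
  next
    show "up_map A f \<one>\<^bsub>UP A\<^esub> = \<one>\<^bsub>UP B\<^esub>"
      using A.P.one_closed by (auto simp: up_map_def UP_def)
  qed
qed

end

(* Quillen patching reduces the theorem to a dilation principle: if w becomes trivial over the
   localisation R_S[X] and w(0) = 1, then w(sX) is trivial over R[X] for some s in S. With the ring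
   B of pairs of an element of R and a polynomial over R_S with the same constant term, w dies over
   B as soon as St(B) -> St(R_S[X]) is injective on the kernel of St(B) -> St(R) (excision), and
   the substitutions X -> sX lift finitely many relations over B to R[X].

   For excision one lets St(R_S[X]) act. S acts bijectively on the ideal I = X R_S[X] of B. A system
   of root elements assigns to each root and each exponent (a finite product of elements of S that is
   thought of as a denominator) an element of a group, subject to the Steinberg relations whenever
   the parameters are divisible enough. Root elements with denominators act on systems by
   conjugation. The commutator formula does not describe the effect on the values at the opposite
   root, so this root is first eliminated: its root elements are written as commutators, and that
   the result is independent of all choices is where rank >= 3 enters. *)
theory Submission
  imports Defs "HOL-Algebra.Subrings" "HOL-Algebra.Ring_Divisibility" "HOL-Library.Multiset"
begin


section \<open>Root systems and structure constants\<close>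

text \<open>Excision is read off from an invariant of words. A state is a pair
  \<open>(f, h)\<close>: a letter of St(A) conjugates the system \<open>f\<close> by the fractional
  part of its parameter and adds to \<open>h\<close> the contribution of the part in
  \<open>I\<close>. A word over \<open>B\<close> that starts from the root elements of St(B) ends
  with \<open>h\<close> equal to its value times the inverse of the value of its constant part. If
  the word is trivial over \<open>A\<close>, then \<open>h\<close> cannot have changed, so the word
  equals its constant part.

  The obstacle is that St(B) contains no root elements with denominators. Conjugation by them is
  known only through the commutator formula, for large exponents and away from the opposite root.
  Hence systems are compared for large exponents only, the action consists of relations instead of
  functions, and roots without a formula are reached as sums of two roots that have one.

  For patching, dilation is applied over R[Y] to w(Y + X) w(Y)^-1, which is trivial at X = 0 by
  construction. The \<open>s\<close> with w(Y + s X) = w(Y) form an ideal, whereas for w(s X) = 1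
  closure under addition is not visible.\<close>

locale signed_root_system =
  fixes \<Phi> :: "'v::ab_group_add set" and N :: "'v \<Rightarrow> 'v \<Rightarrow> int" and c :: "'v \<Rightarrow> 'v \<Rightarrow> real"
  assumes c_add: "c (x + y) z = c x z + c y z"
    and c_minus: "c (- x) y = - c x y"
    and c_sym: "c x y = c y x"
    and c_root: "\<lbrakk>\<alpha> \<in> \<Phi>; \<beta> \<in> \<Phi>\<rbrakk> \<Longrightarrow> c \<alpha> \<beta> \<in> {-2, -1, 0, 1, 2}"
    and c_self: "\<alpha> \<in> \<Phi> \<Longrightarrow> c \<alpha> \<alpha> = 2"
    and c_opposite: "\<lbrakk>\<alpha> \<in> \<Phi>; \<beta> \<in> \<Phi>; c \<alpha> \<beta> = -2\<rbrakk> \<Longrightarrow> \<beta> = - \<alpha>"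
    and neg_root: "\<alpha> \<in> \<Phi> \<Longrightarrow> - \<alpha> \<in> \<Phi>"
    and sum_root: "\<lbrakk>\<alpha> \<in> \<Phi>; \<beta> \<in> \<Phi>\<rbrakk> \<Longrightarrow> \<alpha> + \<beta> \<in> \<Phi> \<longleftrightarrow> c \<alpha> \<beta> = -1"
    and N_unit: "\<lbrakk>\<alpha> \<in> \<Phi>; \<beta> \<in> \<Phi>; c \<alpha> \<beta> = -1\<rbrakk> \<Longrightarrow> N \<alpha> \<beta> = 1 \<or> N \<alpha> \<beta> = -1"
    and N_skew: "\<lbrakk>\<alpha> \<in> \<Phi>; \<beta> \<in> \<Phi>; c \<alpha> \<beta> = -1\<rbrakk> \<Longrightarrow> N \<beta> \<alpha> = - N \<alpha> \<beta>"
    and N_jacobi: "\<lbrakk>\<alpha> \<in> \<Phi>; \<beta> \<in> \<Phi>; \<gamma> \<in> \<Phi>; c \<alpha> \<beta> = -1; c \<beta> \<gamma> = -1; c \<alpha> \<gamma> = 0\<rbrakk> \<Longrightarrow>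
          N \<beta> \<gamma> * N \<alpha> (\<beta> + \<gamma>) = N \<alpha> \<beta> * N (\<alpha> + \<beta>) \<gamma>"
    and avoiding_root: "\<lbrakk>\<xi> \<in> \<Phi>; \<zeta> \<in> \<Phi>\<rbrakk> \<Longrightarrow> \<exists>\<mu>\<in>\<Phi>. c \<xi> \<mu> = 1 \<and> \<mu> \<noteq> \<zeta> \<and> \<xi> - \<mu> \<noteq> \<zeta>"

text \<open>The bracket of two root vectors is a weight vector for
  \<open>rt (\<alpha> + \<beta>)\<close>. If it were nonzero, this weight would be a root of the Lie
  algebra, hence agree on \<open>H\<close> with \<open>rt \<gamma>\<close> for some
  \<open>\<gamma>\<close> in \<open>\<Phi>\<close>; as \<open>rt\<close> separates vectors,
  \<open>\<alpha> + \<beta>\<close> would be \<open>\<gamma>\<close>.\<close>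

lemma chevalley_bracket_zero:
  fixes \<Phi> :: "'v::euclidean_space set"
  assumes \<Phi>: "root_system \<Phi>"
    and C: "chevalley_basis sc br \<Phi> H rt e N"
    and ab: "\<alpha> \<in> \<Phi>" "\<beta> \<in> \<Phi>" "\<alpha> + \<beta> \<notin> \<Phi>" "\<alpha> + \<beta> \<noteq> 0"
  shows "br (e \<alpha>) (e \<beta>) = 0"
proof (rule ccontr)
  interpret chevalley_basis sc br \<Phi> H rt e N by (rule C)
  have H0: "subspace H" using cartan_subalgebra by (simp add: cartan_subalgebra_def)
  \<comment> \<open>The coroots already detect \<open>v\<close>: on them \<open>rt v\<close> takes
    the Cartan numbers of \<open>v\<close>, and a vector orthogonal to the spanning set
    \<open>\<Phi>\<close> is zero.\<close>
  have rt0: "\<exists>h\<in>H. rt v h \<noteq> 0" if "v \<noteq> 0" for v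
  proof (rule ccontr)
    assume none: "\<not> (\<exists>h\<in>H. rt v h \<noteq> 0)"
    have "v \<bullet> \<gamma> = 0" if g: "\<gamma> \<in> \<Phi>" for \<gamma>
    proof -
      let ?h = "br (e \<gamma>) (e (- \<gamma>))"
      have "rt v ?h = of_real (cartan_number v \<gamma>)"
      proof (rule linear_eq_on_span[where B = \<Phi> and f = "\<lambda>w. rt w ?h"
            and g = "\<lambda>w. complex_of_real (cartan_number w \<gamma>)"])
        show "linear (\<lambda>w. rt w ?h)" using coroot_in[OF g] by (rule rt_linear)
        show "linear (\<lambda>w. complex_of_real (cartan_number w \<gamma>))"
          by (rule linearI) (simp_all add: cartan_number_def inner_simps add_divide_distrib
              distrib_left scaleR_conv_of_real)
        show "v \<in> Real_Vector_Spaces.span \<Phi>" using \<Phi> by (simp add: root_system_def)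
      qed (simp add: rt_coroot g)
      then show ?thesis using none coroot_in[OF g] by (auto simp: cartan_number_def)
    qed
    moreover have "v \<in> Real_Vector_Spaces.span \<Phi>" using \<Phi> by (simp add: root_system_def)
    ultimately have "v \<bullet> v = 0"
      using linear_eq_on_span[where f = "\<lambda>x. v \<bullet> x" and g = "\<lambda>x. 0" and B = \<Phi> and x = v]
      by (simp add: linearI inner_simps)
    with that show False by simp
  qed
  have skew: "br x y = - br y x" for x y
    using br_self[of "x + y"] br_self[of x] br_self[of y]
    by (simp add: br_add_left br_add_right eq_neg_iff_add_eq_0 add.commute)
  let ?x = "br (e \<alpha>) (e \<beta>)"
  assume nx: "?x \<noteq> 0"
  have e_br: "br h (e \<gamma>) = sc (rt \<gamma> h) (e \<gamma>)" if "\<gamma> \<in> \<Phi>" "h \<in> H" for \<gamma> h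
    using e_root_vector[OF that(1)] that(2) by (simp add: weight_space_def)
  have w: "br h ?x = sc (rt (\<alpha> + \<beta>) h) ?x" if h: "h \<in> H" for h
  proof -
    have "br h ?x = br (br h (e \<alpha>)) (e \<beta>) + br (e \<alpha>) (br h (e \<beta>))"
      using jacobi[of "e \<alpha>" "e \<beta>" h] skew[of "e \<beta>" "br h (e \<alpha>)"] skew[of "e \<beta>" h]
        skew[of h "e \<alpha>"] br_scale_right[of "e \<alpha>" "-1" "br h (e \<beta>)"]
        br_scale_right[of "e \<beta>" "-1" "br h (e \<alpha>)"]
      by (simp add: algebra_simps)
    also have "\<dots> = sc (rt \<alpha> h + rt \<beta> h) ?x"
      using h ab by (simp add: e_br br_scale_left br_scale_right scale_left_distrib)
    also have "rt \<alpha> h + rt \<beta> h = rt (\<alpha> + \<beta>) h"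
      using linear_add[OF rt_linear[OF h], of \<alpha> \<beta>] by simp
    finally show ?thesis .
  qed
  let ?l = "restrict (rt (\<alpha> + \<beta>)) H"
  \<comment> \<open>The weight inherits linearity from the bracket, because coefficients of the
    nonzero vector \<open>?x\<close> can be compared.\<close>
  have l: "?l (y + z) = ?l y + ?l z \<and> ?l (sc d y) = d * ?l y" if "y \<in> H" "z \<in> H" for y z d
  proof -
    have yz: "y + z \<in> H" "sc d y \<in> H"
      using H0 that by (auto simp: subspace_add subspace_scale)
    have "sc (?l (y + z)) ?x = sc (?l y + ?l z) ?x"
      using w[OF yz(1)] w[OF that(1)] w[OF that(2)] yz that
      by (simp add: br_add_left scale_left_distrib)
    moreover have "sc (?l (sc d y)) ?x = sc (d * ?l y) ?x"
      using w[OF yz(2)] w[OF that(1)] yz that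
      by (simp only: br_scale_left scale_scale restrict_apply if_True)
    ultimately show ?thesis using nx by (simp only: scale_cancel_right) blast
  qed
  have "?x \<in> weight_space H ?l" using w by (simp add: weight_space_def)
  moreover have "\<exists>h\<in>H. ?l h \<noteq> 0" using rt0[OF ab(4)] by auto
  ultimately have "?l \<in> roots H" using l nx by (auto simp: roots_def simp del: restrict_apply)
  then obtain \<gamma> where \<gamma>: "\<gamma> \<in> \<Phi>" "?l = restrict (rt \<gamma>) H"
    unfolding rt_roots[symmetric] by (rule imageE) blast
  then have "\<exists>h\<in>H. rt (\<alpha> + \<beta> - \<gamma>) h \<noteq> 0" using ab by (intro rt0) auto
  moreover have "rt (\<alpha> + \<beta> - \<gamma>) h = rt (\<alpha> + \<beta>) h - rt \<gamma> h" if "h \<in> H" for h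
    by (rule linear_diff[OF rt_linear[OF that]])
  moreover have "rt (\<alpha> + \<beta>) h = rt \<gamma> h" if "h \<in> H" for h
    using fun_cong[OF \<gamma>(2), of h] that by simp
  ultimately show False by auto
qed

lemma structure_constants_skew:
  fixes \<Phi> :: "'v::euclidean_space set"
  assumes C: "chevalley_basis sc br \<Phi> H rt e N"
    and ab: "\<alpha> \<in> \<Phi>" "\<beta> \<in> \<Phi>" "\<alpha> + \<beta> \<in> \<Phi>"
  shows "N \<beta> \<alpha> = - N \<alpha> \<beta>"
proof -
  interpret chevalley_basis sc br \<Phi> H rt e N by (rule C)
  have "br (e \<beta>) (e \<alpha>) = - br (e \<alpha>) (e \<beta>)"
    using br_self[of "e \<alpha> + e \<beta>"] br_self[of "e \<alpha>"] br_self[of "e \<beta>"]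
    by (simp add: br_add_left br_add_right eq_neg_iff_add_eq_0 add.commute)
  then have "sc (of_int (N \<beta> \<alpha>)) (e (\<alpha> + \<beta>)) = sc (of_int (- N \<alpha> \<beta>)) (e (\<alpha> + \<beta>))"
    using structure_constants[of \<alpha> \<beta>] structure_constants[of \<beta> \<alpha>] ab by (simp add: add.commute)
  moreover have "e (\<alpha> + \<beta>) \<noteq> 0" using e_root_vector[OF ab(3)] by simp
  ultimately have "(of_int (N \<beta> \<alpha>) :: complex) = of_int (- N \<alpha> \<beta>)" by (metis scale_cancel_right)
  then show ?thesis using of_int_eq_iff by blast
qed

text \<open>Since \<open>\<alpha> + \<gamma>\<close> is neither a root nor zero, one term of the
  Jacobi identity drops out, and the other two are multiples of the same nonzero root vector. All
  later agreements of signs come from this identity and from skew-symmetry.\<close>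

lemma structure_constants_jacobi:
  fixes \<Phi> :: "'v::euclidean_space set"
  assumes \<Phi>: "root_system \<Phi>"
    and C: "chevalley_basis sc br \<Phi> H rt e N"
    and abc: "\<alpha> \<in> \<Phi>" "\<beta> \<in> \<Phi>" "\<gamma> \<in> \<Phi>"
    and sums: "\<alpha> + \<beta> \<in> \<Phi>" "\<beta> + \<gamma> \<in> \<Phi>" "\<alpha> + \<beta> + \<gamma> \<in> \<Phi>"
    and zero: "\<alpha> + \<gamma> \<notin> \<Phi>" "\<alpha> + \<gamma> \<noteq> 0"
  shows "N \<beta> \<gamma> * N \<alpha> (\<beta> + \<gamma>) = N \<alpha> \<beta> * N (\<alpha> + \<beta>) \<gamma>"
proof -
  interpret chevalley_basis sc br \<Phi> H rt e N by (rule C)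
  have skew: "br x y = - br y x" for x y
    using br_self[of "x + y"] br_self[of x] br_self[of y]
    by (simp add: br_add_left br_add_right eq_neg_iff_add_eq_0 add.commute)
  have br0: "br x 0 = 0" for x using br_scale_right[of x 0 0] by simp
  let ?e = "e (\<alpha> + \<beta> + \<gamma>)"
  have "br (e \<gamma>) (e \<alpha>) = 0"
    using chevalley_bracket_zero[OF \<Phi> C abc(3,1)] zero by (simp add: add.commute)
  then have "br (e \<alpha>) (br (e \<beta>) (e \<gamma>)) = br (br (e \<alpha>) (e \<beta>)) (e \<gamma>)"
    using jacobi[of "e \<alpha>" "e \<beta>" "e \<gamma>"] skew[of "e \<gamma>" "br (e \<alpha>) (e \<beta>)"] by (simp add: br0)
  also have "br (e \<alpha>) (br (e \<beta>) (e \<gamma>)) = sc (of_int (N \<beta> \<gamma> * N \<alpha> (\<beta> + \<gamma>))) ?e"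
    using structure_constants[of \<beta> \<gamma>] structure_constants[of \<alpha> "\<beta> + \<gamma>"] abc sums
    by (simp add: br_scale_right add.assoc)
  also have "br (br (e \<alpha>) (e \<beta>)) (e \<gamma>) = sc (of_int (N \<alpha> \<beta> * N (\<alpha> + \<beta>) \<gamma>)) ?e"
    using structure_constants[of \<alpha> \<beta>] structure_constants[of "\<alpha> + \<beta>" \<gamma>] abc sums
    by (simp add: br_scale_left add.assoc)
  finally have "sc (of_int (N \<beta> \<gamma> * N \<alpha> (\<beta> + \<gamma>))) ?e = sc (of_int (N \<alpha> \<beta> * N (\<alpha> + \<beta>) \<gamma>)) ?e" .
  moreover have "?e \<noteq> 0" using e_root_vector[OF sums(3)] by simp
  ultimately have "(of_int (N \<beta> \<gamma> * N \<alpha> (\<beta> + \<gamma>)) :: complex) = of_int (N \<alpha> \<beta> * N (\<alpha> + \<beta>) \<gamma>)"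
    by (metis scale_cancel_right)
  then show ?thesis using of_int_eq_iff by blast
qed

text \<open>\<open>c\<close> is the inner product rescaled so that every root has norm 2. On roots
  it is the Cartan number, but it is bilinear and symmetric on the whole space, so sums of roots can
  be treated by plain arithmetic.\<close>

theorem signed_root_system_chevalley:
  fixes \<Phi> :: "'v::euclidean_space set"
  assumes irr: "irreducible_root_system \<Phi>" and sl: "simply_laced \<Phi>" and dim: "DIM('v) \<ge> 3"
    and C: "chevalley_basis sc br \<Phi> H rt e N"
  obtains c where "signed_root_system \<Phi> N c"
proof -
  have rs: "root_system \<Phi>" "\<Phi> \<noteq> {}" using irr by (auto simp: irreducible_root_system_def)
  then obtain \<alpha>0 where \<alpha>0: "\<alpha>0 \<in> \<Phi>" by blast
  define L where "L = \<alpha>0 \<bullet> \<alpha>0"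
  define c where "c = (\<lambda>x y :: 'v. 2 * (x \<bullet> y) / L)"
  have z: "0 \<notin> \<Phi>" using rs by (simp add: root_system_def)
  have L: "L > 0" using \<alpha>0 z unfolding L_def by auto
  have len: "\<alpha> \<bullet> \<alpha> = L" if "\<alpha> \<in> \<Phi>" for \<alpha>
  proof -
    have "norm \<alpha> = norm \<alpha>0" using sl \<alpha>0 that unfolding simply_laced_def by blast
    then show ?thesis by (simp add: norm_eq L_def)
  qed
  have cc: "cartan_number \<beta> \<alpha> = c \<beta> \<alpha>" if "\<alpha> \<in> \<Phi>" for \<alpha> \<beta>
    using len[OF that] by (simp add: cartan_number_def c_def)
  have c_add: "c (x + y) w = c x w + c y w" for x y w
    by (simp add: c_def inner_simps add_divide_distrib)
  have c_minus: "c (- x) y = - c x y" for x y by (simp add: c_def)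
  have c_sym: "c x y = c y x" for x y by (simp add: c_def inner_commute)
  have c_self: "c \<alpha> \<alpha> = 2" if "\<alpha> \<in> \<Phi>" for \<alpha> using len[OF that] L by (simp add: c_def)
  have refl: "\<beta> - c \<beta> \<alpha> *\<^sub>R \<alpha> \<in> \<Phi>" and ints: "c \<beta> \<alpha> \<in> \<int>" if "\<alpha> \<in> \<Phi>" "\<beta> \<in> \<Phi>" for \<alpha> \<beta>
    using rs(1) that cc[OF that(1), of \<beta>] unfolding root_system_def by metis+
  have neg: "- \<alpha> \<in> \<Phi>" if "\<alpha> \<in> \<Phi>" for \<alpha>
    using refl[OF that that] c_self[OF that] by (simp add: scaleR_2)
  have opp: "\<beta> = - \<alpha>" if "\<alpha> \<in> \<Phi>" "\<beta> \<in> \<Phi>" "c \<alpha> \<beta> = -2" for \<alpha> \<beta>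
  proof -
    have "\<alpha> \<bullet> \<beta> = - L" using that(3) L by (simp add: c_def field_simps)
    then have "(\<alpha> + \<beta>) \<bullet> (\<alpha> + \<beta>) = 0"
      using len[OF that(1)] len[OF that(2)] by (simp add: inner_simps inner_commute)
    then show ?thesis by (simp add: eq_neg_iff_add_eq_0 add.commute)
  qed
  have c_root: "c \<alpha> \<beta> \<in> {-2, -1, 0, 1, 2}" if r: "\<alpha> \<in> \<Phi>" "\<beta> \<in> \<Phi>" for \<alpha> \<beta>
  proof -
    have "\<bar>\<alpha> \<bullet> \<beta>\<bar> \<le> norm \<alpha> * norm \<beta>" by (rule Cauchy_Schwarz_ineq2)
    also have "norm \<alpha> = norm \<beta>" using sl r unfolding simply_laced_def by blast
    also have "norm \<beta> * norm \<beta> = L" using len[OF r(2)] by (simp add: power2_norm_eq_inner flip: power2_eq_square)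
    finally have "\<bar>c \<alpha> \<beta>\<bar> \<le> 2" using L by (simp add: c_def abs_divide abs_mult pos_divide_le_eq)
    moreover obtain k where k: "c \<alpha> \<beta> = of_int k" using ints[OF r(2,1)] by (auto elim: Ints_cases)
    ultimately have "\<bar>k\<bar> \<le> 2" by linarith
    then have "k \<in> {-2, -1, 0, 1, 2}" by auto
    then show ?thesis using k by auto
  qed
  have sum_root: "\<alpha> + \<beta> \<in> \<Phi> \<longleftrightarrow> c \<alpha> \<beta> = -1" if "\<alpha> \<in> \<Phi>" "\<beta> \<in> \<Phi>" for \<alpha> \<beta>
  proof
    assume "\<alpha> + \<beta> \<in> \<Phi>"
    then have "c (\<alpha> + \<beta>) (\<alpha> + \<beta>) = 2" by (rule c_self)
    moreover have "c (\<alpha> + \<beta>) (\<alpha> + \<beta>) = c \<alpha> \<alpha> + 2 * c \<alpha> \<beta> + c \<beta> \<beta>"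
      using c_add c_sym by (metis add.assoc mult_2)
    ultimately show "c \<alpha> \<beta> = -1" using c_self that by simp
  next
    assume "c \<alpha> \<beta> = -1"
    then show "\<alpha> + \<beta> \<in> \<Phi>" using refl[OF that(2,1)] by simp
  qed
  \<comment> \<open>If every root with value 1 at \<open>\<xi>\<close> were \<open>\<zeta>\<close>
    or \<open>\<xi> - \<zeta>\<close>, these roots and \<open>\<xi>\<close> would span at most a
    plane \<open>V\<close>. Roots outside \<open>V\<close> turn out to be orthogonal to
    \<open>V\<close>, so irreducibility puts all of \<open>\<Phi>\<close> into that plane, which
    contradicts rank at least 3.\<close>
  have avoiding: "\<exists>\<mu>\<in>\<Phi>. c \<xi> \<mu> = 1 \<and> \<mu> \<noteq> \<zeta> \<and> \<xi> - \<mu> \<noteq> \<zeta>" if \<xi>: "\<xi> \<in> \<Phi>" for \<xi> \<zeta>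
  proof (rule ccontr)
    assume no: "\<not> (\<exists>\<mu>\<in>\<Phi>. c \<xi> \<mu> = 1 \<and> \<mu> \<noteq> \<zeta> \<and> \<xi> - \<mu> \<noteq> \<zeta>)"
    define \<Psi> where "\<Psi> = insert \<xi> {\<mu> \<in> \<Phi>. c \<xi> \<mu> = 1}"
    define V where "V = span \<Psi>"
    have "\<Psi> \<subseteq> span {\<xi>, \<zeta>}"
    proof
      fix \<mu> assume "\<mu> \<in> \<Psi>"
      then have "\<mu> = \<xi> \<or> \<mu> = \<zeta> \<or> \<mu> = \<xi> - \<zeta>" using no by (auto simp: \<Psi>_def)
      then show "\<mu> \<in> span {\<xi>, \<zeta>}" by (auto intro: span_base span_diff)
    qed
    then have VS: "V \<subseteq> span {\<xi>, \<zeta>}" unfolding V_def by (simp add: span_minimal)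
    have perp: "\<delta> \<bullet> \<psi> = 0" if \<delta>: "\<delta> \<in> \<Phi>" "\<delta> \<notin> V" and \<psi>: "\<psi> \<in> \<Psi>" for \<delta> \<psi>
    proof -
      have base: "\<mu> \<in> V" if "\<mu> \<in> \<Phi>" "c \<xi> \<mu> = 1" for \<mu>
        using that unfolding V_def \<Psi>_def by (intro span_base) auto
      have nV: "- \<delta> \<notin> V" using \<delta>(2) span_neg unfolding V_def by fastforce
      have x0: "c \<xi> \<delta> = 0"
      proof -
        have "c \<xi> (- \<delta>) = - c \<xi> \<delta>" by (metis c_minus c_sym)
        then have "c \<xi> \<delta> \<noteq> 1" "c \<xi> \<delta> \<noteq> -1"
          using base[OF \<delta>(1)] base[OF neg[OF \<delta>(1)]] \<delta>(2) nV by auto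
        moreover have "c \<xi> \<delta> \<noteq> -2"
          using opp[OF \<xi> \<delta>(1)] \<delta>(2) span_neg span_base unfolding V_def \<Psi>_def by blast
        moreover have "c \<xi> \<delta> \<noteq> 2"
          using opp[OF neg[OF \<xi>] \<delta>(1)] \<delta>(2) span_base[of \<xi> \<Psi>] c_minus[of \<xi> \<delta>]
          unfolding V_def \<Psi>_def by auto
        ultimately show ?thesis using c_root[OF \<xi> \<delta>(1)] by auto
      qed
      have "c \<psi> \<delta> = 0" if "\<psi> \<in> \<Phi>" "c \<xi> \<psi> = 1"
      proof -
        \<comment> \<open>Otherwise \<open>\<psi> + \<theta>\<close> would again be a root with
          value 1 at \<open>\<xi>\<close>, and \<open>\<theta>\<close> would be a difference of two
          elements of \<open>V\<close>. Used for \<open>\<delta>\<close> and for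
          \<open>- \<delta>\<close>, which excludes the values -1 and 1.\<close>
        have ne: "c \<psi> \<theta> \<noteq> -1" if \<theta>: "\<theta> \<in> \<Phi>" "\<theta> \<notin> V" "c \<xi> \<theta> = 0" for \<theta>
        proof
          assume "c \<psi> \<theta> = -1"
          then have "\<psi> + \<theta> \<in> \<Phi>" using sum_root \<open>\<psi> \<in> \<Phi>\<close> \<theta> by blast
          moreover have "c \<xi> (\<psi> + \<theta>) = 1" using \<theta> \<open>c \<xi> \<psi> = 1\<close> by (metis c_add c_sym add.right_neutral)
          ultimately have "\<psi> + \<theta> \<in> V" by (rule base)
          moreover have "\<psi> \<in> V" using \<open>\<psi> \<in> \<Phi>\<close> \<open>c \<xi> \<psi> = 1\<close> by (rule base)
          ultimately have "\<theta> \<in> V" unfolding V_def using span_diff by fastforce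
          with \<theta> show False by blast
        qed
        have "c \<xi> (- \<delta>) = 0" "c \<psi> (- \<delta>) = - c \<psi> \<delta>" using x0 by (metis c_minus c_sym neg_0_equal_iff_equal)+
        then have "c \<psi> \<delta> \<noteq> -1" "c \<psi> \<delta> \<noteq> 1"
          using ne[OF \<delta> x0] ne[OF neg[OF \<delta>(1)] nV] by auto
        moreover have "c \<psi> \<delta> \<noteq> -2" using opp[OF that(1) \<delta>(1)] nV base[OF that] by auto
        moreover have "c \<psi> \<delta> \<noteq> 2"
          using opp[OF neg[OF that(1)] \<delta>(1)] base[OF that] \<delta>(2) c_minus[of \<psi> \<delta>] by auto
        ultimately show ?thesis using c_root[OF that(1) \<delta>(1)] by auto
      qed
      then have "c \<psi> \<delta> = 0" using \<psi> x0 by (auto simp: \<Psi>_def)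
      then show ?thesis using L by (simp add: c_def inner_commute)
    qed
    have "\<forall>\<alpha>\<in>\<Phi> \<inter> V. \<forall>\<beta>\<in>\<Phi> - V. \<alpha> \<bullet> \<beta> = 0"
    proof (intro ballI)
      fix \<alpha> \<beta> assume a: "\<alpha> \<in> \<Phi> \<inter> V" and b: "\<beta> \<in> \<Phi> - V"
      have "\<beta> \<bullet> \<alpha> = 0"
        using linear_eq_on_span[where f = "\<lambda>x. \<beta> \<bullet> x" and g = "\<lambda>x. 0" and B = \<Psi> and x = \<alpha>]
          perp[of \<beta>] a b by (auto simp: linearI inner_simps V_def)
      then show "\<alpha> \<bullet> \<beta> = 0" by (simp add: inner_commute)
    qed
    moreover have "\<Phi> = (\<Phi> \<inter> V) \<union> (\<Phi> - V)" by blast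
    ultimately have "\<Phi> \<inter> V = {} \<or> \<Phi> - V = {}"
      using irr unfolding irreducible_root_system_def by blast
    moreover have "\<xi> \<in> \<Phi> \<inter> V" using \<xi> by (auto simp: V_def \<Psi>_def intro: span_base)
    ultimately have "\<Phi> \<subseteq> V" by blast
    then have "\<Phi> \<subseteq> span {\<xi>, \<zeta>}" using VS by blast
    moreover have "span \<Phi> = UNIV" using rs by (simp add: root_system_def)
    ultimately have "span {\<xi>, \<zeta>} = UNIV" using span_minimal[of \<Phi> "span {\<xi>, \<zeta>}"] by (simp add: top.extremum_unique)
    then have "DIM('v) = dim {\<xi>, \<zeta>}" by (metis dim_UNIV dim_span)
    also have "\<dots> \<le> card {\<xi>, \<zeta>}" by (rule dim_le_card') simp
    also have "\<dots> \<le> 2" by (simp add: card_insert_if)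
    finally show False using dim by simp
  qed
  have "signed_root_system \<Phi> N c"
  proof
    fix \<alpha> \<beta> \<gamma> assume r: "\<alpha> \<in> \<Phi>" "\<beta> \<in> \<Phi>" "\<gamma> \<in> \<Phi>"
      and cs: "c \<alpha> \<beta> = -1" "c \<beta> \<gamma> = -1" "c \<alpha> \<gamma> = 0"
    have s: "\<alpha> + \<beta> \<in> \<Phi>" "\<beta> + \<gamma> \<in> \<Phi>" "\<alpha> + \<gamma> \<notin> \<Phi>" using r cs sum_root by auto
    moreover have "\<alpha> + \<beta> + \<gamma> \<in> \<Phi>" using sum_root[OF s(1) r(3)] c_add cs by simp
    moreover have "\<alpha> + \<gamma> \<noteq> 0"
    proof
      assume "\<alpha> + \<gamma> = 0"
      then have "\<gamma> = - \<alpha>" by (simp add: eq_neg_iff_add_eq_0 add.commute)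
      then have "c \<alpha> \<gamma> = -2" using c_self[OF r(1)] by (metis c_minus c_sym)
      with cs show False by simp
    qed
    ultimately show "N \<beta> \<gamma> * N \<alpha> (\<beta> + \<gamma>) = N \<alpha> \<beta> * N (\<alpha> + \<beta>) \<gamma>"
      using structure_constants_jacobi[OF rs(1) C r] by blast
  next
    fix \<alpha> \<beta> assume "\<alpha> \<in> \<Phi>" "\<beta> \<in> \<Phi>" "c \<alpha> \<beta> = -1"
    then show "N \<alpha> \<beta> = 1 \<or> N \<alpha> \<beta> = -1" and "N \<beta> \<alpha> = - N \<alpha> \<beta>"
      using structure_constants_pm1[OF rs(1) sl C, of \<alpha> \<beta>] structure_constants_skew[OF C, of \<alpha> \<beta>]
        sum_root[of \<alpha> \<beta>] by blast+
  next
    fix \<alpha> assume "\<alpha> \<in> \<Phi>"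
    then show "c \<alpha> \<alpha> = 2" "- \<alpha> \<in> \<Phi>" by (fact c_self, fact neg)
  next
    fix \<alpha> \<beta> assume r: "\<alpha> \<in> \<Phi>" "\<beta> \<in> \<Phi>"
    show "c \<alpha> \<beta> \<in> {-2, -1, 0, 1, 2}" "\<alpha> + \<beta> \<in> \<Phi> \<longleftrightarrow> c \<alpha> \<beta> = -1"
      "\<exists>\<mu>\<in>\<Phi>. c \<alpha> \<mu> = 1 \<and> \<mu> \<noteq> \<beta> \<and> \<alpha> - \<mu> \<noteq> \<beta>"
      by (fact c_root[OF r], fact sum_root[OF r], fact avoiding[OF r(1)])
    show "\<beta> = - \<alpha>" if "c \<alpha> \<beta> = -2" by (fact opp[OF r that])
  qed (fact c_add c_minus c_sym)+
  then show thesis by (rule that)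
qed


section \<open>Commutators\<close>

text \<open>Groups of class \<open>group_add\<close> need not be commutative. Written additively,
  their elements form a type, so that long computations are free of membership conditions.\<close>

definition com :: "'k::group_add \<Rightarrow> 'k \<Rightarrow> 'k" where
  "com x y = x + y - x - y"

definition cm :: "'k::group_add \<Rightarrow> 'k \<Rightarrow> bool" where
  "cm x y \<longleftrightarrow> x + y = y + x"

text \<open>These rules rewrite to right-nested sums in which adjacent inverses are cancelled, the
  normal form of a free group; they prove identities valid in all groups.\<close>

lemmas group_nf = diff_conv_add_uminus minus_add minus_minus add.assoc add_minus_cancel
  minus_add_cancel right_minus left_minus add_0_left add_0_right

lemma com_eq_0_iff: "com x y = 0 \<longleftrightarrow> cm x y"
  by (simp add: com_def cm_def diff_eq_eq)

lemma com_eqD: "com x y = z \<Longrightarrow> x + y = z + y + x"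
  by (auto simp only: com_def group_nf)

lemma com_eqI: "x + y = z + y + x \<Longrightarrow> com x y = z"
  by (simp only: com_def) (simp only: group_nf)

lemma com_minus: "- com x y = com y x"
  by (simp only: com_def group_nf)

lemma cm_sym: "cm x y \<Longrightarrow> cm y x"
  by (simp add: cm_def)

lemma cm_refl [simp]: "cm x x" and cm_0 [simp]: "cm x 0" "cm 0 x"
  by (simp_all add: cm_def)

lemma cm_add: "cm x y \<Longrightarrow> cm x z \<Longrightarrow> cm x (y + z)"
  unfolding cm_def by (metis add.assoc)

lemma cm_minus:
  assumes "cm x y"
  shows "cm x (- y)"
proof -
  have "- y + (x + y) + - y = - y + (y + x) + - y" using assms by (simp add: cm_def)
  then show ?thesis unfolding cm_def by (simp only: group_nf)
qed

lemma cm_com: "cm x y \<Longrightarrow> cm x z \<Longrightarrow> cm x (com y z)"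
  unfolding com_def diff_conv_add_uminus by (intro cm_add cm_minus)

lemma com_add_right:
  assumes "cm y (com x y')"
  shows "com x (y + y') = com x y + com x y'"
proof -
  have "com x (y + y') = com x y + (y + com x y' - y)"
    by (simp only: com_def group_nf)
  also have "y + com x y' = com x y' + y" using assms by (simp add: cm_def)
  finally show ?thesis by (simp add: add.assoc)
qed

text \<open>Conjugation by \<open>x\<close> fixes \<open>y\<close> and turns \<open>e\<close> into
  \<open>z + e\<close>; the claim results from computing the conjugate of \<open>w\<close> in this
  way. It is the Jacobi identity with one vanishing term, and it moves the factor \<open>e\<close>
  from one argument of a commutator to the other.\<close>

lemma com_transfer:
  assumes xy: "cm x y" and xe: "com x e = z" and w: "com e y = w" and wz: "cm w z" and wy: "cm w y"
  shows "com x w = com z y"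
proof -
  have 1: "x + e - x = z + e" using com_eqD[OF xe] by (simp only: group_nf)
  have 2: "x + y - x = y" using xy by (simp add: cm_def diff_eq_eq)
  have "x + w - x = (x + e - x) + (x + y - x) - (x + e - x) - (x + y - x)"
    unfolding w[symmetric] com_def by (simp only: group_nf)
  also have "\<dots> = z + w + (y - z - y)"
    unfolding 1 2 w[symmetric] com_def by (simp only: group_nf)
  also have "z + w = w + z" using wz by (simp add: cm_def)
  also have "w + z + (y - z - y) = w + com z y" by (simp only: com_def group_nf)
  also have "\<dots> = com z y + w"
    using cm_com[OF wz wy] by (simp add: cm_def)
  finally show ?thesis by (simp add: com_def diff_eq_eq)
qed

text \<open>Conjugation by \<open>d\<close> fixes \<open>x\<close> and turns \<open>y\<close> into
  \<open>z + y\<close>. This passes a root element through another one that is written as a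
  commutator.\<close>

lemma com_conj:
  assumes dx: "cm d x" and dy: "com d y = z" and zw: "cm z (com x y)"
  shows "com d (com x y) = com x z"
proof -
  have 1: "d + y - d = z + y" using com_eqD[OF dy] by (simp only: group_nf)
  have 2: "d + x - d = x" using dx by (simp add: cm_def diff_eq_eq)
  have "d + com x y - d = (d + x - d) + (d + y - d) - (d + x - d) - (d + y - d)"
    unfolding com_def by (simp only: group_nf)
  also have "\<dots> = com x z + (z + com x y) - z" unfolding 1 2 com_def by (simp only: group_nf)
  also have "z + com x y = com x y + z" using zw by (simp add: cm_def)
  finally have "d + com x y - d = com x z + com x y" by (simp only: group_nf)
  then have "d + com x y = com x z + com x y + d" by (simp only: diff_eq_eq)
  then show ?thesis by (rule com_eqI)
qed


section \<open>Systems of root elements\<close>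

definition big :: "'e::cancel_comm_monoid_add \<Rightarrow> 'e \<Rightarrow> bool" where
  "big n m \<longleftrightarrow> (\<exists>k. m = n + k)"

lemma big_add [simp]: "big n (n + k)" "big n n" "big 0 m"
  by (auto simp: big_def intro: exI[of _ 0])

lemma big_mono: "big n m \<Longrightarrow> big n (m + k)" "big n m \<Longrightarrow> big n (k + m)"
  unfolding big_def by (metis add.assoc, metis add.assoc add.commute)

lemma big_weaken: "big (n + k) m \<Longrightarrow> big n m" "big (n + k) m \<Longrightarrow> big k m"
  unfolding big_def by (metis add.assoc, metis add.assoc add.commute)

text \<open>The element \<open>f \<beta> \<nu> b\<close> plays the role of the root element for \<open>\<beta>\<close> with the parameter
  \<open>ev \<nu> * b\<close>. Exponents are kept formal since \<open>ev \<nu>\<close> may be a zero divisor, so that dividing the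
  parameter by a part of \<open>ev \<nu>\<close> would not be well defined. Only big exponents matter, i.e. parameters
  that are divisible by a given power: this makes every parameter a product of two parameters.\<close>

locale steinberg_systems = signed_root_system \<Phi> N c + B?: cring B
  for \<Phi> :: "'v::ab_group_add set" and N and c and B :: "('b, 'm) ring_scheme" (structure) +
  fixes ev :: "'e::cancel_comm_monoid_add \<Rightarrow> 'b"
  assumes ev_closed [simp]: "ev \<nu> \<in> carrier B"
    and ev_0 [simp]: "ev 0 = \<one>"
    and ev_add: "ev (\<nu> + \<mu>) = ev \<nu> \<otimes> ev \<mu>"
begin

text \<open>Two roots of \<open>X\<close> with value -1 whose sum lies outside \<open>X\<close> are
  left unconstrained. For \<open>X\<close> consisting of all roots but a pair of opposite ones,
  their commutators are what the missing values are built from.\<close>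

definition sys :: "'v set \<Rightarrow> 'e \<Rightarrow> ('v \<Rightarrow> 'e \<Rightarrow> 'b \<Rightarrow> 'k::group_add) \<Rightarrow> bool" where
  "sys X n f \<longleftrightarrow>
     (\<forall>\<beta>\<in>X. \<forall>\<nu> b d. big n \<nu> \<longrightarrow> b \<in> carrier B \<longrightarrow> d \<in> carrier B \<longrightarrow>
        f \<beta> \<nu> (b \<oplus> d) = f \<beta> \<nu> b + f \<beta> \<nu> d) \<and>
     (\<forall>\<beta>\<in>X. \<forall>\<nu> \<kappa> b. big n \<nu> \<longrightarrow> b \<in> carrier B \<longrightarrow> f \<beta> (\<nu> + \<kappa>) b = f \<beta> \<nu> (ev \<kappa> \<otimes> b)) \<and>
     (\<forall>\<beta>\<in>X. \<forall>\<gamma>\<in>X. \<forall>\<nu> \<mu> b d. big n \<nu> \<longrightarrow> big n \<mu> \<longrightarrow> b \<in> carrier B \<longrightarrow> d \<in> carrier B \<longrightarrow>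
        (\<beta> + \<gamma> \<in> X \<longrightarrow> com (f \<beta> \<nu> b) (f \<gamma> \<mu> d) = f (\<beta> + \<gamma>) (\<nu> + \<mu>) ([N \<beta> \<gamma>] \<cdot> (b \<otimes> d))) \<and>
        (c \<beta> \<gamma> \<ge> 0 \<longrightarrow> cm (f \<beta> \<nu> b) (f \<gamma> \<mu> d)))"

lemma sysI:
  assumes "\<And>\<beta> \<nu> b d. \<lbrakk>\<beta> \<in> X; big n \<nu>; b \<in> carrier B; d \<in> carrier B\<rbrakk> \<Longrightarrow>
      f \<beta> \<nu> (b \<oplus> d) = f \<beta> \<nu> b + f \<beta> \<nu> d"
    and "\<And>\<beta> \<nu> \<kappa> b. \<lbrakk>\<beta> \<in> X; big n \<nu>; b \<in> carrier B\<rbrakk> \<Longrightarrow> f \<beta> (\<nu> + \<kappa>) b = f \<beta> \<nu> (ev \<kappa> \<otimes> b)"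
    and "\<And>\<beta> \<gamma> \<nu> \<mu> b d. \<lbrakk>\<beta> \<in> X; \<gamma> \<in> X; big n \<nu>; big n \<mu>; b \<in> carrier B; d \<in> carrier B; \<beta> + \<gamma> \<in> X\<rbrakk>
      \<Longrightarrow> com (f \<beta> \<nu> b) (f \<gamma> \<mu> d) = f (\<beta> + \<gamma>) (\<nu> + \<mu>) ([N \<beta> \<gamma>] \<cdot> (b \<otimes> d))"
    and "\<And>\<beta> \<gamma> \<nu> \<mu> b d. \<lbrakk>\<beta> \<in> X; \<gamma> \<in> X; big n \<nu>; big n \<mu>; b \<in> carrier B; d \<in> carrier B; c \<beta> \<gamma> \<ge> 0\<rbrakk>
      \<Longrightarrow> cm (f \<beta> \<nu> b) (f \<gamma> \<mu> d)"
  shows "sys X n f"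
  unfolding sys_def by (intro conjI ballI allI impI; rule assms; assumption)

lemma
  assumes "sys X n f"
  shows sys_add: "\<And>\<beta> \<nu> b d. \<lbrakk>\<beta> \<in> X; big n \<nu>; b \<in> carrier B; d \<in> carrier B\<rbrakk> \<Longrightarrow>
      f \<beta> \<nu> (b \<oplus> d) = f \<beta> \<nu> b + f \<beta> \<nu> d"
    and sys_ev: "\<And>\<beta> \<nu> \<kappa> b. \<lbrakk>\<beta> \<in> X; big n \<nu>; b \<in> carrier B\<rbrakk> \<Longrightarrow> f \<beta> (\<nu> + \<kappa>) b = f \<beta> \<nu> (ev \<kappa> \<otimes> b)"
    and sys_com: "\<And>\<beta> \<gamma> \<nu> \<mu> b d. \<lbrakk>\<beta> \<in> X; \<gamma> \<in> X; big n \<nu>; big n \<mu>; b \<in> carrier B; d \<in> carrier B; \<beta> + \<gamma> \<in> X\<rbrakk>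
      \<Longrightarrow> com (f \<beta> \<nu> b) (f \<gamma> \<mu> d) = f (\<beta> + \<gamma>) (\<nu> + \<mu>) ([N \<beta> \<gamma>] \<cdot> (b \<otimes> d))"
    and sys_cm: "\<And>\<beta> \<gamma> \<nu> \<mu> b d. \<lbrakk>\<beta> \<in> X; \<gamma> \<in> X; big n \<nu>; big n \<mu>; b \<in> carrier B; d \<in> carrier B; c \<beta> \<gamma> \<ge> 0\<rbrakk>
      \<Longrightarrow> cm (f \<beta> \<nu> b) (f \<gamma> \<mu> d)"
proof -
  note * = assms[unfolded sys_def]
  note 1 = *[THEN conjunct1, rule_format]
    and 2 = *[THEN conjunct2, THEN conjunct1, rule_format]
    and 3 = *[THEN conjunct2, THEN conjunct2, rule_format, THEN conjunct1, rule_format]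
    and 4 = *[THEN conjunct2, THEN conjunct2, rule_format, THEN conjunct2, rule_format]
  show "\<lbrakk>\<beta> \<in> X; big n \<nu>; b \<in> carrier B; d \<in> carrier B\<rbrakk> \<Longrightarrow>
      f \<beta> \<nu> (b \<oplus> d) = f \<beta> \<nu> b + f \<beta> \<nu> d" for \<beta> \<nu> b d by (rule 1)
  show "\<lbrakk>\<beta> \<in> X; big n \<nu>; b \<in> carrier B\<rbrakk> \<Longrightarrow> f \<beta> (\<nu> + \<kappa>) b = f \<beta> \<nu> (ev \<kappa> \<otimes> b)" for \<beta> \<nu> \<kappa> b
    by (rule 2)
  show "\<lbrakk>\<beta> \<in> X; \<gamma> \<in> X; big n \<nu>; big n \<mu>; b \<in> carrier B; d \<in> carrier B; \<beta> + \<gamma> \<in> X\<rbrakk>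
      \<Longrightarrow> com (f \<beta> \<nu> b) (f \<gamma> \<mu> d) = f (\<beta> + \<gamma>) (\<nu> + \<mu>) ([N \<beta> \<gamma>] \<cdot> (b \<otimes> d))" for \<beta> \<gamma> \<nu> \<mu> b d
    by (rule 3)
  show "\<lbrakk>\<beta> \<in> X; \<gamma> \<in> X; big n \<nu>; big n \<mu>; b \<in> carrier B; d \<in> carrier B; c \<beta> \<gamma> \<ge> 0\<rbrakk>
      \<Longrightarrow> cm (f \<beta> \<nu> b) (f \<gamma> \<mu> d)" for \<beta> \<gamma> \<nu> \<mu> b d by (rule 4)
qed

lemma sys_zero:
  assumes "sys X n f" "\<beta> \<in> X" "big n \<nu>"
  shows "f \<beta> \<nu> \<zero> = 0"
proof -
  have "f \<beta> \<nu> \<zero> + f \<beta> \<nu> \<zero> = f \<beta> \<nu> \<zero> + 0"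
    using sys_add[OF assms, of \<zero> \<zero>] by simp
  then show ?thesis by (rule add_left_imp_eq)
qed

lemma sys_minus:
  assumes "sys X n f" "\<beta> \<in> X" "big n \<nu>" "b \<in> carrier B"
  shows "f \<beta> \<nu> (\<ominus> b) = - f \<beta> \<nu> b"
proof -
  have "f \<beta> \<nu> (\<ominus> b) + f \<beta> \<nu> b = 0"
    using sys_add[OF assms(1-3), of "\<ominus> b" b] sys_zero[OF assms(1-3)] assms(4) by (simp add: l_neg)
  then show ?thesis by (simp add: eq_neg_iff_add_eq_0)
qed

lemma sys_mono: "sys X n f \<Longrightarrow> sys X (n + k) f" "sys X n f \<Longrightarrow> sys X (k + n) f"
  by (intro sysI; erule sys_add sys_ev sys_com sys_cm; (assumption | erule big_weaken))+

lemma sgn_closed [simp]: "b \<in> carrier B \<Longrightarrow> [(m::int)] \<cdot> b \<in> carrier B"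
  by (rule add.int_pow_closed)

lemma sgn_1 [simp]: "b \<in> carrier B \<Longrightarrow> [(1::int)] \<cdot> b = b"
  by (simp add: add_pow_def int_pow_def2)

lemma sgn_minus_1: "b \<in> carrier B \<Longrightarrow> [(-1::int)] \<cdot> b = \<ominus> b"
  using add.int_pow_neg[of b 1] by simp

lemma sgn_minus: "b \<in> carrier B \<Longrightarrow> [(- m::int)] \<cdot> b = \<ominus> ([m] \<cdot> b)"
  by (rule add.int_pow_neg)

lemma sgn_sgn: "b \<in> carrier B \<Longrightarrow> [(m::int)] \<cdot> ([(k::int)] \<cdot> b) = [(m * k)] \<cdot> b"
  using add.int_pow_pow[of b m k] by (simp add: mult.commute)

lemma sgn_mult_left: "\<lbrakk>b \<in> carrier B; d \<in> carrier B\<rbrakk> \<Longrightarrow> ([(m::int)] \<cdot> b) \<otimes> d = [m] \<cdot> (b \<otimes> d)"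
  by (simp add: add_pow_ldistr_int)

lemma sgn_mult_right: "\<lbrakk>b \<in> carrier B; d \<in> carrier B\<rbrakk> \<Longrightarrow> b \<otimes> ([(m::int)] \<cdot> d) = [m] \<cdot> (b \<otimes> d)"
  by (simp add: add_pow_rdistr_int)

lemmas sgn_simps = sgn_sgn sgn_mult_left sgn_mult_right

lemma c_add_right: "c x (y + z) = c x y + c x z"
  using c_add[of y z x] by (simp add: c_sym)

lemma c_minus_right: "c x (- y) = - c x y"
  using c_minus[of y x] by (simp add: c_sym)

lemma c_diff: "c (x - y) z = c x z - c y z"
  using c_add[of x "- y" z] c_minus[of y z] by simp

lemma c_diff_right: "c x (y - z) = c x y - c x z"
  using c_diff[of y z x] by (simp add: c_sym)

lemmas c_simps = c_add c_add_right c_minus c_minus_right c_diff c_diff_right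

lemma root_cases: "\<alpha> \<in> \<Phi> \<Longrightarrow> \<beta> \<in> \<Phi> \<Longrightarrow>
    c \<alpha> \<beta> = -2 \<or> c \<alpha> \<beta> = -1 \<or> c \<alpha> \<beta> = 0 \<or> c \<alpha> \<beta> = 1 \<or> c \<alpha> \<beta> = 2"
  using c_root by blast

lemma c_equal: "\<alpha> \<in> \<Phi> \<Longrightarrow> \<beta> \<in> \<Phi> \<Longrightarrow> c \<alpha> \<beta> = 2 \<longleftrightarrow> \<beta> = \<alpha>"
  using c_opposite[of "- \<alpha>" \<beta>] c_self neg_root c_minus by force

lemma c_opposite_iff: "\<alpha> \<in> \<Phi> \<Longrightarrow> \<beta> \<in> \<Phi> \<Longrightarrow> c \<alpha> \<beta> = -2 \<longleftrightarrow> \<beta> = - \<alpha>"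
  using c_opposite[of \<alpha> \<beta>] c_self c_minus_right by force

lemma diff_root: "\<alpha> \<in> \<Phi> \<Longrightarrow> \<beta> \<in> \<Phi> \<Longrightarrow> \<alpha> - \<beta> \<in> \<Phi> \<longleftrightarrow> c \<alpha> \<beta> = 1"
  using sum_root[of \<alpha> "- \<beta>"] neg_root[of \<beta>] by (simp add: c_minus_right)

lemma N_square: "\<alpha> \<in> \<Phi> \<Longrightarrow> \<beta> \<in> \<Phi> \<Longrightarrow> c \<alpha> \<beta> = -1 \<Longrightarrow> N \<alpha> \<beta> * N \<alpha> \<beta> = 1"
  using N_unit by fastforce

end


section \<open>Elimination of a root\<close>

context steinberg_systems
begin

text \<open>The remaining values 2 and -2 of \<open>c \<alpha>\<close> belong to
  \<open>\<alpha>\<close> and \<open>- \<alpha>\<close>, so these are all the other roots.\<close>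

definition off :: "'v \<Rightarrow> 'v set" where
  "off \<alpha> = {\<delta> \<in> \<Phi>. c \<alpha> \<delta> = -1 \<or> c \<alpha> \<delta> = 0 \<or> c \<alpha> \<delta> = 1}"

text \<open>A candidate for the root element at \<open>\<beta> + \<gamma>\<close> with exponent
  \<open>\<nu> + \<mu>\<close> and parameter \<open>b \<otimes> d\<close>: the sign in the second
  argument cancels the sign of the commutator formula.\<close>

definition Z :: "('v \<Rightarrow> 'e \<Rightarrow> 'b \<Rightarrow> 'k::group_add) \<Rightarrow> 'v \<Rightarrow> 'v \<Rightarrow> 'e \<Rightarrow> 'b \<Rightarrow> 'e \<Rightarrow> 'b \<Rightarrow> 'k" where
  "Z f \<beta> \<gamma> \<nu> b \<mu> d = com (f \<beta> \<nu> b) (f \<gamma> \<mu> ([N \<beta> \<gamma>] \<cdot> d))"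

text \<open>The difference \<open>\<beta>' - \<beta>\<close> is a root. By
  \<open>com_transfer\<close> its root element with parameter \<open>b2\<close> can be joined to
  either argument, where it turns \<open>\<alpha> - \<beta>'\<close> into
  \<open>\<alpha> - \<beta>\<close> or \<open>\<beta>\<close> into \<open>\<beta>'\<close>. So the
  splittings of the root and of the parameter change together.\<close>

lemma Z_shift:
  assumes f: "sys (off \<alpha>) n f"
    and r: "\<alpha> \<in> \<Phi>" "\<beta> \<in> \<Phi>" "\<beta>' \<in> \<Phi>" and ip: "c \<alpha> \<beta> = 1" "c \<alpha> \<beta>' = 1" "c \<beta> \<beta>' = 1"
    and \<nu>: "big n \<nu>1" "big n \<nu>2" "big n \<nu>3"
    and b: "b1 \<in> carrier B" "b2 \<in> carrier B" "b3 \<in> carrier B"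
  shows "Z f \<beta> (\<alpha> - \<beta>) \<nu>1 b1 (\<nu>2 + \<nu>3) (b2 \<otimes> b3)
    = Z f \<beta>' (\<alpha> - \<beta>') (\<nu>1 + \<nu>2) (b1 \<otimes> b2) \<nu>3 b3"
proof -
  let ?g = "\<alpha> - \<beta>" and ?g' = "\<alpha> - \<beta>'" and ?e = "\<beta>' - \<beta>"
  have ip': "c \<beta> \<alpha> = 1" "c \<beta>' \<alpha> = 1" "c \<beta>' \<beta> = 1" using ip by (simp_all add: c_sym)
  note cs = c_simps c_self[OF r(1)] c_self[OF r(2)] c_self[OF r(3)] ip ip'
  have R: "?g \<in> \<Phi>" "?g' \<in> \<Phi>" "?e \<in> \<Phi>" using r by (simp_all add: diff_root ip ip')
  have X: "\<beta> \<in> off \<alpha>" "\<beta>' \<in> off \<alpha>" "?g \<in> off \<alpha>" "?g' \<in> off \<alpha>" "?e \<in> off \<alpha>"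
    using r R by (auto simp: off_def cs)
  have s: "\<beta> + ?e = \<beta>'" "?e + ?g' = ?g" by simp_all
  have N: "N \<beta> ?e * N \<beta> ?e = 1" "N ?e ?g' * N ?e ?g' = 1"
    using r R by (auto intro!: N_square simp: cs)
  have J: "N ?e ?g' * N \<beta> ?g = N \<beta> ?e * N \<beta>' ?g'"
    using N_jacobi[of \<beta> ?e ?g'] r R by (simp add: cs s)
  have sg: "N ?e ?g' * (N \<beta> ?e * N \<beta>' ?g') = N \<beta> ?g"
    using N(2) by (simp add: J[symmetric] flip: mult.assoc)
  have sg': "N ?e ?g' * (N \<beta>' ?g' * N \<beta> ?e) = N \<beta> ?g" using sg by (simp add: ac_simps)
  have xe: "com (f \<beta> \<nu>1 b1) (f ?e \<nu>2 ([N \<beta> ?e] \<cdot> b2)) = f \<beta>' (\<nu>1 + \<nu>2) (b1 \<otimes> b2)"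
    using sys_com[OF f X(1,5) \<nu>(1,2), of b1 "[N \<beta> ?e] \<cdot> b2"] b X
    by (simp add: s sgn_simps N)
  have w: "com (f ?e \<nu>2 ([N \<beta> ?e] \<cdot> b2)) (f ?g' \<nu>3 ([N \<beta>' ?g'] \<cdot> b3))
      = f ?g (\<nu>2 + \<nu>3) ([N \<beta> ?g] \<cdot> (b2 \<otimes> b3))"
    using sys_com[OF f X(5,4) \<nu>(2,3), of "[N \<beta> ?e] \<cdot> b2" "[N \<beta>' ?g'] \<cdot> b3"] b X
    by (simp add: s sgn_simps sg')
  show ?thesis unfolding Z_def
    by (rule com_transfer[OF _ xe w])
       (use b \<nu> big_mono in \<open>auto intro!: sys_cm[OF f] X simp: cs\<close>)
qed

lemma big_split: "big (n + m) \<nu> \<Longrightarrow> \<exists>\<mu>. \<nu> = n + \<mu> \<and> big m \<mu>"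
  unfolding big_def by (metis add.assoc)

text \<open>A shift from \<open>\<beta>\<close> to \<open>\<beta>'\<close> and back carries the
  whole second parameter over to the first argument. Of the three copies of \<open>n\<close> in the
  bound for \<open>\<nu>2\<close>, one is carried over by the first shift, one keeps the exponent
  \<open>\<mu>\<close> of the second shift big, and one stays behind.\<close>

lemma Z_normal:
  assumes f: "sys (off \<alpha>) n f"
    and r: "\<alpha> \<in> \<Phi>" "\<beta> \<in> \<Phi>" "\<beta>' \<in> \<Phi>" and ip: "c \<alpha> \<beta> = 1" "c \<alpha> \<beta>' = 1" "c \<beta> \<beta>' = 1"
    and \<nu>: "big n \<nu>1" "big (n + n + n) \<nu>2"
    and b: "b \<in> carrier B" "d \<in> carrier B"
  shows "Z f \<beta> (\<alpha> - \<beta>) \<nu>1 b \<nu>2 d = Z f \<beta> (\<alpha> - \<beta>) (\<nu>1 + \<nu>2 - n) (b \<otimes> d) n \<one>"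
proof -
  obtain \<mu> where \<mu>: "\<nu>2 = n + (n + \<mu>)" "big n \<mu>"
    using big_split[of n "n + n" \<nu>2] big_split[of n n] \<nu>(2) by (metis add.assoc)
  have ip': "c \<beta>' \<beta> = 1" using ip(3) by (simp add: c_sym)
  have "Z f \<beta> (\<alpha> - \<beta>) \<nu>1 b (n + (\<mu> + n)) (\<one> \<otimes> d) = Z f \<beta>' (\<alpha> - \<beta>') (\<nu>1 + n) (b \<otimes> \<one>) (\<mu> + n) d"
    by (rule Z_shift[OF f r ip]) (use \<nu> \<mu> b big_mono in auto)
  also have "\<dots> = Z f \<beta>' (\<alpha> - \<beta>') (\<nu>1 + n) b (\<mu> + n) (d \<otimes> \<one>)" using b by simp
  also have "\<dots> = Z f \<beta> (\<alpha> - \<beta>) (\<nu>1 + n + \<mu>) (b \<otimes> d) n \<one>"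
    by (rule Z_shift[OF f r(1,3,2) ip(2,1) ip']) (use \<nu> \<mu> b big_mono in auto)
  also have "\<nu>1 + n + \<mu> = \<nu>1 + \<nu>2 - n"
    using \<mu> add_diff_cancel_left'[of n "\<nu>1 + n + \<mu>"] by (simp add: ac_simps)
  finally show ?thesis using \<mu> b by (simp add: ac_simps)
qed

text \<open>\<open>c \<beta> \<mu>\<close> and \<open>c \<beta> (\<alpha> - \<mu>)\<close> add up to
  1. As \<open>\<mu>\<close> and \<open>\<alpha> - \<mu>\<close> both differ from
  \<open>\<beta>\<close>, neither value is 2, so one of them is 1.\<close>

lemma partner:
  assumes "\<alpha> \<in> \<Phi>" "\<beta> \<in> \<Phi>" "c \<alpha> \<beta> = 1"
  obtains \<beta>' where "\<beta>' \<in> \<Phi>" "c \<alpha> \<beta>' = 1" "c \<beta> \<beta>' = 1"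
proof -
  obtain \<mu> where \<mu>: "\<mu> \<in> \<Phi>" "c \<alpha> \<mu> = 1" "\<mu> \<noteq> \<beta>" "\<alpha> - \<mu> \<noteq> \<beta>"
    using avoiding_root[OF assms(1,2)] by blast
  have g: "\<alpha> - \<mu> \<in> \<Phi>" "c \<alpha> (\<alpha> - \<mu>) = 1" using assms \<mu> by (auto simp: diff_root c_simps c_self)
  have "c \<beta> \<mu> \<noteq> 2" "c \<beta> (\<alpha> - \<mu>) \<noteq> 2"
    using c_equal assms \<mu> g by auto
  moreover have "c \<beta> \<alpha> = 1" using assms(3) by (simp add: c_sym)
  ultimately have "c \<beta> \<mu> = 1 \<or> c \<beta> (\<alpha> - \<mu>) = 1"
    using root_cases[OF assms(2) \<mu>(1)] root_cases[OF assms(2) g(1)] by (auto simp: c_simps)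
  then show thesis using that \<mu> g by blast
qed

lemma eliminate_values:
  fixes f :: "'v \<Rightarrow> 'e \<Rightarrow> 'b \<Rightarrow> 'k::group_add" and n
  defines "q \<equiv> n + n + n"
  assumes f: "sys (off \<alpha>) n f" and \<alpha>: "\<alpha> \<in> \<Phi>"
  obtains F where
    "\<And>\<beta> \<nu> \<mu> b d. \<lbrakk>\<beta> \<in> \<Phi>; c \<alpha> \<beta> = 1; big q \<nu>; big q \<mu>; b \<in> carrier B; d \<in> carrier B\<rbrakk>
      \<Longrightarrow> Z f \<beta> (\<alpha> - \<beta>) \<nu> b \<mu> d = F (\<nu> + \<mu>) (b \<otimes> d)"
    and "\<And>\<delta> \<nu> \<mu> b d. \<lbrakk>\<delta> \<in> \<Phi>; c \<alpha> \<delta> = 1; big (q + q) \<nu>; big n \<mu>; b \<in> carrier B; d \<in> carrier B\<rbrakk>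
      \<Longrightarrow> cm (f \<delta> \<mu> d) (F \<nu> b)"
proof -
  obtain \<beta>0 where \<beta>0: "\<beta>0 \<in> \<Phi>" "c \<alpha> \<beta>0 = 1" using avoiding_root[OF \<alpha> \<alpha>] by blast
  obtain \<beta>1 where \<beta>1: "\<beta>1 \<in> \<Phi>" "c \<alpha> \<beta>1 = 1" "c \<beta>0 \<beta>1 = 1" using partner[OF \<alpha> \<beta>0] by blast
  \<comment> \<open>All other splittings of \<open>\<alpha>\<close> are compared with the one by
    \<open>\<beta>0\<close>, brought into the normal form of \<open>Z_normal\<close>.\<close>
  define F where "F = (\<lambda>\<nu> b. Z f \<beta>0 (\<alpha> - \<beta>0) (\<nu> - n) b n \<one>)"
  have bq: "big n \<nu>" "big (n + n) \<nu>" if "big q \<nu>" for \<nu>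
    using that big_weaken unfolding q_def by blast+
  have R0: "Z f \<beta>0 (\<alpha> - \<beta>0) \<nu> b \<mu> d = F (\<nu> + \<mu>) (b \<otimes> d)"
    if "big n \<nu>" "big q \<mu>" "b \<in> carrier B" "d \<in> carrier B" for \<nu> \<mu> b d
    unfolding F_def using that by (intro Z_normal[OF f \<alpha> \<beta>0(1) \<beta>1(1) \<beta>0(2) \<beta>1(2,3)]) (auto simp: q_def)
  have R1: "Z f \<beta> (\<alpha> - \<beta>) \<nu> b \<mu> d = F (\<nu> + \<mu>) (b \<otimes> d)"
    if \<beta>: "\<beta> \<in> \<Phi>" "c \<alpha> \<beta> = 1" "c \<beta>0 \<beta> = 1"
      and h: "big q \<nu>" "big q \<mu>" "b \<in> carrier B" "d \<in> carrier B" for \<beta> \<nu> \<mu> b d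
  proof -
    obtain \<kappa> where \<kappa>: "\<nu> = n + \<kappa>" "big n \<kappa>"
      using big_split[of n n \<nu>] bq(2)[OF h(1)] by blast
    have "F (\<nu> + \<mu>) (b \<otimes> d) = Z f \<beta>0 (\<alpha> - \<beta>0) n b (\<kappa> + \<mu>) (\<one> \<otimes> d)"
      using R0[of n "\<kappa> + \<mu>" b d] h \<kappa> big_mono(2)[OF h(2)] by (simp add: ac_simps)
    also have "\<dots> = Z f \<beta> (\<alpha> - \<beta>) (n + \<kappa>) (b \<otimes> \<one>) \<mu> d"
      by (rule Z_shift[OF f \<alpha> \<beta>0(1) \<beta>(1) \<beta>0(2) \<beta>(2,3)]) (use \<kappa> h bq in auto)
    finally show ?thesis using h \<kappa> by simp
  qed
  \<comment> \<open>A root with value 1 at \<open>\<alpha>\<close> that is neither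
    \<open>\<beta>\<close> nor \<open>\<alpha> - \<beta>\<close> has nonnegative product with both
    and commutes with both factors. \<open>F\<close> has an expression by \<open>\<beta>0\<close>
    and one by \<open>\<beta>1\<close>; a \<open>\<delta>\<close> that occurs in the first does not
    occur in the second.\<close>
  have C: "cm (f \<delta> \<mu> d) (F \<nu> b)"
    if \<delta>: "\<delta> \<in> \<Phi>" "c \<alpha> \<delta> = 1" and h: "big (q + q) \<nu>" "big n \<mu>" "b \<in> carrier B" "d \<in> carrier B"
    for \<delta> \<nu> \<mu> b d
  proof -
    have C': "cm (f \<delta> \<mu> d) (Z f \<beta> (\<alpha> - \<beta>) \<nu>1 \<one> \<nu>2 b)"
      if \<beta>: "\<beta> \<in> \<Phi>" "c \<alpha> \<beta> = 1" "c \<delta> \<beta> \<noteq> 2" "c \<delta> (\<alpha> - \<beta>) \<noteq> 2" and \<nu>: "big n \<nu>1" "big n \<nu>2"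
      for \<beta> \<nu>1 \<nu>2
    proof -
      have g: "\<alpha> - \<beta> \<in> \<Phi>" "c \<alpha> (\<alpha> - \<beta>) = 1" using \<alpha> \<beta> by (auto simp: diff_root c_simps c_self)
      have "c \<delta> \<alpha> = 1" using \<delta>(2) by (simp add: c_sym)
      then have "c \<delta> \<beta> \<ge> 0" "c \<delta> (\<alpha> - \<beta>) \<ge> 0"
        using root_cases[OF \<delta>(1) \<beta>(1)] root_cases[OF \<delta>(1) g(1)] \<beta>(3,4) by (auto simp: c_simps)
      then show ?thesis unfolding Z_def using \<delta> \<beta> g h \<nu>
        by (intro cm_com sys_cm[OF f]) (auto simp: off_def)
    qed
    obtain \<mu>1 where \<mu>1: "\<nu> = q + \<mu>1" "big q \<mu>1" using big_split[OF h(1)] by blast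
    have F: "F \<nu> b = Z f \<beta>0 (\<alpha> - \<beta>0) q \<one> \<mu>1 b" "F \<nu> b = Z f \<beta>1 (\<alpha> - \<beta>1) q \<one> \<mu>1 b"
      using R0[of q \<mu>1 \<one> b] R1[OF \<beta>1, of q \<mu>1 \<one> b] \<mu>1 h bq by auto
    have "c \<delta> \<alpha> = 1" using \<delta>(2) by (simp add: c_sym)
    show ?thesis
    proof (cases "c \<delta> \<beta>0 = 2 \<or> c \<delta> (\<alpha> - \<beta>0) = 2")
      case False
      then show ?thesis unfolding F(1) using C'[OF \<beta>0] \<mu>1 bq by auto
    next
      case True
      have g0: "\<alpha> - \<beta>0 \<in> \<Phi>" using \<alpha> \<beta>0 by (auto simp: diff_root)
      have "\<delta> = \<beta>0 \<or> \<delta> = \<alpha> - \<beta>0" using True c_equal \<delta> \<beta>0 g0 by metis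
      then have "c \<delta> \<beta>1 = 1 \<or> c \<delta> \<beta>1 = 0" using \<beta>1 by (auto simp: c_simps)
      then show ?thesis unfolding F(2) using C'[OF \<beta>1(1,2)] \<mu>1 bq \<open>c \<delta> \<alpha> = 1\<close> by (auto simp: c_simps)
    qed
  qed
  \<comment> \<open>Exchanging \<open>\<beta>\<close> and \<open>\<alpha> - \<beta>\<close> inverts
    the commutator, while \<open>N\<close> changes sign. For \<open>swap\<close> it must therefore
    be known that \<open>F\<close> turns negatives into inverses.\<close>
  have Fminus: "F \<nu> (\<ominus> b) = - F \<nu> b" if h: "big (q + q) \<nu>" "b \<in> carrier B" for \<nu> b
  proof -
    obtain \<mu> where \<mu>: "\<nu> = q + \<mu>" "big q \<mu>" using big_split[OF h(1)] by blast
    have X: "\<alpha> - \<beta>0 \<in> off \<alpha>" "\<alpha> - \<beta>0 \<in> \<Phi>" "c \<alpha> (\<alpha> - \<beta>0) = 1"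
      using \<alpha> \<beta>0 by (auto simp: off_def diff_root c_simps c_self)
    let ?x = "f \<beta>0 q \<one>" and ?y = "\<lambda>b. f (\<alpha> - \<beta>0) \<mu> ([N \<beta>0 (\<alpha> - \<beta>0)] \<cdot> b)"
    have F: "F \<nu> b = com ?x (?y b)" if "b \<in> carrier B" for b
      using R0[of q \<mu> \<one> b] that \<mu> h bq by (simp add: Z_def)
    have "com ?x (?y (\<ominus> b) + ?y b) = com ?x (?y (\<ominus> b)) + com ?x (?y b)"
    proof (rule com_add_right)
      show "cm (?y (\<ominus> b)) (com ?x (?y b))"
        unfolding F[OF h(2), symmetric] using C[OF X(2,3)] h \<mu> bq by simp
    qed
    moreover have "?y (\<ominus> b) + ?y b = 0"
      using sys_add[OF f X(1), of \<mu> "[N \<beta>0 (\<alpha> - \<beta>0)] \<cdot> (\<ominus> b)" "[N \<beta>0 (\<alpha> - \<beta>0)] \<cdot> b"] h \<mu> bq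
        sys_zero[OF f X(1), of \<mu>]
      by (simp add: add.int_pow_inv l_neg)
    ultimately have "F \<nu> (\<ominus> b) + F \<nu> b = 0" using F h by (simp add: com_def)
    then show ?thesis by (simp add: eq_neg_iff_add_eq_0)
  qed
  have swap: "Z f (\<alpha> - \<beta>) \<beta> \<nu> b \<mu> d = F (\<nu> + \<mu>) (b \<otimes> d)"
    if \<beta>: "\<beta> \<in> \<Phi>" "c \<alpha> \<beta> = 1"
      and R: "\<And>\<nu> \<mu> b d. \<lbrakk>big q \<nu>; big q \<mu>; b \<in> carrier B; d \<in> carrier B\<rbrakk>
        \<Longrightarrow> Z f \<beta> (\<alpha> - \<beta>) \<nu> b \<mu> d = F (\<nu> + \<mu>) (b \<otimes> d)"
      and h: "big q \<nu>" "big q \<mu>" "b \<in> carrier B" "d \<in> carrier B" for \<beta> \<nu> \<mu> b d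
  proof -
    let ?g = "\<alpha> - \<beta>"
    have g: "?g \<in> \<Phi>" using \<alpha> \<beta> by (auto simp: diff_root)
    have ip: "c \<beta> ?g = -1" using \<beta> by (simp add: c_simps c_self c_sym[of \<beta> \<alpha>])
    have N: "N ?g \<beta> = - N \<beta> ?g" "N \<beta> ?g * N \<beta> ?g = 1"
      using N_skew[OF \<beta>(1) g ip] N_square[OF \<beta>(1) g ip] by auto
    have "Z f ?g \<beta> \<nu> b \<mu> d = - com (f \<beta> \<mu> ([N ?g \<beta>] \<cdot> d)) (f ?g \<nu> b)"
      by (simp add: Z_def com_minus)
    also have "com (f \<beta> \<mu> ([N ?g \<beta>] \<cdot> d)) (f ?g \<nu> b) = Z f \<beta> ?g \<mu> ([N ?g \<beta>] \<cdot> d) \<nu> ([N \<beta> ?g] \<cdot> b)"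
      using h by (simp add: Z_def sgn_sgn N)
    also have "\<dots> = F (\<mu> + \<nu>) (([N ?g \<beta>] \<cdot> d) \<otimes> ([N \<beta> ?g] \<cdot> b))"
      using h by (intro R) auto
    also have "([N ?g \<beta>] \<cdot> d) \<otimes> ([N \<beta> ?g] \<cdot> b) = \<ominus> (b \<otimes> d)"
      using h by (simp add: sgn_simps N sgn_minus_1 m_comm)
    also have "- F (\<mu> + \<nu>) (\<ominus> (b \<otimes> d)) = F (\<nu> + \<mu>) (b \<otimes> d)"
    proof -
      have "big (q + q) (\<mu> + \<nu>)"
        using h(1,2) unfolding big_def by (metis add.assoc add.commute)
      then show ?thesis using Fminus[of "\<mu> + \<nu>" "b \<otimes> d"] h by (simp add: add.commute)
    qed
    finally show ?thesis .
  qed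
  have R: "Z f \<beta> (\<alpha> - \<beta>) \<nu> b \<mu> d = F (\<nu> + \<mu>) (b \<otimes> d)"
    if \<beta>: "\<beta> \<in> \<Phi>" "c \<alpha> \<beta> = 1"
      and h: "big q \<nu>" "big q \<mu>" "b \<in> carrier B" "d \<in> carrier B" for \<beta> \<nu> \<mu> b d
  proof -
    have g: "\<alpha> - \<beta> \<in> \<Phi>" "c \<alpha> (\<alpha> - \<beta>) = 1" using \<alpha> \<beta> by (auto simp: diff_root c_simps c_self)
    have e: "c \<beta>0 (\<alpha> - \<beta>) = 1 - c \<beta>0 \<beta>" using \<beta>0 by (simp add: c_simps c_sym[of \<beta>0 \<alpha>])
    \<comment> \<open>The two products add up to 1, so one of \<open>\<beta>\<close> and
      \<open>\<alpha> - \<beta>\<close> equals \<open>\<beta>0\<close> or can be compared with it by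
      a single shift.\<close>
    consider "c \<beta>0 \<beta> = 2" | "c \<beta>0 \<beta> = 1" | "c \<beta>0 (\<alpha> - \<beta>) = 1" | "c \<beta>0 (\<alpha> - \<beta>) = 2"
      using root_cases[OF \<beta>0(1) \<beta>(1)] root_cases[OF \<beta>0(1) g(1)] e by force
    then show ?thesis
    proof cases
      case 1
      then have "\<beta> = \<beta>0" using c_equal \<beta>0 \<beta> by blast
      then show ?thesis using R0 h bq by simp
    next
      case 2
      then show ?thesis using R1 \<beta> h by blast
    next
      case 3
      then show ?thesis using swap[OF g R1[OF g 3] h] by simp
    next
      case 4
      then have "\<alpha> - \<beta> = \<beta>0" using c_equal \<beta>0 g by blast
      then show ?thesis using swap[OF g _ h] R0 bq by auto
    qed
  qed
  show thesis by (rule that[of F]) (fact R, fact C)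
qed


text \<open>These are the Steinberg relations between the new values \<open>F\<close> at
  \<open>\<alpha>\<close> and the values of \<open>f\<close> off \<open>\<alpha>\<close>. The root
  \<open>- \<alpha>\<close> does not occur: Steinberg relations never involve a pair of opposite
  roots.\<close>

definition eliminated :: "('v \<Rightarrow> 'e \<Rightarrow> 'b \<Rightarrow> 'k::group_add) \<Rightarrow> 'v \<Rightarrow> 'e \<Rightarrow> ('e \<Rightarrow> 'b \<Rightarrow> 'k) \<Rightarrow> bool" where
  "eliminated f \<alpha> m F \<longleftrightarrow>
     (\<forall>\<nu> b d. big m \<nu> \<longrightarrow> b \<in> carrier B \<longrightarrow> d \<in> carrier B \<longrightarrow> F \<nu> (b \<oplus> d) = F \<nu> b + F \<nu> d) \<and>
     (\<forall>\<nu> \<kappa> b. big m \<nu> \<longrightarrow> b \<in> carrier B \<longrightarrow> F (\<nu> + \<kappa>) b = F \<nu> (ev \<kappa> \<otimes> b)) \<and>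
     (\<forall>\<beta>\<in>off \<alpha>. \<forall>\<gamma>\<in>off \<alpha>. \<forall>\<nu> \<mu> b d. \<beta> + \<gamma> = \<alpha> \<longrightarrow> big m \<nu> \<longrightarrow> big m \<mu> \<longrightarrow> b \<in> carrier B \<longrightarrow>
        d \<in> carrier B \<longrightarrow> com (f \<beta> \<nu> b) (f \<gamma> \<mu> d) = F (\<nu> + \<mu>) ([N \<beta> \<gamma>] \<cdot> (b \<otimes> d))) \<and>
     (\<forall>\<delta>\<in>off \<alpha>. \<forall>\<nu> \<mu> b d. big m \<nu> \<longrightarrow> big m \<mu> \<longrightarrow> b \<in> carrier B \<longrightarrow> d \<in> carrier B \<longrightarrow>
        (c \<alpha> \<delta> = -1 \<longrightarrow> com (f \<delta> \<mu> d) (F \<nu> b) = f (\<delta> + \<alpha>) (\<mu> + \<nu>) ([N \<delta> \<alpha>] \<cdot> (d \<otimes> b))) \<and>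
        (c \<alpha> \<delta> \<ge> 0 \<longrightarrow> cm (f \<delta> \<mu> d) (F \<nu> b))) \<and>
     (\<forall>\<nu> \<mu> b d. big m \<nu> \<longrightarrow> big m \<mu> \<longrightarrow> b \<in> carrier B \<longrightarrow> d \<in> carrier B \<longrightarrow> cm (F \<nu> b) (F \<mu> d))"

lemma eliminate_root:
  fixes f :: "'v \<Rightarrow> 'e \<Rightarrow> 'b \<Rightarrow> 'k::group_add" and n
  defines "q \<equiv> n + n + n"
  assumes f: "sys (off \<alpha>) n f" and \<alpha>: "\<alpha> \<in> \<Phi>"
  obtains F where "eliminated f \<alpha> (q + q) F"
proof -
  obtain F where R: "\<And>\<beta> \<nu> \<mu> b d. \<lbrakk>\<beta> \<in> \<Phi>; c \<alpha> \<beta> = 1; big q \<nu>; big q \<mu>; b \<in> carrier B; d \<in> carrier B\<rbrakk>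
      \<Longrightarrow> Z f \<beta> (\<alpha> - \<beta>) \<nu> b \<mu> d = F (\<nu> + \<mu>) (b \<otimes> d)"
    and C: "\<And>\<delta> \<nu> \<mu> b d. \<lbrakk>\<delta> \<in> \<Phi>; c \<alpha> \<delta> = 1; big (q + q) \<nu>; big n \<mu>; b \<in> carrier B; d \<in> carrier B\<rbrakk>
      \<Longrightarrow> cm (f \<delta> \<mu> d) (F \<nu> b)"
    using eliminate_values[OF f \<alpha>] unfolding q_def by metis
  obtain \<beta>0 where \<beta>0: "\<beta>0 \<in> \<Phi>" "c \<alpha> \<beta>0 = 1" using avoiding_root[OF \<alpha> \<alpha>] by blast
  have bq: "big n \<nu>" if "big q \<nu>" for \<nu>
    using that big_weaken unfolding q_def by blast
  have bqq: "big q \<nu>" if "big (q + q) \<nu>" for \<nu>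
    using that big_weaken by blast
  have G: "\<alpha> - \<beta> \<in> \<Phi>" "c \<alpha> (\<alpha> - \<beta>) = 1" "c \<beta> (\<alpha> - \<beta>) = -1" "\<beta> \<in> off \<alpha>" "\<alpha> - \<beta> \<in> off \<alpha>"
    if "\<beta> \<in> \<Phi>" "c \<alpha> \<beta> = 1" for \<beta>
    using \<alpha> that by (auto simp: off_def diff_root c_simps c_self c_sym[of \<beta> \<alpha>])
  \<comment> \<open>With parameter 1 in the first factor, the dependence on \<open>b\<close> rests
    on the second factor alone. Each factor takes up one \<open>q\<close>, which explains the bound
    \<open>q + q\<close>.\<close>
  have F: "F (q + \<mu>) b = com (f \<beta> q \<one>) (f (\<alpha> - \<beta>) \<mu> ([N \<beta> (\<alpha> - \<beta>)] \<cdot> b))"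
    if "\<beta> \<in> \<Phi>" "c \<alpha> \<beta> = 1" "big q \<mu>" "b \<in> carrier B" for \<beta> \<mu> b
    using R[of \<beta> q \<mu> \<one> b] that by (simp add: Z_def)
  have add: "F \<nu> (b \<oplus> d) = F \<nu> b + F \<nu> d"
    if h: "big (q + q) \<nu>" "b \<in> carrier B" "d \<in> carrier B" for \<nu> b d
  proof -
    obtain \<mu> where \<mu>: "\<nu> = q + \<mu>" "big q \<mu>" using big_split[OF h(1)] by blast
    let ?y = "\<lambda>b. f (\<alpha> - \<beta>0) \<mu> ([N \<beta>0 (\<alpha> - \<beta>0)] \<cdot> b)"
    have "?y (b \<oplus> d) = ?y b + ?y d"
      using sys_add[OF f G(5)[OF \<beta>0] bq[OF \<mu>(2)]] h by (simp add: add.int_pow_distrib)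
    moreover have "cm (?y b) (com (f \<beta>0 q \<one>) (?y d))"
      using C[OF G(1,2)[OF \<beta>0] h(1) bq[OF \<mu>(2)], of d "[N \<beta>0 (\<alpha> - \<beta>0)] \<cdot> b"] h
      by (simp add: \<mu>(1) F[OF \<beta>0 \<mu>(2)])
    ultimately show ?thesis using h by (simp add: \<mu>(1) F[OF \<beta>0 \<mu>(2)] com_add_right)
  qed
  have ev: "F (\<nu> + \<kappa>) b = F \<nu> (ev \<kappa> \<otimes> b)"
    if h: "big (q + q) \<nu>" "b \<in> carrier B" for \<nu> \<kappa> b
  proof -
    obtain \<mu> where \<mu>: "\<nu> = q + \<mu>" "big q \<mu>" using big_split[OF h(1)] by blast
    have "F (q + (\<mu> + \<kappa>)) b = F (q + \<mu>) (ev \<kappa> \<otimes> b)"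
      using F[OF \<beta>0 big_mono(1)[OF \<mu>(2)] h(2)] F[OF \<beta>0 \<mu>(2), of "ev \<kappa> \<otimes> b"]
        sys_ev[OF f G(5)[OF \<beta>0] bq[OF \<mu>(2)], of "[N \<beta>0 (\<alpha> - \<beta>0)] \<cdot> b" \<kappa>] h
      by (simp add: sgn_simps)
    then show ?thesis by (simp add: \<mu> add.assoc)
  qed
  have into: "com (f \<beta> \<nu> b) (f \<gamma> \<mu> d) = F (\<nu> + \<mu>) ([N \<beta> \<gamma>] \<cdot> (b \<otimes> d))"
    if \<beta>: "\<beta> \<in> off \<alpha>" "\<gamma> \<in> off \<alpha>" "\<beta> + \<gamma> = \<alpha>"
      and h: "big q \<nu>" "big q \<mu>" "b \<in> carrier B" "d \<in> carrier B" for \<beta> \<gamma> \<nu> \<mu> b d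
  proof -
    have r: "\<beta> \<in> \<Phi>" "\<gamma> \<in> \<Phi>" using \<beta> by (auto simp: off_def)
    then have "c \<beta> \<gamma> = -1" using sum_root \<alpha> \<beta>(3) by blast
    moreover from this have "c \<alpha> \<beta> = 1" using r by (simp add: \<beta>(3)[symmetric] c_simps c_self c_sym[of \<gamma> \<beta>])
    moreover have "\<gamma> = \<alpha> - \<beta>" using \<beta>(3) by (simp add: algebra_simps)
    ultimately show ?thesis
      using R[of \<beta> \<nu> \<mu> b "[N \<beta> \<gamma>] \<cdot> d"] r h N_square[OF r] by (simp add: Z_def sgn_simps)
  qed
  have cm0: "cm (f \<delta> \<mu> d) (F \<nu> b)"
    if \<delta>: "\<delta> \<in> \<Phi>" "c \<alpha> \<delta> = 0"
      and h: "big (q + q) \<nu>" "big n \<mu>" "b \<in> carrier B" "d \<in> carrier B" for \<delta> \<nu> \<mu> b d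
  proof -
    obtain \<kappa> where \<kappa>: "\<nu> = q + \<kappa>" "big q \<kappa>" using big_split[OF h(1)] by blast
    have \<delta>': "c \<delta> \<alpha> = 0" "\<delta> \<in> off \<alpha>" using \<delta> by (auto simp: c_sym off_def)
    \<comment> \<open>The products of \<open>\<delta>\<close> with \<open>\<beta>0\<close> and with
      \<open>\<alpha> - \<beta>0\<close> add up to 0, so one of them is nonnegative.\<close>
    have "\<exists>\<beta>. \<beta> \<in> \<Phi> \<and> c \<alpha> \<beta> = 1 \<and> c \<delta> \<beta> \<ge> 0"
      using \<beta>0 G[OF \<beta>0] \<delta>' by (cases "c \<delta> \<beta>0 \<ge> 0") (force simp: c_simps)+
    then obtain \<beta> where \<beta>: "\<beta> \<in> \<Phi>" "c \<alpha> \<beta> = 1" "c \<delta> \<beta> \<ge> 0" by blast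
    note G = G[OF \<beta>(1,2)]
    let ?g = "\<alpha> - \<beta>"
    let ?x = "f \<beta> q \<one>" and ?y = "f ?g \<kappa> ([N \<beta> ?g] \<cdot> b)" and ?d = "f \<delta> \<mu> d"
    have q: "big n q" "big n \<kappa>" using bq \<kappa> by auto
    have dx: "cm ?d ?x" using \<beta> G \<delta>' h q by (intro sys_cm[OF f]) auto
    show ?thesis unfolding \<kappa>(1) F[OF \<beta>(1,2) \<kappa>(2) h(3)]
    proof (cases "c \<delta> \<beta> = 0")
      case True
      then have "cm ?d ?y" using \<beta> G \<delta>' h q by (intro sys_cm[OF f]) (auto simp: c_simps)
      then show "cm ?d (com ?x ?y)" using dx by (intro cm_com)
    next
      case False
      moreover have "c \<delta> \<beta> \<noteq> 2" using c_equal[OF \<delta>(1) \<beta>(1)] \<beta> \<delta> by auto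
      ultimately have 1: "c \<delta> \<beta> = 1" using root_cases[OF \<delta>(1) \<beta>(1)] \<beta>(3) by auto
      \<comment> \<open>Here \<open>\<delta>\<close> does not commute with the second factor, but
        the resulting element at \<open>\<delta> + ?g\<close> commutes with the first one, because
        \<open>\<delta> + ?g\<close> is orthogonal to \<open>\<beta>\<close>. By
        \<open>com_conj\<close> nothing remains.\<close>
      have s: "\<delta> + ?g \<in> \<Phi>" using sum_root[OF \<delta>(1) G(1)] by (simp add: c_simps \<delta>' 1)
      have s': "c \<alpha> (\<delta> + ?g) = 1" "c \<beta> (\<delta> + ?g) = 0" "\<delta> + ?g \<in> off \<alpha>"
        using \<delta> G 1 s by (simp_all add: c_add_right c_sym[of \<beta> \<delta>] off_def)
      let ?z = "f (\<delta> + ?g) (\<mu> + \<kappa>) ([N \<delta> ?g] \<cdot> (d \<otimes> ([N \<beta> ?g] \<cdot> b)))"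
      have dy: "com ?d ?y = ?z" using \<delta>' G s' h q by (intro sys_com[OF f]) auto
      have "cm ?z (com ?x ?y)"
        unfolding F[OF \<beta>(1,2) \<kappa>(2) h(3), symmetric] \<kappa>(1)[symmetric]
        using s s' h q big_mono by (intro C) auto
      then have "com ?d (com ?x ?y) = com ?x ?z" by (rule com_conj[OF dx dy])
      moreover have "cm ?x ?z" using G s' h q big_mono by (intro sys_cm[OF f]) auto
      ultimately show "cm ?d (com ?x ?y)" by (metis com_eq_0_iff)
    qed
  qed
  have com: "com (f \<delta> \<mu> d) (F \<nu> b) = f (\<delta> + \<alpha>) (\<mu> + \<nu>) ([N \<delta> \<alpha>] \<cdot> (d \<otimes> b))"
    if \<delta>: "\<delta> \<in> \<Phi>" "c \<alpha> \<delta> = -1"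
      and h: "big (q + q) \<nu>" "big n \<mu>" "b \<in> carrier B" "d \<in> carrier B" for \<delta> \<nu> \<mu> b d
  proof -
    obtain \<kappa> where \<kappa>: "\<nu> = q + \<kappa>" "big q \<kappa>" using big_split[OF h(1)] by blast
    have \<delta>': "c \<delta> \<alpha> = -1" "\<delta> \<in> off \<alpha>" using \<delta> by (auto simp: c_sym off_def)
    \<comment> \<open>The products of \<open>\<delta>\<close> with \<open>\<beta>1\<close> and with
      \<open>\<alpha> - \<beta>1\<close> add up to -1. Since neither root is
      \<open>- \<delta>\<close>, neither product is -2, so one of them is 0. For the corresponding
      splitting \<open>\<delta>\<close> commutes with the first factor, and the new root element
      arises from the second.\<close>
    obtain \<beta>1 where \<beta>1: "\<beta>1 \<in> \<Phi>" "c \<alpha> \<beta>1 = 1" "\<beta>1 \<noteq> - \<delta>" "\<alpha> - \<beta>1 \<noteq> - \<delta>"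
      using avoiding_root[OF \<alpha> neg_root[OF \<delta>(1)]] by blast
    have "c \<delta> \<beta>1 \<noteq> -2" "c \<delta> (\<alpha> - \<beta>1) \<noteq> -2"
      using c_opposite_iff[OF \<delta>(1)] \<beta>1 G[OF \<beta>1(1,2)] by auto
    then have "c \<delta> \<beta>1 = 0 \<or> c \<delta> (\<alpha> - \<beta>1) = 0"
      using root_cases[OF \<delta>(1) \<beta>1(1)] root_cases[OF \<delta>(1) G(1)[OF \<beta>1(1,2)]] \<delta>'
      by (auto simp: c_simps)
    then obtain \<beta> where \<beta>: "\<beta> \<in> \<Phi>" "c \<alpha> \<beta> = 1" "c \<delta> \<beta> = 0"
      using \<beta>1 G[OF \<beta>1(1,2)] by blast
    note G = G[OF \<beta>(1,2)]
    let ?g = "\<alpha> - \<beta>"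
    let ?x = "f \<beta> q \<one>" and ?y = "f ?g \<kappa> ([N \<beta> ?g] \<cdot> b)" and ?d = "f \<delta> \<mu> d"
    have q: "big n q" "big n \<kappa>" using bq \<kappa> by auto
    have s: "?g + \<delta> \<in> \<Phi>" "\<delta> + \<alpha> \<in> \<Phi>"
      using sum_root[OF G(1) \<delta>(1)] sum_root[OF \<delta>(1) \<alpha>]
      by (simp_all add: c_simps c_sym[of \<alpha> \<delta>] c_sym[of \<beta> \<delta>] \<delta>' \<beta>)
    have s': "c \<alpha> (?g + \<delta>) = 0" "c \<beta> (?g + \<delta>) = -1" "?g + \<delta> \<in> off \<alpha>" "\<delta> + \<alpha> \<in> off \<alpha>"
      using \<delta> G \<beta> s \<alpha> by (simp_all add: c_add_right c_sym[of \<beta> \<delta>] off_def c_self)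
    have e: "\<delta> + ?g = ?g + \<delta>" "\<beta> + (?g + \<delta>) = \<delta> + \<alpha>" by (simp_all add: algebra_simps)
    have gd: "c ?g \<delta> = -1" by (simp add: c_simps c_sym[of \<alpha> \<delta>] c_sym[of \<beta> \<delta>] \<delta>' \<beta>)
    have J: "N ?g \<delta> * N \<beta> (?g + \<delta>) = N \<beta> ?g * N \<alpha> \<delta>"
      using N_jacobi[OF \<beta>(1) G(1) \<delta>(1) G(3) gd] \<beta>(3) by (simp add: c_sym)
    have N: "N \<delta> ?g = - N ?g \<delta>" "N \<delta> \<alpha> = - N \<alpha> \<delta>" "N \<beta> ?g * N \<beta> ?g = 1"
      using N_skew[OF G(1) \<delta>(1) gd] N_skew[OF \<alpha> \<delta>] N_square[OF \<beta>(1) G(1,3)] by auto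
    have sg: "N \<beta> (?g + \<delta>) * (N \<delta> ?g * N \<beta> ?g) = N \<delta> \<alpha>"
    proof -
      have "N \<beta> (?g + \<delta>) * (N \<delta> ?g * N \<beta> ?g) = - (N ?g \<delta> * N \<beta> (?g + \<delta>)) * N \<beta> ?g"
        by (simp add: N(1))
      also have "\<dots> = - (N \<beta> ?g * N \<beta> ?g) * N \<alpha> \<delta>" unfolding J by simp
      finally show ?thesis by (simp add: N)
    qed
    let ?z = "f (?g + \<delta>) (\<mu> + \<kappa>) ([N \<delta> ?g] \<cdot> (d \<otimes> ([N \<beta> ?g] \<cdot> b)))"
    have dx: "cm ?d ?x" using \<beta> G \<delta>' h q by (intro sys_cm[OF f]) auto
    have dy: "com ?d ?y = ?z"
      using sys_com[OF f \<delta>'(2) G(5) h(2) q(2), of d "[N \<beta> ?g] \<cdot> b"] s' h by (simp add: e)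
    have "cm ?z (com ?x ?y)"
      unfolding F[OF \<beta>(1,2) \<kappa>(2) h(3), symmetric] \<kappa>(1)[symmetric]
      using s s' h q big_mono by (intro cm0) auto
    then have "com ?d (com ?x ?y) = com ?x ?z" by (rule com_conj[OF dx dy])
    also have "com ?x ?z = f (\<delta> + \<alpha>) (q + (\<mu> + \<kappa>))
        ([N \<beta> (?g + \<delta>)] \<cdot> (\<one> \<otimes> ([N \<delta> ?g] \<cdot> (d \<otimes> ([N \<beta> ?g] \<cdot> b)))))"
      using sys_com[OF f G(4) s'(3) q(1) big_mono(1)[OF h(2)], of \<one>
          "[N \<delta> ?g] \<cdot> (d \<otimes> ([N \<beta> ?g] \<cdot> b))"] s' h by (simp add: e)
    also have "\<dots> = f (\<delta> + \<alpha>) (\<mu> + \<nu>) ([N \<delta> \<alpha>] \<cdot> (d \<otimes> b))"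
      using h \<kappa> sg by (simp add: sgn_simps ac_simps)
    finally show ?thesis unfolding \<kappa>(1) F[OF \<beta>(1,2) \<kappa>(2) h(3)] by simp
  qed
  have self: "cm (F \<nu> b) (F \<mu> d)"
    if h: "big (q + q) \<nu>" "big (q + q) \<mu>" "b \<in> carrier B" "d \<in> carrier B" for \<nu> \<mu> b d
  proof -
    obtain \<kappa> where \<kappa>: "\<nu> = q + \<kappa>" "big q \<kappa>" using big_split[OF h(1)] by blast
    have "cm (F \<mu> d) (F \<nu> b)"
      unfolding \<kappa>(1) F[OF \<beta>0 \<kappa>(2) h(3)]
      using \<beta>0 G[OF \<beta>0] h \<kappa> bq by (intro cm_com; intro cm_sym[OF C]) auto
    then show ?thesis by (rule cm_sym)
  qed
  have "eliminated f \<alpha> (q + q) F" unfolding eliminated_def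
  proof (intro conjI allI ballI impI)
    fix \<delta> \<nu> \<mu> b d
    assume \<delta>: "\<delta> \<in> off \<alpha>" and h: "big (q + q) \<nu>" "big (q + q) \<mu>" "b \<in> carrier B" "d \<in> carrier B"
    then have r: "\<delta> \<in> \<Phi>" "big n \<mu>" using bq bqq by (auto simp: off_def)
    show "com (f \<delta> \<mu> d) (F \<nu> b) = f (\<delta> + \<alpha>) (\<mu> + \<nu>) ([N \<delta> \<alpha>] \<cdot> (d \<otimes> b))" if "c \<alpha> \<delta> = -1"
      by (rule com[OF r(1) that h(1) r(2) h(3,4)])
    show "cm (f \<delta> \<mu> d) (F \<nu> b)" if "c \<alpha> \<delta> \<ge> 0"
      using cm0[OF r(1) _ h(1) r(2) h(3,4)] C[OF r(1) _ h(1) r(2) h(3,4)] \<delta> that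
      by (auto simp: off_def)
  qed (use add ev into self bqq in auto)
  then show thesis by (rule that)
qed

end


section \<open>Transvections of systems\<close>

lemma com_add_left: "com (a + x) y = (a + com x y - a) + com a y"
  by (simp only: com_def group_nf)

lemma com_add_right': "com x (a + y) = com x a + (a + com x y - a)"
  by (simp only: com_def group_nf)

lemma com_swap: "com y x = - z \<Longrightarrow> com x y = z"
  using com_minus[of y x] by simp

lemma cm_conj: "cm a x \<Longrightarrow> a + x - a = x"
  by (simp add: cm_def diff_eq_eq)

text \<open>The cross commutators are inverse to each other and cancel when the four factors are
  reordered. The situation occurs for two orthogonal roots that are both changed by conjugation with
  the root element at \<open>\<alpha>\<close>.\<close>

lemma cm_cross:
  assumes "com a y = w" "com x b = - w" "cm a b" "cm x y" "cm w a" "cm w b"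
  shows "cm (a + x) (b + y)"
proof -
  have xb: "x + b = - w + b + x" and ay: "a + y = w + y + a"
    using assms(1,2) com_eqD by blast+
  have wa: "- w + a = a - w" and wb: "- w + b = b - w"
    using cm_minus[OF cm_sym[OF assms(5)]] cm_minus[OF cm_sym[OF assms(6)]] by (simp_all add: cm_def)
  have "(a + x) + (b + y) = a + (x + b) + y" by (simp add: add.assoc)
  also have "\<dots> = (a - w) + b + (x + y)" unfolding xb by (simp only: group_nf)
  also have "\<dots> = - w + (a + b) + (x + y)" by (simp only: wa[symmetric] add.assoc)
  also have "\<dots> = (- w + b) + a + (y + x)" using assms(3,4) by (simp add: cm_def add.assoc)
  also have "\<dots> = b + (- w + (a + y)) + x" unfolding wb by (simp only: group_nf)
  also have "\<dots> = (b + y) + (a + x)" unfolding ay by (simp only: group_nf)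
  finally show ?thesis by (simp add: cm_def)
qed

section \<open>Extension of a system to a pair of opposite roots\<close>

context steinberg_systems
begin

lemma off_cases: "\<alpha> \<in> \<Phi> \<Longrightarrow> \<beta> \<in> \<Phi> \<Longrightarrow> \<beta> \<in> off \<alpha> \<or> \<beta> = \<alpha> \<or> \<beta> = - \<alpha>"
  using root_cases[of \<alpha> \<beta>] c_equal[of \<alpha> \<beta>] c_opposite_iff[of \<alpha> \<beta>] by (auto simp: off_def)

lemma off_subset: "off \<alpha> \<subseteq> \<Phi>"
  by (auto simp: off_def)

lemma off_minus: "off (- \<alpha>) = off \<alpha>"
  by (auto simp: off_def c_minus)

lemma
  assumes "eliminated f \<alpha> m F"
  shows eliminated_add: "\<And>\<nu> b d. \<lbrakk>big m \<nu>; b \<in> carrier B; d \<in> carrier B\<rbrakk> \<Longrightarrow>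
      F \<nu> (b \<oplus> d) = F \<nu> b + F \<nu> d"
    and eliminated_ev: "\<And>\<nu> \<kappa> b. \<lbrakk>big m \<nu>; b \<in> carrier B\<rbrakk> \<Longrightarrow> F (\<nu> + \<kappa>) b = F \<nu> (ev \<kappa> \<otimes> b)"
    and eliminated_into: "\<And>\<beta> \<gamma> \<nu> \<mu> b d. \<lbrakk>\<beta> \<in> off \<alpha>; \<gamma> \<in> off \<alpha>; \<beta> + \<gamma> = \<alpha>; big m \<nu>; big m \<mu>;
      b \<in> carrier B; d \<in> carrier B\<rbrakk>
      \<Longrightarrow> com (f \<beta> \<nu> b) (f \<gamma> \<mu> d) = F (\<nu> + \<mu>) ([N \<beta> \<gamma>] \<cdot> (b \<otimes> d))"
    and eliminated_com: "\<And>\<delta> \<nu> \<mu> b d. \<lbrakk>\<delta> \<in> off \<alpha>; big m \<nu>; big m \<mu>; b \<in> carrier B; d \<in> carrier B; c \<alpha> \<delta> = -1\<rbrakk>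
      \<Longrightarrow> com (f \<delta> \<mu> d) (F \<nu> b) = f (\<delta> + \<alpha>) (\<mu> + \<nu>) ([N \<delta> \<alpha>] \<cdot> (d \<otimes> b))"
    and eliminated_cm: "\<And>\<delta> \<nu> \<mu> b d. \<lbrakk>\<delta> \<in> off \<alpha>; big m \<nu>; big m \<mu>; b \<in> carrier B; d \<in> carrier B; c \<alpha> \<delta> \<ge> 0\<rbrakk>
      \<Longrightarrow> cm (f \<delta> \<mu> d) (F \<nu> b)"
    and eliminated_self: "\<And>\<nu> \<mu> b d. \<lbrakk>big m \<nu>; big m \<mu>; b \<in> carrier B; d \<in> carrier B\<rbrakk>
      \<Longrightarrow> cm (F \<nu> b) (F \<mu> d)"
proof -
  note * = assms[unfolded eliminated_def]
  note 1 = *[THEN conjunct1, rule_format]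
    and 2 = *[THEN conjunct2, THEN conjunct1, rule_format]
    and 3 = *[THEN conjunct2, THEN conjunct2, THEN conjunct1, rule_format]
    and 4 = *[THEN conjunct2, THEN conjunct2, THEN conjunct2, THEN conjunct1, rule_format, THEN conjunct1, rule_format]
    and 5 = *[THEN conjunct2, THEN conjunct2, THEN conjunct2, THEN conjunct1, rule_format, THEN conjunct2, rule_format]
    and 6 = *[THEN conjunct2, THEN conjunct2, THEN conjunct2, THEN conjunct2, rule_format]
  show "\<lbrakk>big m \<nu>; b \<in> carrier B; d \<in> carrier B\<rbrakk> \<Longrightarrow> F \<nu> (b \<oplus> d) = F \<nu> b + F \<nu> d" for \<nu> b d by (rule 1)
  show "\<lbrakk>big m \<nu>; b \<in> carrier B\<rbrakk> \<Longrightarrow> F (\<nu> + \<kappa>) b = F \<nu> (ev \<kappa> \<otimes> b)" for \<nu> \<kappa> b by (rule 2)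
  show "\<lbrakk>\<beta> \<in> off \<alpha>; \<gamma> \<in> off \<alpha>; \<beta> + \<gamma> = \<alpha>; big m \<nu>; big m \<mu>; b \<in> carrier B; d \<in> carrier B\<rbrakk>
      \<Longrightarrow> com (f \<beta> \<nu> b) (f \<gamma> \<mu> d) = F (\<nu> + \<mu>) ([N \<beta> \<gamma>] \<cdot> (b \<otimes> d))" for \<beta> \<gamma> \<nu> \<mu> b d by (rule 3)
  show "\<lbrakk>\<delta> \<in> off \<alpha>; big m \<nu>; big m \<mu>; b \<in> carrier B; d \<in> carrier B; c \<alpha> \<delta> = -1\<rbrakk>
      \<Longrightarrow> com (f \<delta> \<mu> d) (F \<nu> b) = f (\<delta> + \<alpha>) (\<mu> + \<nu>) ([N \<delta> \<alpha>] \<cdot> (d \<otimes> b))" for \<delta> \<nu> \<mu> b d by (rule 4)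
  show "\<lbrakk>\<delta> \<in> off \<alpha>; big m \<nu>; big m \<mu>; b \<in> carrier B; d \<in> carrier B; c \<alpha> \<delta> \<ge> 0\<rbrakk>
      \<Longrightarrow> cm (f \<delta> \<mu> d) (F \<nu> b)" for \<delta> \<nu> \<mu> b d by (rule 5)
  show "\<lbrakk>big m \<nu>; big m \<mu>; b \<in> carrier B; d \<in> carrier B\<rbrakk> \<Longrightarrow> cm (F \<nu> b) (F \<mu> d)" for \<nu> \<mu> b d by (rule 6)
qed

text \<open>\<open>\<alpha>\<close> and \<open>- \<alpha>\<close> are eliminated independently of
  each other: both leave the same set of roots, and no relation connects them. This supplies the
  value at the opposite root that the commutator formula does not give.\<close>

lemma sys_extend:
  fixes f :: "'v \<Rightarrow> 'e \<Rightarrow> 'b \<Rightarrow> 'k::group_add"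
  assumes f: "sys (off \<alpha>) n f" and \<alpha>: "\<alpha> \<in> \<Phi>"
  obtains f' m where "sys \<Phi> m f'" "\<And>\<beta>. \<beta> \<in> off \<alpha> \<Longrightarrow> f' \<beta> = f \<beta>"
proof -
  obtain m where fm: "sys (off \<alpha>) m f" and E: "\<exists>F. eliminated f \<alpha> m F" "\<exists>F. eliminated f (- \<alpha>) m F"
    using eliminate_root[OF f \<alpha>] eliminate_root[of "- \<alpha>" n f] f neg_root[OF \<alpha>] sys_mono(1)
    by (metis off_minus add.assoc)
  then obtain F G where F: "eliminated f \<alpha> m F" and G: "eliminated f (- \<alpha>) m G" by blast
  have "\<alpha> \<noteq> - \<alpha>" using c_self[OF \<alpha>] c_minus_right[of \<alpha> \<alpha>] by force
  define E where "E = (\<lambda>\<beta>. if \<beta> = \<alpha> then F else G)"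
  define f' where "f' = (\<lambda>\<beta>. if \<beta> \<in> off \<alpha> then f \<beta> else E \<beta>)"
  have fo: "f' \<beta> = f \<beta>" if "\<beta> \<in> off \<alpha>" for \<beta> using that by (simp add: f'_def)
  have E: "eliminated f \<beta> m (f' \<beta>)" and oE: "off \<beta> = off \<alpha>" if "\<beta> \<in> \<Phi>" "\<beta> \<notin> off \<alpha>" for \<beta>
    using off_cases[OF \<alpha> that(1)] that(2) F G \<open>\<alpha> \<noteq> - \<alpha>\<close> by (auto simp: E_def f'_def off_minus)
  have add: "f' \<beta> \<nu> (b \<oplus> d) = f' \<beta> \<nu> b + f' \<beta> \<nu> d"
    if "\<beta> \<in> \<Phi>" "big m \<nu>" "b \<in> carrier B" "d \<in> carrier B" for \<beta> \<nu> b d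
  proof (cases "\<beta> \<in> off \<alpha>")
    case True
    then show ?thesis using sys_add[OF fm] that by (simp add: fo)
  next
    case False
    show ?thesis by (rule eliminated_add[OF E[OF that(1) False] that(2-4)])
  qed
  have minus: "f' \<beta> \<nu> (\<ominus> b) = - f' \<beta> \<nu> b" if "\<beta> \<in> \<Phi>" "big m \<nu>" "b \<in> carrier B" for \<beta> \<nu> b
  proof -
    have "f' \<beta> \<nu> \<zero> + f' \<beta> \<nu> \<zero> = f' \<beta> \<nu> \<zero> + 0" using add[OF that(1,2), of \<zero> \<zero>] by simp
    then have "f' \<beta> \<nu> \<zero> = 0" by (rule add_left_imp_eq)
    then have "f' \<beta> \<nu> (\<ominus> b) + f' \<beta> \<nu> b = 0"
      using add[OF that(1,2), of "\<ominus> b" b] that by (simp add: l_neg)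
    then show ?thesis by (simp add: eq_neg_iff_add_eq_0)
  qed
  have com1: "com (f' \<beta> \<nu> b) (f' \<gamma> \<mu> d) = f' (\<beta> + \<gamma>) (\<nu> + \<mu>) ([N \<beta> \<gamma>] \<cdot> (b \<otimes> d))"
    if r: "\<beta> \<in> off \<alpha>" "\<gamma> \<in> \<Phi>" "\<beta> + \<gamma> \<in> \<Phi>"
      and h: "big m \<nu>" "big m \<mu>" "b \<in> carrier B" "d \<in> carrier B" for \<beta> \<gamma> \<nu> \<mu> b d
  proof -
    have \<beta>: "\<beta> \<in> \<Phi>" using r off_subset by blast
    have c: "c \<beta> \<gamma> = -1" "c \<gamma> \<beta> = -1" using sum_root[OF \<beta> r(2)] r(3) by (auto simp: c_sym)
    show ?thesis
    proof (cases "\<gamma> \<in> off \<alpha>")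
      case True
      show ?thesis
      proof (cases "\<beta> + \<gamma> \<in> off \<alpha>")
        case 2: True
        then show ?thesis using True r h sys_com[OF fm] by (simp add: fo)
      next
        case False
        have "com (f \<beta> \<nu> b) (f \<gamma> \<mu> d) = f' (\<beta> + \<gamma>) (\<nu> + \<mu>) ([N \<beta> \<gamma>] \<cdot> (b \<otimes> d))"
          using r(1) True h by (intro eliminated_into[OF E[OF r(3) False]]) (auto simp: oE[OF r(3) False])
        then show ?thesis using True r(1) by (simp add: fo)
      qed
    next
      case False
      have "com (f \<beta> \<nu> b) (f' \<gamma> \<mu> d) = f (\<beta> + \<gamma>) (\<nu> + \<mu>) ([N \<beta> \<gamma>] \<cdot> (b \<otimes> d))"
        using r(1) c h by (intro eliminated_com[OF E[OF r(2) False]]) (auto simp: oE[OF r(2) False])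
      moreover have "\<beta> + \<gamma> \<in> off \<gamma>" using r c by (simp add: off_def c_simps c_self)
      ultimately show ?thesis using oE[OF r(2) False] r(1) by (simp add: fo)
    qed
  qed
  have cm1: "cm (f' \<beta> \<nu> b) (f' \<gamma> \<mu> d)"
    if r: "\<beta> \<in> off \<alpha>" "\<gamma> \<in> \<Phi>" "c \<beta> \<gamma> \<ge> 0"
      and h: "big m \<nu>" "big m \<mu>" "b \<in> carrier B" "d \<in> carrier B" for \<beta> \<gamma> \<nu> \<mu> b d
  proof (cases "\<gamma> \<in> off \<alpha>")
    case True
    then show ?thesis using r h sys_cm[OF fm] by (simp add: fo)
  next
    case False
    have "c \<gamma> \<beta> \<ge> 0" using r by (simp add: c_sym)
    then have "cm (f \<beta> \<nu> b) (f' \<gamma> \<mu> d)"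
      using r(1) h by (intro eliminated_cm[OF E[OF r(2) False]]) (auto simp: oE[OF r(2) False])
    then show ?thesis using r(1) by (simp add: fo)
  qed
  have "sys \<Phi> m f'"
  proof (rule sysI)
    fix \<beta> \<gamma> \<nu> \<mu> b d
    assume r: "\<beta> \<in> \<Phi>" "\<gamma> \<in> \<Phi>" "\<beta> + \<gamma> \<in> \<Phi>"
      and h: "big m \<nu>" "big m \<mu>" "b \<in> carrier B" "d \<in> carrier B"
    have c: "c \<beta> \<gamma> = -1" using sum_root r by blast
    have big: "big m (\<nu> + \<mu>)" using h by (intro big_mono)
    show "com (f' \<beta> \<nu> b) (f' \<gamma> \<mu> d) = f' (\<beta> + \<gamma>) (\<nu> + \<mu>) ([N \<beta> \<gamma>] \<cdot> (b \<otimes> d))"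
    proof (cases "\<beta> \<in> off \<alpha>")
      case True
      then show ?thesis using com1 r h by blast
    next
      case False
      \<comment> \<open>Two roots whose sum is a root cannot both be \<open>\<alpha>\<close> or
        \<open>- \<alpha>\<close>. Hence the other root is off \<open>\<alpha>\<close>, and
        skew-symmetry reduces to the case already treated.\<close>
      have "\<gamma> \<in> off \<beta>" using r c by (simp add: off_def)
      then have "\<gamma> \<in> off \<alpha>" using oE[OF r(1) False] by simp
      moreover have "\<gamma> + \<beta> \<in> \<Phi>" using r(3) by (simp add: add.commute)
      ultimately have "com (f' \<gamma> \<mu> d) (f' \<beta> \<nu> b) = f' (\<gamma> + \<beta>) (\<mu> + \<nu>) ([N \<gamma> \<beta>] \<cdot> (d \<otimes> b))"
        using com1 r(1) h by blast
      also have "\<dots> = - f' (\<beta> + \<gamma>) (\<nu> + \<mu>) ([N \<beta> \<gamma>] \<cdot> (b \<otimes> d))"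
        using minus[OF r(3) big, of "[N \<beta> \<gamma>] \<cdot> (b \<otimes> d)"] h N_skew[OF r(1,2) c]
        by (simp add: sgn_minus add.commute m_comm[of d b])
      finally show ?thesis by (rule com_swap)
    qed
  next
    fix \<beta> \<gamma> \<nu> \<mu> b d
    assume r: "\<beta> \<in> \<Phi>" "\<gamma> \<in> \<Phi>" "c \<beta> \<gamma> \<ge> 0"
      and h: "big m \<nu>" "big m \<mu>" "b \<in> carrier B" "d \<in> carrier B"
    have c: "c \<gamma> \<beta> \<ge> 0" using r by (simp add: c_sym)
    show "cm (f' \<beta> \<nu> b) (f' \<gamma> \<mu> d)"
    proof (cases "\<beta> \<in> off \<alpha> \<or> \<gamma> \<in> off \<alpha>")
      case True
      then show ?thesis using cm1[of \<beta> \<gamma> \<nu> \<mu> b d] cm1[of \<gamma> \<beta> \<mu> \<nu> d b] r h c cm_sym by blast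
    next
      case False
      then have "\<gamma> \<notin> off \<beta>" using oE[OF r(1)] by blast
      then have "\<gamma> = \<beta>" using off_cases[OF r(1,2)] r c_self[OF r(1)] by (auto simp: c_minus_right)
      then show ?thesis using eliminated_self[OF E[OF r(1)]] False h by blast
    qed
  next
    fix \<beta> \<nu> \<kappa> b assume h: "\<beta> \<in> \<Phi>" "big m \<nu>" "b \<in> carrier B"
    show "f' \<beta> (\<nu> + \<kappa>) b = f' \<beta> \<nu> (ev \<kappa> \<otimes> b)"
    proof (cases "\<beta> \<in> off \<alpha>")
      case True
      then show ?thesis using sys_ev[OF fm] h by (simp add: fo)
    next
      case False
      show ?thesis by (rule eliminated_ev[OF E[OF h(1) False] h(2,3)])
    qed
  qed (rule add)
  then show thesis using that fo by blast
qed

section \<open>Conjugation by a root element with a denominator\<close>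

definition corr :: "('v \<Rightarrow> 'e \<Rightarrow> 'b \<Rightarrow> 'k::group_add) \<Rightarrow> 'v \<Rightarrow> 'b \<Rightarrow> 'v \<Rightarrow> 'e \<Rightarrow> 'b \<Rightarrow> 'k" where
  "corr f \<alpha> r \<beta> \<nu> b = (if c \<alpha> \<beta> = -1 then f (\<alpha> + \<beta>) \<nu> ([N \<alpha> \<beta>] \<cdot> (r \<otimes> b)) else 0)"

text \<open>Conjugation of the system by the root element for \<open>\<alpha>\<close> with the parameter \<open>r / ev k\<close>.\<close>

definition conj_sys :: "('v \<Rightarrow> 'e \<Rightarrow> 'b \<Rightarrow> 'k::group_add) \<Rightarrow> 'v \<Rightarrow> 'b \<Rightarrow> 'e \<Rightarrow> 'v \<Rightarrow> 'e \<Rightarrow> 'b \<Rightarrow> 'k" where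
  "conj_sys f \<alpha> r k \<beta> \<nu> b = corr f \<alpha> r \<beta> (\<nu> - k) b + f \<beta> \<nu> b"

lemma conj_sys_add: "conj_sys f \<alpha> r k \<beta> (k + \<nu>) b = corr f \<alpha> r \<beta> \<nu> b + f \<beta> (k + \<nu>) b"
  by (simp add: conj_sys_def)

text \<open>The conjugating element need not exist in the group, so the relations cannot be obtained
  by conjugating and are verified from the commutator formula. \<open>corr\<close> is the commutator
  with that element; lowering its exponent by \<open>k\<close> accounts for the denominator. The
  restriction to \<open>off \<alpha>\<close> avoids the root \<open>- \<alpha>\<close>, for which
  there is no formula.\<close>

lemma sys_conj_sys:
  fixes f :: "'v \<Rightarrow> 'e \<Rightarrow> 'b \<Rightarrow> 'k::group_add"
  assumes f: "sys \<Phi> n f" and \<alpha>: "\<alpha> \<in> \<Phi>" and r: "r \<in> carrier B"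
  shows "sys (off \<alpha>) (k + n) (conj_sys f \<alpha> r k)"
proof -
  let ?f' = "conj_sys f \<alpha> r k"
  have sum: "\<alpha> + \<beta> \<in> \<Phi>" if "\<beta> \<in> \<Phi>" "c \<alpha> \<beta> = -1" for \<beta> using sum_root \<alpha> that by blast
  have add: "?f' \<beta> (k + \<nu>) (b \<oplus> d) = ?f' \<beta> (k + \<nu>) b + ?f' \<beta> (k + \<nu>) d"
    if h: "\<beta> \<in> off \<alpha>" "big n \<nu>" "b \<in> carrier B" "d \<in> carrier B" for \<beta> \<nu> b d
  proof -
    have \<beta>: "\<beta> \<in> \<Phi>" and k\<nu>: "big n (k + \<nu>)" using h off_subset big_mono by blast+
    have "corr f \<alpha> r \<beta> \<nu> (b \<oplus> d) = corr f \<alpha> r \<beta> \<nu> b + corr f \<alpha> r \<beta> \<nu> d"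
      using sys_add[OF f sum[OF \<beta>] h(2)] h r by (simp add: corr_def r_distr add.int_pow_distrib)
    moreover have "corr f \<alpha> r \<beta> \<nu> d + f \<beta> (k + \<nu>) b = f \<beta> (k + \<nu>) b + corr f \<alpha> r \<beta> \<nu> d"
      using sys_cm[OF f sum[OF \<beta>] \<beta> h(2) k\<nu>, of "[N \<alpha> \<beta>] \<cdot> (r \<otimes> d)" b] h r c_self[OF \<beta>]
      by (simp add: corr_def cm_def c_simps)
    ultimately show ?thesis
      using sys_add[OF f \<beta> k\<nu> h(3,4)] by (simp add: conj_sys_add) (metis add.assoc)
  qed
  have minus: "?f' \<beta> (k + \<nu>) (\<ominus> b) = - ?f' \<beta> (k + \<nu>) b"
    if h: "\<beta> \<in> off \<alpha>" "big n \<nu>" "b \<in> carrier B" for \<beta> \<nu> b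
  proof -
    have "?f' \<beta> (k + \<nu>) \<zero> + ?f' \<beta> (k + \<nu>) \<zero> = ?f' \<beta> (k + \<nu>) \<zero> + 0"
      using add[OF h(1,2), of \<zero> \<zero>] by simp
    then have "?f' \<beta> (k + \<nu>) \<zero> = 0" by (rule add_left_imp_eq)
    then have "?f' \<beta> (k + \<nu>) (\<ominus> b) + ?f' \<beta> (k + \<nu>) b = 0"
      using add[OF h(1,2), of "\<ominus> b" b] h by (simp add: l_neg)
    then show ?thesis by (simp add: eq_neg_iff_add_eq_0)
  qed
  have com1: "com (?f' \<beta> (k + \<nu>) b) (?f' \<gamma> (k + \<mu>) d)
      = ?f' (\<beta> + \<gamma>) (k + \<nu> + (k + \<mu>)) ([N \<beta> \<gamma>] \<cdot> (b \<otimes> d))"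
    if R: "\<beta> \<in> off \<alpha>" "\<gamma> \<in> off \<alpha>" "\<beta> + \<gamma> \<in> off \<alpha>" and c\<gamma>: "c \<alpha> \<gamma> \<noteq> -1"
      and h: "big n \<nu>" "big n \<mu>" "b \<in> carrier B" "d \<in> carrier B" for \<beta> \<gamma> \<nu> \<mu> b d
  proof -
    have \<beta>: "\<beta> \<in> \<Phi>" and \<gamma>: "\<gamma> \<in> \<Phi>" and \<beta>\<gamma>: "\<beta> + \<gamma> \<in> \<Phi>" using R off_subset by blast+
    have c: "c \<beta> \<gamma> = -1" "c \<gamma> \<beta> = -1" using sum_root[OF \<beta> \<gamma>] \<beta>\<gamma> by (auto simp: c_sym)
    have bg: "big n (k + \<nu>)" "big n (k + \<mu>)" "big n (k + \<nu> + \<mu>)" "big n (k + \<nu> + (k + \<mu>))"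
      using h by (blast intro: big_mono)+
    have y: "?f' \<gamma> (k + \<mu>) d = f \<gamma> (k + \<mu>) d" using c\<gamma> by (simp add: conj_sys_add corr_def)
    have xy: "com (f \<beta> (k + \<nu>) b) (f \<gamma> (k + \<mu>) d)
        = f (\<beta> + \<gamma>) (k + \<nu> + (k + \<mu>)) ([N \<beta> \<gamma>] \<cdot> (b \<otimes> d))"
      using sys_com[OF f \<beta> \<gamma> bg(1,2) h(3,4) \<beta>\<gamma>] .
    have rhs: "?f' (\<beta> + \<gamma>) (k + \<nu> + (k + \<mu>)) ([N \<beta> \<gamma>] \<cdot> (b \<otimes> d))
        = corr f \<alpha> r (\<beta> + \<gamma>) (k + \<nu> + \<mu>) ([N \<beta> \<gamma>] \<cdot> (b \<otimes> d))
          + f (\<beta> + \<gamma>) (k + \<nu> + (k + \<mu>)) ([N \<beta> \<gamma>] \<cdot> (b \<otimes> d))"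
      using conj_sys_add[of f \<alpha> r k "\<beta> + \<gamma>" "k + \<nu> + \<mu>"] by (simp add: ac_simps)
    show ?thesis
    proof (cases "c \<alpha> \<beta> = -1")
      case False
      then have "c \<alpha> (\<beta> + \<gamma>) \<noteq> -1" using R(1,2) c\<gamma> by (auto simp: off_def c_add_right)
      then show ?thesis using False y xy rhs by (simp add: conj_sys_add corr_def)
    next
      case True
      let ?a = "f (\<alpha> + \<beta>) \<nu> ([N \<alpha> \<beta>] \<cdot> (r \<otimes> b))" and ?y = "f \<gamma> (k + \<mu>) d"
      have "cm ?a (com (f \<beta> (k + \<nu>) b) ?y)"
        unfolding xy using h r bg
        by (intro sys_cm[OF f sum[OF \<beta> True] \<beta>\<gamma>])
           (use R(2) c\<gamma> in \<open>auto simp: c_simps c_self[OF \<beta>] c True off_def\<close>)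
      then have 1: "com (?f' \<beta> (k + \<nu>) b) ?y = com (f \<beta> (k + \<nu>) b) ?y + com ?a ?y"
        using True by (simp add: conj_sys_add corr_def com_add_left cm_conj)
      \<comment> \<open>In the first case the commutator of \<open>?a\<close> and \<open>?y\<close>
        is the correction at \<open>\<beta> + \<gamma>\<close>, by the Jacobi identity. In the
        second case \<open>?a\<close> and \<open>?y\<close> commute, and
        \<open>\<beta> + \<gamma>\<close> has value 0 at \<open>\<alpha>\<close> and is not
        corrected.\<close>
      consider "c \<alpha> \<gamma> = 0" | "c \<alpha> \<gamma> = 1" using R(2) c\<gamma> by (auto simp: off_def)
      then show ?thesis
      proof cases
        case 1
        have c3: "c \<alpha> (\<beta> + \<gamma>) = -1" using 1 True by (simp add: c_add_right)
        have s: "\<alpha> + \<beta> + \<gamma> \<in> \<Phi>" using sum[OF \<beta>\<gamma> c3] by (simp add: add.assoc)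
        have J: "N \<beta> \<gamma> * N \<alpha> (\<beta> + \<gamma>) = N \<alpha> \<beta> * N (\<alpha> + \<beta>) \<gamma>"
          by (rule N_jacobi[OF \<alpha> \<beta> \<gamma> True c(1) 1])
        have ay: "com ?a ?y = f (\<alpha> + (\<beta> + \<gamma>)) (k + \<nu> + \<mu>)
            ([N \<alpha> (\<beta> + \<gamma>)] \<cdot> (r \<otimes> ([N \<beta> \<gamma>] \<cdot> (b \<otimes> d))))"
          using sys_com[OF f sum[OF \<beta> True] \<gamma> h(1) bg(2) _ h(4) s, of "[N \<alpha> \<beta>] \<cdot> (r \<otimes> b)"] h r J
          by (simp add: sgn_simps ac_simps m_assoc)
        have "cm (com (f \<beta> (k + \<nu>) b) ?y) (com ?a ?y)"
          unfolding xy ay using h r bg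
          by (intro sys_cm[OF f \<beta>\<gamma> sum[OF \<beta>\<gamma> c3]])
             (auto simp: c_simps c_self[OF \<beta>] c_self[OF \<gamma>] c True 1 c_sym[of _ \<alpha>])
        then show ?thesis
          unfolding y 1 \<open>com (?f' \<beta> (k + \<nu>) b) ?y = _\<close> rhs
          using c3 xy ay by (simp add: corr_def cm_def)
      next
        case 2
        have "cm ?a ?y" using h r bg
          by (intro sys_cm[OF f sum[OF \<beta> True] \<gamma>]) (auto simp: c_simps c 2)
        then have "com ?a ?y = 0" by (simp add: com_eq_0_iff)
        moreover have "c \<alpha> (\<beta> + \<gamma>) \<noteq> -1" using 2 True by (simp add: c_add_right)
        ultimately show ?thesis unfolding y 1 rhs xy by (simp add: corr_def)
      qed
    qed
  qed
  have cm1: "cm (?f' \<beta> (k + \<nu>) b) (?f' \<gamma> (k + \<mu>) d)"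
    if R: "\<beta> \<in> off \<alpha>" "\<gamma> \<in> off \<alpha>" "c \<beta> \<gamma> \<ge> 0" and c\<gamma>: "c \<alpha> \<gamma> \<noteq> -1"
      and h: "big n \<nu>" "big n \<mu>" "b \<in> carrier B" "d \<in> carrier B" for \<beta> \<gamma> \<nu> \<mu> b d
  proof -
    have \<beta>: "\<beta> \<in> \<Phi>" and \<gamma>: "\<gamma> \<in> \<Phi>" using R off_subset by blast+
    have bg: "big n (k + \<nu>)" "big n (k + \<mu>)" using h by (blast intro: big_mono)+
    have y: "?f' \<gamma> (k + \<mu>) d = f \<gamma> (k + \<mu>) d" using c\<gamma> by (simp add: conj_sys_add corr_def)
    have "cm (f \<gamma> (k + \<mu>) d) (corr f \<alpha> r \<beta> \<nu> b)" using h r bg R c\<gamma>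
      by (auto simp: corr_def off_def c_simps c_sym[of \<gamma>] intro!: sys_cm[OF f \<gamma> sum[OF \<beta>]])
    moreover have "cm (f \<gamma> (k + \<mu>) d) (f \<beta> (k + \<nu>) b)" using h bg R
      by (intro sys_cm[OF f \<gamma> \<beta>]) (auto simp: c_sym)
    ultimately show ?thesis unfolding y conj_sys_add[of f \<alpha> r k \<beta>] by (rule cm_sym[OF cm_add])
  qed
  have cm2: "cm (?f' \<beta> (k + \<nu>) b) (?f' \<gamma> (k + \<mu>) d)"
    if R: "\<beta> \<in> off \<alpha>" "\<gamma> \<in> off \<alpha>" "c \<beta> \<gamma> \<ge> 0" and cb: "c \<alpha> \<beta> = -1" "c \<alpha> \<gamma> = -1"
      and h: "big n \<nu>" "big n \<mu>" "b \<in> carrier B" "d \<in> carrier B" for \<beta> \<gamma> \<nu> \<mu> b d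
  proof -
    have \<beta>: "\<beta> \<in> \<Phi>" and \<gamma>: "\<gamma> \<in> \<Phi>" using R off_subset by blast+
    have bg: "big n (k + \<nu>)" "big n (k + \<mu>)" "big n (k + \<nu> + \<mu>)" using h by (blast intro: big_mono)+
    note cs = c_simps c_self[OF \<alpha>] c_self[OF \<beta>] c_self[OF \<gamma>] cb c_sym[of \<beta> \<alpha>] c_sym[of \<gamma> \<alpha>] c_sym[of \<gamma> \<beta>]
    note S = sum[OF \<beta> cb(1)] sum[OF \<gamma> cb(2)]
    let ?a = "f (\<alpha> + \<beta>) \<nu> ([N \<alpha> \<beta>] \<cdot> (r \<otimes> b))" and ?x = "f \<beta> (k + \<nu>) b"
    let ?b = "f (\<alpha> + \<gamma>) \<mu> ([N \<alpha> \<gamma>] \<cdot> (r \<otimes> d))" and ?y = "f \<gamma> (k + \<mu>) d"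
    have ab: "cm ?a ?b" and xy: "cm ?x ?y"
      using h r R bg \<beta> \<gamma> S by (auto intro!: sys_cm[OF f] simp: cs)
    show ?thesis
    \<comment> \<open>If the product is positive, all four factors commute. If it is 0, both cross
      commutators lie at \<open>\<alpha> + \<beta> + \<gamma>\<close> and have opposite signs by the
      Jacobi identity.\<close>
    proof (cases "c \<beta> \<gamma> = 0")
      case False
      then have "c \<beta> \<gamma> \<ge> 1" using root_cases[OF \<beta> \<gamma>] R(3) by auto
      then have "cm ?a ?y" "cm ?x ?b"
        using h r R bg \<beta> \<gamma> S by (auto intro!: sys_cm[OF f] simp: cs)
      then have "cm (?a + ?x) (?b + ?y)" using ab xy by (intro cm_add cm_sym[OF cm_add]) (auto intro: cm_sym)
      then show ?thesis by (simp add: conj_sys_add corr_def cb)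
    next
      case True
      have s: "\<alpha> + \<beta> + \<gamma> \<in> \<Phi>" "\<beta> + (\<alpha> + \<gamma>) \<in> \<Phi>"
        using sum_root[OF S(1) \<gamma>] sum_root[OF \<beta> S(2)] by (simp_all add: cs True)
      have e: "\<beta> + (\<alpha> + \<gamma>) = \<alpha> + \<beta> + \<gamma>" "\<beta> + \<alpha> = \<alpha> + \<beta>" "k + \<nu> + \<mu> = \<nu> + (k + \<mu>)"
        by (simp_all add: ac_simps)
      have "N \<alpha> \<gamma> * N \<beta> (\<alpha> + \<gamma>) = N \<beta> \<alpha> * N (\<beta> + \<alpha>) \<gamma>"
        by (rule N_jacobi[OF \<beta> \<alpha> \<gamma>]) (simp_all add: cs True)
      then have J: "N \<beta> (\<alpha> + \<gamma>) * N \<alpha> \<gamma> = - (N (\<alpha> + \<beta>) \<gamma> * N \<alpha> \<beta>)"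
        using N_skew[OF \<alpha> \<beta> cb(1)] by (simp add: e ac_simps)
      let ?w = "f (\<alpha> + \<beta> + \<gamma>) (k + \<nu> + \<mu>) ([(N (\<alpha> + \<beta>) \<gamma> * N \<alpha> \<beta>)] \<cdot> (r \<otimes> b \<otimes> d))"
      have ay: "com ?a ?y = ?w"
        using sys_com[OF f S(1) \<gamma> h(1) bg(2) _ h(4) s(1), of "[N \<alpha> \<beta>] \<cdot> (r \<otimes> b)"] h r
        by (simp add: sgn_simps e)
      have "com ?x ?b = f (\<alpha> + \<beta> + \<gamma>) (k + \<nu> + \<mu>) (\<ominus> ([(N (\<alpha> + \<beta>) \<gamma> * N \<alpha> \<beta>)] \<cdot> (r \<otimes> b \<otimes> d)))"
        using sys_com[OF f \<beta> S(2) bg(1) h(2,3) _ s(2), of "[N \<alpha> \<gamma>] \<cdot> (r \<otimes> d)"] h r J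
        by (simp add: sgn_simps e(1) sgn_minus m_ac)
      then have xb: "com ?x ?b = - ?w"
        using sys_minus[OF f s(1) bg(3)] h r by simp
      have "cm ?w ?a" "cm ?w ?b"
        using h r bg s S by (auto intro!: sys_cm[OF f] simp: cs True)
      then have "cm (?a + ?x) (?b + ?y)" by (rule cm_cross[OF ay xb ab xy])
      then show ?thesis by (simp add: conj_sys_add corr_def cb)
    qed
  qed
  show ?thesis
  proof (rule sysI)
    fix \<beta> \<nu> b d
    assume "\<beta> \<in> off \<alpha>" "big (k + n) \<nu>" "b \<in> carrier B" "d \<in> carrier B"
    then show "?f' \<beta> \<nu> (b \<oplus> d) = ?f' \<beta> \<nu> b + ?f' \<beta> \<nu> d"
      using big_split[of k n \<nu>] add by blast
  next
    fix \<beta> \<nu> \<kappa> b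
    assume h: "\<beta> \<in> off \<alpha>" "big (k + n) \<nu>" "b \<in> carrier B"
    then obtain \<nu>' where \<nu>': "\<nu> = k + \<nu>'" "big n \<nu>'" using big_split by blast
    have \<beta>: "\<beta> \<in> \<Phi>" using h off_subset by blast
    show "?f' \<beta> (\<nu> + \<kappa>) b = ?f' \<beta> \<nu> (ev \<kappa> \<otimes> b)"
      unfolding \<nu>'(1) add.assoc conj_sys_add
      using h r sys_ev[OF f \<beta> big_mono(2)[OF \<nu>'(2)], of b k \<kappa>]
        sys_ev[OF f sum[OF \<beta>] \<nu>'(2), of "[N \<alpha> \<beta>] \<cdot> (r \<otimes> b)" \<kappa>]
      by (simp add: corr_def sgn_simps m_lcomm add.assoc)
  next
    fix \<beta> \<gamma> \<nu> \<mu> b d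
    assume R: "\<beta> \<in> off \<alpha>" "\<gamma> \<in> off \<alpha>" "\<beta> + \<gamma> \<in> off \<alpha>" and \<nu>: "big (k + n) \<nu>" "big (k + n) \<mu>"
      and b: "b \<in> carrier B" "d \<in> carrier B"
    obtain \<nu>' \<mu>' where \<nu>': "\<nu> = k + \<nu>'" "big n \<nu>'" "\<mu> = k + \<mu>'" "big n \<mu>'"
      using big_split[OF \<nu>(1)] big_split[OF \<nu>(2)] by blast
    have r': "\<beta> \<in> \<Phi>" "\<gamma> \<in> \<Phi>" "\<beta> + \<gamma> \<in> \<Phi>" using R off_subset by blast+
    have c: "c \<beta> \<gamma> = -1" using sum_root r' by blast
    show "com (?f' \<beta> \<nu> b) (?f' \<gamma> \<mu> d) = ?f' (\<beta> + \<gamma>) (\<nu> + \<mu>) ([N \<beta> \<gamma>] \<cdot> (b \<otimes> d))"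
    proof (cases "c \<alpha> \<gamma> = -1")
      case False
      then show ?thesis using com1 R \<nu>' b by blast
    next
      case True
      \<comment> \<open>If both roots were corrected, their sum would have value -2 at
        \<open>\<alpha>\<close> and not be off \<open>\<alpha>\<close>. So the roles of the two
        roots can be exchanged.\<close>
      then have "c \<alpha> \<beta> \<noteq> -1" using R(3) by (auto simp: off_def c_add_right)
      moreover have "\<gamma> + \<beta> \<in> off \<alpha>" using R(3) by (simp add: add.commute)
      ultimately have "com (?f' \<gamma> \<mu> d) (?f' \<beta> \<nu> b) = ?f' (\<gamma> + \<beta>) (\<mu> + \<nu>) ([N \<gamma> \<beta>] \<cdot> (d \<otimes> b))"
        using com1 R \<nu>' b by blast
      also have "\<dots> = - ?f' (\<beta> + \<gamma>) (\<nu> + \<mu>) ([N \<beta> \<gamma>] \<cdot> (b \<otimes> d))"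
        using minus[OF R(3), of "\<nu>' + (k + \<mu>')" "[N \<beta> \<gamma>] \<cdot> (b \<otimes> d)"] b N_skew[OF r'(1,2) c] \<nu>'
          big_mono(1)[OF \<nu>'(2), of "k + \<mu>'"]
        by (simp add: sgn_minus ac_simps m_comm[of d b])
      finally show ?thesis by (rule com_swap)
    qed
  next
    fix \<beta> \<gamma> \<nu> \<mu> b d
    assume R: "\<beta> \<in> off \<alpha>" "\<gamma> \<in> off \<alpha>" "c \<beta> \<gamma> \<ge> 0" and \<nu>: "big (k + n) \<nu>" "big (k + n) \<mu>"
      and b: "b \<in> carrier B" "d \<in> carrier B"
    obtain \<nu>' \<mu>' where \<nu>': "\<nu> = k + \<nu>'" "big n \<nu>'" "\<mu> = k + \<mu>'" "big n \<mu>'"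
      using big_split[OF \<nu>(1)] big_split[OF \<nu>(2)] by blast
    have c: "c \<gamma> \<beta> \<ge> 0" using R(3) by (simp add: c_sym)
    show "cm (?f' \<beta> \<nu> b) (?f' \<gamma> \<mu> d)"
      using cm1[OF R, of \<nu>' \<mu>' b d] cm1[OF R(2,1) c, of \<mu>' \<nu>' d b] cm2[OF R, of \<nu>' \<mu>' b d] \<nu>' b cm_sym
      by blast
  qed
qed


section \<open>Equality of systems for large exponents\<close>

definition ae :: "('v \<Rightarrow> 'e \<Rightarrow> 'b \<Rightarrow> 'k::group_add) \<Rightarrow> ('v \<Rightarrow> 'e \<Rightarrow> 'b \<Rightarrow> 'k) \<Rightarrow> bool" where
  "ae f g \<longleftrightarrow> (\<exists>n. \<forall>\<beta>\<in>\<Phi>. \<forall>\<nu> b. big n \<nu> \<longrightarrow> b \<in> carrier B \<longrightarrow> f \<beta> \<nu> b = g \<beta> \<nu> b)"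

lemma aeI:
  assumes "\<And>\<beta> \<nu> b. \<lbrakk>\<beta> \<in> \<Phi>; big n \<nu>; b \<in> carrier B\<rbrakk> \<Longrightarrow> f \<beta> \<nu> b = g \<beta> \<nu> b"
  shows "ae f g"
  using assms unfolding ae_def by blast

lemma aeE:
  assumes "ae f g"
  obtains n where "\<And>m \<beta> \<nu> b. \<lbrakk>\<beta> \<in> \<Phi>; big (n + m) \<nu>; b \<in> carrier B\<rbrakk> \<Longrightarrow> f \<beta> \<nu> b = g \<beta> \<nu> b"
  using assms unfolding ae_def by (metis big_weaken(1))

lemma ae_refl: "ae f f"
  by (simp add: ae_def)

lemma ae_sym: "ae f g \<Longrightarrow> ae g f"
  unfolding ae_def by metis

lemma ae_trans:
  assumes "ae f g" "ae g h" shows "ae f h"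
proof -
  obtain n where n: "\<And>m \<beta> \<nu> b. \<lbrakk>\<beta> \<in> \<Phi>; big (n + m) \<nu>; b \<in> carrier B\<rbrakk> \<Longrightarrow> f \<beta> \<nu> b = g \<beta> \<nu> b"
    using assms(1) by (rule aeE) blast
  obtain m where m: "\<And>k \<beta> \<nu> b. \<lbrakk>\<beta> \<in> \<Phi>; big (m + k) \<nu>; b \<in> carrier B\<rbrakk> \<Longrightarrow> g \<beta> \<nu> b = h \<beta> \<nu> b"
    using assms(2) by (rule aeE) blast
  show ?thesis
  proof (rule aeI[where n = "n + m"])
    fix \<beta> \<nu> b assume "\<beta> \<in> \<Phi>" "big (n + m) \<nu>" "b \<in> carrier B"
    then show "f \<beta> \<nu> b = h \<beta> \<nu> b" using n[of \<beta> m \<nu> b] m[of \<beta> n \<nu> b] by (simp add: add.commute)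
  qed
qed

lemma sys_ae:
  assumes "sys \<Phi> n f" "ae f g"
  obtains m where "sys \<Phi> m g"
proof -
  obtain k where k: "\<And>m \<beta> \<nu> b. \<lbrakk>\<beta> \<in> \<Phi>; big (k + m) \<nu>; b \<in> carrier B\<rbrakk> \<Longrightarrow> f \<beta> \<nu> b = g \<beta> \<nu> b"
    using assms(2) by (rule aeE) blast
  have f: "sys \<Phi> (k + n) f" using assms(1) by (rule sys_mono)
  have e: "g \<beta> \<nu> b = f \<beta> \<nu> b" if "\<beta> \<in> \<Phi>" "big (k + n) \<nu>" "b \<in> carrier B" for \<beta> \<nu> b
    using k that by simp
  have "sys \<Phi> (k + n) g"
  proof (rule sysI)
    fix \<beta> \<nu> b d assume "\<beta> \<in> \<Phi>" "big (k + n) \<nu>" "b \<in> carrier B" "d \<in> carrier B"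
    then show "g \<beta> \<nu> (b \<oplus> d) = g \<beta> \<nu> b + g \<beta> \<nu> d" using sys_add[OF f] by (simp add: e)
  next
    fix \<beta> \<nu> \<kappa> b assume "\<beta> \<in> \<Phi>" "big (k + n) \<nu>" "b \<in> carrier B"
    then show "g \<beta> (\<nu> + \<kappa>) b = g \<beta> \<nu> (ev \<kappa> \<otimes> b)"
      using sys_ev[OF f, of \<beta> \<nu> b \<kappa>] e by (simp add: big_mono)
  next
    fix \<beta> \<gamma> \<nu> \<mu> b d
    assume "\<beta> \<in> \<Phi>" "\<gamma> \<in> \<Phi>" "big (k + n) \<nu>" "big (k + n) \<mu>" "b \<in> carrier B" "d \<in> carrier B"
    then show "\<beta> + \<gamma> \<in> \<Phi> \<Longrightarrow> com (g \<beta> \<nu> b) (g \<gamma> \<mu> d) = g (\<beta> + \<gamma>) (\<nu> + \<mu>) ([N \<beta> \<gamma>] \<cdot> (b \<otimes> d))"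
      and "c \<beta> \<gamma> \<ge> 0 \<Longrightarrow> cm (g \<beta> \<nu> b) (g \<gamma> \<mu> d)"
      using sys_com[OF f, of \<beta> \<gamma> \<nu> \<mu> b d] sys_cm[OF f, of \<beta> \<gamma> \<nu> \<mu> b d] by (simp_all add: e big_mono)
  qed
  then show thesis by (rule that)
qed

lemma sys_ev': "sys \<Phi> n f \<Longrightarrow> \<beta> \<in> \<Phi> \<Longrightarrow> big n \<nu> \<Longrightarrow> b \<in> carrier B \<Longrightarrow> f \<beta> (\<kappa> + \<nu>) b = f \<beta> \<nu> (ev \<kappa> \<otimes> b)"
  unfolding add.commute[of \<kappa> \<nu>] by (erule (3) sys_ev)

text \<open>Every root of \<open>Y\<close> is a sum of two roots outside \<open>Y\<close>, so the
  values there are commutators of values on which the systems agree. Equalities thus need no check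
  at opposite roots. The factor \<open>ev m\<close> leaves room for clearing denominators.\<close>

lemma ae_avoiding:
  assumes f: "sys \<Phi> n f" and g: "sys \<Phi> n g"
    and eq: "\<And>\<beta> \<nu> b. \<lbrakk>\<beta> \<in> \<Phi>; \<beta> \<notin> Y; big n \<nu>; b \<in> carrier B\<rbrakk> \<Longrightarrow> f \<beta> \<nu> (ev m \<otimes> b) = g \<beta> \<nu> (ev m \<otimes> b)"
    and Y: "\<And>\<xi>. \<lbrakk>\<xi> \<in> \<Phi>; \<xi> \<in> Y\<rbrakk> \<Longrightarrow> \<exists>\<mu>\<in>\<Phi>. c \<xi> \<mu> = 1 \<and> \<mu> \<notin> Y \<and> \<xi> - \<mu> \<notin> Y"
  shows "ae f g"
proof (rule aeI[where n = "(n + m) + (n + m)"])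
  have eq': "f \<beta> \<nu> b = g \<beta> \<nu> b"
    if h: "\<beta> \<in> \<Phi>" "\<beta> \<notin> Y" "big (n + m) \<nu>" "b \<in> carrier B" for \<beta> \<nu> b
  proof -
    obtain \<mu> where "\<nu> = m + \<mu>" "big n \<mu>" using big_split[of m n \<nu>] h(3) by (auto simp: add.commute)
    then show ?thesis using eq[OF h(1,2), of \<mu> b] h sys_ev'[OF f] sys_ev'[OF g] by simp
  qed
  fix \<xi> \<nu> b assume \<xi>: "\<xi> \<in> \<Phi>" and \<nu>: "big ((n + m) + (n + m)) \<nu>" and b: "b \<in> carrier B"
  obtain \<kappa> where \<kappa>: "\<nu> = (n + m) + \<kappa>" "big (n + m) \<kappa>" using big_split[OF \<nu>] by blast
  have bg: "big n (n + m)" "big n \<kappa>" using \<kappa> big_weaken by auto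
  show "f \<xi> \<nu> b = g \<xi> \<nu> b"
  proof (cases "\<xi> \<in> Y")
    case False
    then show ?thesis using eq'[OF \<xi> False _ b] \<nu> big_weaken by blast
  next
    case True
    then obtain \<mu> where \<mu>: "\<mu> \<in> \<Phi>" "c \<xi> \<mu> = 1" "\<mu> \<notin> Y" "\<xi> - \<mu> \<notin> Y" using Y \<xi> by blast
    have r: "\<xi> - \<mu> \<in> \<Phi>" "\<mu> + (\<xi> - \<mu>) = \<xi>" using \<xi> \<mu> by (auto simp: diff_root)
    then have s: "N \<mu> (\<xi> - \<mu>) * N \<mu> (\<xi> - \<mu>) = 1"
      using N_square[OF \<mu>(1) r(1)] sum_root[OF \<mu>(1) r(1)] \<xi> by simp
    have *: "h \<xi> \<nu> b = com (h \<mu> (n + m) \<one>) (h (\<xi> - \<mu>) \<kappa> ([N \<mu> (\<xi> - \<mu>)] \<cdot> b))" if "sys \<Phi> n h" for h :: "'v \<Rightarrow> 'e \<Rightarrow> 'b \<Rightarrow> 'c::group_add"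
      using sys_com[OF that \<mu>(1) r(1) bg, of \<one> "[N \<mu> (\<xi> - \<mu>)] \<cdot> b"] \<xi> b r(2) s
      by (simp add: sgn_simps \<kappa>(1))
    show ?thesis
      unfolding *[OF f] *[OF g] using eq'[OF \<mu>(1,3), of "n + m" \<one>] eq'[OF r(1) \<mu>(4) \<kappa>(2)] b by simp
  qed
qed

text \<open>\<open>f'\<close> is \<open>f\<close> conjugated by the root element for
  \<open>\<alpha>\<close> with parameter \<open>r / ev k\<close>; the denominator is cleared by
  evaluating at multiples of \<open>ev k\<close>. Nothing is prescribed at
  \<open>- \<alpha>\<close>, where the relations of the system determine \<open>f'\<close> for large
  exponents.\<close>

definition tr :: "'e \<Rightarrow> 'v \<Rightarrow> 'b \<Rightarrow> 'e \<Rightarrow> ('v \<Rightarrow> 'e \<Rightarrow> 'b \<Rightarrow> 'k::group_add) \<Rightarrow> ('v \<Rightarrow> 'e \<Rightarrow> 'b \<Rightarrow> 'k) \<Rightarrow> bool" where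
  "tr n \<alpha> r k f f' \<longleftrightarrow> sys \<Phi> n f \<and> sys \<Phi> n f' \<and>
     (\<forall>\<beta>\<in>\<Phi>. \<beta> \<noteq> - \<alpha> \<longrightarrow> (\<forall>\<nu> b. big n \<nu> \<longrightarrow> b \<in> carrier B \<longrightarrow>
        f' \<beta> \<nu> (ev k \<otimes> b) = corr f \<alpha> r \<beta> \<nu> b + f \<beta> \<nu> (ev k \<otimes> b)))"

definition transv :: "'v \<Rightarrow> 'b \<Rightarrow> 'e \<Rightarrow> ('v \<Rightarrow> 'e \<Rightarrow> 'b \<Rightarrow> 'k::group_add) \<Rightarrow> ('v \<Rightarrow> 'e \<Rightarrow> 'b \<Rightarrow> 'k) \<Rightarrow> bool" where
  "transv \<alpha> r k f f' \<longleftrightarrow> (\<exists>n. tr n \<alpha> r k f f')"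

lemma trD:
  "tr n \<alpha> r k f f' \<Longrightarrow> sys \<Phi> n f" "tr n \<alpha> r k f f' \<Longrightarrow> sys \<Phi> n f'"
  "\<lbrakk>tr n \<alpha> r k f f'; \<beta> \<in> \<Phi>; \<beta> \<noteq> - \<alpha>; big n \<nu>; b \<in> carrier B\<rbrakk> \<Longrightarrow>
    f' \<beta> \<nu> (ev k \<otimes> b) = corr f \<alpha> r \<beta> \<nu> b + f \<beta> \<nu> (ev k \<otimes> b)"
  unfolding tr_def by simp_all

lemma trI:
  assumes "sys \<Phi> n f" "sys \<Phi> n f'"
    and "\<And>\<beta> \<nu> b. \<lbrakk>\<beta> \<in> \<Phi>; \<beta> \<noteq> - \<alpha>; big n \<nu>; b \<in> carrier B\<rbrakk> \<Longrightarrow>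
      f' \<beta> \<nu> (ev k \<otimes> b) = corr f \<alpha> r \<beta> \<nu> b + f \<beta> \<nu> (ev k \<otimes> b)"
  shows "tr n \<alpha> r k f f'"
  using assms unfolding tr_def by simp

lemma tr_mono: "tr n \<alpha> r k f f' \<Longrightarrow> tr (n + m) \<alpha> r k f f'" "tr n \<alpha> r k f f' \<Longrightarrow> tr (m + n) \<alpha> r k f f'"
  by (rule trI; (erule trD(1)[THEN sys_mono(1)] | erule trD(2)[THEN sys_mono(1)] | erule trD(3); (assumption | erule big_weaken)))
     (rule trI; (erule trD(1)[THEN sys_mono(2)] | erule trD(2)[THEN sys_mono(2)] | erule trD(3); (assumption | erule big_weaken)))

text \<open>\<open>sys_extend\<close> also builds a new value at \<open>\<alpha>\<close>. It agrees
  with the old one for large exponents, because \<open>\<alpha>\<close> is a sum of two roots with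
  value 1 at \<open>\<alpha>\<close>, and these are not corrected.\<close>

lemma transv_exists:
  fixes f :: "'v \<Rightarrow> 'e \<Rightarrow> 'b \<Rightarrow> 'k::group_add"
  assumes f: "sys \<Phi> n f" and \<alpha>: "\<alpha> \<in> \<Phi>" and r: "r \<in> carrier B"
  obtains f' where "transv \<alpha> r k f f'"
proof -
  obtain f' m where f': "sys \<Phi> m f'" and e: "\<And>\<beta>. \<beta> \<in> off \<alpha> \<Longrightarrow> f' \<beta> = conj_sys f \<alpha> r k \<beta>"
    using sys_extend[OF sys_conj_sys[OF f \<alpha> r] \<alpha>] by blast
  let ?n = "n + m + k"
  have bg: "big n \<nu>" "big m \<nu>" "big k \<nu>" if "big ?n \<nu>" for \<nu>
    using that big_weaken by (metis, metis, metis)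
  have "tr (?n + ?n) \<alpha> r k f f'"
  proof (rule trI)
    show "sys \<Phi> (?n + ?n) f" "sys \<Phi> (?n + ?n) f'"
      by (rule sys_mono(1)[OF sys_mono(1)[OF sys_mono(1)[OF f]]],
          rule sys_mono(1)[OF sys_mono(1)[OF sys_mono(2)[OF f']]])
    fix \<beta> \<nu> b assume h: "\<beta> \<in> \<Phi>" "\<beta> \<noteq> - \<alpha>" "big (?n + ?n) \<nu>" "b \<in> carrier B"
    have \<nu>: "big ?n \<nu>" using h(3) big_weaken by blast
    show "f' \<beta> \<nu> (ev k \<otimes> b) = corr f \<alpha> r \<beta> \<nu> b + f \<beta> \<nu> (ev k \<otimes> b)"
    proof (cases "\<beta> \<in> off \<alpha>")
      case True
      have "f' \<beta> (k + \<nu>) b = corr f \<alpha> r \<beta> \<nu> b + f \<beta> (k + \<nu>) b"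
        unfolding e[OF True] by (rule conj_sys_add)
      then show ?thesis using sys_ev'[OF f h(1)] sys_ev'[OF f' h(1)] bg[OF \<nu>] h by simp
    next
      case False
      then have \<beta>: "\<beta> = \<alpha>" using off_cases[OF \<alpha> h(1)] h(2) by blast
      obtain \<kappa> where \<kappa>: "\<nu> = ?n + \<kappa>" "big ?n \<kappa>" using big_split[OF h(3)] by blast
      obtain \<mu> where \<mu>: "\<mu> \<in> \<Phi>" "c \<alpha> \<mu> = 1" using avoiding_root[OF \<alpha> \<alpha>] by blast
      let ?g = "\<alpha> - \<mu>"
      have g: "?g \<in> \<Phi>" "c \<alpha> ?g = 1" "\<mu> + ?g = \<alpha>" "\<mu> \<in> off \<alpha>" "?g \<in> off \<alpha>"
        using \<alpha> \<mu> by (auto simp: off_def diff_root c_simps c_self)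
      then have s: "N \<mu> ?g * N \<mu> ?g = 1"
        using N_square[OF \<mu>(1) g(1)] sum_root[OF \<mu>(1) g(1)] \<alpha> by simp
      have *: "h \<alpha> \<nu> d = com (h \<mu> ?n \<one>) (h ?g \<kappa> ([N \<mu> ?g] \<cdot> d))"
        if "sys \<Phi> j h" "big j ?n" "big j \<kappa>" "d \<in> carrier B" for j d and h :: "'v \<Rightarrow> 'e \<Rightarrow> 'b \<Rightarrow> 'k"
        using sys_com[OF that(1) \<mu>(1) g(1) that(2,3), of \<one> "[N \<mu> ?g] \<cdot> d"] \<alpha> that g(3) s
        by (simp add: sgn_simps \<kappa>(1))
      have "f' \<delta> = f \<delta>" if "\<delta> \<in> off \<alpha>" "c \<alpha> \<delta> = 1" for \<delta>
        unfolding e[OF that(1)] using that(2) by (intro ext) (simp add: conj_sys_def corr_def)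
      then have "f' \<alpha> \<nu> (ev k \<otimes> b) = f \<alpha> \<nu> (ev k \<otimes> b)"
        using *[OF f] *[OF f'] bg[of ?n] bg[OF \<kappa>(2)] g \<mu> h by simp
      then show ?thesis using \<beta> by (simp add: corr_def c_self[OF \<alpha>])
    qed
  qed
  then show thesis using that unfolding transv_def by blast
qed

lemma avoid_opposite: "\<alpha> \<in> \<Phi> \<Longrightarrow> \<xi> \<in> {- \<alpha>} \<Longrightarrow> \<exists>\<mu>\<in>\<Phi>. c \<xi> \<mu> = 1 \<and> \<mu> \<notin> {- \<alpha>} \<and> \<xi> - \<mu> \<notin> {- \<alpha>}"
  using avoiding_root[of "- \<alpha>" "- \<alpha>"] neg_root by auto

text \<open>Away from \<open>- \<alpha>\<close> the formula depends only on the fraction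
  \<open>r / ev k\<close>, and \<open>ae_avoiding\<close> takes care of \<open>- \<alpha>\<close>.
  The exponent \<open>\<kappa>\<close> is present because values of \<open>ev\<close> may be zero
  divisors, so that equal fractions satisfy the cross-multiplied equation only after another
  factor.\<close>

lemma transv_unique:
  assumes t: "transv \<alpha> r k f f'" and t1: "transv \<alpha> s l g g'" and fg: "ae f g"
    and r: "\<alpha> \<in> \<Phi>" "r \<in> carrier B" "s \<in> carrier B"
    and eq: "ev \<kappa> \<otimes> (ev l \<otimes> r) = ev \<kappa> \<otimes> (ev k \<otimes> s)"
  shows "ae f' g'"
proof -
  obtain n1 n2 where n: "tr n1 \<alpha> r k f f'" "tr n2 \<alpha> s l g g'" using t t1 unfolding transv_def by blast
  obtain n3 where n3: "\<And>m \<beta> \<nu> b. \<lbrakk>\<beta> \<in> \<Phi>; big (n3 + m) \<nu>; b \<in> carrier B\<rbrakk> \<Longrightarrow> f \<beta> \<nu> b = g \<beta> \<nu> b"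
    using fg by (rule aeE) blast
  let ?n = "n3 + (n1 + n2)"
  have T: "tr ?n \<alpha> r k f f'" and T1: "tr ?n \<alpha> s l g g'"
    by (rule tr_mono(2)[OF tr_mono(1)[OF n(1)]], rule tr_mono(2)[OF tr_mono(2)[OF n(2)]])
  show ?thesis
  proof (rule ae_avoiding[OF trD(2)[OF T] trD(2)[OF T1] _ avoid_opposite[OF r(1)]])
    fix \<beta> \<nu> b assume h: "\<beta> \<in> \<Phi>" "\<beta> \<notin> {- \<alpha>}" "big ?n \<nu>" "b \<in> carrier B"
    have e: "ev (\<kappa> + k + l) \<otimes> b = ev k \<otimes> (ev (\<kappa> + l) \<otimes> b)" "ev (\<kappa> + k + l) \<otimes> b = ev l \<otimes> (ev (\<kappa> + k) \<otimes> b)"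
      using h by (simp_all add: ev_add m_ac)
    have "r \<otimes> (ev (\<kappa> + l) \<otimes> b) = (ev \<kappa> \<otimes> (ev l \<otimes> r)) \<otimes> b"
      using r h by (simp add: ev_add m_ac)
    also have "\<dots> = s \<otimes> (ev (\<kappa> + k) \<otimes> b)"
      unfolding eq using r h by (simp add: ev_add m_ac)
    finally have rs: "r \<otimes> (ev (\<kappa> + l) \<otimes> b) = s \<otimes> (ev (\<kappa> + k) \<otimes> b)" .
    have fg: "f \<gamma> \<nu> d = g \<gamma> \<nu> d" if "\<gamma> \<in> \<Phi>" "d \<in> carrier B" for \<gamma> d using n3 h that by blast
    have "corr f \<alpha> r \<beta> \<nu> (ev (\<kappa> + l) \<otimes> b) = corr g \<alpha> s \<beta> \<nu> (ev (\<kappa> + k) \<otimes> b)"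
      using fg sum_root[OF r(1) h(1)] r h by (simp add: corr_def rs)
    then show "f' \<beta> \<nu> (ev (\<kappa> + k + l) \<otimes> b) = g' \<beta> \<nu> (ev (\<kappa> + k + l) \<otimes> b)"
      using trD(3)[OF T h(1) _ h(3), of "ev (\<kappa> + l) \<otimes> b"] trD(3)[OF T1 h(1) _ h(3), of "ev (\<kappa> + k) \<otimes> b"] h fg
      by (simp flip: e)
  qed
qed

lemma transv_ae:
  assumes t: "transv \<alpha> r k f f'" and fg: "ae f g" "ae f' g'" and r: "\<alpha> \<in> \<Phi>" "r \<in> carrier B"
  shows "transv \<alpha> r k g g'"
proof -
  obtain n1 where n1: "tr n1 \<alpha> r k f f'" using t unfolding transv_def by blast
  obtain n2 where n2: "\<And>m \<beta> \<nu> b. \<lbrakk>\<beta> \<in> \<Phi>; big (n2 + m) \<nu>; b \<in> carrier B\<rbrakk> \<Longrightarrow> f \<beta> \<nu> b = g \<beta> \<nu> b"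
    using fg(1) by (rule aeE) blast
  obtain n3 where n3: "\<And>m \<beta> \<nu> b. \<lbrakk>\<beta> \<in> \<Phi>; big (n3 + m) \<nu>; b \<in> carrier B\<rbrakk> \<Longrightarrow> f' \<beta> \<nu> b = g' \<beta> \<nu> b"
    using fg(2) by (rule aeE) blast
  obtain n4 n5 where s: "sys \<Phi> n4 g" "sys \<Phi> n5 g'"
    using sys_ae[OF trD(1)[OF n1] fg(1)] sys_ae[OF trD(2)[OF n1] fg(2)] by metis
  let ?n = "n3 + (n2 + (n1 + (n4 + n5)))"
  have T: "tr ?n \<alpha> r k f f'" by (rule tr_mono(2)[OF tr_mono(2)[OF tr_mono(1)[OF n1]]])
  have "tr ?n \<alpha> r k g g'"
  proof (rule trI)
    show "sys \<Phi> ?n g" "sys \<Phi> ?n g'"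
      by (rule sys_mono(2)[OF sys_mono(2)[OF sys_mono(2)[OF sys_mono(1)[OF s(1)]]]],
          rule sys_mono(2)[OF sys_mono(2)[OF sys_mono(2)[OF sys_mono(2)[OF s(2)]]]])
    fix \<beta> \<nu> b assume h: "\<beta> \<in> \<Phi>" "\<beta> \<noteq> - \<alpha>" "big ?n \<nu>" "b \<in> carrier B"
    have e: "f \<gamma> \<nu> d = g \<gamma> \<nu> d" "f' \<gamma> \<nu> d = g' \<gamma> \<nu> d" if "\<gamma> \<in> \<Phi>" "d \<in> carrier B" for \<gamma> d
      using n2[OF that(1) _ that(2)] n3[OF that(1) _ that(2)] h(3) big_weaken(2)[of n3] by blast+
    have "corr f \<alpha> r \<beta> \<nu> b = corr g \<alpha> r \<beta> \<nu> b"
      using e sum_root[OF r(1) h(1)] r h by (simp add: corr_def)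
    then show "g' \<beta> \<nu> (ev k \<otimes> b) = corr g \<alpha> r \<beta> \<nu> b + g \<beta> \<nu> (ev k \<otimes> b)"
      using trD(3)[OF T h] e h by simp
  qed
  then show ?thesis unfolding transv_def by blast
qed

lemma transv_zero:
  assumes f: "sys \<Phi> n f" and \<alpha>: "\<alpha> \<in> \<Phi>"
  shows "transv \<alpha> \<zero> k f f"
proof -
  have "tr n \<alpha> \<zero> k f f"
    using sys_zero[OF f] sum_root[OF \<alpha>] by (intro trI f) (auto simp: corr_def)
  then show ?thesis unfolding transv_def by blast
qed

text \<open>The new parameter is the sum of the fractions \<open>r / ev k\<close> and
  \<open>s / ev l\<close>. The second correction lies at \<open>\<alpha> + \<beta>\<close>, which
  the first transvection leaves alone, so the two corrections add up.\<close>

lemma transv_add: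
  assumes "transv \<alpha> r k f f'" "transv \<alpha> s l f' f''"
    and r: "\<alpha> \<in> \<Phi>" "r \<in> carrier B" "s \<in> carrier B"
  shows "transv \<alpha> (ev l \<otimes> r \<oplus> ev k \<otimes> s) (k + l) f f''"
proof -
  obtain n1 n2 where n: "tr n1 \<alpha> r k f f'" "tr n2 \<alpha> s l f' f''" using assms unfolding transv_def by blast
  let ?n = "n1 + n2"
  have T: "tr ?n \<alpha> r k f f'" and T': "tr ?n \<alpha> s l f' f''"
    by (rule tr_mono(1)[OF n(1)], rule tr_mono(2)[OF n(2)])
  note f = trD(1)[OF T]
  have "tr ?n \<alpha> (ev l \<otimes> r \<oplus> ev k \<otimes> s) (k + l) f f''"
  proof (rule trI[OF f trD(2)[OF T']])
    fix \<beta> \<nu> b assume h: "\<beta> \<in> \<Phi>" "\<beta> \<noteq> - \<alpha>" "big ?n \<nu>" "b \<in> carrier B"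
    have 1: "f'' \<beta> \<nu> (ev l \<otimes> (ev k \<otimes> b)) = corr f' \<alpha> s \<beta> \<nu> (ev k \<otimes> b) + f' \<beta> \<nu> (ev l \<otimes> (ev k \<otimes> b))"
      using trD(3)[OF T' h(1-3)] h by simp
    have 2: "f' \<beta> \<nu> (ev k \<otimes> (ev l \<otimes> b)) = corr f \<alpha> r \<beta> \<nu> (ev l \<otimes> b) + f \<beta> \<nu> (ev k \<otimes> (ev l \<otimes> b))"
      using trD(3)[OF T h(1-3)] h by simp
    have 3: "corr f' \<alpha> s \<beta> \<nu> (ev k \<otimes> b) + corr f \<alpha> r \<beta> \<nu> (ev l \<otimes> b) = corr f \<alpha> (ev l \<otimes> r \<oplus> ev k \<otimes> s) \<beta> \<nu> b"
    proof (cases "c \<alpha> \<beta> = -1")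
      case True
      then have s: "\<alpha> + \<beta> \<in> \<Phi>" "c \<alpha> (\<alpha> + \<beta>) = 1" using sum_root[OF r(1) h(1)] by (auto simp: c_simps c_self[OF r(1)])
      have ne: "\<alpha> + \<beta> \<noteq> - \<alpha>" using s(2) c_self[OF r(1)] by (auto simp: c_minus_right)
      have "f' (\<alpha> + \<beta>) \<nu> (ev k \<otimes> ([N \<alpha> \<beta>] \<cdot> (s \<otimes> b))) = f (\<alpha> + \<beta>) \<nu> (ev k \<otimes> ([N \<alpha> \<beta>] \<cdot> (s \<otimes> b)))"
        using trD(3)[OF T s(1) ne h(3), of "[N \<alpha> \<beta>] \<cdot> (s \<otimes> b)"] r h s(2) by (simp add: corr_def)
      then have "corr f' \<alpha> s \<beta> \<nu> (ev k \<otimes> b) = f (\<alpha> + \<beta>) \<nu> ([N \<alpha> \<beta>] \<cdot> (ev k \<otimes> s \<otimes> b))"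
        using True r h by (simp add: corr_def sgn_simps m_ac)
      moreover have "corr f \<alpha> r \<beta> \<nu> (ev l \<otimes> b) = f (\<alpha> + \<beta>) \<nu> ([N \<alpha> \<beta>] \<cdot> (ev l \<otimes> r \<otimes> b))"
        using True r h by (simp add: corr_def m_ac)
      ultimately show ?thesis
        using sys_add[OF f s(1) h(3), of "[N \<alpha> \<beta>] \<cdot> (ev k \<otimes> s \<otimes> b)" "[N \<alpha> \<beta>] \<cdot> (ev l \<otimes> r \<otimes> b)"] True r h
        by (simp add: corr_def add.int_pow_distrib[symmetric] l_distr a_comm)
    qed (simp add: corr_def)
    show "f'' \<beta> \<nu> (ev (k + l) \<otimes> b) = corr f \<alpha> (ev l \<otimes> r \<oplus> ev k \<otimes> s) \<beta> \<nu> b + f \<beta> \<nu> (ev (k + l) \<otimes> b)"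
      using 1 2 h unfolding 3[symmetric] by (simp add: ev_add m_ac add.assoc)
  qed
  then show ?thesis unfolding transv_def by blast
qed

lemma avoid_commuting:
  assumes "\<alpha> \<in> \<Phi>" "\<beta> \<in> \<Phi>" "c \<alpha> \<beta> = 0 \<or> c \<alpha> \<beta> = 1" "\<xi> \<in> {- \<alpha>, - \<beta>}"
  shows "\<exists>\<mu>\<in>\<Phi>. c \<xi> \<mu> = 1 \<and> \<mu> \<notin> {- \<alpha>, - \<beta>} \<and> \<xi> - \<mu> \<notin> {- \<alpha>, - \<beta>}"
proof -
  have *: "\<exists>\<mu>\<in>\<Phi>. c (- \<alpha>) \<mu> = 1 \<and> \<mu> \<notin> {- \<alpha>, - \<beta>} \<and> - \<alpha> - \<mu> \<notin> {- \<alpha>, - \<beta>}"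
    if r: "\<alpha> \<in> \<Phi>" "\<beta> \<in> \<Phi>" for \<alpha> \<beta>
  proof -
    obtain \<mu> where \<mu>: "\<mu> \<in> \<Phi>" "c (- \<alpha>) \<mu> = 1" "\<mu> \<noteq> - \<beta>" "- \<alpha> - \<mu> \<noteq> - \<beta>"
      using avoiding_root[OF neg_root[OF r(1)] neg_root[OF r(2)]] by blast
    moreover have "\<mu> \<noteq> - \<alpha>" using \<mu>(2) r by (auto simp: c_simps c_self)
    moreover have "- \<alpha> - \<mu> \<noteq> - \<alpha>" using \<mu>(1) c_self[OF \<mu>(1)] c_add[of 0 0 0] by auto
    ultimately show ?thesis by blast
  qed
  show ?thesis using assms *[of \<alpha> \<beta>] *[of \<beta> \<alpha>] by (auto simp: insert_commute)
qed

text \<open>For each of the three roots \<open>\<xi>\<close>, the forbidden roots with value 1 at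
  \<open>\<xi>\<close> belong to a single pair \<open>\<zeta>\<close>,
  \<open>\<xi> - \<zeta>\<close>. This is why \<open>avoiding_root\<close>, which avoids one such
  pair, is sufficient.\<close>

lemma avoid_sum:
  assumes r: "\<alpha> \<in> \<Phi>" "\<beta> \<in> \<Phi>" "c \<alpha> \<beta> = -1" and \<xi>: "\<xi> \<in> {- \<alpha>, - \<beta>, - (\<alpha> + \<beta>)}"
  shows "\<exists>\<mu>\<in>\<Phi>. c \<xi> \<mu> = 1 \<and> \<mu> \<notin> {- \<alpha>, - \<beta>, - (\<alpha> + \<beta>)} \<and> \<xi> - \<mu> \<notin> {- \<alpha>, - \<beta>, - (\<alpha> + \<beta>)}"
proof -
  have ab: "\<alpha> + \<beta> \<in> \<Phi>" using sum_root r by blast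
  have "c \<beta> \<alpha> = -1" using r(3) by (simp add: c_sym)
  note cs = c_simps c_self[OF r(1)] c_self[OF r(2)] r(3) this
  have aux: "\<exists>\<mu>\<in>\<Phi>. c \<xi> \<mu> = 1 \<and> \<mu> \<notin> {- \<alpha>, - \<beta>, - (\<alpha> + \<beta>)} \<and> \<xi> - \<mu> \<notin> {- \<alpha>, - \<beta>, - (\<alpha> + \<beta>)}"
    if x: "\<xi> \<in> \<Phi>" "\<zeta> \<in> \<Phi>" and z: "\<And>\<mu>. \<mu> \<in> {- \<alpha>, - \<beta>, - (\<alpha> + \<beta>)} \<Longrightarrow> c \<xi> \<mu> = 1 \<Longrightarrow> \<mu> = \<zeta> \<or> \<xi> - \<mu> = \<zeta>" for \<xi> \<zeta>
  proof -
    obtain \<mu> where \<mu>: "\<mu> \<in> \<Phi>" "c \<xi> \<mu> = 1" "\<mu> \<noteq> \<zeta>" "\<xi> - \<mu> \<noteq> \<zeta>" using avoiding_root[OF x] by blast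
    moreover have "\<xi> - \<mu> \<in> \<Phi>" using diff_root[OF x(1) \<mu>(1)] \<mu>(2) by blast
    moreover have "c \<xi> (\<xi> - \<mu>) = 1" using \<mu>(2) c_self[OF x(1)] by (simp add: c_diff_right)
    ultimately show ?thesis using z[of \<mu>] z[of "\<xi> - \<mu>"] by (intro bexI[of _ \<mu>]) auto
  qed
  note neg = neg_root[OF r(1)] neg_root[OF r(2)] neg_root[OF ab]
  have 1: "\<mu> = - (\<alpha> + \<beta>) \<or> - \<alpha> - \<mu> = - (\<alpha> + \<beta>)"
    if "\<mu> \<in> {- \<alpha>, - \<beta>, - (\<alpha> + \<beta>)}" "c (- \<alpha>) \<mu> = 1" for \<mu>
    using that by (auto simp: cs simp del: minus_add_distrib)
  have 2: "\<mu> = - (\<alpha> + \<beta>) \<or> - \<beta> - \<mu> = - (\<alpha> + \<beta>)"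
    if "\<mu> \<in> {- \<alpha>, - \<beta>, - (\<alpha> + \<beta>)}" "c (- \<beta>) \<mu> = 1" for \<mu>
    using that by (auto simp: cs simp del: minus_add_distrib)
  have 3: "\<mu> = - \<alpha> \<or> - (\<alpha> + \<beta>) - \<mu> = - \<alpha>"
    if "\<mu> \<in> {- \<alpha>, - \<beta>, - (\<alpha> + \<beta>)}" "c (- (\<alpha> + \<beta>)) \<mu> = 1" for \<mu>
    using that by (auto simp: cs)
  show ?thesis
    using \<xi> aux[OF neg(1,3) 1] aux[OF neg(2,3) 2] aux[OF neg(3,1) 3] by blast
qed

end


lemma add_eq_minusD:
  fixes x y z :: "'a::ab_group_add"
  assumes "x + y = - z"
  shows "y = - (x + z)" "y = - (z + x)"
proof -
  have "y = (x + y) - x" by simp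
  then show "y = - (x + z)" "y = - (z + x)" unfolding assms by simp_all
qed

lemma cm_swap: "cm u v \<Longrightarrow> (w + u) + (v + z) = (w + v) + (u + z)"
  unfolding cm_def by (metis add.assoc)

section \<open>Commutation relations between transvections\<close>

context steinberg_systems
begin

text \<open>The second transvection uses the intermediate system at
  \<open>\<beta> + \<gamma>\<close>; as this root is not \<open>- \<alpha>\<close>, the formula of
  the first transvection applies there. The result is then expressed by the original system
  alone.\<close>

lemma tr_two:
  assumes T: "tr n \<alpha> r k f f1" "tr n \<beta> s l f1 f2"
    and R: "\<alpha> \<in> \<Phi>" "\<beta> \<in> \<Phi>" "\<gamma> \<in> \<Phi>" "\<gamma> \<noteq> - \<alpha>" "\<gamma> \<noteq> - \<beta>" "\<beta> + \<gamma> \<noteq> - \<alpha>"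
    and b: "big n \<nu>" "r \<in> carrier B" "s \<in> carrier B" "x \<in> carrier B"
  shows "f2 \<gamma> \<nu> (ev (k + l) \<otimes> x) =
    (if c \<beta> \<gamma> = -1 then corr f \<alpha> r (\<beta> + \<gamma>) \<nu> ([N \<beta> \<gamma>] \<cdot> (s \<otimes> x))
        + f (\<beta> + \<gamma>) \<nu> ([N \<beta> \<gamma>] \<cdot> (ev k \<otimes> s \<otimes> x)) else 0) +
    ((if c \<alpha> \<gamma> = -1 then f (\<alpha> + \<gamma>) \<nu> ([N \<alpha> \<gamma>] \<cdot> (ev l \<otimes> r \<otimes> x)) else 0) + f \<gamma> \<nu> (ev (k + l) \<otimes> x))"
proof -
  have e: "ev (k + l) \<otimes> x = ev l \<otimes> (ev k \<otimes> x)" "ev (k + l) \<otimes> x = ev k \<otimes> (ev l \<otimes> x)"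
    using b by (simp_all add: ev_add m_ac)
  have 1: "f2 \<gamma> \<nu> (ev (k + l) \<otimes> x) = corr f1 \<beta> s \<gamma> \<nu> (ev k \<otimes> x) + f1 \<gamma> \<nu> (ev (k + l) \<otimes> x)"
    unfolding e(1) using b by (intro trD(3)[OF T(2) R(3,5) b(1)]) simp
  have 2: "f1 \<gamma> \<nu> (ev (k + l) \<otimes> x) = corr f \<alpha> r \<gamma> \<nu> (ev l \<otimes> x) + f \<gamma> \<nu> (ev (k + l) \<otimes> x)"
    unfolding e(2) using b by (intro trD(3)[OF T(1) R(3,4) b(1)]) simp
  have 3: "corr f \<alpha> r \<gamma> \<nu> (ev l \<otimes> x)
      = (if c \<alpha> \<gamma> = -1 then f (\<alpha> + \<gamma>) \<nu> ([N \<alpha> \<gamma>] \<cdot> (ev l \<otimes> r \<otimes> x)) else 0)"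
    using b by (simp add: corr_def m_ac)
  have 4: "corr f1 \<beta> s \<gamma> \<nu> (ev k \<otimes> x)
      = (if c \<beta> \<gamma> = -1 then corr f \<alpha> r (\<beta> + \<gamma>) \<nu> ([N \<beta> \<gamma>] \<cdot> (s \<otimes> x))
        + f (\<beta> + \<gamma>) \<nu> ([N \<beta> \<gamma>] \<cdot> (ev k \<otimes> s \<otimes> x)) else 0)"
  proof (cases "c \<beta> \<gamma> = -1")
    case True
    have e: "s \<otimes> (ev k \<otimes> x) = ev k \<otimes> (s \<otimes> x)" using b by (simp add: m_lcomm)
    have "\<beta> + \<gamma> \<in> \<Phi>" using sum_root R True by blast
    from trD(3)[OF T(1) this R(6) b(1), of "[N \<beta> \<gamma>] \<cdot> (s \<otimes> x)"] show ?thesis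
      using True b by (simp add: corr_def[of f1] e sgn_simps m_assoc)
  qed (simp add: corr_def)
  show ?thesis unfolding 1 2 3 4 ..
qed

lemma transv_commute:
  assumes t: "transv \<alpha> r k f f1" "transv \<beta> s l f1 f2" "transv \<beta> s l f g1" "transv \<alpha> r k g1 g2"
    and R: "\<alpha> \<in> \<Phi>" "\<beta> \<in> \<Phi>" "c \<alpha> \<beta> = 0 \<or> c \<alpha> \<beta> = 1" and b: "r \<in> carrier B" "s \<in> carrier B"
  shows "ae f2 g2"
proof -
  obtain n1 n2 n3 n4 where n: "tr n1 \<alpha> r k f f1" "tr n2 \<beta> s l f1 f2" "tr n3 \<beta> s l f g1" "tr n4 \<alpha> r k g1 g2"
    using t unfolding transv_def by blast
  let ?n = "(n1 + n2) + (n3 + n4)"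
  have T: "tr ?n \<alpha> r k f f1" "tr ?n \<beta> s l f1 f2" "tr ?n \<beta> s l f g1" "tr ?n \<alpha> r k g1 g2"
    by (rule tr_mono(1)[OF tr_mono(1)[OF n(1)]], rule tr_mono(1)[OF tr_mono(2)[OF n(2)]],
        rule tr_mono(2)[OF tr_mono(1)[OF n(3)]], rule tr_mono(2)[OF tr_mono(2)[OF n(4)]])
  note f = trD(1)[OF T(1)]
  have c': "c \<beta> \<alpha> = c \<alpha> \<beta>" by (rule c_sym)
  show ?thesis
  proof (rule ae_avoiding[OF trD(2)[OF T(2)] trD(2)[OF T(4)] _ avoid_commuting[OF R]])
    fix \<gamma> \<nu> x assume h: "\<gamma> \<in> \<Phi>" "\<gamma> \<notin> {- \<alpha>, - \<beta>}" "big ?n \<nu>" "x \<in> carrier B"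
    have ne: "\<beta> + \<gamma> \<noteq> - \<alpha>" "\<alpha> + \<gamma> \<noteq> - \<beta>"
    proof -
      \<comment> \<open>The sum of \<open>\<alpha>\<close> and \<open>\<beta>\<close> has norm 4 or
        6 with respect to \<open>c\<close>, so its negative is not a root.\<close>
      have "\<gamma> \<noteq> - (\<alpha> + \<beta>)"
        using h(1) c_self[OF h(1)] R c_self[OF R(1)] c_self[OF R(2)] c' by (auto simp: c_simps)
      then show "\<beta> + \<gamma> \<noteq> - \<alpha>" "\<alpha> + \<gamma> \<noteq> - \<beta>" by (blast dest: add_eq_minusD)+
    qed
    have nm: "c \<alpha> \<gamma> \<noteq> -2" "c \<beta> \<gamma> \<noteq> -2" using c_opposite_iff R h by auto
    have L: "f2 \<gamma> \<nu> (ev (k + l) \<otimes> x) =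
      (if c \<beta> \<gamma> = -1 then corr f \<alpha> r (\<beta> + \<gamma>) \<nu> ([N \<beta> \<gamma>] \<cdot> (s \<otimes> x))
          + f (\<beta> + \<gamma>) \<nu> ([N \<beta> \<gamma>] \<cdot> (ev k \<otimes> s \<otimes> x)) else 0) +
      ((if c \<alpha> \<gamma> = -1 then f (\<alpha> + \<gamma>) \<nu> ([N \<alpha> \<gamma>] \<cdot> (ev l \<otimes> r \<otimes> x)) else 0) + f \<gamma> \<nu> (ev (k + l) \<otimes> x))"
      using h b ne by (intro tr_two[OF T(1,2) R(1,2)]) auto
    have G: "g2 \<gamma> \<nu> (ev (k + l) \<otimes> x) =
      (if c \<alpha> \<gamma> = -1 then corr f \<beta> s (\<alpha> + \<gamma>) \<nu> ([N \<alpha> \<gamma>] \<cdot> (r \<otimes> x))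
          + f (\<alpha> + \<gamma>) \<nu> ([N \<alpha> \<gamma>] \<cdot> (ev l \<otimes> r \<otimes> x)) else 0) +
      ((if c \<beta> \<gamma> = -1 then f (\<beta> + \<gamma>) \<nu> ([N \<beta> \<gamma>] \<cdot> (ev k \<otimes> s \<otimes> x)) else 0) + f \<gamma> \<nu> (ev (k + l) \<otimes> x))"
      unfolding add.commute[of k l] using h b ne by (intro tr_two[OF T(3,4) R(2,1)]) auto
    show "f2 \<gamma> \<nu> (ev (k + l) \<otimes> x) = g2 \<gamma> \<nu> (ev (k + l) \<otimes> x)"
    proof (cases "c \<alpha> \<gamma> = -1 \<and> c \<beta> \<gamma> = -1")
      case False
      then have "c \<beta> \<gamma> = -1 \<Longrightarrow> c \<alpha> (\<beta> + \<gamma>) \<noteq> -1" "c \<alpha> \<gamma> = -1 \<Longrightarrow> c \<beta> (\<alpha> + \<gamma>) \<noteq> -1"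
        using R(3) nm c' root_cases[OF R(1) h(1)] root_cases[OF R(2) h(1)] by (auto simp: c_add_right)
      then show ?thesis unfolding L G using False by (auto simp: corr_def)
    next
      case True
      have s: "\<beta> + \<gamma> \<in> \<Phi>" "\<alpha> + \<gamma> \<in> \<Phi>" using sum_root R h True by auto
      \<comment> \<open>The product equals \<open>c \<alpha> \<beta>\<close>, so the two single
        corrections commute.\<close>
      have cb: "c (\<beta> + \<gamma>) (\<alpha> + \<gamma>) \<ge> 0"
        using True R(3) c' c_self[OF h(1)] c_sym[of \<gamma> \<alpha>] by (auto simp: c_simps)
      have "cm (f (\<beta> + \<gamma>) \<nu> ([N \<beta> \<gamma>] \<cdot> (ev k \<otimes> s \<otimes> x))) (f (\<alpha> + \<gamma>) \<nu> ([N \<alpha> \<gamma>] \<cdot> (ev l \<otimes> r \<otimes> x)))"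
        using h b by (intro sys_cm[OF f s _ _ _ _ cb]) auto
      from cm_swap[OF this] have "(w + f (\<beta> + \<gamma>) \<nu> ([N \<beta> \<gamma>] \<cdot> (ev k \<otimes> s \<otimes> x))) + (f (\<alpha> + \<gamma>) \<nu> ([N \<alpha> \<gamma>] \<cdot> (ev l \<otimes> r \<otimes> x)) + z)
          = (w + f (\<alpha> + \<gamma>) \<nu> ([N \<alpha> \<gamma>] \<cdot> (ev l \<otimes> r \<otimes> x))) + (f (\<beta> + \<gamma>) \<nu> ([N \<beta> \<gamma>] \<cdot> (ev k \<otimes> s \<otimes> x)) + z)"
        for w z .
      \<comment> \<open>The twofold corrections lie at \<open>\<alpha> + \<beta> + \<gamma>\<close>.
        For orthogonal \<open>\<alpha>\<close> and \<open>\<beta>\<close> they agree by the Jacobi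
        identity; for product 1 there are none.\<close>
      moreover have "corr f \<alpha> r (\<beta> + \<gamma>) \<nu> ([N \<beta> \<gamma>] \<cdot> (s \<otimes> x)) = corr f \<beta> s (\<alpha> + \<gamma>) \<nu> ([N \<alpha> \<gamma>] \<cdot> (r \<otimes> x))"
      proof (cases "c \<alpha> \<beta> = 0")
        case False
        then show ?thesis using R(3) c' True by (simp add: corr_def c_add_right)
      next
        case 0: True
        have "N \<gamma> \<beta> * N \<alpha> (\<gamma> + \<beta>) = N \<alpha> \<gamma> * N (\<alpha> + \<gamma>) \<beta>"
          using True 0 by (intro N_jacobi R h) (auto simp: c_sym[of \<gamma>])
        moreover have "N \<gamma> \<beta> = - N \<beta> \<gamma>" "N (\<alpha> + \<gamma>) \<beta> = - N \<beta> (\<alpha> + \<gamma>)"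
          using N_skew[OF R(2) h(1)] N_skew[OF R(2) s(2)] True 0 c' by (auto simp: c_add_right)
        ultimately have J: "N \<alpha> (\<beta> + \<gamma>) * N \<beta> \<gamma> = N \<beta> (\<alpha> + \<gamma>) * N \<alpha> \<gamma>"
          by (simp add: ac_simps)
        have e: "\<alpha> + (\<beta> + \<gamma>) = \<beta> + (\<alpha> + \<gamma>)" by (simp add: ac_simps)
        show ?thesis using True 0 c' b h by (simp add: corr_def c_add_right sgn_simps J e m_ac)
      qed
      ultimately show ?thesis
        unfolding L G simp_thms(7) if_True if_P[OF conjunct1[OF True]] if_P[OF conjunct2[OF True]] by metis
    qed
  qed
qed

text \<open>This is the commutator relation in the form x y = z y x with z at
  \<open>\<alpha> + \<beta>\<close>, the factor on the left acting first. In this form it contains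
  no inverses.\<close>

lemma transv_com:
  fixes f :: "'v \<Rightarrow> 'e \<Rightarrow> 'b \<Rightarrow> 'k::group_add"
  assumes t: "transv \<alpha> r k f f1" "transv \<beta> s l f1 f2"
    "transv (\<alpha> + \<beta>) ([N \<alpha> \<beta>] \<cdot> (r \<otimes> s)) (k + l) f g1" "transv \<beta> s l g1 g2" "transv \<alpha> r k g2 g3"
    and R: "\<alpha> \<in> \<Phi>" "\<beta> \<in> \<Phi>" "c \<alpha> \<beta> = -1" and b: "r \<in> carrier B" "s \<in> carrier B"
  shows "ae f2 g3"
proof -
  let ?q = "[N \<alpha> \<beta>] \<cdot> (r \<otimes> s)" and ?s = "\<alpha> + \<beta>" and ?M = "ev (k + l)"
  obtain n1 n2 n3 n4 n5 where n: "tr n1 \<alpha> r k f f1" "tr n2 \<beta> s l f1 f2" "tr n3 ?s ?q (k + l) f g1"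
    "tr n4 \<beta> s l g1 g2" "tr n5 \<alpha> r k g2 g3"
    using t unfolding transv_def by blast
  let ?n = "(n1 + n2) + (n3 + (n4 + n5))"
  have T: "tr ?n \<alpha> r k f f1" "tr ?n \<beta> s l f1 f2" "tr ?n ?s ?q (k + l) f g1" "tr ?n \<beta> s l g1 g2" "tr ?n \<alpha> r k g2 g3"
    by (rule tr_mono(1)[OF tr_mono(1)[OF n(1)]], rule tr_mono(1)[OF tr_mono(2)[OF n(2)]],
        rule tr_mono(2)[OF tr_mono(1)[OF n(3)]], rule tr_mono(2)[OF tr_mono(2)[OF tr_mono(1)[OF n(4)]]],
        rule tr_mono(2)[OF tr_mono(2)[OF tr_mono(2)[OF n(5)]]])
  note f = trD(1)[OF T(1)]
  have ab: "?s \<in> \<Phi>" using sum_root R by blast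
  have c': "c \<beta> \<alpha> = -1" using R(3) by (simp add: c_sym)
  show ?thesis
  proof (rule ae_avoiding[OF trD(2)[OF T(2)] trD(2)[OF T(5)] _ avoid_sum[OF R]])
    fix \<gamma> \<nu> x assume h: "\<gamma> \<in> \<Phi>" "\<gamma> \<notin> {- \<alpha>, - \<beta>, - ?s}" "big ?n \<nu>" "x \<in> carrier B"
    note cs = c_simps c_self[OF R(1)] c_self[OF R(2)] c_self[OF h(1)] R(3) c' c_sym[of \<gamma> \<alpha>] c_sym[of \<gamma> \<beta>]
    have "\<gamma> \<noteq> - (\<alpha> + \<beta>)" using h(2) by blast
    then have ne: "\<beta> + \<gamma> \<noteq> - \<alpha>" "\<alpha> + \<gamma> \<noteq> - \<beta>" by (blast dest: add_eq_minusD)+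
    have nm: "c \<alpha> \<gamma> \<noteq> -2" "c \<beta> \<gamma> \<noteq> -2" "c ?s \<gamma> \<noteq> -2" using c_opposite_iff R h ab by auto
    \<comment> \<open>One factor \<open>?M\<close> clears the denominators of the outer two
      transvections, a second one those of the transvection for \<open>?s\<close>, whose formula
      requires parameters divisible by \<open>?M\<close>.\<close>
    define y where "y = ?M \<otimes> x"
    have y: "y \<in> carrier B" using h by (simp add: y_def)
    have My: "ev ((k + l) + (k + l)) \<otimes> x = ?M \<otimes> y" using h by (simp add: y_def ev_add m_assoc)
    have pull: "[m] \<cdot> (u \<otimes> y) = ?M \<otimes> ([m] \<cdot> (u \<otimes> x))" if "u \<in> carrier B" for m :: int and u
      using h that by (simp add: y_def sgn_simps m_lcomm)
    have L: "f2 \<gamma> \<nu> (?M \<otimes> y) =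
      (if c \<beta> \<gamma> = -1 then corr f \<alpha> r (\<beta> + \<gamma>) \<nu> ([N \<beta> \<gamma>] \<cdot> (s \<otimes> y))
          + f (\<beta> + \<gamma>) \<nu> ([N \<beta> \<gamma>] \<cdot> (ev k \<otimes> s \<otimes> y)) else 0) +
      ((if c \<alpha> \<gamma> = -1 then f (\<alpha> + \<gamma>) \<nu> ([N \<alpha> \<gamma>] \<cdot> (ev l \<otimes> r \<otimes> y)) else 0) + f \<gamma> \<nu> (?M \<otimes> y))"
      using h b ne y by (intro tr_two[OF T(1,2) R(1,2)]) auto
    have G: "g3 \<gamma> \<nu> (?M \<otimes> y) =
      (if c \<alpha> \<gamma> = -1 then corr g1 \<beta> s (\<alpha> + \<gamma>) \<nu> ([N \<alpha> \<gamma>] \<cdot> (r \<otimes> y))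
          + g1 (\<alpha> + \<gamma>) \<nu> ([N \<alpha> \<gamma>] \<cdot> (ev l \<otimes> r \<otimes> y)) else 0) +
      ((if c \<beta> \<gamma> = -1 then g1 (\<beta> + \<gamma>) \<nu> ([N \<beta> \<gamma>] \<cdot> (ev k \<otimes> s \<otimes> y)) else 0) + g1 \<gamma> \<nu> (?M \<otimes> y))"
      unfolding add.commute[of k l] using h b ne y by (intro tr_two[OF T(4,5) R(2,1)]) auto
    have g1: "g1 \<delta> \<nu> (?M \<otimes> z) = corr f ?s ?q \<delta> \<nu> z + f \<delta> \<nu> (?M \<otimes> z)"
      if "\<delta> \<in> \<Phi>" "\<delta> \<noteq> - ?s" "z \<in> carrier B" for \<delta> z
      using trD(3)[OF T(3) that(1,2) h(3) that(3)] .
    have g1': "g1 \<delta> \<nu> ([m] \<cdot> (u \<otimes> y)) = f \<delta> \<nu> ([m] \<cdot> (u \<otimes> y))"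
      if "\<delta> \<in> \<Phi>" "c ?s \<delta> \<ge> 0" "u \<in> carrier B" for \<delta> u and m :: int
    proof -
      have "\<delta> \<noteq> - ?s" using that(2) c_self[OF ab] c_minus_right[of ?s ?s] by fastforce
      then show ?thesis
        unfolding pull[OF that(3)] using that h by (subst g1) (simp_all add: corr_def)
    qed
    have g\<gamma>: "g1 \<gamma> \<nu> (?M \<otimes> y) = corr f ?s ?q \<gamma> \<nu> y + f \<gamma> \<nu> (?M \<otimes> y)" using g1 h y by simp
    have "f2 \<gamma> \<nu> (?M \<otimes> y) = g3 \<gamma> \<nu> (?M \<otimes> y)"
    proof -
      \<comment> \<open>The two values cannot both be -1, since then \<open>\<gamma>\<close> would
        be \<open>- ?s\<close>, which is among the avoided roots.\<close>
      consider (none) "c \<alpha> \<gamma> \<ge> 0" "c \<beta> \<gamma> \<ge> 0" | (b0) "c \<beta> \<gamma> = -1" "c \<alpha> \<gamma> = 0" | (b1) "c \<beta> \<gamma> = -1" "c \<alpha> \<gamma> \<ge> 1"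
        | (a0) "c \<alpha> \<gamma> = -1" "c \<beta> \<gamma> = 0" | (a1) "c \<alpha> \<gamma> = -1" "c \<beta> \<gamma> \<ge> 1"
        using nm root_cases[OF R(1) h(1)] root_cases[OF R(2) h(1)] by (auto simp: c_add)
      then show ?thesis
      proof cases
        case none
        then show ?thesis unfolding L G g\<gamma> by (simp add: corr_def c_add)
      next
        case b0
        have s: "\<beta> + \<gamma> \<in> \<Phi>" "?s + \<gamma> \<in> \<Phi>" using sum_root[OF R(2) h(1)] sum_root[OF ab h(1)] b0 by (auto simp: c_add)
        have J: "N \<alpha> (\<beta> + \<gamma>) * N \<beta> \<gamma> = N ?s \<gamma> * N \<alpha> \<beta>"
          using N_jacobi[OF R(1,2) h(1) R(3) b0] by (simp add: ac_simps)
        have k1: "corr f ?s ?q \<gamma> \<nu> y = f (?s + \<gamma>) \<nu> ([(N ?s \<gamma> * N \<alpha> \<beta>)] \<cdot> (r \<otimes> s \<otimes> y))"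
          using b0 b y by (simp add: corr_def c_add sgn_simps)
        have k2: "corr f \<alpha> r (\<beta> + \<gamma>) \<nu> ([N \<beta> \<gamma>] \<cdot> (s \<otimes> y)) = f (?s + \<gamma>) \<nu> ([(N ?s \<gamma> * N \<alpha> \<beta>)] \<cdot> (r \<otimes> s \<otimes> y))"
          using b0 b y R(3) by (simp add: corr_def c_add_right sgn_simps J m_assoc add.assoc)
        have "g1 (\<beta> + \<gamma>) \<nu> ([N \<beta> \<gamma>] \<cdot> (ev k \<otimes> s \<otimes> y)) = f (\<beta> + \<gamma>) \<nu> ([N \<beta> \<gamma>] \<cdot> (ev k \<otimes> s \<otimes> y))"
          using s b b0 by (intro g1') (auto simp: cs)
        moreover have "cm (f (\<beta> + \<gamma>) \<nu> ([N \<beta> \<gamma>] \<cdot> (ev k \<otimes> s \<otimes> y))) (f (?s + \<gamma>) \<nu> ([(N ?s \<gamma> * N \<alpha> \<beta>)] \<cdot> (r \<otimes> s \<otimes> y)))"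
          using s h b y b0 by (intro sys_cm[OF f]) (auto simp: cs)
        ultimately show ?thesis unfolding L G g\<gamma> k1 k2 using b0 by (simp add: cm_def flip: add.assoc)
      next
        case b1
        have s: "\<beta> + \<gamma> \<in> \<Phi>" using sum_root[OF R(2) h(1)] b1 by auto
        have "g1 (\<beta> + \<gamma>) \<nu> ([N \<beta> \<gamma>] \<cdot> (ev k \<otimes> s \<otimes> y)) = f (\<beta> + \<gamma>) \<nu> ([N \<beta> \<gamma>] \<cdot> (ev k \<otimes> s \<otimes> y))"
          using s b b1 by (intro g1') (auto simp: cs)
        then show ?thesis unfolding L G g\<gamma> using b1 R(3) by (simp add: corr_def c_add c_add_right)
      next
        case a0
        have s: "\<alpha> + \<gamma> \<in> \<Phi>" "?s + \<gamma> \<in> \<Phi>" "\<beta> + (\<alpha> + \<gamma>) = ?s + \<gamma>"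
          using sum_root[OF R(1) h(1)] sum_root[OF ab h(1)] a0 by (auto simp: c_add ac_simps)
        have "N \<alpha> \<gamma> * N \<beta> (\<alpha> + \<gamma>) = N \<beta> \<alpha> * N (\<beta> + \<alpha>) \<gamma>"
          using a0 c' by (intro N_jacobi R h)
        then have J: "N \<beta> (\<alpha> + \<gamma>) * N \<alpha> \<gamma> = - (N ?s \<gamma> * N \<alpha> \<beta>)"
          using N_skew[OF R] by (simp add: ac_simps)
        let ?w = "f (?s + \<gamma>) \<nu> ([(N ?s \<gamma> * N \<alpha> \<beta>)] \<cdot> (r \<otimes> s \<otimes> y))"
        \<comment> \<open>On this side \<open>\<beta>\<close> acts before \<open>\<alpha>\<close>,
          which reverses the sign of the twofold correction at \<open>?s + \<gamma>\<close>. It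
          cancels the correction made by the transvection for \<open>?s\<close>, in accordance with
          the other side, where no twofold correction occurs.\<close>
        have k1: "corr f ?s ?q \<gamma> \<nu> y = ?w"
          using a0 b y by (simp add: corr_def c_add sgn_simps)
        have "corr g1 \<beta> s (\<alpha> + \<gamma>) \<nu> ([N \<alpha> \<gamma>] \<cdot> (r \<otimes> y))
            = g1 (?s + \<gamma>) \<nu> ([(- (N ?s \<gamma> * N \<alpha> \<beta>))] \<cdot> (r \<otimes> s \<otimes> y))"
          using a0 b y c' by (simp add: corr_def c_add_right sgn_simps J m_ac s(3))
        also have "\<dots> = f (?s + \<gamma>) \<nu> ([(- (N ?s \<gamma> * N \<alpha> \<beta>))] \<cdot> (r \<otimes> s \<otimes> y))"
          using s b a0 by (intro g1') (auto simp: cs)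
        also have "\<dots> = - ?w"
          using sys_minus[OF f s(2) h(3)] b y by (simp add: sgn_minus)
        finally have k2: "corr g1 \<beta> s (\<alpha> + \<gamma>) \<nu> ([N \<alpha> \<gamma>] \<cdot> (r \<otimes> y)) = - ?w" .
        have k3: "g1 (\<alpha> + \<gamma>) \<nu> ([N \<alpha> \<gamma>] \<cdot> (ev l \<otimes> r \<otimes> y)) = f (\<alpha> + \<gamma>) \<nu> ([N \<alpha> \<gamma>] \<cdot> (ev l \<otimes> r \<otimes> y))"
          using s b a0 by (intro g1') (auto simp: cs)
        have "cm (f (\<alpha> + \<gamma>) \<nu> ([N \<alpha> \<gamma>] \<cdot> (ev l \<otimes> r \<otimes> y))) ?w"
          using s h b y a0 by (intro sys_cm[OF f]) (auto simp: cs)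
        then have "- ?w + f (\<alpha> + \<gamma>) \<nu> ([N \<alpha> \<gamma>] \<cdot> (ev l \<otimes> r \<otimes> y)) + ?w = f (\<alpha> + \<gamma>) \<nu> ([N \<alpha> \<gamma>] \<cdot> (ev l \<otimes> r \<otimes> y))"
          unfolding cm_def add.assoc by simp
        then show ?thesis unfolding L G g\<gamma> k1 k2 k3 using a0 by (simp add: add.assoc[symmetric])
      next
        case a1
        have s: "\<alpha> + \<gamma> \<in> \<Phi>" using sum_root[OF R(1) h(1)] a1 by auto
        have "g1 (\<alpha> + \<gamma>) \<nu> ([N \<alpha> \<gamma>] \<cdot> (ev l \<otimes> r \<otimes> y)) = f (\<alpha> + \<gamma>) \<nu> ([N \<alpha> \<gamma>] \<cdot> (ev l \<otimes> r \<otimes> y))"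
          using s b a1 by (intro g1') (auto simp: cs)
        then show ?thesis unfolding L G g\<gamma> using a1 c' by (simp add: corr_def c_add c_add_right)
      qed
    qed
    then show "f2 \<gamma> \<nu> (ev ((k + l) + (k + l)) \<otimes> x) = g3 \<gamma> \<nu> (ev ((k + l) + (k + l)) \<otimes> x)"
      unfolding My .
  qed
qed

end


section \<open>Excision\<close>

context cring begin
lemma cross_diff:
  assumes "l \<in> carrier R" "k \<in> carrier R" "r \<in> carrier R" "s \<in> carrier R" "i \<in> carrier R" "j \<in> carrier R"
  shows "l \<otimes> (r \<oplus> k \<otimes> i) \<ominus> k \<otimes> (s \<oplus> l \<otimes> j) = (l \<otimes> r \<ominus> k \<otimes> s) \<oplus> (k \<otimes> l) \<otimes> (i \<ominus> j)"
  using assms by algebra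
lemma cross_add:
  assumes "l \<in> carrier R" "k \<in> carrier R" "r \<in> carrier R" "s \<in> carrier R" "i \<in> carrier R" "j \<in> carrier R"
  shows "l \<otimes> (r \<oplus> k \<otimes> i) \<oplus> k \<otimes> (s \<oplus> l \<otimes> j) = (l \<otimes> r \<oplus> k \<otimes> s) \<oplus> (k \<otimes> l) \<otimes> (i \<oplus> j)"
  using assms by algebra
lemma cross_mult:
  assumes "l \<in> carrier R" "k \<in> carrier R" "r \<in> carrier R" "s \<in> carrier R" "i \<in> carrier R" "j \<in> carrier R"
  shows "(r \<oplus> k \<otimes> i) \<otimes> (s \<oplus> l \<otimes> j)
        = r \<otimes> s \<oplus> ((k \<otimes> l) \<otimes> (i \<otimes> j) \<oplus> r \<otimes> (l \<otimes> j) \<oplus> (k \<otimes> i) \<otimes> s)"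
  using assms by algebra
lemma scale_add:
  assumes "l \<in> carrier R" "k \<in> carrier R" "p \<in> carrier R" "q \<in> carrier R"
  shows "(k \<otimes> l) \<otimes> (p \<oplus> q) = l \<otimes> (k \<otimes> p) \<oplus> k \<otimes> (l \<otimes> q)"
  using assms by algebra
lemma scale_mult:
  assumes "l \<in> carrier R" "k \<in> carrier R" "p \<in> carrier R" "q \<in> carrier R"
  shows "(k \<otimes> l) \<otimes> (p \<otimes> q) = (k \<otimes> p) \<otimes> (l \<otimes> q)"
  using assms by algebra
end

text \<open>Here \<open>B = C + I\<close>, where \<open>ev\<close> acts bijectively on the ideal \<open>I\<close>, and \<open>A\<close> is obtained from
  \<open>B\<close> by inverting the values of \<open>ev\<close>; hence \<open>I\<close> is also an ideal of \<open>A\<close>.\<close>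

locale steinberg_excision = steinberg_systems \<Phi> N c B ev + h: ring_hom_cring B A \<pi> + I: ideal I B
  for \<Phi> :: "'v::euclidean_space set" and N and c and B :: "('b, 'm) ring_scheme" (structure)
    and ev :: "'e::cancel_comm_monoid_add \<Rightarrow> 'b" and A :: "('a, 'n) ring_scheme" and \<pi> and I +
  fixes C :: "'b set" and cst :: "'b \<Rightarrow> 'b"
  assumes C: "subring C B"
    and cst: "b \<in> carrier B \<Longrightarrow> cst b \<in> C" "b \<in> carrier B \<Longrightarrow> b \<ominus> cst b \<in> I"
    and ev_C: "ev \<nu> \<in> C"
    and decomposition: "p \<in> carrier A \<Longrightarrow> \<exists>r\<in>C. \<exists>k. \<exists>i\<in>I. \<pi> (ev k) \<otimes>\<^bsub>A\<^esub> p = \<pi> (r \<oplus> ev k \<otimes> i)"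
    and decomposition_unique: "\<lbrakk>r \<in> C; i \<in> I; \<pi> (r \<oplus> i) = \<zero>\<^bsub>A\<^esub>\<rbrakk> \<Longrightarrow> i = \<zero> \<and> (\<exists>\<kappa>. ev \<kappa> \<otimes> r = \<zero>)"
    and divisible: "i \<in> I \<Longrightarrow> \<exists>j\<in>I. ev \<nu> \<otimes> j = i"
    and torsion_free: "\<lbrakk>i \<in> I; ev \<nu> \<otimes> i = \<zero>\<rbrakk> \<Longrightarrow> i = \<zero>"
begin

section \<open>Elements of \<open>A\<close> as fractions plus elements of \<open>I\<close>\<close>

lemma I_carrier [simp]: "i \<in> I \<Longrightarrow> i \<in> carrier B"
  using I.Icarr .

lemma C_carrier [simp]: "r \<in> C \<Longrightarrow> r \<in> carrier B"
  using subringE(1)[OF C] by blast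

lemma C_closed [simp]: "r \<in> C \<Longrightarrow> s \<in> C \<Longrightarrow> r \<oplus> s \<in> C" "r \<in> C \<Longrightarrow> s \<in> C \<Longrightarrow> r \<otimes> s \<in> C" "r \<in> C \<Longrightarrow> \<ominus> r \<in> C"
  "\<zero> \<in> C"
  using subringE[OF C] by auto

lemma I_closed [simp]: "i \<in> I \<Longrightarrow> j \<in> I \<Longrightarrow> i \<oplus> j \<in> I" "i \<in> I \<Longrightarrow> b \<in> carrier B \<Longrightarrow> b \<otimes> i \<in> I"
  "i \<in> I \<Longrightarrow> b \<in> carrier B \<Longrightarrow> i \<otimes> b \<in> I" "i \<in> I \<Longrightarrow> \<ominus> i \<in> I" "\<zero> \<in> I"
  using I.a_closed I.I_l_closed I.I_r_closed I.a_inv_closed I.zero_closed by auto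

lemma divide_unique:
  assumes "i \<in> I" "j \<in> I" "ev \<nu> \<otimes> i = ev \<nu> \<otimes> j"
  shows "i = j"
proof -
  have "ev \<nu> \<otimes> (i \<ominus> j) = \<zero>" using assms by (simp add: minus_eq r_distr r_minus r_neg)
  moreover have "i \<ominus> j \<in> I" using assms by (simp add: minus_eq)
  ultimately have "i \<ominus> j = \<zero>" using torsion_free by blast
  then show ?thesis using assms by (metis I_carrier r_right_minus_eq)
qed

text \<open>Read as \<open>p = r / ev k + i\<close> with the denominator cleared; \<open>r\<close>
  and \<open>k\<close> are determined only as a fraction.\<close>

definition dec :: "'a \<Rightarrow> 'b \<Rightarrow> 'e \<Rightarrow> 'b \<Rightarrow> bool" where
  "dec p r k i \<longleftrightarrow> p \<in> carrier A \<and> r \<in> C \<and> i \<in> I \<and> \<pi> (ev k) \<otimes>\<^bsub>A\<^esub> p = \<pi> (r \<oplus> ev k \<otimes> i)"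

lemma dec_exists:
  assumes "p \<in> carrier A"
  obtains r k i where "dec p r k i"
  using decomposition[OF assms] assms unfolding dec_def by blast

text \<open>Cross-multiplication produces an element of \<open>C\<close> plus an element of
  \<open>I\<close> in the kernel of \<open>\<pi>\<close>. There \<open>decomposition_unique\<close>
  forces the part in \<open>I\<close> to vanish, while the part from \<open>C\<close> is only
  annihilated by some value of \<open>ev\<close>.\<close>

lemma dec_unique:
  assumes 1: "dec p r k i" and 2: "dec p s l j"
  shows "i = j" "\<exists>\<kappa>. ev \<kappa> \<otimes> (ev l \<otimes> r) = ev \<kappa> \<otimes> (ev k \<otimes> s)"
proof -
  note c = 1[unfolded dec_def] 2[unfolded dec_def]
  have cB: "r \<in> carrier B" "s \<in> carrier B" "i \<in> carrier B" "j \<in> carrier B" using c by auto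
  have "\<pi> (ev l \<otimes> (r \<oplus> ev k \<otimes> i)) = \<pi> (ev k \<otimes> (s \<oplus> ev l \<otimes> j))"
  proof -
    have "\<pi> (ev l \<otimes> (r \<oplus> ev k \<otimes> i)) = \<pi> (ev l) \<otimes>\<^bsub>A\<^esub> (\<pi> (ev k) \<otimes>\<^bsub>A\<^esub> p)" using c by simp
    also have "\<dots> = \<pi> (ev k) \<otimes>\<^bsub>A\<^esub> (\<pi> (ev l) \<otimes>\<^bsub>A\<^esub> p)" using c by (intro h.S.m_lcomm) auto
    also have "\<dots> = \<pi> (ev k \<otimes> (s \<oplus> ev l \<otimes> j))" using c by simp
    finally show ?thesis .
  qed
  then have "\<pi> (ev l \<otimes> (r \<oplus> ev k \<otimes> i) \<ominus> ev k \<otimes> (s \<oplus> ev l \<otimes> j)) = \<zero>\<^bsub>A\<^esub>"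
    using c by (simp add: minus_eq h.S.r_neg)
  moreover have "ev l \<otimes> (r \<oplus> ev k \<otimes> i) \<ominus> ev k \<otimes> (s \<oplus> ev l \<otimes> j)
      = (ev l \<otimes> r \<ominus> ev k \<otimes> s) \<oplus> ev (k + l) \<otimes> (i \<ominus> j)"
    unfolding ev_add by (rule cross_diff) (simp_all add: cB)
  ultimately have 0: "\<pi> ((ev l \<otimes> r \<ominus> ev k \<otimes> s) \<oplus> ev (k + l) \<otimes> (i \<ominus> j)) = \<zero>\<^bsub>A\<^esub>"
    by (simp only:)
  have mem: "ev l \<otimes> r \<ominus> ev k \<otimes> s \<in> C" "ev (k + l) \<otimes> (i \<ominus> j) \<in> I"
    using c ev_C by (simp_all add: minus_eq)
  have *: "ev (k + l) \<otimes> (i \<ominus> j) = \<zero>" "\<exists>\<kappa>. ev \<kappa> \<otimes> (ev l \<otimes> r \<ominus> ev k \<otimes> s) = \<zero>"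
    using decomposition_unique[OF mem 0] by blast+
  have "i \<ominus> j = \<zero>" using torsion_free[OF _ *(1)] c by (simp add: minus_eq)
  then show "i = j" using c by (metis I_carrier r_right_minus_eq)
  from *(2) obtain \<kappa> where "ev \<kappa> \<otimes> (ev l \<otimes> r \<ominus> ev k \<otimes> s) = \<zero>" ..
  then have "ev \<kappa> \<otimes> (ev l \<otimes> r) \<ominus> ev \<kappa> \<otimes> (ev k \<otimes> s) = \<zero>" using c by (simp add: minus_eq r_distr r_minus)
  then show "\<exists>\<kappa>. ev \<kappa> \<otimes> (ev l \<otimes> r) = ev \<kappa> \<otimes> (ev k \<otimes> s)"
    using c by (intro exI[of _ \<kappa>]) (metis C_carrier ev_closed m_closed r_right_minus_eq)
qed

lemma dec_add:
  assumes "dec p r k i" "dec q s l j"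
  shows "dec (p \<oplus>\<^bsub>A\<^esub> q) (ev l \<otimes> r \<oplus> ev k \<otimes> s) (k + l) (i \<oplus> j)"
proof -
  note c = assms(1)[unfolded dec_def] assms(2)[unfolded dec_def]
  have "\<pi> (ev (k + l)) \<otimes>\<^bsub>A\<^esub> (p \<oplus>\<^bsub>A\<^esub> q)
      = \<pi> (ev l) \<otimes>\<^bsub>A\<^esub> (\<pi> (ev k) \<otimes>\<^bsub>A\<^esub> p) \<oplus>\<^bsub>A\<^esub> \<pi> (ev k) \<otimes>\<^bsub>A\<^esub> (\<pi> (ev l) \<otimes>\<^bsub>A\<^esub> q)"
    using c by (simp add: ev_add h.S.scale_add del: h.S.r_distr)
  also have "\<dots> = \<pi> (ev l \<otimes> (r \<oplus> ev k \<otimes> i) \<oplus> ev k \<otimes> (s \<oplus> ev l \<otimes> j))" using c by simp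
  also have "ev l \<otimes> (r \<oplus> ev k \<otimes> i) \<oplus> ev k \<otimes> (s \<oplus> ev l \<otimes> j)
      = (ev l \<otimes> r \<oplus> ev k \<otimes> s) \<oplus> ev (k + l) \<otimes> (i \<oplus> j)"
    unfolding ev_add using c by (intro cross_add) simp_all
  finally show ?thesis using c ev_C by (simp add: dec_def)
qed

text \<open>In the product of \<open>r / ev k + i\<close> and \<open>s / ev l + j\<close> the mixed
  terms belong to \<open>I\<close>: dividing \<open>j\<close> by \<open>ev k\<close> and
  \<open>i\<close> by \<open>ev l\<close> turns them into \<open>r \<otimes> j'\<close> and
  \<open>s \<otimes> i'\<close>. The factor \<open>m\<close> is a structure constant.\<close>

lemma dec_mult:
  assumes "dec p r k i" "dec q s l j" "ev l \<otimes> i' = i" "ev k \<otimes> j' = j" "i' \<in> I" "j' \<in> I" and m: "m = 1 \<or> m = (-1::int)"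
  shows "dec ([m] \<cdot>\<^bsub>A\<^esub> (p \<otimes>\<^bsub>A\<^esub> q)) ([m] \<cdot> (r \<otimes> s)) (k + l) ([m] \<cdot> (i \<otimes> j \<oplus> r \<otimes> j' \<oplus> s \<otimes> i'))"
proof -
  note c = assms(1)[unfolded dec_def] assms(2)[unfolded dec_def]
  have [simp]: "[(-1::int)] \<cdot>\<^bsub>A\<^esub> a = \<ominus>\<^bsub>A\<^esub> a" "[(1::int)] \<cdot>\<^bsub>A\<^esub> a = a" if "a \<in> carrier A" for a
    using h.S.add.int_pow_neg[of a 1] that by (auto simp: add_pow_def int_pow_def2)
  have "\<pi> (ev (k + l)) \<otimes>\<^bsub>A\<^esub> (p \<otimes>\<^bsub>A\<^esub> q)
      = (\<pi> (ev k) \<otimes>\<^bsub>A\<^esub> p) \<otimes>\<^bsub>A\<^esub> (\<pi> (ev l) \<otimes>\<^bsub>A\<^esub> q)"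
    unfolding ev_add h.hom_mult[OF ev_closed ev_closed]
    using c by (intro h.S.scale_mult) (simp_all only: h.hom_closed ev_closed)
  also have "\<dots> = \<pi> ((r \<oplus> ev k \<otimes> i) \<otimes> (s \<oplus> ev l \<otimes> j))" using c by simp
  also have "(r \<oplus> ev k \<otimes> i) \<otimes> (s \<oplus> ev l \<otimes> j)
      = r \<otimes> s \<oplus> ev (k + l) \<otimes> (i \<otimes> j \<oplus> r \<otimes> j' \<oplus> s \<otimes> i')"
  proof -
    have "r \<otimes> (ev l \<otimes> (ev k \<otimes> j')) = ev (k + l) \<otimes> (r \<otimes> j')"
      "(ev k \<otimes> (ev l \<otimes> i')) \<otimes> s = ev (k + l) \<otimes> (s \<otimes> i')"
      using conjunct1[OF conjunct2[OF c(1)]] conjunct1[OF conjunct2[OF c(2)]] assms(5,6)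
      by (simp_all add: ev_add m_ac)
    then have "r \<otimes> (ev l \<otimes> j) = ev (k + l) \<otimes> (r \<otimes> j')" "(ev k \<otimes> i) \<otimes> s = ev (k + l) \<otimes> (s \<otimes> i')"
      unfolding assms(3,4) by simp_all
    moreover have "(r \<oplus> ev k \<otimes> i) \<otimes> (s \<oplus> ev l \<otimes> j)
        = r \<otimes> s \<oplus> (ev (k + l) \<otimes> (i \<otimes> j) \<oplus> r \<otimes> (ev l \<otimes> j) \<oplus> (ev k \<otimes> i) \<otimes> s)"
      unfolding ev_add using c by (intro cross_mult) simp_all
    ultimately show ?thesis using c assms(5,6) by (simp add: r_distr)
  qed
  finally have *: "\<pi> (ev (k + l)) \<otimes>\<^bsub>A\<^esub> (p \<otimes>\<^bsub>A\<^esub> q)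
      = \<pi> (r \<otimes> s \<oplus> ev (k + l) \<otimes> (i \<otimes> j \<oplus> r \<otimes> j' \<oplus> s \<otimes> i'))" .
  show ?thesis
    using m
  proof
    assume "m = 1"
    then show ?thesis using * c assms(5,6) by (simp add: dec_def)
  next
    assume m: "m = -1"
    let ?z = "i \<otimes> j \<oplus> r \<otimes> j' \<oplus> s \<otimes> i'"
    have z: "?z \<in> I" using c assms(5,6) by simp
    have "\<pi> (ev (k + l)) \<otimes>\<^bsub>A\<^esub> (\<ominus>\<^bsub>A\<^esub> (p \<otimes>\<^bsub>A\<^esub> q)) = \<pi> (\<ominus> (r \<otimes> s \<oplus> ev (k + l) \<otimes> ?z))"
      using * c z by (simp add: h.S.r_minus)
    also have "\<ominus> (r \<otimes> s \<oplus> ev (k + l) \<otimes> ?z) = \<ominus> (r \<otimes> s) \<oplus> ev (k + l) \<otimes> (\<ominus> ?z)"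
      using c z by (simp add: minus_add r_minus)
    finally show ?thesis unfolding m using c z by (simp add: dec_def sgn_minus_1)
  qed
qed

text \<open>The value of a system at an element of \<open>I\<close>, which is divisible by all exponents.\<close>

definition ival :: "('v \<Rightarrow> 'e \<Rightarrow> 'b \<Rightarrow> 'k::group_add) \<Rightarrow> 'v \<Rightarrow> 'b \<Rightarrow> 'k" where
  "ival f \<alpha> i = (THE v. \<exists>n. \<forall>\<nu> b. big n \<nu> \<longrightarrow> b \<in> I \<longrightarrow> ev \<nu> \<otimes> b = i \<longrightarrow> f \<alpha> \<nu> b = v)"

text \<open>Two ways of writing an element as a multiple, with exponents \<open>\<nu>\<close> and
  \<open>\<mu>\<close>, are compared at \<open>\<nu> + \<mu>\<close>: by unique division
  \<open>b\<close> and \<open>d\<close> are the multiples by \<open>ev \<mu>\<close> and by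
  \<open>ev \<nu>\<close> of one element \<open>j\<close>.\<close>

lemma ival_eq:
  assumes f: "sys \<Phi> n f" "\<alpha> \<in> \<Phi>" and b: "big n \<nu>" "b \<in> I"
  shows "ival f \<alpha> (ev \<nu> \<otimes> b) = f \<alpha> \<nu> b"
  unfolding ival_def
proof (rule the_equality)
  let ?i = "ev \<nu> \<otimes> b"
  show "\<exists>n. \<forall>\<mu> d. big n \<mu> \<longrightarrow> d \<in> I \<longrightarrow> ev \<mu> \<otimes> d = ?i \<longrightarrow> f \<alpha> \<mu> d = f \<alpha> \<nu> b"
  proof (intro exI[of _ n] allI impI)
    fix \<mu> d assume d: "big n \<mu>" "d \<in> I" "ev \<mu> \<otimes> d = ?i"
    have "?i \<in> I" using b by simp
    then obtain j where j: "j \<in> I" "ev (\<nu> + \<mu>) \<otimes> j = ?i" using divisible by blast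
    have "b = ev \<mu> \<otimes> j" by (rule divide_unique[of _ _ \<nu>]) (use b j in \<open>simp_all add: ev_add m_assoc\<close>)
    moreover have "d = ev \<nu> \<otimes> j"
      by (rule divide_unique[of _ _ \<mu>]) (use b d j in \<open>simp_all add: ev_add m_ac\<close>)
    ultimately show "f \<alpha> \<mu> d = f \<alpha> \<nu> b"
      using sys_ev[OF f d(1), of j \<nu>] sys_ev[OF f b(1), of j \<mu>] j by (simp add: add.commute)
  qed
  fix v assume "\<exists>n. \<forall>\<nu>' b'. big n \<nu>' \<longrightarrow> b' \<in> I \<longrightarrow> ev \<nu>' \<otimes> b' = ?i \<longrightarrow> f \<alpha> \<nu>' b' = v"
  then obtain m where m: "\<And>\<mu> d. big m \<mu> \<Longrightarrow> d \<in> I \<Longrightarrow> ev \<mu> \<otimes> d = ?i \<Longrightarrow> f \<alpha> \<mu> d = v" by blast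
  obtain j where j: "j \<in> I" "ev m \<otimes> j = b" using divisible[OF b(2)] by blast
  have "f \<alpha> (\<nu> + m) j = v"
    using j b by (intro m) (auto simp: big_mono ev_add m_assoc)
  then show "v = f \<alpha> \<nu> b" using sys_ev[OF f b(1), of j m] j by simp
qed

lemma I_cases:
  assumes "i \<in> I"
  obtains b where "b \<in> I" "i = ev \<nu> \<otimes> b"
  using divisible[OF assms] by metis

lemma ival_add:
  assumes f: "sys \<Phi> n f" "\<alpha> \<in> \<Phi>" and i: "i \<in> I" "j \<in> I"
  shows "ival f \<alpha> (i \<oplus> j) = ival f \<alpha> i + ival f \<alpha> j"
proof -
  obtain b where b: "b \<in> I" "i = ev n \<otimes> b" using i(1) by (rule I_cases)
  obtain d where d: "d \<in> I" "j = ev n \<otimes> d" using i(2) by (rule I_cases)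
  have "i \<oplus> j = ev n \<otimes> (b \<oplus> d)" using b d by (simp add: r_distr)
  then show ?thesis using b d ival_eq[OF f, of n] sys_add[OF f, of n b d] by simp
qed

lemma ival_com:
  assumes f: "sys \<Phi> n f" and r: "\<alpha> \<in> \<Phi>" "\<beta> \<in> \<Phi>" "c \<alpha> \<beta> = -1" and i: "i \<in> I" "j \<in> I"
  shows "com (ival f \<alpha> i) (ival f \<beta> j) = ival f (\<alpha> + \<beta>) ([N \<alpha> \<beta>] \<cdot> (i \<otimes> j))"
proof -
  obtain b where b: "b \<in> I" "i = ev n \<otimes> b" using i(1) by (rule I_cases)
  obtain d where d: "d \<in> I" "j = ev n \<otimes> d" using i(2) by (rule I_cases)
  have s: "\<alpha> + \<beta> \<in> \<Phi>" using sum_root r by blast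
  have e: "[N \<alpha> \<beta>] \<cdot> (i \<otimes> j) = ev (n + n) \<otimes> ([N \<alpha> \<beta>] \<cdot> (b \<otimes> d))"
    using b d by (simp add: ev_add sgn_simps m_ac)
  have "[N \<alpha> \<beta>] \<cdot> (b \<otimes> d) \<in> I" using N_unit[OF r] b d by (auto simp: sgn_minus_1)
  then show ?thesis
    unfolding e using b d ival_eq[OF f r(1), of n] ival_eq[OF f r(2), of n]
      ival_eq[OF f s, of "n + n"] sys_com[OF f r(1,2), of n n b d] s by simp
qed

lemma ival_cm:
  assumes f: "sys \<Phi> n f" and r: "\<alpha> \<in> \<Phi>" "\<beta> \<in> \<Phi>" "c \<alpha> \<beta> \<ge> 0" and i: "i \<in> I" "j \<in> I"
  shows "cm (ival f \<alpha> i) (ival f \<beta> j)"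
proof -
  obtain b where b: "b \<in> I" "i = ev n \<otimes> b" using i(1) by (rule I_cases)
  obtain d where d: "d \<in> I" "j = ev n \<otimes> d" using i(2) by (rule I_cases)
  show ?thesis
    using b d ival_eq[OF f r(1), of n] ival_eq[OF f r(2), of n] sys_cm[OF f r(1,2), of n n b d] r(3) by simp
qed

lemma ival_ae:
  assumes f: "sys \<Phi> n f" "sys \<Phi> m g" "ae f g" and r: "\<alpha> \<in> \<Phi>" "i \<in> I"
  shows "ival f \<alpha> i = ival g \<alpha> i"
proof -
  obtain k where k: "\<And>m \<beta> \<nu> b. \<lbrakk>\<beta> \<in> \<Phi>; big (k + m) \<nu>; b \<in> carrier B\<rbrakk> \<Longrightarrow> f \<beta> \<nu> b = g \<beta> \<nu> b"
    using f(3) by (rule aeE) blast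
  let ?n = "k + (n + m)"
  have s: "sys \<Phi> ?n f" "sys \<Phi> ?n g"
    by (rule sys_mono(2)[OF sys_mono(1)[OF f(1)]], rule sys_mono(2)[OF sys_mono(2)[OF f(2)]])
  obtain b where b: "b \<in> I" "i = ev ?n \<otimes> b" using r(2) by (rule I_cases)
  show ?thesis using b ival_eq[OF s(1) r(1), of ?n] ival_eq[OF s(2) r(1), of ?n] k[OF r(1), of "n + m" ?n b] by simp
qed

text \<open>Every element of \<open>I\<close> is divisible by \<open>ev n\<close>, so a formula that
  holds for large exponents holds on \<open>I\<close> without restriction.\<close>

lemma ival_transv:
  assumes t: "transv \<alpha> r k f f'" and r: "\<alpha> \<in> \<Phi>" "r \<in> carrier B" "\<beta> \<in> \<Phi>" "\<beta> \<noteq> - \<alpha>" and j: "j \<in> I"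
  shows "ival f' \<beta> (ev k \<otimes> j)
    = (if c \<alpha> \<beta> = -1 then ival f (\<alpha> + \<beta>) ([N \<alpha> \<beta>] \<cdot> (r \<otimes> j)) else 0) + ival f \<beta> (ev k \<otimes> j)"
proof -
  obtain n where n: "tr n \<alpha> r k f f'" using t unfolding transv_def by blast
  note f = trD(1)[OF n] and f' = trD(2)[OF n]
  obtain b where b: "b \<in> I" "j = ev n \<otimes> b" using j by (rule I_cases)
  have e: "ev k \<otimes> j = ev n \<otimes> (ev k \<otimes> b)" "[N \<alpha> \<beta>] \<cdot> (r \<otimes> j) = ev n \<otimes> ([N \<alpha> \<beta>] \<cdot> (r \<otimes> b))"
    using b r by (simp_all add: sgn_simps m_lcomm)
  have 1: "ival f' \<beta> (ev k \<otimes> j) = corr f \<alpha> r \<beta> n b + f \<beta> n (ev k \<otimes> b)"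
    unfolding e using ival_eq[OF f' r(3), of n] trD(3)[OF n r(3,4), of n b] b by simp
  have 2: "ival f \<beta> (ev k \<otimes> j) = f \<beta> n (ev k \<otimes> b)"
    unfolding e using ival_eq[OF f r(3), of n] b by simp
  have 3: "ival f (\<alpha> + \<beta>) ([N \<alpha> \<beta>] \<cdot> (r \<otimes> j)) = f (\<alpha> + \<beta>) n ([N \<alpha> \<beta>] \<cdot> (r \<otimes> b))" if "c \<alpha> \<beta> = -1"
  proof -
    have "[N \<alpha> \<beta>] \<cdot> (r \<otimes> b) \<in> I" using N_unit[OF r(1,3) that] b r by (auto simp: sgn_minus_1)
    moreover have "\<alpha> + \<beta> \<in> \<Phi>" using sum_root r that by blast
    ultimately show ?thesis unfolding e using ival_eq[OF f, of "\<alpha> + \<beta>" n] by simp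
  qed
  show ?thesis unfolding 1 2 using 3 by (simp add: corr_def)
qed

end


text \<open>The second components of states meet the commutator relation in this shape. There
  \<open>p\<close> and \<open>q\<close> are the values at the two parts in \<open>I\<close>,
  \<open>u\<close> comes from the product of these parts, and \<open>v\<close> and \<open>w\<close>
  come from the products of a fraction with a part in \<open>I\<close>.\<close>

lemma com_reorder:
  assumes "com p q = u" "cm v p" "cm u v" "cm w q"
  shows "p + (v + q) = (u + v + w) + (q + (- w + p))"
proof -
  have "p + (v + q) = v + (p + q)" using assms(2) unfolding cm_def by (metis add.assoc)
  also have "p + q = u + q + p" by (rule com_eqD[OF assms(1)])
  also have "v + (u + q + p) = u + v + (q + p)" using assms(3) unfolding cm_def by (metis add.assoc)
  also have "q + p = w + (q + - w) + p"
    using cm_minus[OF cm_sym[OF assms(4)]] by (simp add: cm_def)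
  finally show ?thesis by (simp only: add.assoc)
qed

section \<open>Action of the Steinberg group of \<open>A\<close> on states\<close>

type_synonym ('v, 'e, 'b, 'k) state = "('v \<Rightarrow> 'e \<Rightarrow> 'b \<Rightarrow> 'k) \<times> 'k"

text \<open>\<open>xr\<close> stands for root elements over \<open>B\<close> in an arbitrary group
  of class \<open>group_add\<close> in which the Steinberg relations hold.\<close>

locale steinberg_excision_rep = steinberg_excision \<Phi> N c B ev A \<pi> I C cst
  for \<Phi> :: "'v::euclidean_space set" and N and c and B :: "('b, 'm) ring_scheme" (structure)
    and ev :: "'e::cancel_comm_monoid_add \<Rightarrow> 'b" and A :: "('a, 'n) ring_scheme" and \<pi> and I and C and cst +
  fixes xr :: "'v \<Rightarrow> 'b \<Rightarrow> 'k::group_add"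
  assumes x_add: "\<lbrakk>\<beta> \<in> \<Phi>; b \<in> carrier B; d \<in> carrier B\<rbrakk> \<Longrightarrow> xr \<beta> (b \<oplus> d) = xr \<beta> b + xr \<beta> d"
    and x_com: "\<lbrakk>\<beta> \<in> \<Phi>; \<gamma> \<in> \<Phi>; b \<in> carrier B; d \<in> carrier B; c \<beta> \<gamma> = -1\<rbrakk> \<Longrightarrow>
        com (xr \<beta> b) (xr \<gamma> d) = xr (\<beta> + \<gamma>) ([N \<beta> \<gamma>] \<cdot> (b \<otimes> d))"
    and x_cm: "\<lbrakk>\<beta> \<in> \<Phi>; \<gamma> \<in> \<Phi>; b \<in> carrier B; d \<in> carrier B; c \<beta> \<gamma> \<ge> 0\<rbrakk> \<Longrightarrow> cm (xr \<beta> b) (xr \<gamma> d)"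
begin

definition valid :: "('v \<Rightarrow> 'e \<Rightarrow> 'b \<Rightarrow> 'k) \<Rightarrow> bool" where
  "valid f \<longleftrightarrow> (\<exists>n. sys \<Phi> n f)"

text \<open>The Steinberg group of \<open>A\<close> acts from the right on the classes modulo \<open>steq\<close> of pairs
  \<open>(f, h)\<close>: the system \<open>f\<close> is conjugated by the part of the parameter which comes from \<open>C\<close>, and
  \<open>h\<close> collects the conjugated root elements with parameters in \<open>I\<close>.\<close>

definition steq :: "('v, 'e, 'b, 'k) state rel" where
  "steq = {((f, h), (g, h')). valid f \<and> ae f g \<and> h = h'}"

definition step :: "'v \<Rightarrow> 'a \<Rightarrow> ('v, 'e, 'b, 'k) state rel" where
  "step \<alpha> p = {((f, h), (f', h')). \<exists>r k i. dec p r k i \<and> transv \<alpha> r k f f' \<and> h' = h + ival f \<alpha> i}"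

text \<open>These relations are the graphs of total maps on classes modulo \<open>steq\<close>.
  Working with graphs makes it unnecessary to choose a decomposition of the parameter or one of the
  many systems that a transvection may produce.\<close>

definition good :: "('v, 'e, 'b, 'k) state rel \<Rightarrow> bool" where
  "good F \<longleftrightarrow> (\<forall>x y. (x, y) \<in> F \<longrightarrow> valid (fst x) \<and> valid (fst y)) \<and>
     (\<forall>x. valid (fst x) \<longrightarrow> (\<exists>y. (x, y) \<in> F)) \<and>
     (\<forall>x x' y y'. (x, y) \<in> F \<longrightarrow> (x', y') \<in> F \<longrightarrow> (x, x') \<in> steq \<longrightarrow> (y, y') \<in> steq) \<and>
     (\<forall>x y z. (x, y) \<in> F \<longrightarrow> (y, z) \<in> steq \<longrightarrow> (x, z) \<in> F)"

lemma valid_ae: "valid f \<Longrightarrow> ae f g \<Longrightarrow> valid g"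
  unfolding valid_def by (metis sys_ae)

lemma steq_refl: "valid (fst x) \<Longrightarrow> (x, x) \<in> steq"
  by (cases x) (simp add: steq_def ae_refl)

lemma steq_sym: "(x, y) \<in> steq \<Longrightarrow> (y, x) \<in> steq"
  by (cases x; cases y) (auto simp: steq_def ae_sym intro: valid_ae)

lemma steq_trans: "(x, y) \<in> steq \<Longrightarrow> (y, z) \<in> steq \<Longrightarrow> (x, z) \<in> steq"
  by (cases x; cases y; cases z) (auto simp: steq_def intro: ae_trans)

lemma steq_valid: "(x, y) \<in> steq \<Longrightarrow> valid (fst x) \<and> valid (fst y)"
  by (cases x; cases y) (auto simp: steq_def intro: valid_ae)

lemma
  assumes "good F"
  shows good_valid: "\<And>x y. (x, y) \<in> F \<Longrightarrow> valid (fst x) \<and> valid (fst y)"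
    and good_total: "\<And>x. valid (fst x) \<Longrightarrow> \<exists>y. (x, y) \<in> F"
    and good_unique: "\<And>x x' y y'. (x, y) \<in> F \<Longrightarrow> (x', y') \<in> F \<Longrightarrow> (x, x') \<in> steq \<Longrightarrow> (y, y') \<in> steq"
    and good_right: "\<And>x y z. (x, y) \<in> F \<Longrightarrow> (y, z) \<in> steq \<Longrightarrow> (x, z) \<in> F"
  using assms unfolding good_def by metis+

lemma goodI:
  assumes "\<And>x y. (x, y) \<in> F \<Longrightarrow> valid (fst x) \<and> valid (fst y)"
    and "\<And>x. valid (fst x) \<Longrightarrow> \<exists>y. (x, y) \<in> F"
    and "\<And>x x' y y'. (x, y) \<in> F \<Longrightarrow> (x', y') \<in> F \<Longrightarrow> (x, x') \<in> steq \<Longrightarrow> (y, y') \<in> steq"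
    and "\<And>x y z. (x, y) \<in> F \<Longrightarrow> (y, z) \<in> steq \<Longrightarrow> (x, z) \<in> F"
  shows "good F"
  unfolding good_def
proof (intro conjI)
  show "\<forall>x y. (x, y) \<in> F \<longrightarrow> valid (fst x) \<and> valid (fst y)" by (intro allI impI) (rule assms(1))
  show "\<forall>x. valid (fst x) \<longrightarrow> (\<exists>y. (x, y) \<in> F)" by (intro allI impI) (rule assms(2))
  show "\<forall>x x' y y'. (x, y) \<in> F \<longrightarrow> (x', y') \<in> F \<longrightarrow> (x, x') \<in> steq \<longrightarrow> (y, y') \<in> steq"
    by (intro allI impI) (rule assms(3))
  show "\<forall>x y z. (x, y) \<in> F \<longrightarrow> (y, z) \<in> steq \<longrightarrow> (x, z) \<in> F" by (intro allI impI) (rule assms(4))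
qed

lemma good_left:
  assumes F: "good F" and xy: "(x, y) \<in> steq" "(y, z) \<in> F"
  shows "(x, z) \<in> F"
proof -
  obtain w where w: "(x, w) \<in> F" using good_total[OF F] steq_valid[OF xy(1)] by blast
  then have "(w, z) \<in> steq" using good_unique[OF F w xy(2,1)] by blast
  then show ?thesis using good_right[OF F w] by blast
qed

lemma good_steq: "good steq"
  by (rule goodI) (blast intro: steq_refl steq_sym steq_trans dest: steq_valid)+

lemma good_comp:
  assumes F: "good F" and G: "good G"
  shows "good (F O G)"
proof (rule goodI)
  fix x y assume "(x, y) \<in> F O G"
  then obtain z where "(x, z) \<in> F" "(z, y) \<in> G" by blast
  then show "valid (fst x) \<and> valid (fst y)" using good_valid[OF F] good_valid[OF G] by blast
next
  fix x :: "('v, 'e, 'b, 'k) state" assume "valid (fst x)"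
  then obtain y where y: "(x, y) \<in> F" using good_total[OF F] by blast
  then obtain z where "(y, z) \<in> G" using good_total[OF G] good_valid[OF F] by blast
  then show "\<exists>y. (x, y) \<in> F O G" using y by blast
next
  fix x x' y y' assume "(x, y) \<in> F O G" "(x', y') \<in> F O G" and x: "(x, x') \<in> steq"
  then obtain z z' where z: "(x, z) \<in> F" "(z, y) \<in> G" "(x', z') \<in> F" "(z', y') \<in> G" by blast
  show "(y, y') \<in> steq"
    by (rule good_unique[OF G z(2,4) good_unique[OF F z(1,3) x]])
next
  fix x y z assume "(x, y) \<in> F O G" "(y, z) \<in> steq"
  then show "(x, z) \<in> F O G" using good_right[OF G] by blast
qed

text \<open>A map on classes is determined by one value for each state. An equation between composed
  steps can therefore be checked for a single choice of decompositions and transvected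
  systems.\<close>

lemma good_eqI:
  assumes F: "good F" and G: "good G"
    and eq: "\<And>x. valid (fst x) \<Longrightarrow> \<exists>y z. (x, y) \<in> F \<and> (x, z) \<in> G \<and> (y, z) \<in> steq"
  shows "F = G"
proof -
  have *: "F \<subseteq> G" if F: "good F" and G: "good G"
    and eq: "\<And>x. valid (fst x) \<Longrightarrow> \<exists>y z. (x, y) \<in> F \<and> (x, z) \<in> G \<and> (y, z) \<in> steq"
    for F G :: "('v, 'e, 'b, 'k) state rel"
  proof
    fix p assume p: "p \<in> F"
    obtain x w where xw: "p = (x, w)" by (cases p)
    have x: "valid (fst x)" using good_valid[OF F] p xw by blast
    from eq[OF x] obtain y z where yz: "(x, y) \<in> F" "(x, z) \<in> G" "(y, z) \<in> steq" by blast
    have "(y, w) \<in> steq" using good_unique[OF F yz(1) _ steq_refl[OF x]] p xw by blast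
    then have "(z, w) \<in> steq" using yz(3) steq_sym steq_trans by blast
    then show "p \<in> G" using good_right[OF G yz(2)] xw by blast
  qed
  show ?thesis
  proof (rule equalityI)
    show "F \<subseteq> G" by (rule *[OF F G eq])
    show "G \<subseteq> F" by (rule *[OF G F]) (use eq steq_sym in blast)
  qed
qed

lemma transv_valid: "transv \<alpha> r k f f' \<Longrightarrow> valid f" "transv \<alpha> r k f f' \<Longrightarrow> valid f'"
  unfolding transv_def valid_def using trD(1) trD(2) by blast+

text \<open>The choices in a step do not matter: the system depends only on the fraction by
  \<open>transv_unique\<close>, the part in \<open>I\<close> is unique by \<open>dec_unique\<close>,
  and values at it respect equality for large exponents by \<open>ival_ae\<close>.\<close>

lemma good_step:
  assumes \<alpha>: "\<alpha> \<in> \<Phi>" and p: "p \<in> carrier A"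
  shows "good (step \<alpha> p)"
proof (rule goodI)
  fix x y assume "(x, y) \<in> step \<alpha> p"
  then show "valid (fst x) \<and> valid (fst y)"
    unfolding step_def using transv_valid by force
next
  fix x :: "('v, 'e, 'b, 'k) state" assume "valid (fst x)"
  then obtain f h n where x: "x = (f, h)" "sys \<Phi> n f" unfolding valid_def by (cases x) auto
  obtain r k i where d: "dec p r k i" using p by (rule dec_exists)
  then have "r \<in> carrier B" unfolding dec_def by auto
  with x \<alpha> obtain f' where "transv \<alpha> r k f f'" using transv_exists by blast
  then show "\<exists>y. (x, y) \<in> step \<alpha> p" using d x unfolding step_def by blast
next
  fix x x' y y' assume a: "(x, y) \<in> step \<alpha> p" "(x', y') \<in> step \<alpha> p" "(x, x') \<in> steq"
  obtain f h f' h' g l g' l' where xy: "x = (f, h)" "y = (f', h')" "x' = (g, l)" "y' = (g', l')"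
    by (metis surj_pair)
  obtain r k i where 1: "dec p r k i" "transv \<alpha> r k f f'" "h' = h + ival f \<alpha> i"
    using a(1) unfolding step_def xy by blast
  obtain s k' j where 2: "dec p s k' j" "transv \<alpha> s k' g g'" "l' = l + ival g \<alpha> j"
    using a(2) unfolding step_def xy by blast
  have e: "ae f g" "h = l" using a(3) by (auto simp: steq_def xy)
  have c: "r \<in> carrier B" "s \<in> carrier B" "i \<in> I" using 1(1) 2(1) unfolding dec_def by auto
  obtain \<kappa> where "ev \<kappa> \<otimes> (ev k' \<otimes> r) = ev \<kappa> \<otimes> (ev k \<otimes> s)" using dec_unique(2)[OF 1(1) 2(1)] by blast
  then have "ae f' g'" using transv_unique[OF 1(2) 2(2) e(1) \<alpha> c(1,2)] by blast
  moreover have "ival f \<alpha> i = ival g \<alpha> j"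
    using transv_valid(1)[OF 1(2)] transv_valid(1)[OF 2(2)] ival_ae[OF _ _ e(1) \<alpha> c(3)]
      dec_unique(1)[OF 1(1) 2(1)] unfolding valid_def by blast
  moreover have "valid f'" by (rule transv_valid(2)[OF 1(2)])
  ultimately show "(y, y') \<in> steq" using 1(3) 2(3) e(2) by (simp add: steq_def xy)
next
  fix x y z assume a: "(x, y) \<in> step \<alpha> p" "(y, z) \<in> steq"
  obtain f h f' h' g' where xy: "x = (f, h)" "y = (f', h')" "z = (g', h')"
    using a(2) by (cases x; cases y; cases z) (auto simp: steq_def)
  have e: "ae f' g'" using a(2) by (simp add: steq_def xy)
  obtain r k i where 1: "dec p r k i" "transv \<alpha> r k f f'" "h' = h + ival f \<alpha> i"
    using a(1) unfolding step_def xy by blast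
  then have "r \<in> carrier B" unfolding dec_def by auto
  then have "transv \<alpha> r k f g'" by (rule transv_ae[OF 1(2) ae_refl e \<alpha>])
  then show "(x, z) \<in> step \<alpha> p" using 1 unfolding step_def xy by blast
qed

lemma stepI:
  "\<lbrakk>dec p r k i; transv \<alpha> r k f f'; h' = h + ival f \<alpha> i\<rbrakk> \<Longrightarrow> ((f, h), (f', h')) \<in> step \<alpha> p"
  unfolding step_def by blast

lemma step_zero:
  assumes \<alpha>: "\<alpha> \<in> \<Phi>"
  shows "step \<alpha> \<zero>\<^bsub>A\<^esub> = steq"
proof (rule good_eqI[OF good_step[OF \<alpha>] good_steq])
  fix x :: "('v, 'e, 'b, 'k) state" assume v: "valid (fst x)"
  then obtain f h n where x: "x = (f, h)" "sys \<Phi> n f" unfolding valid_def by (cases x) auto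
  have "dec \<zero>\<^bsub>A\<^esub> \<zero> 0 \<zero>" by (simp add: dec_def)
  moreover have "ival f \<alpha> \<zero> + ival f \<alpha> \<zero> = ival f \<alpha> \<zero> + 0" using ival_add[OF x(2) \<alpha>, of \<zero> \<zero>] by simp
  then have "ival f \<alpha> \<zero> = 0" by (rule add_left_imp_eq)
  ultimately have "(x, x) \<in> step \<alpha> \<zero>\<^bsub>A\<^esub>"
    unfolding x(1) using transv_zero[OF x(2) \<alpha>] by (intro stepI) auto
  then show "\<exists>y z. (x, y) \<in> step \<alpha> \<zero>\<^bsub>A\<^esub> \<and> (x, z) \<in> steq \<and> (y, z) \<in> steq"
    using steq_refl[OF v] by blast
qed simp

lemma ival_transv_fixed:
  assumes t: "transv \<alpha> r k f f'" and r: "\<alpha> \<in> \<Phi>" "r \<in> carrier B" "\<beta> \<in> \<Phi>" "c \<alpha> \<beta> \<ge> 0" and j: "j \<in> I"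
  shows "ival f' \<beta> j = ival f \<beta> j"
proof -
  obtain j' where "j' \<in> I" "j = ev k \<otimes> j'" using j by (rule I_cases)
  moreover have "\<beta> \<noteq> - \<alpha>" using r c_self by (auto simp: c_minus_right)
  ultimately show ?thesis using ival_transv[OF t r(1-3)] r(4) by simp
qed

lemma step_add:
  assumes \<alpha>: "\<alpha> \<in> \<Phi>" and p: "p \<in> carrier A" "q \<in> carrier A"
  shows "step \<alpha> p O step \<alpha> q = step \<alpha> (p \<oplus>\<^bsub>A\<^esub> q)"
proof (rule good_eqI[OF good_comp[OF good_step good_step] good_step])
  fix x :: "('v, 'e, 'b, 'k) state" assume v: "valid (fst x)"
  then obtain f h n where x: "x = (f, h)" "sys \<Phi> n f" unfolding valid_def by (cases x) auto
  obtain r k i where 1: "dec p r k i" using p(1) by (rule dec_exists)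
  obtain s l j where 2: "dec q s l j" using p(2) by (rule dec_exists)
  have c: "r \<in> carrier B" "s \<in> carrier B" "i \<in> I" "j \<in> I" using 1 2 unfolding dec_def by auto
  obtain f1 where f1: "transv \<alpha> r k f f1" using x \<alpha> c transv_exists by blast
  then obtain m where "sys \<Phi> m f1" using transv_valid(2) unfolding valid_def by blast
  then obtain f2 where f2: "transv \<alpha> s l f1 f2" using \<alpha> c transv_exists by blast
  let ?y = "(f2, h + ival f \<alpha> i + ival f1 \<alpha> j)"
  have "(x, ?y) \<in> step \<alpha> p O step \<alpha> q"
    unfolding x(1) by (rule relcompI[OF stepI[OF 1 f1 HOL.refl] stepI[OF 2 f2 HOL.refl]])
  moreover have "ival f1 \<alpha> j = ival f \<alpha> j"
    using ival_transv_fixed[OF f1 \<alpha> c(1) \<alpha> _ c(4)] c_self[OF \<alpha>] by simp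
  then have "(x, ?y) \<in> step \<alpha> (p \<oplus>\<^bsub>A\<^esub> q)"
    unfolding x(1) using ival_add[OF x(2) \<alpha> c(3,4)]
    by (intro stepI[OF dec_add[OF 1 2] transv_add[OF f1 f2 \<alpha> c(1,2)]]) (simp add: add.assoc)
  moreover have "(?y, ?y) \<in> steq"
    using transv_valid(2)[OF f2] by (intro steq_refl) simp
  ultimately show "\<exists>y z. (x, y) \<in> step \<alpha> p O step \<alpha> q \<and> (x, z) \<in> step \<alpha> (p \<oplus>\<^bsub>A\<^esub> q) \<and> (y, z) \<in> steq"
    by blast
qed (use assms in auto)

lemma step_commute:
  assumes R: "\<alpha> \<in> \<Phi>" "\<beta> \<in> \<Phi>" "c \<alpha> \<beta> \<ge> 0" and p: "p \<in> carrier A" "q \<in> carrier A"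
  shows "step \<alpha> p O step \<beta> q = step \<beta> q O step \<alpha> p"
proof (cases "c \<alpha> \<beta> = 2")
  case True
  then have "\<beta> = \<alpha>" using c_equal R by blast
  then show ?thesis using R p by (simp add: step_add h.S.a_comm)
next
  case False
  then have R3: "c \<alpha> \<beta> = 0 \<or> c \<alpha> \<beta> = 1" "c \<beta> \<alpha> \<ge> 0" using R root_cases[OF R(1,2)] by (auto simp: c_sym)
  show ?thesis
  proof (rule good_eqI[OF good_comp[OF good_step good_step] good_comp[OF good_step good_step]])
    fix x :: "('v, 'e, 'b, 'k) state" assume v: "valid (fst x)"
    then obtain f h n where x: "x = (f, h)" "sys \<Phi> n f" unfolding valid_def by (cases x) auto
    obtain r k i where 1: "dec p r k i" using p(1) by (rule dec_exists)
    obtain s l j where 2: "dec q s l j" using p(2) by (rule dec_exists)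
    have c: "r \<in> carrier B" "s \<in> carrier B" "i \<in> I" "j \<in> I" using 1 2 unfolding dec_def by auto
    obtain f1 where f1: "transv \<alpha> r k f f1" using x R c transv_exists by blast
    then obtain m where "sys \<Phi> m f1" using transv_valid(2) unfolding valid_def by blast
    then obtain f2 where f2: "transv \<beta> s l f1 f2" using R c transv_exists by blast
    obtain g1 where g1: "transv \<beta> s l f g1" using x R c transv_exists by blast
    then obtain m where "sys \<Phi> m g1" using transv_valid(2) unfolding valid_def by blast
    then obtain g2 where g2: "transv \<alpha> r k g1 g2" using R c transv_exists by blast
    let ?y = "(f2, h + ival f \<alpha> i + ival f1 \<beta> j)" and ?z = "(g2, h + ival f \<beta> j + ival g1 \<alpha> i)"
    have "(x, ?y) \<in> step \<alpha> p O step \<beta> q" "(x, ?z) \<in> step \<beta> q O step \<alpha> p"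
      unfolding x(1) by (rule relcompI[OF stepI[OF 1 f1 HOL.refl] stepI[OF 2 f2 HOL.refl]],
          rule relcompI[OF stepI[OF 2 g1 HOL.refl] stepI[OF 1 g2 HOL.refl]])
    moreover have "(?y, ?z) \<in> steq"
    proof -
      have "ival f1 \<beta> j = ival f \<beta> j" "ival g1 \<alpha> i = ival f \<alpha> i"
        using ival_transv_fixed[OF f1 R(1) c(1) R(2,3) c(4)] ival_transv_fixed[OF g1 R(2) c(2) R(1) R3(2) c(3)]
        by auto
      moreover have "cm (ival f \<alpha> i) (ival f \<beta> j)" by (rule ival_cm[OF x(2) R c(3,4)])
      moreover have "ae f2 g2" by (rule transv_commute[OF f1 f2 g1 g2 R(1,2) R3(1) c(1,2)])
      moreover have "valid f2" by (rule transv_valid(2)[OF f2])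
      ultimately show ?thesis by (simp add: steq_def cm_def add.assoc)
    qed
    ultimately show "\<exists>y z. (x, y) \<in> step \<alpha> p O step \<beta> q \<and> (x, z) \<in> step \<beta> q O step \<alpha> p \<and> (y, z) \<in> steq"
      by blast
  qed (use assms in auto)
qed

text \<open>On systems this is \<open>transv_com\<close>. The second components differ by the terms
  that \<open>dec_mult\<close> produces for the product of the parameters, and
  \<open>com_reorder\<close> puts them in order.\<close>

lemma step_com:
  assumes R: "\<alpha> \<in> \<Phi>" "\<beta> \<in> \<Phi>" "c \<alpha> \<beta> = -1" and p: "p \<in> carrier A" "q \<in> carrier A"
  shows "step \<alpha> p O step \<beta> q = step (\<alpha> + \<beta>) ([N \<alpha> \<beta>] \<cdot>\<^bsub>A\<^esub> (p \<otimes>\<^bsub>A\<^esub> q)) O (step \<beta> q O step \<alpha> p)"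
proof -
  let ?s = "\<alpha> + \<beta>" and ?n = "N \<alpha> \<beta>"
  have s: "?s \<in> \<Phi>" using sum_root R by blast
  have c': "c \<beta> \<alpha> = -1" using R by (simp add: c_sym)
  have cs: "c ?s \<beta> \<ge> 0" "c ?s \<alpha> \<ge> 0" "c ?s ?s \<ge> 0"
    using R c' c_self[OF R(1)] c_self[OF R(2)] c_self[OF s] by (auto simp: c_add)
  have ne: "\<beta> \<noteq> - \<alpha>" "\<alpha> \<noteq> - \<beta>" using R c_self[OF R(1)] c' c_self[OF R(2)] by (auto simp: c_minus_right)
  have pq: "[?n] \<cdot>\<^bsub>A\<^esub> (p \<otimes>\<^bsub>A\<^esub> q) \<in> carrier A" using p by simp
  note g = good_step[OF R(1) p(1)] good_step[OF R(2) p(2)] good_step[OF s pq]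
  show ?thesis
  proof (rule good_eqI[OF good_comp[OF g(1,2)] good_comp[OF g(3) good_comp[OF g(2,1)]]])
    fix x :: "('v, 'e, 'b, 'k) state" assume v: "valid (fst x)"
    then obtain f h n where x: "x = (f, h)" "sys \<Phi> n f" unfolding valid_def by (cases x) auto
    obtain r k i where 1: "dec p r k i" using p(1) by (rule dec_exists)
    obtain t l j where 2: "dec q t l j" using p(2) by (rule dec_exists)
    have c: "r \<in> carrier B" "t \<in> carrier B" "i \<in> I" "j \<in> I" using 1 2 unfolding dec_def by auto
    \<comment> \<open>Each part in \<open>I\<close> is divided by the denominator of the other
      parameter, which prepares the mixed terms of the product.\<close>
    obtain i' where i': "i' \<in> I" "ev l \<otimes> i' = i" using divisible[OF c(3)] by blast
    obtain j' where j': "j' \<in> I" "ev k \<otimes> j' = j" using divisible[OF c(4)] by blast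
    let ?q = "[?n] \<cdot> (r \<otimes> t)"
    let ?m = "[?n] \<cdot> (i \<otimes> j \<oplus> r \<otimes> j' \<oplus> t \<otimes> i')"
    have 3: "dec ([?n] \<cdot>\<^bsub>A\<^esub> (p \<otimes>\<^bsub>A\<^esub> q)) ?q (k + l) ?m"
      by (rule dec_mult[OF 1 2 i'(2) j'(2) i'(1) j'(1) N_unit[OF R]])
    have q: "?q \<in> carrier B" using c by simp
    obtain f1 where f1: "transv \<alpha> r k f f1" using x R c transv_exists by blast
    then obtain m where "sys \<Phi> m f1" using transv_valid(2) unfolding valid_def by blast
    then obtain f2 where f2: "transv \<beta> t l f1 f2" using R c transv_exists by blast
    obtain g1 where g1: "transv ?s ?q (k + l) f g1" using x s q transv_exists by blast
    then obtain m1 where m1: "sys \<Phi> m1 g1" using transv_valid(2) unfolding valid_def by blast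
    then obtain g2 where g2: "transv \<beta> t l g1 g2" using R c transv_exists by blast
    then obtain m where "sys \<Phi> m g2" using transv_valid(2) unfolding valid_def by blast
    then obtain g3 where g3: "transv \<alpha> r k g2 g3" using R c transv_exists by blast
    let ?y = "(f2, h + ival f \<alpha> i + ival f1 \<beta> j)"
    let ?z = "(g3, h + ival f ?s ?m + ival g1 \<beta> j + ival g2 \<alpha> i)"
    have "(x, ?y) \<in> step \<alpha> p O step \<beta> q"
      unfolding x(1) by (rule relcompI[OF stepI[OF 1 f1 HOL.refl] stepI[OF 2 f2 HOL.refl]])
    moreover have "(x, ?z) \<in> step ?s ([?n] \<cdot>\<^bsub>A\<^esub> (p \<otimes>\<^bsub>A\<^esub> q)) O (step \<beta> q O step \<alpha> p)"
      unfolding x(1)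
      by (rule relcompI[OF stepI[OF 3 g1 HOL.refl] relcompI[OF stepI[OF 2 g2 HOL.refl] stepI[OF 1 g3 HOL.refl]]])
    moreover have "(?y, ?z) \<in> steq"
    proof -
      have sI: "[?n] \<cdot> b \<in> I" if "b \<in> I" for b using N_unit[OF R] that by (auto simp: sgn_minus_1)
      let ?u = "ival f ?s ([?n] \<cdot> (i \<otimes> j))" and ?v = "ival f ?s ([?n] \<cdot> (r \<otimes> j'))"
        and ?w = "ival f ?s ([?n] \<cdot> (t \<otimes> i'))"
      let ?P = "ival f \<alpha> i" and ?Q = "ival f \<beta> j"
      have I3: "i \<otimes> j \<in> I" "r \<otimes> j' \<in> I" "t \<otimes> i' \<in> I" using c i' j' by auto
      have f1Q: "ival f1 \<beta> j = ?v + ?Q"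
        using ival_transv[OF f1 R(1) c(1) R(2) ne(1) j'(1)] R(3) j'(2) by simp
      have m: "ival f ?s ?m = ?u + ?v + ?w"
        using I3 ival_add[OF x(2) s] sI by (simp add: add.int_pow_distrib)
      have g1Q: "ival g1 \<beta> j = ?Q" by (rule ival_transv_fixed[OF g1 s q R(2) cs(1) c(4)])
      have "ival g2 \<alpha> i = ival g1 (\<beta> + \<alpha>) ([N \<beta> \<alpha>] \<cdot> (t \<otimes> i')) + ival g1 \<alpha> i"
        using ival_transv[OF g2 R(2) c(2) R(1) ne(2) i'(1)] c' i'(2) by simp
      also have "ival g1 \<alpha> i = ?P" by (rule ival_transv_fixed[OF g1 s q R(1) cs(2) c(3)])
      also have "[N \<beta> \<alpha>] \<cdot> (t \<otimes> i') = \<ominus> ([?n] \<cdot> (t \<otimes> i'))"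
        using N_skew[OF R] I3 by (simp add: sgn_minus)
      also have "ival g1 (\<beta> + \<alpha>) (\<ominus> ([?n] \<cdot> (t \<otimes> i'))) = ival f ?s (\<ominus> ([?n] \<cdot> (t \<otimes> i')))"
        unfolding add.commute[of \<beta> \<alpha>] using sI[OF I3(3)]
        by (intro ival_transv_fixed[OF g1 s q s cs(3)]) simp
      also have "\<dots> = - ?w"
      proof -
        have z: "ival f ?s \<zero> + ival f ?s \<zero> = ival f ?s \<zero> + 0" using ival_add[OF x(2) s, of \<zero> \<zero>] by simp
        have "ival f ?s \<zero> = 0" using add_left_imp_eq[OF z] .
        then have "ival f ?s (\<ominus> ([?n] \<cdot> (t \<otimes> i'))) + ?w = 0"
          using ival_add[OF x(2) s, of "\<ominus> ([?n] \<cdot> (t \<otimes> i'))" "[?n] \<cdot> (t \<otimes> i')"] sI[OF I3(3)]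
          by (simp add: l_neg)
        then show ?thesis by (simp add: eq_neg_iff_add_eq_0)
      qed
      finally have g2P: "ival g2 \<alpha> i = - ?w + ?P" .
      have "?P + (?v + ?Q) = (?u + ?v + ?w) + (?Q + (- ?w + ?P))"
      proof (rule com_reorder)
        show "com ?P ?Q = ?u" by (rule ival_com[OF x(2) R c(3,4)])
        show "cm ?v ?P" "cm ?w ?Q" "cm ?u ?v"
          by (rule ival_cm[OF x(2) s R(1) cs(2) sI[OF I3(2)] c(3)],
              rule ival_cm[OF x(2) s R(2) cs(1) sI[OF I3(3)] c(4)],
              rule ival_cm[OF x(2) s s cs(3) sI[OF I3(1)] sI[OF I3(2)]])
      qed
      moreover have "ae f2 g3" by (rule transv_com[OF f1 f2 g1 g2 g3 R c(1,2)])
      moreover have "valid f2" by (rule transv_valid(2)[OF f2])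
      ultimately show ?thesis unfolding f1Q m g1Q g2P by (simp add: steq_def add.assoc)
    qed
    ultimately show "\<exists>y z. (x, y) \<in> step \<alpha> p O step \<beta> q \<and>
        (x, z) \<in> step ?s ([?n] \<cdot>\<^bsub>A\<^esub> (p \<otimes>\<^bsub>A\<^esub> q)) O (step \<beta> q O step \<alpha> p) \<and> (y, z) \<in> steq"
      by blast
  qed
qed

fun reach :: "('v \<times> 'a) word \<Rightarrow> ('v, 'e, 'b, 'k) state rel" where
  "reach [] = steq"
| "reach (((\<alpha>, p), s) # w) = step \<alpha> (if s then p else \<ominus>\<^bsub>A\<^esub> p) O reach w"

lemma good_reach: "w \<in> words (steinberg_gens \<Phi> A) \<Longrightarrow> good (reach w)"
proof (induction w rule: reach.induct)
  case 1
  show ?case by (simp add: good_steq)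
next
  case (2 \<alpha> p s w)
  then have "\<alpha> \<in> \<Phi>" "p \<in> carrier A" "good (reach w)" by (auto simp: steinberg_gens_def)
  then show ?case by (auto intro!: good_comp good_step)
qed

lemma steq_good: "good F \<Longrightarrow> steq O F = F"
proof
  assume F: "good F"
  show "steq O F \<subseteq> F" using good_left[OF F] by blast
  show "F \<subseteq> steq O F"
  proof
    fix p assume "p \<in> F"
    then show "p \<in> steq O F" using good_valid[OF F] steq_refl by (cases p) blast
  qed
qed

lemma reach_append:
  assumes v: "v \<in> words (steinberg_gens \<Phi> A)"
  shows "reach (u @ v) = reach u O reach v"
proof (induction u rule: reach.induct)
  case 1
  show ?case using steq_good[OF good_reach[OF v]] by (simp only: append_Nil reach.simps(1))
next
  case (2 \<alpha> p s w)
  then show ?case by (simp add: O_assoc)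
qed

text \<open>Steps are invertible by \<open>step_add\<close> and \<open>step_zero\<close>. So the
  commutator words reduce to the inverse-free equations \<open>step_com\<close> and
  \<open>step_commute\<close>.\<close>

lemma reach_word_eq:
  assumes "(u, v) \<in> word_eq (steinberg_gens \<Phi> A) (steinberg_rels \<Phi> N A)"
  shows "reach u = reach v"
  using assms
proof (induction rule: word_eq.induct)
  case (cancel u v a b)
  obtain \<alpha> p where a: "a = (\<alpha>, p)" by (cases a)
  then have R: "\<alpha> \<in> \<Phi>" "p \<in> carrier A" using cancel(3) by (auto simp: steinberg_gens_def)
  have "reach ([(a, b), (a, \<not> b)] @ v) = (step \<alpha> (if b then p else \<ominus>\<^bsub>A\<^esub> p) O step \<alpha> (if b then \<ominus>\<^bsub>A\<^esub> p else p)) O reach v"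
    by (simp add: a O_assoc)
  also have "\<dots> = reach v"
    using R steq_good[OF good_reach[OF cancel(2)]] by (simp add: step_add step_zero h.S.r_neg h.S.l_neg)
  finally have "reach ([(a, b), (a, \<not> b)] @ v) = reach v" .
  moreover have "[(a, b), (a, \<not> b)] @ v \<in> words (steinberg_gens \<Phi> A)" using cancel by simp
  ultimately show ?case using reach_append[of _ u] cancel(2) by metis
next
  case (rel u v l r)
  note w = \<open>l \<in> words _\<close> \<open>r \<in> words _\<close> \<open>v \<in> words _\<close>
  have st: "F O steq = F" if "good F" for F :: "('v, 'e, 'b, 'k) state rel"
  proof
    show "F O steq \<subseteq> F" using good_right[OF that] by blast
    show "F \<subseteq> F O steq"
    proof
      fix p assume "p \<in> F"
      then show "p \<in> F O steq" using good_valid[OF that] steq_refl by (cases p) blast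
    qed
  qed
  have inv: "step \<alpha> p O (step \<alpha> (\<ominus>\<^bsub>A\<^esub> p) O F) = F"
    if "\<alpha> \<in> \<Phi>" "p \<in> carrier A" "good F" for \<alpha> p and F :: "('v, 'e, 'b, 'k) state rel"
    using that steq_good[OF that(3)] by (simp add: step_add step_zero h.S.r_neg flip: O_assoc)
  have cw: "reach (comm_word (\<alpha>, p) (\<beta>, q)) = (step \<alpha> p O step \<beta> q) O (step \<alpha> (\<ominus>\<^bsub>A\<^esub> p) O step \<beta> (\<ominus>\<^bsub>A\<^esub> q))"
    if "\<alpha> \<in> \<Phi>" "\<beta> \<in> \<Phi>" "p \<in> carrier A" "q \<in> carrier A" for \<alpha> \<beta> p q
    using that by (simp add: comm_word_def O_assoc st good_step)
  have "reach l = reach r"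
    using \<open>(l, r) \<in> steinberg_rels \<Phi> N A\<close> unfolding steinberg_rels_def
  proof (elim UnE)
    assume "(l, r) \<in> {([((\<alpha>, r), True), ((\<alpha>, s), True)], [((\<alpha>, r \<oplus>\<^bsub>A\<^esub> s), True)]) | \<alpha> r s.
        \<alpha> \<in> \<Phi> \<and> r \<in> carrier A \<and> s \<in> carrier A}"
    then show ?thesis by (auto simp: step_add simp flip: O_assoc)
  next
    assume "(l, r) \<in> {(comm_word (\<alpha>, r) (\<beta>, s), [((\<alpha> + \<beta>, [N \<alpha> \<beta>] \<cdot>\<^bsub>A\<^esub> (r \<otimes>\<^bsub>A\<^esub> s)), True)]) | \<alpha> \<beta> r s.
        \<alpha> \<in> \<Phi> \<and> \<beta> \<in> \<Phi> \<and> \<alpha> + \<beta> \<in> \<Phi> \<and> r \<in> carrier A \<and> s \<in> carrier A}"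
    then obtain \<alpha> \<beta> p q where lr: "l = comm_word (\<alpha>, p) (\<beta>, q)" "r = [((\<alpha> + \<beta>, [N \<alpha> \<beta>] \<cdot>\<^bsub>A\<^esub> (p \<otimes>\<^bsub>A\<^esub> q)), True)]"
      and R: "\<alpha> \<in> \<Phi>" "\<beta> \<in> \<Phi>" "\<alpha> + \<beta> \<in> \<Phi>" "p \<in> carrier A" "q \<in> carrier A" by blast
    have "c \<alpha> \<beta> = -1" using sum_root R by blast
    then have "reach l = (step (\<alpha> + \<beta>) ([N \<alpha> \<beta>] \<cdot>\<^bsub>A\<^esub> (p \<otimes>\<^bsub>A\<^esub> q)) O (step \<beta> q O step \<alpha> p)) O (step \<alpha> (\<ominus>\<^bsub>A\<^esub> p) O step \<beta> (\<ominus>\<^bsub>A\<^esub> q))"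
      unfolding lr using R by (simp only: cw step_com)
    also have "\<dots> = step (\<alpha> + \<beta>) ([N \<alpha> \<beta>] \<cdot>\<^bsub>A\<^esub> (p \<otimes>\<^bsub>A\<^esub> q)) O (step \<beta> q O (step \<alpha> p O (step \<alpha> (\<ominus>\<^bsub>A\<^esub> p) O (step \<beta> (\<ominus>\<^bsub>A\<^esub> q) O steq))))"
      using R by (simp add: O_assoc st good_step)
    also have "\<dots> = reach r" unfolding lr using R by (simp add: inv good_comp good_step good_steq)
    finally show ?thesis .
  next
    assume "(l, r) \<in> {(comm_word (\<alpha>, r) (\<beta>, s), []) | \<alpha> \<beta> r s.
        \<alpha> \<in> \<Phi> \<and> \<beta> \<in> \<Phi> \<and> \<alpha> + \<beta> \<notin> \<Phi> \<union> {0} \<and> r \<in> carrier A \<and> s \<in> carrier A}"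
    then obtain \<alpha> \<beta> p q where lr: "l = comm_word (\<alpha>, p) (\<beta>, q)" "r = []"
      and R: "\<alpha> \<in> \<Phi>" "\<beta> \<in> \<Phi>" "\<alpha> + \<beta> \<notin> \<Phi> \<union> {0}" "p \<in> carrier A" "q \<in> carrier A" by blast
    have "\<beta> \<noteq> - \<alpha>" using R(3) by auto
    then have "c \<alpha> \<beta> \<noteq> -1" "c \<alpha> \<beta> \<noteq> -2" using sum_root R c_opposite_iff by auto
    then have "c \<alpha> \<beta> \<ge> 0" using root_cases[OF R(1,2)] by auto
    then have "reach l = (step \<beta> q O step \<alpha> p) O (step \<alpha> (\<ominus>\<^bsub>A\<^esub> p) O step \<beta> (\<ominus>\<^bsub>A\<^esub> q))"
      unfolding lr using R step_commute[of \<alpha> \<beta> p q] by (simp only: cw)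
    also have "\<dots> = step \<beta> q O (step \<alpha> p O (step \<alpha> (\<ominus>\<^bsub>A\<^esub> p) O (step \<beta> (\<ominus>\<^bsub>A\<^esub> q) O steq)))"
      using R by (simp add: O_assoc st good_step)
    also have "\<dots> = reach r" unfolding lr using R by (simp add: inv good_comp good_step good_steq)
    finally show ?thesis .
  qed
  then show ?case using w by (simp add: reach_append)
qed simp_all

end


section \<open>Orbit of the root elements of the given group\<close>

lemma com_conjugate: "com (g + x - g) (g + y - g) = g + com x y - g"
  by (simp only: com_def group_nf)

lemma cm_conjugate: "cm x y \<Longrightarrow> cm (g + x - g) (g + y - g)"
  unfolding com_eq_0_iff[symmetric] com_conjugate by simp

lemma add_conjugate: "((g :: 'k::group_add) + x - g) + (g + y - g) = g + (x + y) - g"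
  by (simp only: group_nf)

context steinberg_excision_rep
begin

fun val :: "('v \<times> 'b) word \<Rightarrow> 'k" where
  "val [] = 0"
| "val (((\<beta>, b), s) # w) = (if s then xr \<beta> b else - xr \<beta> b) + val w"

text \<open>These systems come from honest conjugation in the group. Words with parameters from
  \<open>B\<close> lead from one of them to another.\<close>

definition cj :: "'k \<Rightarrow> 'v \<Rightarrow> 'e \<Rightarrow> 'b \<Rightarrow> 'k" where
  "cj g \<beta> \<nu> b = g + xr \<beta> (ev \<nu> \<otimes> b) - g"

lemma xr_minus: "\<beta> \<in> \<Phi> \<Longrightarrow> b \<in> carrier B \<Longrightarrow> xr \<beta> (\<ominus> b) = - xr \<beta> b"
proof -
  assume b: "\<beta> \<in> \<Phi>" "b \<in> carrier B"
  have z: "xr \<beta> \<zero> + xr \<beta> \<zero> = xr \<beta> \<zero> + 0" using x_add[OF b(1), of \<zero> \<zero>] by simp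
  have "xr \<beta> \<zero> = 0" using add_left_imp_eq[OF z] .
  then have "xr \<beta> (\<ominus> b) + xr \<beta> b = 0" using x_add[OF b(1), of "\<ominus> b" b] b by (simp add: l_neg)
  then show ?thesis by (simp add: eq_neg_iff_add_eq_0)
qed

lemma sys_cj: "sys \<Phi> 0 (cj g)"
proof (rule sysI)
  fix \<beta> \<gamma> \<nu> \<mu> b d
  assume r: "\<beta> \<in> \<Phi>" "\<gamma> \<in> \<Phi>" "\<beta> + \<gamma> \<in> \<Phi>" and b: "b \<in> carrier B" "d \<in> carrier B"
  have "c \<beta> \<gamma> = -1" using sum_root r by blast
  then show "com (cj g \<beta> \<nu> b) (cj g \<gamma> \<mu> d) = cj g (\<beta> + \<gamma>) (\<nu> + \<mu>) ([N \<beta> \<gamma>] \<cdot> (b \<otimes> d))"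
    unfolding cj_def com_conjugate using r b by (simp add: x_com sgn_simps ev_add m_ac)
next
  fix \<beta> \<gamma> \<nu> \<mu> b d
  assume "\<beta> \<in> \<Phi>" "\<gamma> \<in> \<Phi>" "b \<in> carrier B" "d \<in> carrier B" "c \<beta> \<gamma> \<ge> 0"
  then show "cm (cj g \<beta> \<nu> b) (cj g \<gamma> \<mu> d)"
    unfolding cj_def by (intro cm_conjugate x_cm) auto
next
  fix \<beta> \<nu> b d assume "\<beta> \<in> \<Phi>" "b \<in> carrier B" "d \<in> carrier B"
  then show "cj g \<beta> \<nu> (b \<oplus> d) = cj g \<beta> \<nu> b + cj g \<beta> \<nu> d"
    unfolding cj_def add_conjugate by (simp add: r_distr x_add)
next
  fix \<beta> \<nu> \<kappa> b assume "\<beta> \<in> \<Phi>" "b \<in> carrier B"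
  then show "cj g \<beta> (\<nu> + \<kappa>) b = cj g \<beta> \<nu> (ev \<kappa> \<otimes> b)" by (simp add: cj_def ev_add m_assoc)
qed

lemma transv_cj:
  assumes r: "\<alpha> \<in> \<Phi>" "r \<in> carrier B"
  shows "transv \<alpha> r 0 (cj g) (cj (g + xr \<alpha> r))"
proof -
  have "tr 0 \<alpha> r 0 (cj g) (cj (g + xr \<alpha> r))"
  proof (rule trI[OF sys_cj sys_cj])
    fix \<beta> \<nu> b assume h: "\<beta> \<in> \<Phi>" "\<beta> \<noteq> - \<alpha>" "b \<in> carrier B"
    let ?y = "ev \<nu> \<otimes> b"
    have y: "?y \<in> carrier B" using h by simp
    have 1: "cj (g + xr \<alpha> r) \<beta> \<nu> (ev 0 \<otimes> b) = g + (xr \<alpha> r + xr \<beta> ?y - xr \<alpha> r) - g"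
      unfolding cj_def using h by (simp only: group_nf ev_0 l_one)
    have 2: "xr \<alpha> r + xr \<beta> ?y - xr \<alpha> r
        = (if c \<alpha> \<beta> = -1 then xr (\<alpha> + \<beta>) ([N \<alpha> \<beta>] \<cdot> (r \<otimes> ?y)) else 0) + xr \<beta> ?y"
    proof (cases "c \<alpha> \<beta> = -1")
      case True
      then show ?thesis using com_eqD[OF x_com[OF r(1) h(1) r(2) y]] by (simp add: diff_eq_eq)
    next
      case False
      moreover have "c \<alpha> \<beta> \<noteq> -2" using c_opposite_iff r h by auto
      ultimately have "c \<alpha> \<beta> \<ge> 0" using root_cases[OF r(1) h(1)] by auto
      then show ?thesis using False x_cm[OF r(1) h(1) r(2) y] by (simp add: cm_conj)
    qed
    have 3: "corr (cj g) \<alpha> r \<beta> \<nu> b = g + (if c \<alpha> \<beta> = -1 then xr (\<alpha> + \<beta>) ([N \<alpha> \<beta>] \<cdot> (r \<otimes> ?y)) else 0) - g"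
      using h r by (simp add: corr_def cj_def sgn_simps m_lcomm)
    show "cj (g + xr \<alpha> r) \<beta> \<nu> (ev 0 \<otimes> b) = corr (cj g) \<alpha> r \<beta> \<nu> b + cj g \<beta> \<nu> (ev 0 \<otimes> b)"
      unfolding 1 2 3 using h by (simp add: cj_def add_conjugate)
  qed
  then show ?thesis unfolding transv_def by blast
qed

lemma ival_cj: "\<alpha> \<in> \<Phi> \<Longrightarrow> i \<in> I \<Longrightarrow> ival (cj g) \<alpha> i = g + xr \<alpha> i - g"
  using ival_eq[OF sys_cj, of \<alpha> 0 i g] by (simp add: cj_def)

lemma step_cj:
  assumes \<alpha>: "\<alpha> \<in> \<Phi>" and b: "r \<in> C" "i \<in> I"
  shows "((cj g, h), (cj (g + xr \<alpha> r), h + (g + xr \<alpha> i - g))) \<in> step \<alpha> (\<pi> (r \<oplus> i))"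
proof (rule stepI[OF _ transv_cj])
  show "dec (\<pi> (r \<oplus> i)) r 0 i" using b by (simp add: dec_def)
qed (use assms in \<open>simp_all add: ival_cj\<close>)

text \<open>A letter with parameter \<open>r \<oplus> i\<close> multiplies the conjugating element
  by the root element of its constant part \<open>r\<close> and adds to \<open>h\<close> the
  conjugate of the root element of \<open>i\<close>. Over a word these conjugates telescope to the
  value of the word times the inverse of the value of its constant part.\<close>

lemma reach_cj:
  "w \<in> words (steinberg_gens \<Phi> B) \<Longrightarrow>
    ((cj g, h), (cj (g + val (map_word cst w)), h + (g + val w - val (map_word cst w) - g)))
      \<in> reach (map_word \<pi> w)"
proof (induction w arbitrary: g h rule: val.induct)
  case 1
  have "valid (cj g)" using sys_cj unfolding valid_def by blast
  then have "((cj g, h), (cj g, h)) \<in> steq" using steq_refl[of "(cj g, h)"] by simp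
  then show ?case by simp
next
  case (2 \<beta> b s w)
  then have b: "\<beta> \<in> \<Phi>" "b \<in> carrier B" and w: "w \<in> words (steinberg_gens \<Phi> B)"
    by (auto simp: steinberg_gens_def)
  define r where "r = (if s then cst b else \<ominus> cst b)"
  define i where "i = (if s then b \<ominus> cst b else \<ominus> (b \<ominus> cst b))"
  let ?b = "if s then b else \<ominus> b"
  have ri: "r \<in> C" "i \<in> I" using cst[OF b(2)] by (simp_all add: r_def i_def)
  have "b = cst b \<oplus> (b \<ominus> cst b)" using b(2) cst[OF b(2)] by (simp add: minus_eq a_lcomm r_neg)
  then have s: "r \<oplus> i = ?b"
    using b(2) cst[OF b(2)] minus_add[of "cst b" "b \<ominus> cst b"] by (simp add: r_def i_def)
  have p: "\<pi> (r \<oplus> i) = (if s then \<pi> b else \<ominus>\<^bsub>A\<^esub> \<pi> b)" unfolding s using b by simp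
  have x: "xr \<beta> r = (if s then xr \<beta> (cst b) else - xr \<beta> (cst b))"
    "xr \<beta> ?b = (if s then xr \<beta> b else - xr \<beta> b)"
    using b cst[OF b(2)] by (simp_all add: r_def xr_minus)
  have sum: "xr \<beta> ?b = xr \<beta> i + xr \<beta> r"
    unfolding s[symmetric] using x_add[OF b(1), of i r] ri by (simp add: a_comm)
  let ?u = "val (map_word cst w)" and ?r = "xr \<beta> r"
  have "((cj g, h), (cj (g + ?r), h + (g + xr \<beta> i - g))) \<in> step \<beta> (\<pi> (r \<oplus> i))"
    by (rule step_cj[OF b(1) ri])
  moreover have "((cj (g + ?r), h + (g + xr \<beta> i - g)), (cj ((g + ?r) + ?u),
      (h + (g + xr \<beta> i - g)) + ((g + ?r) + val w - ?u - (g + ?r)))) \<in> reach (map_word \<pi> w)"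
    by (rule 2(1)[OF w])
  ultimately have "((cj g, h), (cj ((g + ?r) + ?u), (h + (g + xr \<beta> i - g)) + ((g + ?r) + val w - ?u - (g + ?r))))
      \<in> reach (map_word \<pi> (((\<beta>, b), s) # w))"
    by (auto simp: p)
  also have "(h + (g + xr \<beta> i - g)) + ((g + ?r) + val w - ?u - (g + ?r))
      = h + (g + ((xr \<beta> i + ?r) + val w) - (?r + ?u) - g)"
    by (simp only: group_nf)
  also have "(g + ?r) + ?u = g + (?r + ?u)" by (simp add: add.assoc)
  finally show ?case unfolding sum[symmetric] by (simp add: x)
qed

text \<open>A word that is trivial over \<open>A\<close> acts as \<open>steq\<close>, which compares
  second components by plain equality. Started from the state \<open>(cj 0, 0)\<close>, the second
  component is the value of \<open>w\<close> once the constant part has value 0.\<close>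

theorem val_eq_0:
  assumes w: "w \<in> words (steinberg_gens \<Phi> B)"
    and A: "(map_word \<pi> w, []) \<in> word_eq (steinberg_gens \<Phi> A) (steinberg_rels \<Phi> N A)"
    and C: "val (map_word cst w) = 0"
  shows "val w = 0"
proof -
  have "((cj 0, 0), (cj (0 + val (map_word cst w)), 0 + (0 + val w - val (map_word cst w) - 0))) \<in> steq"
    using reach_cj[OF w, of 0 0] unfolding reach_word_eq[OF A] by simp
  then show ?thesis by (simp add: steq_def C)
qed

end


section \<open>Cayley embedding\<close>

text \<open>The Steinberg group of \<open>B\<close> acts by left multiplication, which turns it into a subgroup of
  a type of class \<open>group_add\<close>.\<close>

typedef 'a bijection = "{f :: 'a \<Rightarrow> 'a. bij f}"
  by (rule exI[of _ id]) simp

instantiation bijection :: (type) group_add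
begin

definition "0 = Abs_bijection id"
definition "f + g = Abs_bijection (Rep_bijection f \<circ> Rep_bijection g)"
definition "- f = Abs_bijection (inv_into UNIV (Rep_bijection f))"
definition "f - g = f + (- g :: 'a bijection)"

lemma bij_Rep: "bij (Rep_bijection f)"
  using Rep_bijection by blast

lemma Rep_simps:
  "Rep_bijection 0 = id"
  "Rep_bijection (f + g) = Rep_bijection f \<circ> Rep_bijection g"
  "Rep_bijection (- f) = inv_into UNIV (Rep_bijection f)"
  unfolding zero_bijection_def plus_bijection_def uminus_bijection_def
  by (simp_all add: Abs_bijection_inverse bij_Rep bij_comp bij_imp_bij_inv)

instance
  by standard (simp_all add: Rep_bijection_inject[symmetric] Rep_simps o_assoc minus_bijection_def
      inv_o_cancel bij_is_inj bij_Rep)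

end

definition cayley :: "('g, 'm) monoid_scheme \<Rightarrow> 'g \<Rightarrow> 'g bijection" where
  "cayley G a = Abs_bijection (\<lambda>y. if y \<in> carrier G then a \<otimes>\<^bsub>G\<^esub> y else y)"

context group
begin

lemma Rep_cayley:
  assumes "a \<in> carrier G"
  shows "Rep_bijection (cayley G a) = (\<lambda>y. if y \<in> carrier G then a \<otimes> y else y)"
proof -
  have "bij (\<lambda>y. if y \<in> carrier G then a \<otimes> y else y)"
    by (rule o_bij[where g = "\<lambda>y. if y \<in> carrier G then inv a \<otimes> y else y"])
       (use assms in \<open>auto simp: fun_eq_iff m_assoc[symmetric]\<close>)
  then show ?thesis by (simp add: cayley_def Abs_bijection_inverse)
qed

lemma cayley_mult: "a \<in> carrier G \<Longrightarrow> b \<in> carrier G \<Longrightarrow> cayley G (a \<otimes> b) = cayley G a + cayley G b"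
  by (simp add: Rep_bijection_inject[symmetric] Rep_cayley Rep_simps fun_eq_iff m_assoc)

lemma cayley_one: "cayley G \<one> = 0"
  by (simp add: Rep_bijection_inject[symmetric] Rep_cayley Rep_simps fun_eq_iff)

lemma cayley_eq_0D: "a \<in> carrier G \<Longrightarrow> cayley G a = 0 \<Longrightarrow> a = \<one>"
proof -
  assume a: "a \<in> carrier G" "cayley G a = 0"
  have "Rep_bijection (cayley G a) \<one> = \<one>" unfolding a(2) by (simp add: Rep_simps)
  then show ?thesis using a(1) by (simp add: Rep_cayley)
qed

end

context steinberg_excision
begin

text \<open>The Steinberg group of \<open>B\<close> itself, embedded by left multiplication, takes
  the part of the group with root elements \<open>xr\<close>. The embedding is faithful, so value 0
  means triviality.\<close>

theorem steinberg_excision: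
  assumes w: "w \<in> words (steinberg_gens \<Phi> B)"
    and A: "(map_word \<pi> w, []) \<in> word_eq (steinberg_gens \<Phi> A) (steinberg_rels \<Phi> N A)"
    and cw: "(map_word cst w, []) \<in> word_eq (steinberg_gens \<Phi> B) (steinberg_rels \<Phi> N B)"
  shows "(w, []) \<in> word_eq (steinberg_gens \<Phi> B) (steinberg_rels \<Phi> N B)"
proof -
  let ?S = "steinberg_gens \<Phi> B" and ?R = "steinberg_rels \<Phi> N B"
  let ?G = "presented_group ?S ?R"
  interpret G: group ?G by (rule group_presented_group)
  define Y where "Y = (\<lambda>u. cayley ?G (word_eq ?S ?R `` {u}))"
  have Y_append: "Y (u @ v) = Y u + Y v" if "u \<in> words ?S" "v \<in> words ?S" for u v
    using that unfolding Y_def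
    by (simp add: presented_group_mult[symmetric] G.cayley_mult presented_group_carrierI)
  have Y_Nil: "Y [] = 0"
    unfolding Y_def presented_group_one[symmetric] by (rule G.cayley_one)
  have Y_eq: "Y u = Y v" if "(u, v) \<in> word_eq ?S ?R" for u v
    unfolding Y_def equiv_class_eq[OF equiv_word_eq that] ..
  have Y_zero: "(u, []) \<in> word_eq ?S ?R" if "u \<in> words ?S" "Y u = 0" for u
  proof -
    have "word_eq ?S ?R `` {u} = word_eq ?S ?R `` {[]}"
      using that unfolding Y_def presented_group_one[symmetric]
      by (intro G.cayley_eq_0D presented_group_carrierI)
    then show ?thesis using word_class_eq_iff[of u ?S "[]" ?R] that(1) by simp
  qed
  define X where "X = (\<lambda>\<beta> b. Y [((\<beta>, b), True)])"
  have gen: "[((\<beta>, b), s)] \<in> words ?S" if "\<beta> \<in> \<Phi>" "b \<in> carrier B" for \<beta> b s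
    using that by (simp add: steinberg_gens_def)
  have Y_False: "Y [((\<beta>, b), False)] = - X \<beta> b" if b: "\<beta> \<in> \<Phi>" "b \<in> carrier B" for \<beta> b
  proof -
    have "([] @ [((\<beta>, b), False), ((\<beta>, b), \<not> False)] @ [], [] @ []) \<in> word_eq ?S ?R"
      by (rule word_eq.cancel) (use b in \<open>auto simp: steinberg_gens_def\<close>)
    then have "Y [((\<beta>, b), False), ((\<beta>, b), True)] = 0" using Y_eq Y_Nil by fastforce
    then have "Y [((\<beta>, b), False)] + X \<beta> b = 0"
      using Y_append[OF gen[OF b, of False] gen[OF b, of True]] by (simp add: X_def)
    then show ?thesis by (simp add: eq_neg_iff_add_eq_0)
  qed
  have rel: "Y l = Y r" if "(l, r) \<in> ?R" "l \<in> words ?S" "r \<in> words ?S" for l r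
    using word_eq.rel[of "[]" ?S "[]" l r ?R] that by (intro Y_eq) simp
  have Y_com: "Y (comm_word (\<beta>, b) (\<gamma>, d)) = com (X \<beta> b) (X \<gamma> d)"
    and com_words: "comm_word (\<beta>, b) (\<gamma>, d) \<in> words ?S"
    if b: "\<beta> \<in> \<Phi>" "\<gamma> \<in> \<Phi>" "b \<in> carrier B" "d \<in> carrier B" for \<beta> \<gamma> b d
  proof -
    have g: "[((\<beta>, b), s)] \<in> words ?S" "[((\<gamma>, d), s)] \<in> words ?S" for s using gen b by auto
    have "Y ([((\<beta>, b), True)] @ ([((\<gamma>, d), True)] @ ([((\<beta>, b), False)] @ [((\<gamma>, d), False)])))
        = Y [((\<beta>, b), True)] + (Y [((\<gamma>, d), True)] + (Y [((\<beta>, b), False)] + Y [((\<gamma>, d), False)]))"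
      using g by (simp only: Y_append words_simps)
    then show "Y (comm_word (\<beta>, b) (\<gamma>, d)) = com (X \<beta> b) (X \<gamma> d)"
      unfolding Y_False[OF b(1,3)] Y_False[OF b(2,4)] comm_word_def com_def
      by (simp add: X_def diff_conv_add_uminus add.assoc del: add_uminus_conv_diff)
    show "comm_word (\<beta>, b) (\<gamma>, d) \<in> words ?S" using b by (simp add: comm_word_def steinberg_gens_def)
  qed
  interpret E: steinberg_excision_rep \<Phi> N c B ev A \<pi> I C cst X
  proof
    fix \<beta> b d assume b: "\<beta> \<in> \<Phi>" "b \<in> carrier B" "d \<in> carrier B"
    have "Y [((\<beta>, b), True), ((\<beta>, d), True)] = Y [((\<beta>, b \<oplus> d), True)]"
      by (rule rel) (use b in \<open>auto simp: steinberg_rels_def steinberg_gens_def\<close>)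
    then show "X \<beta> (b \<oplus> d) = X \<beta> b + X \<beta> d"
      using Y_append[OF gen[OF b(1,2), of True] gen[OF b(1,3), of True]] by (simp add: X_def)
  next
    fix \<beta> \<gamma> b d assume b: "\<beta> \<in> \<Phi>" "\<gamma> \<in> \<Phi>" "b \<in> carrier B" "d \<in> carrier B" and c: "c \<beta> \<gamma> = -1"
    have s: "\<beta> + \<gamma> \<in> \<Phi>" using sum_root b c by blast
    have "Y (comm_word (\<beta>, b) (\<gamma>, d)) = Y [((\<beta> + \<gamma>, [N \<beta> \<gamma>] \<cdot> (b \<otimes> d)), True)]"
    proof (rule rel)
      show "(comm_word (\<beta>, b) (\<gamma>, d), [((\<beta> + \<gamma>, [N \<beta> \<gamma>] \<cdot> (b \<otimes> d)), True)]) \<in> ?R"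
        unfolding steinberg_rels_def using b s by blast
    qed (use b s in \<open>auto simp: comm_word_def steinberg_gens_def\<close>)
    then show "com (X \<beta> b) (X \<gamma> d) = X (\<beta> + \<gamma>) ([N \<beta> \<gamma>] \<cdot> (b \<otimes> d))" using Y_com[OF b] by (simp add: X_def)
  next
    fix \<beta> \<gamma> b d assume b: "\<beta> \<in> \<Phi>" "\<gamma> \<in> \<Phi>" "b \<in> carrier B" "d \<in> carrier B" and c: "c \<beta> \<gamma> \<ge> 0"
    have "\<beta> + \<gamma> \<notin> \<Phi>" using sum_root b c by auto
    moreover have "\<beta> + \<gamma> \<noteq> 0"
      using c c_opposite_iff[OF b(1,2)] by (auto simp: eq_neg_iff_add_eq_0 add.commute)
    ultimately have "Y (comm_word (\<beta>, b) (\<gamma>, d)) = Y []"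
      using b by (intro rel com_words) (auto simp: steinberg_rels_def)
    then show "cm (X \<beta> b) (X \<gamma> d)" using Y_com[OF b] Y_Nil by (simp add: com_eq_0_iff)
  qed
  have val: "E.val u = Y u" if "u \<in> words ?S" for u
    using that
  proof (induction u rule: E.val.induct)
    case (2 \<beta> b s w)
    then have b: "\<beta> \<in> \<Phi>" "b \<in> carrier B" "w \<in> words ?S" by (auto simp: steinberg_gens_def)
    have "Y (((\<beta>, b), s) # w) = Y [((\<beta>, b), s)] + Y w" using Y_append[OF gen[OF b(1,2)] b(3), of s] by simp
    moreover have "Y [((\<beta>, b), True)] = X \<beta> b" by (simp add: X_def)
    ultimately show ?case using 2(1)[OF b(3)] Y_False[OF b(1,2)] by (cases s) simp_all
  qed (simp add: Y_Nil)
  have cw': "map_word cst w \<in> words ?S" using word_eq_in_words[OF cw] by blast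
  have "E.val (map_word cst w) = 0" using val[OF cw'] Y_eq[OF cw] Y_Nil by simp
  then have "E.val w = 0" by (rule E.val_eq_0[OF w A])
  then show ?thesis using val[OF w] w by (intro Y_zero) auto
qed

end


section \<open>Polynomials over a localisation\<close>

context UP_cring
begin

text \<open>Polynomials are represented by their coefficient functions, so coefficients can be taken
  by application and equality is equality of functions.\<close>

lemma coeff_app: "p \<in> carrier P \<Longrightarrow> coeff P p n = p n"
  by (simp add: P_def UP_def)

lemma carrier_iff: "p \<in> carrier P \<longleftrightarrow> (\<forall>n. p n \<in> carrier R) \<and> (\<exists>k. \<forall>n>k. p n = \<zero>)"
  by (auto simp: P_def UP_def up_def bound_def)

lemma app_closed [simp]: "p \<in> carrier P \<Longrightarrow> p n \<in> carrier R"
  using carrier_iff by blast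

lemma app_add [simp]: "p \<in> carrier P \<Longrightarrow> q \<in> carrier P \<Longrightarrow> (p \<oplus>\<^bsub>P\<^esub> q) n = p n \<oplus> q n"
  using coeff_add[of p q n] by (simp add: coeff_app)

lemma app_mult: "p \<in> carrier P \<Longrightarrow> q \<in> carrier P \<Longrightarrow>
    (p \<otimes>\<^bsub>P\<^esub> q) n = (\<Oplus>i\<in>{..n}. p i \<otimes> q (n - i))"
  using coeff_mult[of p q n] by (simp add: coeff_app)

lemma app_mult_0 [simp]: "p \<in> carrier P \<Longrightarrow> q \<in> carrier P \<Longrightarrow> (p \<otimes>\<^bsub>P\<^esub> q) 0 = p 0 \<otimes> q 0"
  by (simp add: app_mult)

lemma app_zero [simp]: "\<zero>\<^bsub>P\<^esub> n = \<zero>"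
  by (rule HOL.trans[OF coeff_app[OF UP_zero_closed, symmetric] coeff_zero])

lemma app_one [simp]: "\<one>\<^bsub>P\<^esub> n = (if n = 0 then \<one> else \<zero>)"
  by (rule HOL.trans[OF coeff_app[OF UP_one_closed, symmetric] coeff_one])

lemma app_monom [simp]: "a \<in> carrier R \<Longrightarrow> monom P a m n = (if m = n then a else \<zero>)"
  using coeff_monom[of a m n] by (simp add: coeff_app)

lemma app_minus [simp]: "p \<in> carrier P \<Longrightarrow> (\<ominus>\<^bsub>P\<^esub> p) n = \<ominus> p n"
  using coeff_a_inv[of p n] by (simp add: coeff_app)

lemma app_const_mult [simp]: "a \<in> carrier R \<Longrightarrow> p \<in> carrier P \<Longrightarrow> (monom P a 0 \<otimes>\<^bsub>P\<^esub> p) n = a \<otimes> p n"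
  using coeff_smult[of a p n] by (simp add: coeff_app monom_mult_is_smult)

lemma app_eqI: "p \<in> carrier P \<Longrightarrow> q \<in> carrier P \<Longrightarrow> (\<And>n. p n = q n) \<Longrightarrow> p = q"
  by blast

end

lemma up_map_app: "p \<in> carrier (UP R) \<Longrightarrow> up_map R f p n = f (p n)"
  by (simp add: up_map_def UP_def)

section \<open>Localisation at a multiplicative set and the excision ring\<close>

locale localised_ring = P?: cring P for P :: "('a, 'm) ring_scheme" (structure) +
  fixes S :: "'a set"
  assumes S_sub: "S \<subseteq> carrier P" and S_one: "\<one> \<in> S" and S_mult: "\<And>s t. s \<in> S \<Longrightarrow> t \<in> S \<Longrightarrow> s \<otimes> t \<in> S"
begin

abbreviation L where "L \<equiv> loc_ring P S"

definition lam :: "'a \<Rightarrow> ('a \<times> 'a) set" where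
  "lam a = loc_frac P S a \<one>"

lemma S_carrier [simp]: "s \<in> S \<Longrightarrow> s \<in> carrier P"
  using S_sub by blast

lemma cring_P: "cring P" ..

lemma cring_L: "cring L"
  by (rule cring_loc_ring[OF cring_P S_sub S_one S_mult])

lemma lam_hom: "lam \<in> ring_hom P L"
  unfolding lam_def[abs_def] by (rule loc_frac_ring_hom[OF cring_P S_sub S_one S_mult])

end

sublocale localised_ring \<subseteq> lam: ring_hom_cring P "loc_ring P S" lam
  using cring_P cring_L lam_hom by (rule ring_hom_cringI)

sublocale localised_ring \<subseteq> UPP: UP_cring P "UP P"
  by unfold_locales simp

sublocale localised_ring \<subseteq> UPL: UP_cring "loc_ring P S" "UP (loc_ring P S)"
  by unfold_locales simp

context localised_ring
begin

lemma frac_mult: "\<lbrakk>a \<in> carrier P; b \<in> carrier P; s \<in> S; t \<in> S\<rbrakk> \<Longrightarrow>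
    loc_frac P S a s \<otimes>\<^bsub>L\<^esub> loc_frac P S b t = loc_frac P S (a \<otimes> b) (s \<otimes> t)"
  by (rule loc_frac_mult[OF cring_P S_sub S_one]) (auto intro: S_mult)

lemma frac_eq_iff: "\<lbrakk>a \<in> carrier P; b \<in> carrier P; s \<in> S; t \<in> S\<rbrakk> \<Longrightarrow>
    loc_frac P S a s = loc_frac P S b t \<longleftrightarrow> (\<exists>u\<in>S. u \<otimes> (t \<otimes> a) = u \<otimes> (s \<otimes> b))"
  by (rule loc_frac_eq_iff[OF cring_P S_sub S_one]) (auto intro: S_mult)

lemma frac_eqI: "\<lbrakk>a \<in> carrier P; b \<in> carrier P; s \<in> S; t \<in> S; t \<otimes> a = s \<otimes> b\<rbrakk> \<Longrightarrow>
    loc_frac P S a s = loc_frac P S b t"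
  using S_one by (subst frac_eq_iff) auto

lemma frac_one: "\<one>\<^bsub>L\<^esub> = loc_frac P S \<one> \<one>"
  by (simp add: loc_ring_def)

lemma frac_closed: "\<lbrakk>a \<in> carrier P; s \<in> S\<rbrakk> \<Longrightarrow> loc_frac P S a s \<in> carrier L"
  by (rule loc_frac_in_carrier[OF cring_P S_sub S_one]) (auto intro: S_mult)

lemma frac_cases:
  assumes "x \<in> carrier L"
  obtains a s where "a \<in> carrier P" "s \<in> S" "x = loc_frac P S a s"
  using assms by (auto simp: loc_ring_def loc_frac_def elim: quotientE)

lemma lam_eq_iff: "a \<in> carrier P \<Longrightarrow> b \<in> carrier P \<Longrightarrow> lam a = lam b \<longleftrightarrow> (\<exists>u\<in>S. u \<otimes> a = u \<otimes> b)"
  unfolding lam_def using frac_eq_iff[of a b \<one> \<one>] S_one by simp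

lemma L_cases:
  assumes "x \<in> carrier L"
  obtains a s where "a \<in> carrier P" "s \<in> S" "lam s \<otimes>\<^bsub>L\<^esub> x = lam a"
proof -
  obtain a s where a: "a \<in> carrier P" "s \<in> S" "x = loc_frac P S a s"
    using assms by (rule frac_cases)
  have "lam s \<otimes>\<^bsub>L\<^esub> x = loc_frac P S (s \<otimes> a) (\<one> \<otimes> s)"
    unfolding a(3) lam_def using a S_one by (simp add: frac_mult)
  also have "\<dots> = lam a"
    unfolding lam_def using a S_one S_mult by (intro frac_eqI) auto
  finally show thesis using that a by blast
qed

lemma lam_inverse:
  assumes "s \<in> S"
  obtains t where "t \<in> carrier L" "t \<otimes>\<^bsub>L\<^esub> lam s = \<one>\<^bsub>L\<^esub>"
proof
  have "loc_frac P S \<one> s \<otimes>\<^bsub>L\<^esub> lam s = loc_frac P S (\<one> \<otimes> s) (s \<otimes> \<one>)"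
    unfolding lam_def using assms S_one by (simp add: frac_mult)
  also have "\<dots> = \<one>\<^bsub>L\<^esub>"
    unfolding frac_one using assms S_one by (intro frac_eqI) auto
  finally show "loc_frac P S \<one> s \<otimes>\<^bsub>L\<^esub> lam s = \<one>\<^bsub>L\<^esub>" .
  show "loc_frac P S \<one> s \<in> carrier L" using assms by (intro frac_closed) auto
qed

text \<open>The guards make the folded function left-commutative on the whole type, as folding over
  a multiset demands. Members outside \<open>S\<close> are skipped, so the value always lies in
  \<open>S\<close>.\<close>

definition evP :: "'a multiset \<Rightarrow> 'a" where
  "evP \<mu> = fold_mset (\<lambda>s a. if s \<in> S \<and> a \<in> carrier P then s \<otimes> a else a) \<one> \<mu>"

lemma evP_simps: "evP {#} = \<one>" "evP (add_mset s \<mu>) = (if s \<in> S \<and> evP \<mu> \<in> carrier P then s \<otimes> evP \<mu> else evP \<mu>)"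
proof -
  interpret comp_fun_commute "\<lambda>s a. if s \<in> S \<and> a \<in> carrier P then s \<otimes> a else a"
    by unfold_locales (auto simp: fun_eq_iff m_lcomm)
  show "evP {#} = \<one>" "evP (add_mset s \<mu>) = (if s \<in> S \<and> evP \<mu> \<in> carrier P then s \<otimes> evP \<mu> else evP \<mu>)"
    by (simp_all add: evP_def)
qed

lemma evP_S: "evP \<mu> \<in> S"
  by (induction \<mu>) (auto simp: evP_simps S_one S_mult)

lemma evP_closed [simp]: "evP \<mu> \<in> carrier P"
  using evP_S S_sub by blast

lemma evP_add: "evP (\<mu> + \<nu>) = evP \<mu> \<otimes> evP \<nu>"
  by (induction \<mu>) (auto simp: evP_simps m_assoc)

lemma evP_single: "s \<in> S \<Longrightarrow> evP {#s#} = s"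
  by (simp add: evP_simps)

text \<open>The ring of all pairs of an element of \<open>P\<close> and a polynomial over the localisation whose
  constant coefficient is the image of that element; it is the union of the rings of polynomials
  over \<open>P\<close> in \<open>X / s\<close>.\<close>

definition B :: "('a \<times> (nat \<Rightarrow> ('a \<times> 'a) set)) ring" where
  "B = \<lparr>carrier = {(r, p). r \<in> carrier P \<and> p \<in> carrier (UP L) \<and> p 0 = lam r},
     monoid.mult = (\<lambda>(r, p) (s, q). (r \<otimes> s, p \<otimes>\<^bsub>UP L\<^esub> q)), one = (\<one>, \<one>\<^bsub>UP L\<^esub>),
     zero = (\<zero>, \<zero>\<^bsub>UP L\<^esub>), add = (\<lambda>(r, p) (s, q). (r \<oplus> s, p \<oplus>\<^bsub>UP L\<^esub> q))\<rparr>"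

lemma B_simps [simp]:
  "(r, p) \<in> carrier B \<longleftrightarrow> r \<in> carrier P \<and> p \<in> carrier (UP L) \<and> p 0 = lam r"
  "(r, p) \<otimes>\<^bsub>B\<^esub> (s, q) = (r \<otimes> s, p \<otimes>\<^bsub>UP L\<^esub> q)"
  "(r, p) \<oplus>\<^bsub>B\<^esub> (s, q) = (r \<oplus> s, p \<oplus>\<^bsub>UP L\<^esub> q)"
  "\<one>\<^bsub>B\<^esub> = (\<one>, \<one>\<^bsub>UP L\<^esub>)" "\<zero>\<^bsub>B\<^esub> = (\<zero>, \<zero>\<^bsub>UP L\<^esub>)"
  by (simp_all add: B_def)

lemma B_cases:
  assumes "b \<in> carrier B"
  obtains r p where "b = (r, p)" "r \<in> carrier P" "p \<in> carrier (UP L)" "p 0 = lam r"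
  using assms by (cases b) auto

lemma cring_B: "cring B"
proof (intro cringI abelian_groupI comm_monoidI)
  fix x assume "x \<in> carrier B"
  then obtain r p where x: "x = (r, p)" "r \<in> carrier P" "p \<in> carrier (UP L)" "p 0 = lam r" by (rule B_cases)
  then show "\<exists>y\<in>carrier B. y \<oplus>\<^bsub>B\<^esub> x = \<zero>\<^bsub>B\<^esub>"
    by (intro bexI[of _ "(\<ominus> r, \<ominus>\<^bsub>UP L\<^esub> p)"]) (auto simp: l_neg UPL.P.l_neg)
qed (auto elim!: B_cases intro: m_assoc m_comm a_assoc a_comm l_distr
      UPL.P.m_assoc UPL.P.m_comm UPL.P.a_assoc UPL.P.a_comm UPL.P.l_distr)

sublocale B: cring B
  by (rule cring_B)

lemma B_minus: "(r, p) \<in> carrier B \<Longrightarrow> \<ominus>\<^bsub>B\<^esub> (r, p) = (\<ominus> r, \<ominus>\<^bsub>UP L\<^esub> p)"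
  by (rule B.minus_equality) (auto simp: l_neg UPL.P.l_neg)

lemma snd_hom: "snd \<in> ring_hom B (UP L)"
  by (rule ring_hom_memI) (auto elim!: B_cases)

definition const :: "'a \<Rightarrow> 'a \<times> (nat \<Rightarrow> ('a \<times> 'a) set)" where
  "const r = (r, monom (UP L) (lam r) 0)"

lemma const_hom: "const \<in> ring_hom P B"
  by (rule ring_hom_memI) (simp_all add: const_def UPL.monom_mult[of _ _ 0 0, simplified] del: UPL.monom_mult)

text \<open>This is \<open>X L[X]\<close>, the kernel of the projection from \<open>B\<close> to
  \<open>P\<close>. With constant coefficient zero, its elements can be divided by elements of
  \<open>S\<close> without leaving \<open>B\<close>.\<close>

definition I :: "('a \<times> (nat \<Rightarrow> ('a \<times> 'a) set)) set" where
  "I = {(\<zero>, p) | p. p \<in> carrier (UP L) \<and> p 0 = \<zero>\<^bsub>L\<^esub>}"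

lemma ideal_I: "ideal I B"
proof (rule idealI[OF B.ring_axioms])
  show "subgroup I (add_monoid B)"
  proof (rule subgroup.intro)
    show "x \<otimes>\<^bsub>add_monoid B\<^esub> y \<in> I" if "x \<in> I" "y \<in> I" for x y
      using that by (auto simp: I_def)
    show "inv\<^bsub>add_monoid B\<^esub> x \<in> I" if "x \<in> I" for x
    proof -
      obtain p where p: "x = (\<zero>, p)" "p \<in> carrier (UP L)" "p 0 = \<zero>\<^bsub>L\<^esub>" using \<open>x \<in> I\<close> by (auto simp: I_def)
      then have "\<ominus>\<^bsub>B\<^esub> x = (\<zero>, \<ominus>\<^bsub>UP L\<^esub> p)" by (simp add: B_minus)
      then have "\<ominus>\<^bsub>B\<^esub> x \<in> I" using p by (simp add: I_def)
      then show ?thesis by (simp add: a_inv_def)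
    qed
  qed (auto simp: I_def)
qed (auto simp: I_def elim!: B_cases)

lemma subring_C: "subring (const ` carrier P) B"
proof -
  interpret const: ring_hom_ring P B const by (rule ring_hom_ringI2[OF ring_axioms B.ring_axioms const_hom])
  show ?thesis by (rule const.img_is_subring[OF carrier_is_subring])
qed

definition ev :: "'a multiset \<Rightarrow> 'a \<times> (nat \<Rightarrow> ('a \<times> 'a) set)" where
  "ev \<mu> = const (evP \<mu>)"

lemma ring_hom_cring_snd: "ring_hom_cring B (UP L) snd"
  by (rule ring_hom_cringI[OF cring_B UPL.P.is_cring snd_hom])

end

text \<open>A polynomial over the localisation is its constant coefficient, which is a fraction,
  plus an element of \<open>X L[X]\<close>, on which \<open>S\<close> already acts bijectively. Only
  the constant coefficients separate \<open>B\<close> from \<open>UP L\<close>.\<close>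

lemma (in localised_ring) steinberg_excision_B:
  fixes \<Phi> :: "'v::euclidean_space set"
  assumes "signed_root_system \<Phi> N c"
  shows "steinberg_excision \<Phi> N c B ev (UP L) snd I (const ` carrier P) (\<lambda>b. const (fst b))"
proof -
  interpret signed_root_system \<Phi> N c by (rule assms)
  interpret const: ring_hom_cring P B const by (rule ring_hom_cringI[OF cring_P cring_B const_hom])
  interpret h: ring_hom_cring B "UP L" snd by (rule ring_hom_cring_snd)
  interpret I: ideal I B by (rule ideal_I)
  interpret C: subring "const ` carrier P" B by (rule subring_C)
  have lamS: "lam (evP \<mu>) \<in> carrier L" for \<mu> by simp
  show ?thesis
  proof
    show "ev \<nu> \<in> carrier B" for \<nu> by (simp add: ev_def)
    show "ev 0 = \<one>\<^bsub>B\<^esub>" by (simp add: ev_def evP_simps)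
    show "ev (\<nu> + \<mu>) = ev \<nu> \<otimes>\<^bsub>B\<^esub> ev \<mu>" for \<nu> \<mu> by (simp add: ev_def evP_add)
    show "ev \<nu> \<in> const ` carrier P" for \<nu> by (simp add: ev_def)
    show "const (fst b) \<in> const ` carrier P" if "b \<in> carrier B" for b using that by (auto elim: B_cases)
    show "b \<ominus>\<^bsub>B\<^esub> const (fst b) \<in> I" if "b \<in> carrier B" for b
      using that by (auto elim!: B_cases simp: B.minus_eq const_def B_minus I_def r_neg lam.S.r_neg)
  next
    fix p assume p: "p \<in> carrier (UP L)"
    obtain a s where a: "a \<in> carrier P" "s \<in> S" "lam s \<otimes>\<^bsub>L\<^esub> p 0 = lam a"
      using L_cases[of "p 0"] p by auto
    \<comment> \<open>Removing the constant coefficient leaves an element of \<open>I\<close>,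
      whatever the denominators of the other coefficients. The single denominator \<open>s\<close>
      is the one of the constant coefficient.\<close>
    let ?i = "(\<zero>, p \<ominus>\<^bsub>UP L\<^esub> monom (UP L) (p 0) 0)"
    have i: "?i \<in> I" using p by (auto simp: I_def UPL.P.minus_eq lam.S.r_neg)
    have "monom (UP L) (lam s) 0 \<otimes>\<^bsub>UP L\<^esub> p
        = monom (UP L) (lam a) 0 \<oplus>\<^bsub>UP L\<^esub> monom (UP L) (lam s) 0 \<otimes>\<^bsub>UP L\<^esub> snd ?i"
      using p a by (intro UPL.app_eqI ext) (auto simp: UPL.P.minus_eq lam.S.r_distr lam.S.r_minus lam.S.r_neg)
    then show "\<exists>r\<in>const ` carrier P. \<exists>k. \<exists>i\<in>I. snd (ev k) \<otimes>\<^bsub>UP L\<^esub> p = snd (r \<oplus>\<^bsub>B\<^esub> ev k \<otimes>\<^bsub>B\<^esub> i)"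
      using a i by (intro bexI[of _ "const a"] exI[of _ "{#s#}"] bexI[of _ ?i])
        (auto simp: ev_def evP_single const_def)
  next
    fix r i assume r: "r \<in> const ` carrier P" and i: "i \<in> I" and z: "snd (r \<oplus>\<^bsub>B\<^esub> i) = \<zero>\<^bsub>UP L\<^esub>"
    obtain a where a: "r = const a" "a \<in> carrier P" using r by blast
    obtain p where p: "i = (\<zero>, p)" "p \<in> carrier (UP L)" "p 0 = \<zero>\<^bsub>L\<^esub>" using i by (auto simp: I_def)
    have *: "(monom (UP L) (lam a) 0 \<oplus>\<^bsub>UP L\<^esub> p) n = \<zero>\<^bsub>L\<^esub>" for n
      using z unfolding a(1) p(1) by (simp add: const_def)
    have la: "lam a = \<zero>\<^bsub>L\<^esub>" using *[of 0] a p by simp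
    have "p n = \<zero>\<^bsub>L\<^esub>" for n using *[of n] a p la by (cases "n = 0") auto
    then have pz: "p = \<zero>\<^bsub>UP L\<^esub>" using p by (intro UPL.app_eqI) auto
    have "lam a = lam \<zero>" using la by simp
    \<comment> \<open>\<open>lam\<close> may have a kernel: an element of \<open>P\<close> with
      image zero is only annihilated by some element of \<open>S\<close>, and this becomes the
      exponent in the claim.\<close>
    then obtain u where u: "u \<in> S" "u \<otimes> a = u \<otimes> \<zero>" using lam_eq_iff a by blast
    have "ev {#u#} \<otimes>\<^bsub>B\<^esub> r = const (u \<otimes> a)" using u(1) a(2) by (simp add: a(1) ev_def evP_single)
    also have "u \<otimes> a = \<zero>" using u by simp
    also have "const \<zero> = \<zero>\<^bsub>B\<^esub>" by (rule const.hom_zero)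
    finally have "\<exists>\<kappa>. ev \<kappa> \<otimes>\<^bsub>B\<^esub> r = \<zero>\<^bsub>B\<^esub>" by blast
    then show "i = \<zero>\<^bsub>B\<^esub> \<and> (\<exists>\<kappa>. ev \<kappa> \<otimes>\<^bsub>B\<^esub> r = \<zero>\<^bsub>B\<^esub>)" using p pz by auto
  next
    fix i \<nu> assume i: "i \<in> I"
    obtain p where p: "i = (\<zero>, p)" "p \<in> carrier (UP L)" "p 0 = \<zero>\<^bsub>L\<^esub>" using i by (auto simp: I_def)
    obtain t where t: "t \<in> carrier L" "t \<otimes>\<^bsub>L\<^esub> lam (evP \<nu>) = \<one>\<^bsub>L\<^esub>" using lam_inverse evP_S by blast
    have t': "lam (evP \<nu>) \<otimes>\<^bsub>L\<^esub> t = \<one>\<^bsub>L\<^esub>" using t lam.S.m_comm[of t "lam (evP \<nu>)"] by simp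
    let ?j = "(\<zero>, monom (UP L) t 0 \<otimes>\<^bsub>UP L\<^esub> p)"
    have "?j \<in> I" using p t by (auto simp: I_def)
    moreover have "monom (UP L) (lam (evP \<nu>)) 0 \<otimes>\<^bsub>UP L\<^esub> (monom (UP L) t 0 \<otimes>\<^bsub>UP L\<^esub> p) = p"
      using p t t' by (intro UPL.app_eqI) (auto simp: lam.S.m_assoc[symmetric])
    then have "ev \<nu> \<otimes>\<^bsub>B\<^esub> ?j = i" using p by (simp add: ev_def const_def)
    ultimately show "\<exists>j\<in>I. ev \<nu> \<otimes>\<^bsub>B\<^esub> j = i" by blast
    assume "ev \<nu> \<otimes>\<^bsub>B\<^esub> i = \<zero>\<^bsub>B\<^esub>"
    then have z: "monom (UP L) (lam (evP \<nu>)) 0 \<otimes>\<^bsub>UP L\<^esub> p = \<zero>\<^bsub>UP L\<^esub>" using p by (simp add: ev_def const_def)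
    have "p n = \<zero>\<^bsub>L\<^esub>" for n
    proof -
      have "p n = (t \<otimes>\<^bsub>L\<^esub> lam (evP \<nu>)) \<otimes>\<^bsub>L\<^esub> p n" unfolding t(2) using p by simp
      also have "\<dots> = t \<otimes>\<^bsub>L\<^esub> (lam (evP \<nu>) \<otimes>\<^bsub>L\<^esub> p n)" using t(1) p by (intro lam.S.m_assoc) auto
      also have "lam (evP \<nu>) \<otimes>\<^bsub>L\<^esub> p n = \<zero>\<^bsub>L\<^esub>" using fun_cong[OF z, of n] p by simp
      finally show ?thesis using t(1) by simp
    qed
    then have "p = \<zero>\<^bsub>UP L\<^esub>" using p by (intro UPL.app_eqI) auto
    then show "i = \<zero>\<^bsub>B\<^esub>" using p by simp
  qed
qed


section \<open>Dilation\<close>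

lemma word_eq_map:
  assumes "ring A" "ring B" "f \<in> ring_hom A B"
    and "(u, v) \<in> word_eq (steinberg_gens \<Phi> A) (steinberg_rels \<Phi> N A)"
  shows "(map_word f u, map_word f v) \<in> word_eq (steinberg_gens \<Phi> B) (steinberg_rels \<Phi> N B)"
proof -
  have w: "u \<in> words (steinberg_gens \<Phi> A)" "v \<in> words (steinberg_gens \<Phi> A)"
    using word_eq_in_words[OF assms(4)] by auto
  have e: "word_eq (steinberg_gens \<Phi> A) (steinberg_rels \<Phi> N A) `` {u} = word_eq (steinberg_gens \<Phi> A) (steinberg_rels \<Phi> N A) `` {v}"
    by (rule equiv_class_eq[OF equiv_word_eq assms(4)])
  have "word_eq (steinberg_gens \<Phi> B) (steinberg_rels \<Phi> N B) `` {map_word f u}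
      = word_eq (steinberg_gens \<Phi> B) (steinberg_rels \<Phi> N B) `` {map_word f v}"
    unfolding steinberg_map_class(2)[OF assms(1-3) w(1), symmetric] steinberg_map_class(2)[OF assms(1-3) w(2), symmetric] e ..
  then show ?thesis
    using word_class_eq_iff steinberg_map_class(1)[OF assms(1-3)] w by blast
qed

lemma map_word_map_word: "map_word f (map_word g w) = map_word (f \<circ> g) w"
  by (auto simp: map_word_def)

lemma map_word_cong:
  assumes "w \<in> words (steinberg_gens \<Phi> A)" "\<And>r. r \<in> carrier A \<Longrightarrow> f r = g r"
  shows "map_word f w = map_word g w"
  using assms by (auto simp: map_word_def words_def steinberg_gens_def in_lists_conv_set)

context UP_cring
begin

text \<open>The substitution of \<open>s X\<close> for \<open>X\<close>.\<close>

definition dil :: "'a \<Rightarrow> (nat \<Rightarrow> 'a) \<Rightarrow> nat \<Rightarrow> 'a" where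
  "dil s p = (\<lambda>n. s [^] n \<otimes> p n)"

lemma dil_closed [simp]: "s \<in> carrier R \<Longrightarrow> p \<in> carrier P \<Longrightarrow> dil s p \<in> carrier P"
proof -
  assume s: "s \<in> carrier R" and p: "p \<in> carrier P"
  obtain k where "\<And>n. n > k \<Longrightarrow> p n = \<zero>" using p unfolding carrier_iff by blast
  then show ?thesis unfolding carrier_iff using s p by (auto simp: dil_def intro!: exI[of _ k])
qed

lemma dil_app: "dil s p n = s [^] n \<otimes> p n"
  by (simp add: dil_def)

lemma dil_app_0 [simp]: "p \<in> carrier P \<Longrightarrow> dil s p 0 = p 0"
  by (simp add: dil_app)

lemma dil_hom:
  assumes s: "s \<in> carrier R"
  shows "dil s \<in> ring_hom P P"
proof (rule ring_hom_memI)
  fix p q assume pq: "p \<in> carrier P" "q \<in> carrier P"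
  show "dil s (p \<oplus>\<^bsub>P\<^esub> q) = dil s p \<oplus>\<^bsub>P\<^esub> dil s q"
    using pq s by (intro app_eqI) (auto simp: dil_app R.r_distr)
  show "dil s (p \<otimes>\<^bsub>P\<^esub> q) = dil s p \<otimes>\<^bsub>P\<^esub> dil s q"
  proof (rule app_eqI)
    fix n
    have "dil s (p \<otimes>\<^bsub>P\<^esub> q) n = (\<Oplus>i\<in>{..n}. s [^] n \<otimes> (p i \<otimes> q (n - i)))"
      using pq s by (simp add: dil_app app_mult R.finsum_rdistr)
    also have "\<dots> = (\<Oplus>i\<in>{..n}. (s [^] i \<otimes> p i) \<otimes> (s [^] (n - i) \<otimes> q (n - i)))"
    proof (rule R.finsum_cong')
      fix i assume "i \<in> {..n}"
      then have "s [^] n = s [^] i \<otimes> s [^] (n - i)" using s by (simp add: R.nat_pow_mult)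
      then show "s [^] n \<otimes> (p i \<otimes> q (n - i)) = (s [^] i \<otimes> p i) \<otimes> (s [^] (n - i) \<otimes> q (n - i))"
        using pq s by (simp add: R.m_ac)
    qed (use pq s in auto)
    also have "\<dots> = (dil s p \<otimes>\<^bsub>P\<^esub> dil s q) n"
      using pq s by (simp add: app_mult dil_app)
    finally show "dil s (p \<otimes>\<^bsub>P\<^esub> q) n = (dil s p \<otimes>\<^bsub>P\<^esub> dil s q) n" .
  qed (use pq s in auto)
next
  show "dil s \<one>\<^bsub>P\<^esub> = \<one>\<^bsub>P\<^esub>"
    using s by (intro app_eqI) (auto simp: dil_app)
qed (use s in auto)

lemma dil_dil: "\<lbrakk>s \<in> carrier R; t \<in> carrier R; p \<in> carrier P\<rbrakk> \<Longrightarrow> dil s (dil t p) = dil (s \<otimes> t) p"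
  by (intro app_eqI) (auto simp: dil_app R.nat_pow_distrib R.m_assoc)

lemma dil_one: "p \<in> carrier P \<Longrightarrow> dil \<one> p = p"
  by (intro app_eqI) (auto simp: dil_app)

end

section \<open>Lifting words over \<open>B\<close> to polynomials over \<open>P\<close> by
  dilation\<close>

context localised_ring
begin

abbreviation "lamX \<equiv> up_map P lam"

lemma lamX_hom: "lamX \<in> ring_hom (UP P) (UP L)"
  by (rule up_map_ring_hom[OF cring_P cring_L lam_hom])

lemma lamX_closed [simp]: "q \<in> carrier (UP P) \<Longrightarrow> lamX q \<in> carrier (UP L)"
  using ring_hom_closed[OF lamX_hom] .

lemma lamX_app [simp]: "q \<in> carrier (UP P) \<Longrightarrow> lamX q n = lam (q n)"
  by (rule up_map_app)

lemma lamX_dil: "t \<in> carrier P \<Longrightarrow> q \<in> carrier (UP P) \<Longrightarrow> lamX (UPP.dil t q) = UPL.dil (lam t) (lamX q)"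
  by (intro UPL.app_eqI) (auto simp: UPP.dil_app UPL.dil_app lam.hom_pow)

definition incl :: "(nat \<Rightarrow> 'a) \<Rightarrow> 'a \<times> (nat \<Rightarrow> ('a \<times> 'a) set)" where
  "incl q = (q 0, lamX q)"

lemma incl_hom: "incl \<in> ring_hom (UP P) B"
  using ring_hom_closed[OF lamX_hom] ring_hom_mult[OF lamX_hom] ring_hom_add[OF lamX_hom] ring_hom_one[OF lamX_hom]
  by (intro ring_hom_memI) (auto simp: incl_def)

text \<open>\<open>lifts s q b\<close> says that substituting \<open>X / s\<close> for \<open>X\<close> in the polynomial \<open>q\<close> over \<open>P\<close> yields \<open>b\<close>.\<close>

definition lifts :: "'a \<Rightarrow> (nat \<Rightarrow> 'a) \<Rightarrow> 'a \<times> (nat \<Rightarrow> ('a \<times> 'a) set) \<Rightarrow> bool" where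
  "lifts s q b \<longleftrightarrow> q \<in> carrier (UP P) \<and> b \<in> carrier B \<and> q 0 = fst b \<and> lamX q = UPL.dil (lam s) (snd b)"

lemma lifts_incl: "q \<in> carrier (UP P) \<Longrightarrow> lifts \<one> q (incl q)"
  using ring_hom_closed[OF incl_hom] by (simp add: lifts_def incl_def UPL.dil_one)

lemma lifts_dil:
  assumes "lifts s q b" "s \<in> S" "t \<in> S"
  shows "lifts (t \<otimes> s) (UPP.dil t q) b"
proof -
  obtain r p where b: "b = (r, p)" "p \<in> carrier (UP L)" using assms(1) by (auto simp: lifts_def elim: B_cases)
  then show ?thesis using assms by (auto simp: lifts_def lamX_dil UPL.dil_dil)
qed

lemma lifts_add:
  assumes "lifts s q b" "lifts s q' d" "s \<in> S"
  shows "lifts s (q \<oplus>\<^bsub>UP P\<^esub> q') (b \<oplus>\<^bsub>B\<^esub> d)"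
proof -
  obtain r p r' p' where b: "b = (r, p)" "p \<in> carrier (UP L)" "d = (r', p')" "p' \<in> carrier (UP L)"
    using assms(1,2) by (auto simp: lifts_def elim!: B_cases)
  then show ?thesis
    using assms ring_hom_add[OF lamX_hom, of q q'] ring_hom_add[OF UPL.dil_hom[of "lam s"], of p p']
      B.a_closed[of b d]
    by (auto simp: lifts_def simp del: B.a_closed)
qed

lemma lifts_mult:
  assumes "lifts s q b" "lifts s q' d" "s \<in> S"
  shows "lifts s (q \<otimes>\<^bsub>UP P\<^esub> q') (b \<otimes>\<^bsub>B\<^esub> d)"
proof -
  obtain r p r' p' where b: "b = (r, p)" "p \<in> carrier (UP L)" "d = (r', p')" "p' \<in> carrier (UP L)"
    using assms(1,2) by (auto simp: lifts_def elim!: B_cases)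
  then show ?thesis
    using assms ring_hom_mult[OF lamX_hom, of q q'] ring_hom_mult[OF UPL.dil_hom[of "lam s"], of p p']
      B.m_closed[of b d]
    by (auto simp: lifts_def simp del: B.m_closed)
qed

lemma lifts_minus:
  assumes "lifts s q b" "s \<in> S"
  shows "lifts s (\<ominus>\<^bsub>UP P\<^esub> q) (\<ominus>\<^bsub>B\<^esub> b)"
proof -
  obtain r p where b: "b = (r, p)" "p \<in> carrier (UP L)" using assms(1) by (auto simp: lifts_def elim: B_cases)
  interpret X: ring_hom_cring "UP P" "UP L" lamX
    by (rule ring_hom_cringI[OF UPP.P.is_cring UPL.P.is_cring lamX_hom])
  interpret D: ring_hom_cring "UP L" "UP L" "UPL.dil (lam s)"
    by (rule ring_hom_cringI[OF UPL.P.is_cring UPL.P.is_cring UPL.dil_hom]) (use assms in simp)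
  have "q \<in> carrier (UP P)" "b \<in> carrier B" using assms by (auto simp: lifts_def)
  then show ?thesis
    using assms b B.a_inv_closed[of b] by (auto simp: lifts_def B_minus simp del: B.a_inv_closed)
qed

lemma common_annihilator:
  assumes "\<And>n::nat. a n \<in> carrier P" "\<And>n. b n \<in> carrier P" "\<And>n. lam (a n) = lam (b n)"
  shows "\<exists>u\<in>S. \<forall>n\<le>m. u \<otimes> a n = u \<otimes> b n"
proof (induction m)
  case 0
  then show ?case using lam_eq_iff[of "a 0" "b 0"] assms by auto
next
  case (Suc m)
  then obtain u where u: "u \<in> S" "\<And>n. n \<le> m \<Longrightarrow> u \<otimes> a n = u \<otimes> b n" by blast
  obtain v where v: "v \<in> S" "v \<otimes> a (Suc m) = v \<otimes> b (Suc m)" using lam_eq_iff assms by meson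
  show ?case
  proof (intro bexI[of _ "u \<otimes> v"] allI impI)
    fix n assume "n \<le> Suc m"
    then consider "n \<le> m" | "n = Suc m" by linarith
    then show "(u \<otimes> v) \<otimes> a n = (u \<otimes> v) \<otimes> b n"
    proof cases
      case 1
      have "(u \<otimes> v) \<otimes> a n = v \<otimes> (u \<otimes> a n)" using u(1) v(1) assms(1) by (simp add: m_ac)
      also have "\<dots> = (u \<otimes> v) \<otimes> b n" unfolding u(2)[OF 1] using u(1) v(1) assms(2) by (simp add: m_ac)
      finally show ?thesis .
    next
      case 2
      have "(u \<otimes> v) \<otimes> a n = u \<otimes> (v \<otimes> a n)" using u(1) v(1) assms(1) by (simp add: m_ac)
      also have "\<dots> = (u \<otimes> v) \<otimes> b n" unfolding 2 v(2) using u(1) v(1) assms(2) by (simp add: m_ac)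
      finally show ?thesis .
    qed
  qed (use u v S_mult in auto)
qed

text \<open>The constant coefficients agree, and the other coefficients agree up to one common
  annihilator \<open>u\<close> of their finitely many differences. Dilation by \<open>u\<close>
  multiplies each of these by a positive power of \<open>u\<close>.\<close>

lemma lifts_unique:
  assumes "lifts s q b" "lifts s q' b" "s \<in> S"
  shows "\<exists>u\<in>S. UPP.dil u q = UPP.dil u q'"
proof -
  have q: "q \<in> carrier (UP P)" "q' \<in> carrier (UP P)" "q 0 = q' 0" "lamX q = lamX q'"
    using assms by (auto simp: lifts_def)
  have "lam (q n) = lam (q' n)" for n using fun_cong[OF q(4), of n] q(1,2) by simp
  moreover obtain m where m: "\<And>n. n > m \<Longrightarrow> q n = \<zero> \<and> q' n = \<zero>"
  proof -
    obtain m1 m2 where "\<And>n. n > m1 \<Longrightarrow> q n = \<zero>" "\<And>n. n > m2 \<Longrightarrow> q' n = \<zero>"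
      using q(1,2) unfolding UPP.carrier_iff by blast
    then show thesis using that[of "max m1 m2"] by simp
  qed
  ultimately obtain u where u: "u \<in> S" "\<And>n. n \<le> m \<Longrightarrow> u \<otimes> q n = u \<otimes> q' n"
    using common_annihilator[of q q' m] q by auto
  have "u [^] n \<otimes> q n = u [^] n \<otimes> q' n" for n :: nat
  proof (cases n)
    case 0
    then show ?thesis using q by simp
  next
    case (Suc k)
    have "u \<otimes> q n = u \<otimes> q' n" using u(2)[of n] m[of n] by (cases "n \<le> m") auto
    then show ?thesis using Suc u(1) q by (simp add: m_assoc)
  qed
  then have "UPP.dil u q = UPP.dil u q'" by (simp add: UPP.dil_def)
  then show ?thesis using u by blast
qed

lemma common_denominator:
  assumes "\<And>n::nat. x n \<in> carrier L"
  shows "\<exists>s\<in>S. \<forall>n\<le>m. \<exists>a\<in>carrier P. lam s \<otimes>\<^bsub>L\<^esub> x n = lam a"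
proof (induction m)
  case 0
  obtain a s where "a \<in> carrier P" "s \<in> S" "lam s \<otimes>\<^bsub>L\<^esub> x 0 = lam a" using assms by (rule L_cases)
  then show ?case by auto
next
  case (Suc m)
  then obtain s where s: "s \<in> S" "\<And>n. n \<le> m \<Longrightarrow> \<exists>a\<in>carrier P. lam s \<otimes>\<^bsub>L\<^esub> x n = lam a" by blast
  obtain a t where t: "a \<in> carrier P" "t \<in> S" "lam t \<otimes>\<^bsub>L\<^esub> x (Suc m) = lam a" using assms by (rule L_cases)
  show ?case
  proof (rule bexI[of _ "s \<otimes> t"], intro allI impI)
    fix n assume "n \<le> Suc m"
    then consider "n \<le> m" | "n = Suc m" by linarith
    then show "\<exists>a\<in>carrier P. lam (s \<otimes> t) \<otimes>\<^bsub>L\<^esub> x n = lam a"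
    proof cases
      case 1
      then obtain d where d: "d \<in> carrier P" "lam s \<otimes>\<^bsub>L\<^esub> x n = lam d" using s by blast
      have "lam (s \<otimes> t) \<otimes>\<^bsub>L\<^esub> x n = lam t \<otimes>\<^bsub>L\<^esub> (lam s \<otimes>\<^bsub>L\<^esub> x n)"
        using s(1) t assms[of n] by (simp add: lam.S.m_ac)
      also have "\<dots> = lam (t \<otimes> d)" unfolding d(2) using t d by simp
      finally show ?thesis by (rule bexI) (use t d in simp)
    next
      case 2
      have "lam (s \<otimes> t) \<otimes>\<^bsub>L\<^esub> x n = lam s \<otimes>\<^bsub>L\<^esub> (lam t \<otimes>\<^bsub>L\<^esub> x n)"
        using s(1) t assms[of n] by (simp add: lam.S.m_ac)
      also have "\<dots> = lam (s \<otimes> a)" unfolding 2 t(3) using s t by simp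
      finally show ?thesis by (rule bexI) (use s t in simp)
    qed
  qed (use s t S_mult in auto)
qed

lemma lifts_exists:
  assumes "b \<in> carrier B"
  obtains s q where "s \<in> S" "lifts s q b"
proof -
  obtain r p where b: "b = (r, p)" "r \<in> carrier P" "p \<in> carrier (UP L)" "p 0 = lam r"
    using assms by (rule B_cases)
  obtain m where m: "\<And>n. n > m \<Longrightarrow> p n = \<zero>\<^bsub>L\<^esub>" using b(3) unfolding UPL.carrier_iff by blast
  obtain s where s: "s \<in> S" "\<And>n. n \<le> m \<Longrightarrow> \<exists>a\<in>carrier P. lam s \<otimes>\<^bsub>L\<^esub> p n = lam a"
    using common_denominator[of p m] b by auto
  have "\<exists>a. a \<in> carrier P \<and> lam s \<otimes>\<^bsub>L\<^esub> p n = lam a \<and> (n > m \<longrightarrow> a = \<zero>)" for n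
    using s m[of n] by (cases "n \<le> m") force+
  then obtain a where a: "\<And>n. a n \<in> carrier P" "\<And>n. lam s \<otimes>\<^bsub>L\<^esub> p n = lam (a n)" "\<And>n. n > m \<Longrightarrow> a n = \<zero>"
    by metis
  \<comment> \<open>The coefficient of \<open>X\<close> to the \<open>n\<close> must lift
    \<open>s\<close> to the \<open>n\<close> times \<open>p n\<close>; one factor \<open>s\<close>
    is used up by the numerator \<open>a n\<close>, which explains \<open>n - 1\<close>. The
    constant coefficient gains no factor \<open>s\<close>, so it needs the given preimage
    \<open>r\<close>.\<close>
  define q where "q = (\<lambda>n. if n = 0 then r else s [^] (n - 1) \<otimes> a n)"
  have q: "q \<in> carrier (UP P)" unfolding UPP.carrier_iff
    using a b s by (auto simp: q_def intro!: exI[of _ m])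
  have "lamX q = UPL.dil (lam s) p"
  proof (rule UPL.app_eqI)
    fix n
    show "lamX q n = UPL.dil (lam s) p n"
    proof (cases n)
      case 0
      then show ?thesis using q b by (simp add: UPL.dil_app q_def)
    next
      case (Suc k)
      have "lamX q n = lam s [^]\<^bsub>L\<^esub> k \<otimes>\<^bsub>L\<^esub> (lam s \<otimes>\<^bsub>L\<^esub> p n)"
        using q Suc a s by (simp add: q_def lam.hom_pow)
      then show ?thesis using Suc s b by (simp add: UPL.dil_app lam.S.m_assoc)
    qed
  qed (use q b s in auto)
  then have "lifts s q b" using q b assms by (simp add: lifts_def q_def)
  then show thesis using that s by blast
qed

text \<open>\<open>lft \<mu> b\<close> is the element \<open>b\<close> after substituting \<open>evP \<mu> X\<close> for \<open>X\<close>, which is a polynomial over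
  \<open>P\<close> for large \<open>\<mu>\<close>.\<close>

definition lft :: "'a multiset \<Rightarrow> 'a \<times> (nat \<Rightarrow> ('a \<times> 'a) set) \<Rightarrow> nat \<Rightarrow> 'a" where
  "lft \<mu> b = (let (\<sigma>, q) = (SOME (\<sigma>, q). lifts (evP \<sigma>) q b) in
     if \<sigma> \<subseteq># \<mu> then UPP.dil (evP (\<mu> - \<sigma>)) q else \<zero>\<^bsub>UP P\<^esub>)"

text \<open>A filter on exponents. Closure under finite intersections is the reason why finitely
  many relations can be lifted by one dilation.\<close>

definition evt :: "('a multiset \<Rightarrow> bool) \<Rightarrow> bool" where
  "evt Q \<longleftrightarrow> (\<exists>\<mu>. \<forall>\<kappa>. Q (\<mu> + \<kappa>))"

lemma evt_conj: "evt Q \<Longrightarrow> evt Q' \<Longrightarrow> evt (\<lambda>\<mu>. Q \<mu> \<and> Q' \<mu>)"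
  unfolding evt_def by (metis union_assoc union_commute)

lemma evt_mono: "evt Q \<Longrightarrow> (\<And>\<mu>. Q \<mu> \<Longrightarrow> Q' \<mu>) \<Longrightarrow> evt Q'"
  unfolding evt_def by blast

lemma evt_True: "(\<And>\<mu>. Q \<mu>) \<Longrightarrow> evt Q"
  unfolding evt_def by blast

lemma lft_cases:
  assumes "b \<in> carrier B"
  obtains \<sigma> q where "lifts (evP \<sigma>) q b"
    "\<And>\<mu>. lft \<mu> b = (if \<sigma> \<subseteq># \<mu> then UPP.dil (evP (\<mu> - \<sigma>)) q else \<zero>\<^bsub>UP P\<^esub>)"
proof -
  obtain s q where "s \<in> S" "lifts s q b" using assms by (rule lifts_exists)
  then have "\<exists>z. case z of (\<sigma>, q) \<Rightarrow> lifts (evP \<sigma>) q b"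
    by (intro exI[of _ "({#s#}, q)"]) (simp add: evP_single)
  then have *: "case (SOME (\<sigma>, q). lifts (evP \<sigma>) q b) of (\<sigma>, q) \<Rightarrow> lifts (evP \<sigma>) q b" by (rule someI_ex)
  obtain \<sigma> q where z: "(SOME (\<sigma>, q). lifts (evP \<sigma>) q b) = (\<sigma>, q)" by (rule prod.exhaust)
  show thesis by (rule that[of \<sigma> q]) (use * z in \<open>simp_all add: lft_def\<close>)
qed

lemma lft_closed [simp]: "b \<in> carrier B \<Longrightarrow> lft \<mu> b \<in> carrier (UP P)"
  by (erule lft_cases) (auto simp: lifts_def)

text \<open>The lift picked by choice and the given one have a common dilation by
  \<open>lifts_unique\<close>. The exponents \<open>\<sigma>\<close> and \<open>\<sigma>'\<close> of
  both and the element \<open>u\<close> for this comparison make up the bound.\<close>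

lemma lft_eq:
  assumes l: "lifts (evP \<sigma>) q b"
  shows "evt (\<lambda>\<mu>. \<sigma> \<subseteq># \<mu> \<and> lft \<mu> b = UPP.dil (evP (\<mu> - \<sigma>)) q)"
proof -
  have b: "b \<in> carrier B" using l by (simp add: lifts_def)
  obtain \<sigma>' q' where l': "lifts (evP \<sigma>') q' b"
    "\<And>\<mu>. lft \<mu> b = (if \<sigma>' \<subseteq># \<mu> then UPP.dil (evP (\<mu> - \<sigma>')) q' else \<zero>\<^bsub>UP P\<^esub>)"
    using lft_cases[OF b] by blast
  have c: "q \<in> carrier (UP P)" "q' \<in> carrier (UP P)" using l l' by (auto simp: lifts_def)
  have 1: "lifts (evP \<sigma>' \<otimes> evP \<sigma>) (UPP.dil (evP \<sigma>') q) b" by (rule lifts_dil[OF l evP_S evP_S])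
  have 2: "lifts (evP \<sigma>' \<otimes> evP \<sigma>) (UPP.dil (evP \<sigma>) q') b"
    using lifts_dil[OF l'(1) evP_S evP_S, of \<sigma>] m_comm[OF evP_closed evP_closed, of \<sigma> \<sigma>'] by simp
  obtain u where u: "u \<in> S" "UPP.dil u (UPP.dil (evP \<sigma>') q) = UPP.dil u (UPP.dil (evP \<sigma>) q')"
    using lifts_unique[OF 1 2 S_mult[OF evP_S evP_S]] by blast
  have "\<sigma> \<subseteq># \<sigma> + \<sigma>' + {#u#} + \<kappa> \<and> lft (\<sigma> + \<sigma>' + {#u#} + \<kappa>) b = UPP.dil (evP (\<sigma> + \<sigma>' + {#u#} + \<kappa> - \<sigma>)) q" for \<kappa>
  proof -
    let ?\<mu> = "\<sigma> + \<sigma>' + {#u#} + \<kappa>"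
    have s: "\<sigma> \<subseteq># ?\<mu>" "\<sigma>' \<subseteq># ?\<mu>" by (simp_all add: subseteq_mset_def)
    have d: "?\<mu> - \<sigma> = \<kappa> + ({#u#} + \<sigma>')" "?\<mu> - \<sigma>' = \<kappa> + ({#u#} + \<sigma>)" by (simp_all add: multiset_eq_iff)
    have "UPP.dil (evP (?\<mu> - \<sigma>)) q = UPP.dil (evP \<kappa>) (UPP.dil u (UPP.dil (evP \<sigma>') q))"
      unfolding d evP_add evP_single[OF u(1)] using c u(1) by (simp add: UPP.dil_dil)
    also have "\<dots> = UPP.dil (evP (?\<mu> - \<sigma>')) q'"
      unfolding d evP_add evP_single[OF u(1)] u(2) using c u(1) by (simp add: UPP.dil_dil)
    finally show ?thesis using l'(2)[of ?\<mu>] s by simp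
  qed
  then show ?thesis unfolding evt_def by blast
qed

lemma lft_common:
  assumes "b \<in> carrier B" "d \<in> carrier B"
  obtains \<sigma> q q' where "lifts (evP \<sigma>) q b" "lifts (evP \<sigma>) q' d"
proof -
  obtain \<sigma>1 q1 where 1: "lifts (evP \<sigma>1) q1 b" using lft_cases[OF assms(1)] by blast
  obtain \<sigma>2 q2 where 2: "lifts (evP \<sigma>2) q2 d" using lft_cases[OF assms(2)] by blast
  show thesis
  proof (rule that)
    show "lifts (evP (\<sigma>2 + \<sigma>1)) (UPP.dil (evP \<sigma>2) q1) b"
      unfolding evP_add by (rule lifts_dil[OF 1 evP_S evP_S])
    show "lifts (evP (\<sigma>2 + \<sigma>1)) (UPP.dil (evP \<sigma>1) q2) d"
      using lifts_dil[OF 2 evP_S evP_S, of \<sigma>1] by (simp add: evP_add m_comm)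
  qed
qed

text \<open>\<open>lft \<mu>\<close> need not be a homomorphism for a fixed \<open>\<mu>\<close>:
  how large \<open>\<mu>\<close> has to be depends on the two elements. The same applies to products
  and negatives.\<close>

lemma lft_add:
  assumes "b \<in> carrier B" "d \<in> carrier B"
  shows "evt (\<lambda>\<mu>. lft \<mu> (b \<oplus>\<^bsub>B\<^esub> d) = lft \<mu> b \<oplus>\<^bsub>UP P\<^esub> lft \<mu> d)"
proof -
  obtain \<sigma> q q' where l: "lifts (evP \<sigma>) q b" "lifts (evP \<sigma>) q' d" using assms by (rule lft_common)
  then have c: "q \<in> carrier (UP P)" "q' \<in> carrier (UP P)" by (auto simp: lifts_def)
  show ?thesis
    by (rule evt_mono[OF evt_conj[OF evt_conj[OF lft_eq[OF l(1)] lft_eq[OF l(2)]] lft_eq[OF lifts_add[OF l evP_S]]]])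
      (use c in \<open>auto simp: ring_hom_add[OF UPP.dil_hom]\<close>)
qed

lemma lft_mult:
  assumes "b \<in> carrier B" "d \<in> carrier B"
  shows "evt (\<lambda>\<mu>. lft \<mu> (b \<otimes>\<^bsub>B\<^esub> d) = lft \<mu> b \<otimes>\<^bsub>UP P\<^esub> lft \<mu> d)"
proof -
  obtain \<sigma> q q' where l: "lifts (evP \<sigma>) q b" "lifts (evP \<sigma>) q' d" using assms by (rule lft_common)
  then have c: "q \<in> carrier (UP P)" "q' \<in> carrier (UP P)" by (auto simp: lifts_def)
  show ?thesis
    by (rule evt_mono[OF evt_conj[OF evt_conj[OF lft_eq[OF l(1)] lft_eq[OF l(2)]] lft_eq[OF lifts_mult[OF l evP_S]]]])
      (use c in \<open>auto simp: ring_hom_mult[OF UPP.dil_hom]\<close>)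
qed

lemma lft_minus:
  assumes "b \<in> carrier B"
  shows "evt (\<lambda>\<mu>. lft \<mu> (\<ominus>\<^bsub>B\<^esub> b) = \<ominus>\<^bsub>UP P\<^esub> lft \<mu> b)"
proof -
  obtain \<sigma> q where l: "lifts (evP \<sigma>) q b" using lft_cases[OF assms] by blast
  then have c: "q \<in> carrier (UP P)" by (auto simp: lifts_def)
  have h: "UPP.dil s (\<ominus>\<^bsub>UP P\<^esub> q) = \<ominus>\<^bsub>UP P\<^esub> UPP.dil s q" if "s \<in> carrier P" for s
  proof -
    interpret D: ring_hom_cring "UP P" "UP P" "UPP.dil s"
      by (rule ring_hom_cringI[OF UPP.P.is_cring UPP.P.is_cring UPP.dil_hom[OF that]])
    show ?thesis using c by (rule D.hom_a_inv)
  qed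
  show ?thesis
    by (rule evt_mono[OF evt_conj[OF lft_eq[OF l] lft_eq[OF lifts_minus[OF l evP_S]]]])
      (use c h in auto)
qed

lemma lft_incl:
  assumes "q \<in> carrier (UP P)"
  shows "evt (\<lambda>\<mu>. lft \<mu> (incl q) = UPP.dil (evP \<mu>) q)"
  using lft_eq[of "{#}" q "incl q"] lifts_incl[OF assms] by (auto simp: evP_simps elim: evt_mono)


lemma lft_sgn:
  assumes "b \<in> carrier B" "m = 1 \<or> m = (-1::int)"
  shows "evt (\<lambda>\<mu>. lft \<mu> ([m] \<cdot>\<^bsub>B\<^esub> b) = [m] \<cdot>\<^bsub>UP P\<^esub> lft \<mu> b)"
  using assms(2)
proof
  assume m: "m = 1"
  show ?thesis unfolding m
    using assms(1) by (intro evt_True) (simp add: add_pow_def int_pow_def2 del: B_simps)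
next
  assume m: "m = -1"
  have "[(-1::int)] \<cdot>\<^bsub>B\<^esub> b = \<ominus>\<^bsub>B\<^esub> b" using B.add.int_pow_neg[of b 1] assms(1)
    by (simp add: add_pow_def int_pow_def2 del: B_simps)
  moreover have "[(-1::int)] \<cdot>\<^bsub>UP P\<^esub> q = \<ominus>\<^bsub>UP P\<^esub> q" if "q \<in> carrier (UP P)" for q
    using UPP.P.add.int_pow_neg[of q 1] that by (simp add: add_pow_def int_pow_def2)
  ultimately show ?thesis unfolding m using lft_minus[OF assms(1)] assms(1) by simp
qed

lemma lft_words:
  "w \<in> words (steinberg_gens \<Phi> B) \<Longrightarrow> map_word (lft \<mu>) w \<in> words (steinberg_gens \<Phi> (UP P))"
proof (induction w)
  case (Cons a w)
  then show ?case by (cases a; cases "fst a") (auto simp: steinberg_gens_def)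
qed simp

lemma lft_rel:
  assumes \<Phi>: "signed_root_system \<Phi> N c" and lr: "(l, r) \<in> steinberg_rels \<Phi> N B"
  shows "evt (\<lambda>\<mu>. (map_word (lft \<mu>) l, map_word (lft \<mu>) r) \<in> steinberg_rels \<Phi> N (UP P))"
proof -
  interpret signed_root_system \<Phi> N c by (rule \<Phi>)
  show ?thesis using lr[unfolded steinberg_rels_def]
  proof (elim UnE)
    assume "(l, r) \<in> {([((\<alpha>, r), True), ((\<alpha>, s), True)], [((\<alpha>, r \<oplus>\<^bsub>B\<^esub> s), True)]) | \<alpha> r s.
        \<alpha> \<in> \<Phi> \<and> r \<in> carrier B \<and> s \<in> carrier B}"
    then obtain \<alpha> b d where lr: "l = [((\<alpha>, b), True), ((\<alpha>, d), True)]" "r = [((\<alpha>, b \<oplus>\<^bsub>B\<^esub> d), True)]"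
      and b: "\<alpha> \<in> \<Phi>" "b \<in> carrier B" "d \<in> carrier B" by blast
    show ?thesis
      by (rule evt_mono[OF lft_add[OF b(2,3)]]) (use b in \<open>auto simp: lr steinberg_rels_def\<close>)
  next
    assume "(l, r) \<in> {(comm_word (\<alpha>, r) (\<beta>, s), [((\<alpha> + \<beta>, [N \<alpha> \<beta>] \<cdot>\<^bsub>B\<^esub> (r \<otimes>\<^bsub>B\<^esub> s)), True)]) | \<alpha> \<beta> r s.
        \<alpha> \<in> \<Phi> \<and> \<beta> \<in> \<Phi> \<and> \<alpha> + \<beta> \<in> \<Phi> \<and> r \<in> carrier B \<and> s \<in> carrier B}"
    then obtain \<alpha> \<beta> b d where lr: "l = comm_word (\<alpha>, b) (\<beta>, d)" "r = [((\<alpha> + \<beta>, [N \<alpha> \<beta>] \<cdot>\<^bsub>B\<^esub> (b \<otimes>\<^bsub>B\<^esub> d)), True)]"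
      and b: "\<alpha> \<in> \<Phi>" "\<beta> \<in> \<Phi>" "\<alpha> + \<beta> \<in> \<Phi>" "b \<in> carrier B" "d \<in> carrier B" by blast
    have bd: "b \<otimes>\<^bsub>B\<^esub> d \<in> carrier B" using b by (intro B.m_closed)
    have "N \<alpha> \<beta> = 1 \<or> N \<alpha> \<beta> = -1" using N_unit[OF b(1,2)] sum_root[OF b(1,2)] b(3) by blast
    from evt_conj[OF lft_sgn[OF bd this] lft_mult[OF b(4,5)]]
    show ?thesis
    proof (rule evt_mono)
      fix \<mu>
      assume *: "lft \<mu> ([N \<alpha> \<beta>] \<cdot>\<^bsub>B\<^esub> (b \<otimes>\<^bsub>B\<^esub> d)) = [N \<alpha> \<beta>] \<cdot>\<^bsub>UP P\<^esub> lft \<mu> (b \<otimes>\<^bsub>B\<^esub> d) \<and>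
        lft \<mu> (b \<otimes>\<^bsub>B\<^esub> d) = lft \<mu> b \<otimes>\<^bsub>UP P\<^esub> lft \<mu> d"
      have "map_word (lft \<mu>) l = comm_word (\<alpha>, lft \<mu> b) (\<beta>, lft \<mu> d)"
        "map_word (lft \<mu>) r = [((\<alpha> + \<beta>, [N \<alpha> \<beta>] \<cdot>\<^bsub>UP P\<^esub> (lft \<mu> b \<otimes>\<^bsub>UP P\<^esub> lft \<mu> d)), True)]"
        using * by (simp_all add: lr comm_word_def)
      moreover have "lft \<mu> b \<in> carrier (UP P)" "lft \<mu> d \<in> carrier (UP P)" using b by simp_all
      ultimately show "(map_word (lft \<mu>) l, map_word (lft \<mu>) r) \<in> steinberg_rels \<Phi> N (UP P)"
        unfolding steinberg_rels_def using b by blast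
    qed
  next
    assume "(l, r) \<in> {(comm_word (\<alpha>, r) (\<beta>, s), []) | \<alpha> \<beta> r s.
        \<alpha> \<in> \<Phi> \<and> \<beta> \<in> \<Phi> \<and> \<alpha> + \<beta> \<notin> \<Phi> \<union> {0} \<and> r \<in> carrier B \<and> s \<in> carrier B}"
    then obtain \<alpha> \<beta> b d where lr: "l = comm_word (\<alpha>, b) (\<beta>, d)" "r = []"
      and b: "\<alpha> \<in> \<Phi>" "\<beta> \<in> \<Phi>" "\<alpha> + \<beta> \<notin> \<Phi> \<union> {0}" "b \<in> carrier B" "d \<in> carrier B" by blast
    have "map_word (lft \<mu>) l = comm_word (\<alpha>, lft \<mu> b) (\<beta>, lft \<mu> d)" "map_word (lft \<mu>) r = []"
      "lft \<mu> b \<in> carrier (UP P)" "lft \<mu> d \<in> carrier (UP P)" for \<mu>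
      using b by (simp_all add: lr comm_word_def)
    then show ?thesis unfolding steinberg_rels_def using b by (intro evt_True) blast
  qed
qed

text \<open>A derivation over \<open>B\<close> mentions finitely many elements and relations. The
  induction collects their bounds, whose sum is one exponent that works for the whole
  derivation.\<close>

lemma lft_word_eq:
  assumes \<Phi>: "signed_root_system \<Phi> N c" and uv: "(u, v) \<in> word_eq (steinberg_gens \<Phi> B) (steinberg_rels \<Phi> N B)"
  shows "evt (\<lambda>\<mu>. (map_word (lft \<mu>) u, map_word (lft \<mu>) v) \<in> word_eq (steinberg_gens \<Phi> (UP P)) (steinberg_rels \<Phi> N (UP P)))"
  using uv
proof (induction rule: word_eq.induct)
  case (refl w)
  then show ?case by (intro evt_True word_eq.refl lft_words)
next
  case (sym v w)
  show ?case by (rule evt_mono[OF sym.IH]) (rule word_eq.sym)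
next
  case (trans u v w)
  show ?case by (rule evt_mono[OF evt_conj[OF trans.IH]]) (blast intro: word_eq.trans)
next
  case (cancel u v a b)
  show ?case
  proof (rule evt_True)
    fix \<mu>
    have "(fst a, lft \<mu> (snd a)) \<in> steinberg_gens \<Phi> (UP P)"
      using cancel(3) by (auto simp: steinberg_gens_def)
    from word_eq.cancel[OF lft_words[OF cancel(1)] lft_words[OF cancel(2)] this, of \<mu> b]
    show "(map_word (lft \<mu>) (u @ [(a, b), (a, \<not> b)] @ v), map_word (lft \<mu>) (u @ v))
        \<in> word_eq (steinberg_gens \<Phi> (UP P)) (steinberg_rels \<Phi> N (UP P))"
      by (cases a) simp
  qed
next
  case (rel u v l r)
  show ?case
  proof (rule evt_mono[OF lft_rel[OF \<Phi> rel(3)]])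
    fix \<mu> assume "(map_word (lft \<mu>) l, map_word (lft \<mu>) r) \<in> steinberg_rels \<Phi> N (UP P)"
    from word_eq.rel[OF lft_words[OF rel(1)] lft_words[OF rel(2)] this lft_words[OF rel(4)] lft_words[OF rel(5)]]
    show "(map_word (lft \<mu>) (u @ l @ v), map_word (lft \<mu>) (u @ r @ v))
        \<in> word_eq (steinberg_gens \<Phi> (UP P)) (steinberg_rels \<Phi> N (UP P))" by simp
  qed
qed

lemma lft_incl_word:
  assumes "w \<in> words (steinberg_gens \<Phi> (UP P))"
  shows "evt (\<lambda>\<mu>. map_word (lft \<mu>) (map_word incl w) = map_word (UPP.dil (evP \<mu>)) w)"
  using assms
proof (induction w)
  case Nil
  show ?case by (rule evt_True) simp
next
  case (Cons a w)
  obtain \<alpha> q s where a: "a = ((\<alpha>, q), s)" by (metis surj_pair)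
  then have "q \<in> carrier (UP P)" "w \<in> words (steinberg_gens \<Phi> (UP P))" using Cons.prems by (auto simp: steinberg_gens_def)
  then show ?case
    by (intro evt_mono[OF evt_conj[OF lft_incl Cons.IH]]) (auto simp: a)
qed

text \<open>Excision makes the image of \<open>w\<close> over \<open>B\<close> trivial, since its
  constant part is the image of w(0). The derivation is then lifted; on words coming from
  \<open>UP P\<close> the lift is the dilation itself.\<close>

theorem dilation:
  fixes \<Phi> :: "'v::euclidean_space set"
  assumes \<Phi>: "signed_root_system \<Phi> N c"
    and w: "w \<in> words (steinberg_gens \<Phi> (UP P))"
    and w0: "(map_word (\<lambda>q. q 0) w, []) \<in> word_eq (steinberg_gens \<Phi> P) (steinberg_rels \<Phi> N P)"
    and wL: "(map_word lamX w, []) \<in> word_eq (steinberg_gens \<Phi> (UP L)) (steinberg_rels \<Phi> N (UP L))"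
  obtains s where "s \<in> S"
    "(map_word (UPP.dil s) w, []) \<in> word_eq (steinberg_gens \<Phi> (UP P)) (steinberg_rels \<Phi> N (UP P))"
proof -
  interpret E: steinberg_excision \<Phi> N c B ev "UP L" snd I "const ` carrier P" "\<lambda>b. const (fst b)"
    by (rule steinberg_excision_B[OF \<Phi>])
  have "(map_word incl w, []) \<in> word_eq (steinberg_gens \<Phi> B) (steinberg_rels \<Phi> N B)"
  proof (rule E.steinberg_excision)
    show "map_word incl w \<in> words (steinberg_gens \<Phi> B)"
      by (rule steinberg_map_class(1)[OF UPP.P.ring_axioms B.ring_axioms incl_hom w])
    have "snd \<circ> incl = lamX" by (auto simp: incl_def)
    then show "(map_word snd (map_word incl w), []) \<in> word_eq (steinberg_gens \<Phi> (UP L)) (steinberg_rels \<Phi> N (UP L))"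
      using wL by (simp add: map_word_map_word)
    have "(\<lambda>b. const (fst b)) \<circ> incl = const \<circ> (\<lambda>q. q 0)" by (auto simp: incl_def)
    then show "(map_word (\<lambda>b. const (fst b)) (map_word incl w), []) \<in> word_eq (steinberg_gens \<Phi> B) (steinberg_rels \<Phi> N B)"
      using word_eq_map[OF ring_axioms B.ring_axioms const_hom w0] by (simp add: map_word_map_word)
  qed
  from evt_conj[OF lft_word_eq[OF \<Phi> this] lft_incl_word[OF w]]
  obtain \<mu> where *: "\<And>\<kappa>. (map_word (lft (\<mu> + \<kappa>)) (map_word incl w), map_word (lft (\<mu> + \<kappa>)) []) \<in> word_eq (steinberg_gens \<Phi> (UP P)) (steinberg_rels \<Phi> N (UP P)) \<and>
      map_word (lft (\<mu> + \<kappa>)) (map_word incl w) = map_word (UPP.dil (evP (\<mu> + \<kappa>))) w"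
    unfolding evt_def by blast
  have "(map_word (UPP.dil (evP \<mu>)) w, []) \<in> word_eq (steinberg_gens \<Phi> (UP P)) (steinberg_rels \<Phi> N (UP P))"
    using conjunct1[OF *[of "{#}"]] unfolding conjunct2[OF *[of "{#}"]] by simp
  then show thesis using that evP_S by blast
qed

end


section \<open>Patching\<close>

lemma (in cring) maximalideal_exists:
  assumes J: "ideal J R" and one: "\<one> \<notin> J"
  obtains M where "maximalideal M R" "J \<subseteq> M"
proof -
  let ?A = "{I. ideal I R \<and> J \<subseteq> I \<and> \<one> \<notin> I}"
  have "\<exists>M\<in>?A. \<forall>X\<in>?A. M \<subseteq> X \<longrightarrow> X = M"
  proof (rule subset_Zorn_nonempty)
    show "?A \<noteq> {}" using J one by blast
    fix C assume C: "C \<noteq> {}" "subset.chain ?A C"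
    then have "subset.chain {I. ideal I R} C" by (auto simp: subset_chain_def)
    from chain_Union_is_ideal[OF this] C show "\<Union>C \<in> ?A"
      by (auto simp: subset_chain_def)
  qed
  then obtain M where M: "ideal M R" "J \<subseteq> M" "\<one> \<notin> M" and max: "\<And>X. X \<in> ?A \<Longrightarrow> M \<subseteq> X \<Longrightarrow> X = M"
    by auto
  have "maximalideal M R"
  proof (rule maximalidealI)
    show "ideal M R" "carrier R \<noteq> M" using M by auto
    fix I assume I: "ideal I R" "M \<subseteq> I" "I \<subseteq> carrier R"
    show "I = M \<or> I = carrier R"
    proof (cases "\<one> \<in> I")
      case True then show ?thesis using ideal.one_imp_carrier[OF I(1)] by simp
    next
      case False then show ?thesis using max[of I] I M by auto
    qed
  qed
  with M that show thesis by blast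
qed

section \<open>Homomorphisms out of polynomial rings and localisations\<close>

lemma UP_hom_eqI:
  assumes R: "cring R" and A: "cring A" and f: "f \<in> ring_hom (UP R) A" and g: "g \<in> ring_hom (UP R) A"
    and c: "\<And>r. r \<in> carrier R \<Longrightarrow> f (monom (UP R) r 0) = g (monom (UP R) r 0)"
    and x: "f (monom (UP R) \<one>\<^bsub>R\<^esub> 1) = g (monom (UP R) \<one>\<^bsub>R\<^esub> 1)"
    and p: "p \<in> carrier (UP R)"
  shows "f p = g p"
proof -
  interpret R: UP_cring R "UP R" using R by (rule UP_cring.intro)
  interpret A: cring A by (rule A)
  have const: "(\<lambda>r. monom (UP R) r 0) \<in> ring_hom R (UP R)"
    using R.const_ring_hom by simp
  have h: "(\<lambda>r. f (monom (UP R) r 0)) \<in> ring_hom R A"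
    using ring_hom_trans[OF const f] by (simp add: comp_def)
  interpret UP_pre_univ_prop R A "\<lambda>r. f (monom (UP R) r 0)" "UP R"
    using UP_pre_univ_propI[OF R A h] by simp
  show ?thesis
  proof (rule UP_hom_unique)
    show "ring_hom_cring (UP R) A f" "ring_hom_cring (UP R) A g"
      using R.UP_cring A f g by (blast intro: ring_hom_cringI)+
    show "f (monom (UP R) \<one>\<^bsub>R\<^esub> (Suc 0)) = f (monom (UP R) \<one>\<^bsub>R\<^esub> 1)"
      "g (monom (UP R) \<one>\<^bsub>R\<^esub> (Suc 0)) = f (monom (UP R) \<one>\<^bsub>R\<^esub> 1)"
      using x by simp_all
    show "f (monom (UP R) \<one>\<^bsub>R\<^esub> 1) \<in> carrier A"
      using ring_hom_closed[OF f] by simp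
  qed (use c p in \<open>simp_all only:\<close>)
qed

lemma
  assumes R: "cring R" and A: "cring A" and h: "h \<in> ring_hom R A" and x: "x \<in> carrier A"
  shows UP_eval_hom: "eval R A h x \<in> ring_hom (UP R) A"
    and UP_eval_const: "r \<in> carrier R \<Longrightarrow> eval R A h x (monom (UP R) r 0) = h r"
    and UP_eval_X: "eval R A h x (monom (UP R) \<one>\<^bsub>R\<^esub> 1) = x"
proof -
  interpret UP_pre_univ_prop R A h "UP R"
    using UP_pre_univ_propI[OF R A h] by simp
  show "eval R A h x \<in> ring_hom (UP R) A"
    "r \<in> carrier R \<Longrightarrow> eval R A h x (monom (UP R) r 0) = h r"
    "eval R A h x (monom (UP R) \<one>\<^bsub>R\<^esub> 1) = x"
    using eval_ring_hom[OF x] eval_const[OF x] eval_monom1[OF x] by simp_all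
qed

context UP_cring
begin

lemma const_hom: "(\<lambda>r. monom P r 0) \<in> ring_hom R P"
  using const_ring_hom by simp

lemma app_0_hom: "(\<lambda>q. q 0) \<in> ring_hom P R"
  by (rule ring_hom_memI) auto

lemma monom_one_one_closed [simp]: "monom P \<one> 1 \<in> carrier P"
  by simp

lemma dil_const: "s \<in> carrier R \<Longrightarrow> r \<in> carrier R \<Longrightarrow> dil s (monom P r 0) = monom P r 0"
  by (rule app_eqI) (auto simp: dil_app)

lemma dil_X: "s \<in> carrier R \<Longrightarrow> dil s (monom P \<one> 1) = monom P s 0 \<otimes>\<^bsub>P\<^esub> monom P \<one> 1"
  by (rule app_eqI) (auto simp: dil_app monom_mult[symmetric] simp del: monom_mult)

end

theorem (in localised_ring) localisation_universal:
  assumes A: "cring A" and h: "h \<in> ring_hom P A"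
    and inv: "\<And>s. s \<in> S \<Longrightarrow> \<exists>t\<in>carrier A. t \<otimes>\<^bsub>A\<^esub> h s = \<one>\<^bsub>A\<^esub>"
  obtains \<tau> where "\<tau> \<in> ring_hom L A" "\<And>r. r \<in> carrier P \<Longrightarrow> \<tau> (lam r) = h r"
proof -
  interpret A: cring A by (rule A)
  interpret h: ring_hom_cring P A h using cring_P A h by (rule ring_hom_cringI)
  have S [simp]: "s \<in> S \<Longrightarrow> s \<in> carrier P" for s by (rule S_carrier)
  have cancel: "y = z" if hyz: "s \<in> S" "y \<in> carrier A" "z \<in> carrier A" "h s \<otimes>\<^bsub>A\<^esub> y = h s \<otimes>\<^bsub>A\<^esub> z" for s y z
  proof -
    from inv[OF hyz(1)] obtain t where t: "t \<in> carrier A" "t \<otimes>\<^bsub>A\<^esub> h s = \<one>\<^bsub>A\<^esub>" by blast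
    have "y = (t \<otimes>\<^bsub>A\<^esub> h s) \<otimes>\<^bsub>A\<^esub> y" using t hyz by simp
    also have "\<dots> = t \<otimes>\<^bsub>A\<^esub> (h s \<otimes>\<^bsub>A\<^esub> y)" using t hyz by (intro A.m_assoc) auto
    also have "\<dots> = t \<otimes>\<^bsub>A\<^esub> (h s \<otimes>\<^bsub>A\<^esub> z)" using hyz by simp
    also have "\<dots> = (t \<otimes>\<^bsub>A\<^esub> h s) \<otimes>\<^bsub>A\<^esub> z" using t hyz by (intro A.m_assoc[symmetric]) auto
    also have "\<dots> = z" using t hyz by simp
    finally show ?thesis .
  qed
  \<comment> \<open>The value at a fraction is characterised by an equation with cleared
    denominators. It is unique because the elements \<open>h s\<close> can be cancelled, which also
    covers different representations of the same fraction.\<close>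
  define rep where "rep x y \<longleftrightarrow> (\<exists>a\<in>carrier P. \<exists>s\<in>S. y \<in> carrier A \<and> lam s \<otimes>\<^bsub>L\<^esub> x = lam a \<and> h s \<otimes>\<^bsub>A\<^esub> y = h a)" for x y
  define \<tau> where "\<tau> x = (THE y. rep x y)" for x
  have unique: "y = z" if x: "x \<in> carrier L" and yz: "rep x y" "rep x z" for x y z
  proof -
    from yz obtain a s b t where a: "a \<in> carrier P" "s \<in> S" "y \<in> carrier A" "lam s \<otimes>\<^bsub>L\<^esub> x = lam a" "h s \<otimes>\<^bsub>A\<^esub> y = h a"
      and b: "b \<in> carrier P" "t \<in> S" "z \<in> carrier A" "lam t \<otimes>\<^bsub>L\<^esub> x = lam b" "h t \<otimes>\<^bsub>A\<^esub> z = h b"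
      unfolding rep_def by blast
    have "lam (t \<otimes> a) = lam t \<otimes>\<^bsub>L\<^esub> (lam s \<otimes>\<^bsub>L\<^esub> x)" using a b by simp
    also have "\<dots> = lam s \<otimes>\<^bsub>L\<^esub> (lam t \<otimes>\<^bsub>L\<^esub> x)" using a(2) b(2) x by (intro lam.S.m_lcomm) auto
    also have "\<dots> = lam (s \<otimes> b)" using a b by simp
    finally obtain u where u: "u \<in> S" "u \<otimes> (t \<otimes> a) = u \<otimes> (s \<otimes> b)"
      using lam_eq_iff[of "t \<otimes> a" "s \<otimes> b"] a b by auto
    have "h u \<otimes>\<^bsub>A\<^esub> (h t \<otimes>\<^bsub>A\<^esub> (h s \<otimes>\<^bsub>A\<^esub> y)) = h (u \<otimes> (t \<otimes> a))" using a b u(1) by simp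
    also have "\<dots> = h u \<otimes>\<^bsub>A\<^esub> (h s \<otimes>\<^bsub>A\<^esub> (h t \<otimes>\<^bsub>A\<^esub> z))" unfolding u(2) using a b u(1) by simp
    also have "\<dots> = h u \<otimes>\<^bsub>A\<^esub> (h t \<otimes>\<^bsub>A\<^esub> (h s \<otimes>\<^bsub>A\<^esub> z))" using a b u(1) by (simp add: A.m_lcomm)
    finally have e: "h u \<otimes>\<^bsub>A\<^esub> (h t \<otimes>\<^bsub>A\<^esub> (h s \<otimes>\<^bsub>A\<^esub> y)) = h u \<otimes>\<^bsub>A\<^esub> (h t \<otimes>\<^bsub>A\<^esub> (h s \<otimes>\<^bsub>A\<^esub> z))" .
    have "h t \<otimes>\<^bsub>A\<^esub> (h s \<otimes>\<^bsub>A\<^esub> y) = h t \<otimes>\<^bsub>A\<^esub> (h s \<otimes>\<^bsub>A\<^esub> z)"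
      by (rule cancel[OF u(1) _ _ e]) (use a(2,3) b(2,3) in simp_all)
    then have "h s \<otimes>\<^bsub>A\<^esub> y = h s \<otimes>\<^bsub>A\<^esub> z"
      by (rule cancel[OF b(2), rotated 2]) (use a(2,3) b(3) in simp_all)
    then show ?thesis by (rule cancel[OF a(2,3) b(3)])
  qed
  have exists: "\<exists>y. rep x y" if x: "x \<in> carrier L" for x
  proof -
    from x obtain a s where a: "a \<in> carrier P" "s \<in> S" "lam s \<otimes>\<^bsub>L\<^esub> x = lam a" by (rule L_cases)
    from inv[OF a(2)] obtain t where t: "t \<in> carrier A" "t \<otimes>\<^bsub>A\<^esub> h s = \<one>\<^bsub>A\<^esub>" by blast
    have "h s \<otimes>\<^bsub>A\<^esub> (t \<otimes>\<^bsub>A\<^esub> h a) = (t \<otimes>\<^bsub>A\<^esub> h s) \<otimes>\<^bsub>A\<^esub> h a"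
      using a t(1) by (subst A.m_assoc[symmetric]) (auto simp: A.m_comm[of _ t])
    then show ?thesis using a t unfolding rep_def by (intro exI[of _ "t \<otimes>\<^bsub>A\<^esub> h a"]) auto
  qed
  have rep: "rep x (\<tau> x)" if x: "x \<in> carrier L" for x
  proof -
    obtain y where y: "rep x y" using exists[OF x] ..
    show ?thesis unfolding \<tau>_def by (rule theI[of "rep x", OF y]) (rule unique[OF x _ y])
  qed
  have eq: "\<tau> x = y" if "x \<in> carrier L" "rep x y" for x y
    using unique[OF that(1) rep[OF that(1)] that(2)] .
  have lam: "\<tau> (lam r) = h r" if "r \<in> carrier P" for r
  proof (rule eq)
    show "rep (lam r) (h r)"
      unfolding rep_def by (rule bexI[of _ r], rule bexI[of _ \<one>]) (use that S_one in auto)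
  qed (use that in simp)
  have "\<tau> \<in> ring_hom L A"
  proof (rule ring_hom_memI)
    show "\<tau> x \<in> carrier A" if "x \<in> carrier L" for x using rep[OF that] by (auto simp: rep_def)
    show "\<tau> \<one>\<^bsub>L\<^esub> = \<one>\<^bsub>A\<^esub>" using lam[of \<one>] by simp
  next
    fix x y assume xy: "x \<in> carrier L" "y \<in> carrier L"
    from rep[OF xy(1)] rep[OF xy(2)] obtain a s b t where
      a: "a \<in> carrier P" "s \<in> S" "\<tau> x \<in> carrier A" "lam s \<otimes>\<^bsub>L\<^esub> x = lam a" "h s \<otimes>\<^bsub>A\<^esub> \<tau> x = h a"
      and b: "b \<in> carrier P" "t \<in> S" "\<tau> y \<in> carrier A" "lam t \<otimes>\<^bsub>L\<^esub> y = lam b" "h t \<otimes>\<^bsub>A\<^esub> \<tau> y = h b"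
      unfolding rep_def by blast
    have c: "h s \<in> carrier A" "h t \<in> carrier A" "lam s \<in> carrier L" "lam t \<in> carrier L" using a b by auto
    show "\<tau> (x \<otimes>\<^bsub>L\<^esub> y) = \<tau> x \<otimes>\<^bsub>A\<^esub> \<tau> y"
    proof (intro eq)
      have 1: "lam (s \<otimes> t) \<otimes>\<^bsub>L\<^esub> (x \<otimes>\<^bsub>L\<^esub> y) = (lam s \<otimes>\<^bsub>L\<^esub> x) \<otimes>\<^bsub>L\<^esub> (lam t \<otimes>\<^bsub>L\<^esub> y)"
        using xy a(2) b(2) c by (simp add: lam.S.m_ac)
      have 2: "h (s \<otimes> t) \<otimes>\<^bsub>A\<^esub> (\<tau> x \<otimes>\<^bsub>A\<^esub> \<tau> y) = (h s \<otimes>\<^bsub>A\<^esub> \<tau> x) \<otimes>\<^bsub>A\<^esub> (h t \<otimes>\<^bsub>A\<^esub> \<tau> y)"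
        using a(2,3) b(2,3) c by (simp add: A.m_ac)
      show "rep (x \<otimes>\<^bsub>L\<^esub> y) (\<tau> x \<otimes>\<^bsub>A\<^esub> \<tau> y)"
        unfolding rep_def
        by (rule bexI[of _ "a \<otimes> b"], rule bexI[of _ "s \<otimes> t"]) (use a b S_mult 1 2 in auto)
    qed (use xy in auto)
    show "\<tau> (x \<oplus>\<^bsub>L\<^esub> y) = \<tau> x \<oplus>\<^bsub>A\<^esub> \<tau> y"
    proof (intro eq)
      have 1: "lam (s \<otimes> t) \<otimes>\<^bsub>L\<^esub> (x \<oplus>\<^bsub>L\<^esub> y) = lam t \<otimes>\<^bsub>L\<^esub> (lam s \<otimes>\<^bsub>L\<^esub> x) \<oplus>\<^bsub>L\<^esub> lam s \<otimes>\<^bsub>L\<^esub> (lam t \<otimes>\<^bsub>L\<^esub> y)"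
        using xy a(2) b(2) c by (simp add: lam.S.m_ac lam.S.r_distr)
      have 2: "h (s \<otimes> t) \<otimes>\<^bsub>A\<^esub> (\<tau> x \<oplus>\<^bsub>A\<^esub> \<tau> y) = h t \<otimes>\<^bsub>A\<^esub> (h s \<otimes>\<^bsub>A\<^esub> \<tau> x) \<oplus>\<^bsub>A\<^esub> h s \<otimes>\<^bsub>A\<^esub> (h t \<otimes>\<^bsub>A\<^esub> \<tau> y)"
        using a(2,3) b(2,3) c by (simp add: A.m_ac A.r_distr)
      show "rep (x \<oplus>\<^bsub>L\<^esub> y) (\<tau> x \<oplus>\<^bsub>A\<^esub> \<tau> y)"
        unfolding rep_def
        by (rule bexI[of _ "t \<otimes> a \<oplus> s \<otimes> b"], rule bexI[of _ "s \<otimes> t"]) (use a b S_mult 1 2 in auto)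
    qed (use xy in auto)
  qed
  with lam that show thesis by blast
qed

section \<open>Substitutions in polynomials in two variables\<close>

locale bivariate = R?: cring R for R :: "('a, 'm) ring_scheme" (structure)

sublocale bivariate \<subseteq> T: UP_cring R "UP R"
  by unfold_locales simp

sublocale bivariate \<subseteq> U: UP_cring "UP R" "UP (UP R)"
  by unfold_locales simp

sublocale localised_ring \<subseteq> bi: bivariate P
  by unfold_locales

context bivariate
begin

definition cc :: "'a \<Rightarrow> nat \<Rightarrow> nat \<Rightarrow> 'a" where
  "cc r = monom (UP (UP R)) (monom (UP R) r 0) 0"

text \<open>The element Y + s X, where Y is the variable of the coefficient ring \<open>UP R\<close>
  and X is the outer variable.\<close>

definition pt :: "'a \<Rightarrow> nat \<Rightarrow> nat \<Rightarrow> 'a" where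
  "pt s = monom (UP (UP R)) (monom (UP R) \<one> 1) 0 \<oplus>\<^bsub>UP (UP R)\<^esub> cc s \<otimes>\<^bsub>UP (UP R)\<^esub> monom (UP (UP R)) \<one>\<^bsub>UP R\<^esub> 1"

text \<open>The substitution \<open>p(Y) \<mapsto> p(Y + s X)\<close> of Quillen's patching argument.\<close>

definition tay :: "'a \<Rightarrow> (nat \<Rightarrow> 'a) \<Rightarrow> nat \<Rightarrow> nat \<Rightarrow> 'a" where
  "tay s = eval R (UP (UP R)) cc (pt s)"

lemma cc_hom: "cc \<in> ring_hom R (UP (UP R))"
  using ring_hom_trans[OF T.const_hom U.const_hom] by (simp add: comp_def cc_def[abs_def])

lemma cc_closed [simp]: "r \<in> carrier R \<Longrightarrow> cc r \<in> carrier (UP (UP R))"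
  by (rule ring_hom_closed[OF cc_hom])

lemma pt_closed [simp]: "s \<in> carrier R \<Longrightarrow> pt s \<in> carrier (UP (UP R))"
  by (simp add: pt_def)

lemma
  assumes "s \<in> carrier R"
  shows tay_hom: "tay s \<in> ring_hom (UP R) (UP (UP R))"
    and tay_const: "r \<in> carrier R \<Longrightarrow> tay s (monom (UP R) r 0) = cc r"
    and tay_X: "tay s (monom (UP R) \<one> 1) = pt s"
  unfolding tay_def
  using UP_eval_hom[OF R.is_cring U.UP_cring cc_hom pt_closed[OF assms]]
    UP_eval_const[OF R.is_cring U.UP_cring cc_hom pt_closed[OF assms]]
    UP_eval_X[OF R.is_cring U.UP_cring cc_hom pt_closed[OF assms]] by auto

lemma tay_eqI:
  assumes "s \<in> carrier R" "cring A" and f: "f \<in> ring_hom (UP (UP R)) A" and "g \<in> ring_hom (UP R) A"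
    and "\<And>r. r \<in> carrier R \<Longrightarrow> f (cc r) = g (monom (UP R) r 0)" "f (pt s) = g (monom (UP R) \<one> 1)"
    and "p \<in> carrier (UP R)"
  shows "f (tay s p) = g p"
proof -
  have "(f \<circ> tay s) p = g p"
  proof (rule UP_hom_eqI[OF R.is_cring assms(2)])
    show "f \<circ> tay s \<in> ring_hom (UP R) A" by (rule ring_hom_trans[OF tay_hom[OF assms(1)] f])
  qed (use assms in \<open>simp_all only: comp_apply tay_const tay_X\<close>)
  then show ?thesis by simp
qed

lemma tay_app_0:
  assumes "s \<in> carrier R" "p \<in> carrier (UP R)"
  shows "tay s p 0 = p"
proof (rule tay_eqI[where f = "\<lambda>q. q 0" and g = "\<lambda>p. p", OF assms(1) T.UP_cring U.app_0_hom])
  show "(\<lambda>p. p) \<in> ring_hom (UP R) (UP R)" by (rule ring_hom_memI) auto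
qed (use assms in \<open>auto simp: cc_def pt_def\<close>)

text \<open>Replacing X by r X sends Y + s X to Y + r s X and fixes the constants from
  \<open>R\<close>.\<close>

lemma dil_tay:
  assumes "r \<in> carrier R" "s \<in> carrier R" "p \<in> carrier (UP R)"
  shows "U.dil (monom (UP R) r 0) (tay s p) = tay (r \<otimes> s) p"
proof (rule tay_eqI[OF assms(2) U.UP_cring])
  let ?d = "U.dil (monom (UP R) r 0)"
  show d: "?d \<in> ring_hom (UP (UP R)) (UP (UP R))" using assms by (intro U.dil_hom) auto
  show "tay (r \<otimes> s) \<in> ring_hom (UP R) (UP (UP R))" using assms by (intro tay_hom) auto
  show "p \<in> carrier (UP R)" by fact
  have dc: "?d (cc t) = cc t" if "t \<in> carrier R" for t
    using that assms unfolding cc_def by (intro U.dil_const) auto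
  then show "?d (cc t) = tay (r \<otimes> s) (monom (UP R) t 0)" if "t \<in> carrier R" for t
    using that assms by (simp add: tay_const)
  have "?d (monom (UP (UP R)) \<one>\<^bsub>UP R\<^esub> 1) = cc r \<otimes>\<^bsub>UP (UP R)\<^esub> monom (UP (UP R)) \<one>\<^bsub>UP R\<^esub> 1"
    using assms unfolding cc_def by (intro U.dil_X) auto
  moreover have "?d (monom (UP (UP R)) (monom (UP R) \<one> 1) 0) = monom (UP (UP R)) (monom (UP R) \<one> 1) 0"
    using assms by (intro U.dil_const) auto
  ultimately have "?d (pt s) = pt (r \<otimes> s)"
    unfolding pt_def using assms ring_hom_mult[OF cc_hom, of r s]
    by (simp add: ring_hom_add[OF d] ring_hom_mult[OF d] dc U.P.m_ac U.P.m_comm del: One_nat_def)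
  then show "?d (pt s) = tay (r \<otimes> s) (monom (UP R) \<one> 1)"
    using assms tay_X[of "r \<otimes> s"] by simp
qed

lemma shift_exists:
  assumes t: "t \<in> carrier R"
  obtains \<theta> where "\<theta> \<in> ring_hom (UP (UP R)) (UP (UP R))"
    "\<And>s p. s \<in> carrier R \<Longrightarrow> p \<in> carrier (UP R) \<Longrightarrow> \<theta> (tay s p) = tay (s \<oplus> t) p"
proof
  let ?X = "monom (UP (UP R)) \<one>\<^bsub>UP R\<^esub> 1"
  \<comment> \<open>The substitution of Y + t X for Y that fixes X; it sends Y + s X to Y + (s + t)
    X.\<close>
  let ?\<theta> = "eval (UP R) (UP (UP R)) (tay t) ?X"
  note ev = UP_eval_hom[OF T.UP_cring U.UP_cring tay_hom[OF t] U.monom_one_one_closed]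
    UP_eval_const[OF T.UP_cring U.UP_cring tay_hom[OF t] U.monom_one_one_closed]
    UP_eval_X[OF T.UP_cring U.UP_cring tay_hom[OF t] U.monom_one_one_closed]
  show hom: "?\<theta> \<in> ring_hom (UP (UP R)) (UP (UP R))" by (rule ev)
  fix s p assume s: "s \<in> carrier R" and p: "p \<in> carrier (UP R)"
  show "?\<theta> (tay s p) = tay (s \<oplus> t) p"
  proof (rule tay_eqI[OF s U.UP_cring hom _ _ _ p])
    show "tay (s \<oplus> t) \<in> ring_hom (UP R) (UP (UP R))" using s t by (intro tay_hom) auto
    have c: "?\<theta> (cc r) = cc r" if "r \<in> carrier R" for r
      using that t ev(2)[of "monom (UP R) r 0"] tay_const[OF t] by (simp add: cc_def)
    then show "?\<theta> (cc r) = tay (s \<oplus> t) (monom (UP R) r 0)" if "r \<in> carrier R" for r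
      using that s t by (simp add: tay_const)
    have Y: "?\<theta> (monom (UP (UP R)) (monom (UP R) \<one> 1) 0) = pt t"
      using ev(2)[of "monom (UP R) \<one> 1"] tay_X[OF t] by simp
    have "?\<theta> (pt s) = pt t \<oplus>\<^bsub>UP (UP R)\<^esub> cc s \<otimes>\<^bsub>UP (UP R)\<^esub> ?X"
      unfolding pt_def[of s] using s
      by (simp add: ring_hom_add[OF hom] ring_hom_mult[OF hom] c ev(3) Y del: One_nat_def)
    also have "\<dots> = pt (s \<oplus> t)"
      unfolding pt_def using s t ring_hom_add[OF cc_hom, of s t]
      by (simp add: U.P.l_distr U.P.a_ac del: One_nat_def)
    finally show "?\<theta> (pt s) = tay (s \<oplus> t) (monom (UP R) \<one> 1)"
      using s t tay_X[of "s \<oplus> t"] by simp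
  qed
qed

lemma specialise_exists:
  obtains \<zeta> where "\<zeta> \<in> ring_hom (UP (UP R)) (UP R)"
    "\<And>p. p \<in> carrier (UP R) \<Longrightarrow> \<zeta> (tay \<one> p) = p"
    "\<And>p. p \<in> carrier (UP R) \<Longrightarrow> \<zeta> (tay \<zero> p) = monom (UP R) (p 0) 0"
proof
  let ?c = "\<lambda>p. monom (UP R) (p (0::nat)) (0::nat)"
  have c: "?c \<in> ring_hom (UP R) (UP R)"
    using ring_hom_trans[OF T.app_0_hom T.const_hom] by (simp add: comp_def)
  let ?X = "monom (UP R) \<one> 1"
  \<comment> \<open>The substitution of 0 for Y that keeps X, followed by the identification of X
    with the variable of \<open>UP R\<close>.\<close>
  let ?\<zeta> = "eval (UP R) (UP R) ?c ?X"
  note ev = UP_eval_hom[OF T.UP_cring T.UP_cring c T.monom_one_one_closed]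
    UP_eval_const[OF T.UP_cring T.UP_cring c T.monom_one_one_closed]
    UP_eval_X[OF T.UP_cring T.UP_cring c T.monom_one_one_closed]
  show hom: "?\<zeta> \<in> ring_hom (UP (UP R)) (UP R)" by (rule ev)
  have const: "?\<zeta> (cc r) = monom (UP R) r 0" if "r \<in> carrier R" for r
    using that ev(2)[of "monom (UP R) r 0"] by (simp add: cc_def)
  have Y: "?\<zeta> (monom (UP (UP R)) ?X 0) = \<zero>\<^bsub>UP R\<^esub>"
    using ev(2)[of ?X] by simp
  have z: "?\<zeta> (pt s) = monom (UP R) s 0 \<otimes>\<^bsub>UP R\<^esub> ?X" if "s \<in> carrier R" for s
    unfolding pt_def using that
    by (simp add: ring_hom_add[OF hom] ring_hom_mult[OF hom] const ev(3) Y del: One_nat_def)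
  fix p assume p: "p \<in> carrier (UP R)"
  show "?\<zeta> (tay \<one> p) = p"
  proof (rule tay_eqI[where g = "\<lambda>p. p", OF R.one_closed T.UP_cring hom _ const _ p])
    show "(\<lambda>p. p) \<in> ring_hom (UP R) (UP R)" by (rule ring_hom_memI) auto
    show "?\<zeta> (pt \<one>) = ?X" using z[of \<one>] by (simp del: One_nat_def)
  qed
  show "?\<zeta> (tay \<zero> p) = ?c p"
  proof (rule tay_eqI[where g = ?c, OF R.zero_closed T.UP_cring hom c _ _ p])
    show "?\<zeta> (pt \<zero>) = monom (UP R) (?X 0) 0" using z[of \<zero>] by (simp del: One_nat_def)
  qed (simp add: const del: One_nat_def)
qed

end


section \<open>Inverse words\<close>

definition winv :: "'g word \<Rightarrow> 'g word" where
  "winv u = rev (map (\<lambda>(a, b). (a, \<not> b)) u)"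

lemma winv_words [simp]: "winv u \<in> words G \<longleftrightarrow> u \<in> words G"
  by (auto simp: winv_def words_def in_lists_conv_set split: prod.splits)

lemma winv_winv [simp]: "winv (winv u) = u"
  by (simp add: winv_def rev_map comp_def split_def)

lemma map_word_winv: "map_word f (winv u) = winv (map_word f u)"
  by (simp add: map_word_def winv_def rev_map comp_def split_def)

lemma winv_append: "u \<in> words G \<Longrightarrow> (winv u @ u, []) \<in> word_eq G Rel"
  using word_inverse[of u G Rel] by (simp add: winv_def)

lemma append_winv_iff:
  assumes "u \<in> words G" "v \<in> words G"
  shows "(u @ winv v, []) \<in> word_eq G Rel \<longleftrightarrow> (u, v) \<in> word_eq G Rel"
proof
  assume "(u @ winv v, []) \<in> word_eq G Rel"
  then have "(u @ winv v @ v, v) \<in> word_eq G Rel"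
    using word_eq_append_right[OF _ assms(2), of "u @ winv v" "[]"] by simp
  moreover have "(u @ winv v @ v, u) \<in> word_eq G Rel"
    using word_eq_append_left[OF winv_append[OF assms(2)] assms(1)] by simp
  ultimately show "(u, v) \<in> word_eq G Rel" using word_eq.sym word_eq.trans by metis
next
  assume "(u, v) \<in> word_eq G Rel"
  then have "(u @ winv v, v @ winv v) \<in> word_eq G Rel"
    using assms by (intro word_eq_append_right) auto
  moreover have "(v @ winv v, []) \<in> word_eq G Rel"
    using winv_append[of "winv v" G Rel] assms by simp
  ultimately show "(u @ winv v, []) \<in> word_eq G Rel" by (rule word_eq.trans)
qed

text \<open>Dilation is used for the base ring P[Y] and the word w(Y + X) w(Y)^-1. Dilating this
  word by a constant \<open>s\<close> turns it into w(Y + s X) w(Y)^-1.\<close>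

theorem (in localised_ring) patching_locally:
  fixes \<Phi> :: "'v::euclidean_space set"
  assumes \<Phi>: "signed_root_system \<Phi> N c"
    and w: "w \<in> words (steinberg_gens \<Phi> (UP P))"
    and wL: "(map_word lamX w, []) \<in> word_eq (steinberg_gens \<Phi> (UP L)) (steinberg_rels \<Phi> N (UP L))"
  obtains s where "s \<in> S"
    "(map_word (bi.tay s) w, map_word (bi.tay \<zero>) w)
      \<in> word_eq (steinberg_gens \<Phi> (UP (UP P))) (steinberg_rels \<Phi> N (UP (UP P)))"
proof -
  let ?S = "(\<lambda>r. monom (UP P) r 0) ` S"
  have S [simp]: "s \<in> S \<Longrightarrow> s \<in> carrier P" for s by (rule S_carrier)
  interpret l2: localised_ring "UP P" ?S
  proof (unfold_locales)
    show "?S \<subseteq> carrier (UP P)" by auto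
    show "\<one>\<^bsub>UP P\<^esub> \<in> ?S" using S_one UPP.monom_one by (metis image_eqI)
    show "s \<otimes>\<^bsub>UP P\<^esub> t \<in> ?S" if "s \<in> ?S" "t \<in> ?S" for s t
      using that S_mult by (auto simp: UPP.monom_mult[of _ _ 0 0, simplified, symmetric])
  qed
  let ?h = "\<lambda>r. l2.lam (monom (UP P) r 0)"
  have h: "?h \<in> ring_hom P l2.L"
    using ring_hom_trans[OF UPP.const_hom l2.lam_hom] by (simp add: comp_def)
  have inv: "\<exists>t\<in>carrier l2.L. t \<otimes>\<^bsub>l2.L\<^esub> ?h s = \<one>\<^bsub>l2.L\<^esub>" if "s \<in> S" for s
    using l2.lam_inverse[of "monom (UP P) s 0"] that by blast
  \<comment> \<open>The triviality of \<open>w\<close> is known over L[X] but needed over the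
    localisation of P[Y] at the constants from \<open>S\<close>; the universal property provides the
    map between the coefficient rings.\<close>
  obtain \<tau> where \<tau>: "\<tau> \<in> ring_hom L l2.L" "\<And>r. r \<in> carrier P \<Longrightarrow> \<tau> (lam r) = ?h r"
    using localisation_universal[OF l2.cring_L h inv] by blast
  let ?k = "\<lambda>x. monom (UP l2.L) (\<tau> x) 0"
  have k: "?k \<in> ring_hom L (UP l2.L)"
    using ring_hom_trans[OF \<tau>(1) l2.UPL.const_hom] by (simp add: comp_def)
  let ?E = "word_eq (steinberg_gens \<Phi> (UP l2.L)) (steinberg_rels \<Phi> N (UP l2.L))"
  have loc: "(map_word l2.lamX (map_word (bi.tay s) w), []) \<in> ?E" if s: "s \<in> carrier P" for s
  proof -
    have pt: "l2.lamX (bi.pt s) \<in> carrier (UP l2.L)" using s by simp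
    \<comment> \<open>The substitution of Y + s X, carried out over the localisation. Substituting
      and then localising agrees with localising and then applying \<open>?\<psi>\<close>, so the
      word inherits triviality from L[X].\<close>
    let ?\<psi> = "eval L (UP l2.L) ?k (l2.lamX (bi.pt s))"
    note ev = UP_eval_hom[OF cring_L l2.UPL.UP_cring k pt]
      UP_eval_const[OF cring_L l2.UPL.UP_cring k pt]
      UP_eval_X[OF cring_L l2.UPL.UP_cring k pt]
    have lc: "lamX (monom (UP P) r 0) = monom (UP L) (lam r) 0" if "r \<in> carrier P" for r
      using that by (intro UPL.app_eqI) auto
    have lX: "lamX (monom (UP P) \<one> 1) = monom (UP L) \<one>\<^bsub>L\<^esub> 1"
      by (intro UPL.app_eqI) auto
    have lc2: "l2.lamX (bi.cc r) = monom (UP l2.L) (l2.lam (monom (UP P) r 0)) 0" if "r \<in> carrier P" for r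
      using that by (intro l2.UPL.app_eqI) (auto simp: bi.cc_def)
    have "l2.lamX (bi.tay s p) = (?\<psi> \<circ> lamX) p" if p: "p \<in> carrier (UP P)" for p
    proof (rule bi.tay_eqI[OF s l2.UPL.UP_cring l2.lamX_hom _ _ _ p])
      show "?\<psi> \<circ> lamX \<in> ring_hom (UP P) (UP l2.L)"
        by (rule ring_hom_trans[OF lamX_hom ev(1)])
      show "l2.lamX (bi.cc r) = (?\<psi> \<circ> lamX) (monom (UP P) r 0)" if r: "r \<in> carrier P" for r
        using ev(2)[of "lam r"] r by (simp only: comp_apply lc lc2 \<tau>(2) lam.hom_closed)
      show "l2.lamX (bi.pt s) = (?\<psi> \<circ> lamX) (monom (UP P) \<one> 1)"
        by (simp only: comp_apply lX ev(3))
    qed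
    then have "map_word l2.lamX (map_word (bi.tay s) w) = map_word ?\<psi> (map_word lamX w)"
      unfolding map_word_map_word by (intro map_word_cong[OF w]) simp
    moreover have "(map_word ?\<psi> (map_word lamX w), map_word ?\<psi> []) \<in> ?E"
      by (rule word_eq_map[OF UPL.UP_ring l2.UPL.UP_ring ev(1) wL])
    ultimately show ?thesis by simp
  qed
  \<comment> \<open>At X = 0 both factors become w(Y), so the hypothesis of dilation on constant
    terms holds by cancellation.\<close>
  let ?W = "map_word (bi.tay \<one>) w @ winv (map_word (bi.tay \<zero>) w)"
  have tw: "map_word (bi.tay s) w \<in> words (steinberg_gens \<Phi> (UP (UP P)))" if "s \<in> carrier P" for s
    using steinberg_map_class(1)[OF UPP.UP_ring bi.U.UP_ring bi.tay_hom[OF that] w] .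
  have W: "?W \<in> words (steinberg_gens \<Phi> (UP (UP P)))" using tw by simp
  have t0: "map_word (\<lambda>q. q 0) (map_word (bi.tay s) w) = w" if "s \<in> carrier P" for s
  proof -
    have "map_word (\<lambda>q. q 0) (map_word (bi.tay s) w) = map_word id w"
      unfolding map_word_map_word using that by (intro map_word_cong[OF w]) (simp add: bi.tay_app_0)
    then show ?thesis by (simp add: map_word_def split_def)
  qed
  have W0: "(map_word (\<lambda>q. q 0) ?W, []) \<in> word_eq (steinberg_gens \<Phi> (UP P)) (steinberg_rels \<Phi> N (UP P))"
    using w by (simp add: t0 map_word_winv append_winv_iff word_eq.refl)
  have mw: "map_word l2.lamX (map_word (bi.tay s) w) \<in> words (steinberg_gens \<Phi> (UP l2.L))" if "s \<in> carrier P" for s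
    using word_eq_in_words[OF loc[OF that]] by blast
  have "(map_word l2.lamX (map_word (bi.tay \<one>) w), map_word l2.lamX (map_word (bi.tay \<zero>) w)) \<in> ?E"
    using loc[of \<one>] loc[of \<zero>] by (meson one_closed zero_closed word_eq.sym word_eq.trans)
  then have WL: "(map_word l2.lamX ?W, []) \<in> ?E"
    using mw[of \<one>] mw[of \<zero>] by (simp add: map_word_winv append_winv_iff)
  obtain s' where s': "s' \<in> ?S"
    "(map_word (bi.U.dil s') ?W, []) \<in> word_eq (steinberg_gens \<Phi> (UP (UP P))) (steinberg_rels \<Phi> N (UP (UP P)))"
    by (rule l2.dilation[OF \<Phi> W W0 WL])
  then obtain s where s: "s \<in> S" "s' = monom (UP P) s 0" by blast
  have "map_word (bi.U.dil s') (map_word (bi.tay t) w) = map_word (bi.tay (s \<otimes> t)) w" if "t \<in> carrier P" for t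
    unfolding map_word_map_word s(2) using that s(1) by (intro map_word_cong[OF w]) (simp add: bi.dil_tay)
  then have "map_word (bi.U.dil s') ?W = map_word (bi.tay s) w @ winv (map_word (bi.tay \<zero>) w)"
    using s(1) by (simp add: map_word_winv)
  with s'(2) have "(map_word (bi.tay s) w, map_word (bi.tay \<zero>) w)
      \<in> word_eq (steinberg_gens \<Phi> (UP (UP P))) (steinberg_rels \<Phi> N (UP (UP P)))"
    using tw s(1) by (simp add: append_winv_iff)
  with s(1) that show thesis by blast
qed

text \<open>The elements \<open>s\<close> with w(Y + s X) = w(Y) form an ideal. By the local result
  it meets the complement of every maximal ideal, so it contains 1.\<close>

theorem (in bivariate) patching:
  fixes \<Phi> :: "'v::euclidean_space set"
  assumes \<Phi>: "signed_root_system \<Phi> N c"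
    and w: "w \<in> words (steinberg_gens \<Phi> (UP R))"
    and w0: "(map_word (\<lambda>q. q 0) w, []) \<in> word_eq (steinberg_gens \<Phi> R) (steinberg_rels \<Phi> N R)"
    and wM: "\<And>M. maximalideal M R \<Longrightarrow> (map_word (up_map R (localisation_map R M)) w, [])
      \<in> word_eq (steinberg_gens \<Phi> (UP (localisation_at R M))) (steinberg_rels \<Phi> N (UP (localisation_at R M)))"
  shows "(w, []) \<in> word_eq (steinberg_gens \<Phi> (UP R)) (steinberg_rels \<Phi> N (UP R))"
proof -
  let ?E = "word_eq (steinberg_gens \<Phi> (UP (UP R))) (steinberg_rels \<Phi> N (UP (UP R)))"
  define Q where "Q = {s \<in> carrier R. (map_word (tay s) w, map_word (tay \<zero>) w) \<in> ?E}"
  have ring: "ring (UP R)" "ring (UP (UP R))" using T.UP_ring U.UP_ring .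
  have tw: "map_word (tay s) w \<in> words (steinberg_gens \<Phi> (UP (UP R)))" if "s \<in> carrier R" for s
    using steinberg_map_class(1)[OF ring tay_hom[OF that] w] .
  have Q_mult: "r \<otimes> s \<in> Q" if r: "r \<in> carrier R" and s: "s \<in> Q" for r s
  proof -
    have sc: "s \<in> carrier R" using s by (simp add: Q_def)
    let ?d = "U.dil (monom (UP R) r 0)"
    have d: "?d \<in> ring_hom (UP (UP R)) (UP (UP R))" using r by (intro U.dil_hom) auto
    have e: "map_word ?d (map_word (tay t) w) = map_word (tay (r \<otimes> t)) w" if "t \<in> carrier R" for t
      unfolding map_word_map_word using that r by (intro map_word_cong[OF w]) (simp add: dil_tay)
    have "(map_word (tay s) w, map_word (tay \<zero>) w) \<in> ?E" using s by (simp add: Q_def)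
    from word_eq_map[OF ring(2) ring(2) d this] show ?thesis
      using r sc by (simp add: e Q_def)
  qed
  have Q_add: "s \<oplus> t \<in> Q" if s: "s \<in> Q" and t: "t \<in> Q" for s t
  proof -
    have c: "s \<in> carrier R" "t \<in> carrier R" using s t by (simp_all add: Q_def)
    obtain \<theta> where \<theta>: "\<theta> \<in> ring_hom (UP (UP R)) (UP (UP R))"
      "\<And>s p. s \<in> carrier R \<Longrightarrow> p \<in> carrier (UP R) \<Longrightarrow> \<theta> (tay s p) = tay (s \<oplus> t) p"
      using shift_exists[OF c(2)] by blast
    have e: "map_word \<theta> (map_word (tay r) w) = map_word (tay (r \<oplus> t)) w" if "r \<in> carrier R" for r
      unfolding map_word_map_word using that by (intro map_word_cong[OF w]) (simp add: \<theta>(2))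
    have "(map_word (tay s) w, map_word (tay \<zero>) w) \<in> ?E" using s by (simp add: Q_def)
    \<comment> \<open>Substituting Y + t X for Y in the relation for \<open>s\<close> compares w(Y +
      (s + t) X) with w(Y + t X), and the relation for \<open>t\<close> leads on to w(Y).\<close>
    from word_eq_map[OF ring(2) ring(2) \<theta>(1) this]
    have "(map_word (tay (s \<oplus> t)) w, map_word (tay t) w) \<in> ?E" using c by (simp add: e)
    moreover have "(map_word (tay t) w, map_word (tay \<zero>) w) \<in> ?E" using t by (simp add: Q_def)
    ultimately show ?thesis using c unfolding Q_def by (auto intro: word_eq.trans)
  qed
  have Q_zero: "\<zero> \<in> Q" using tw[of \<zero>] by (simp add: Q_def word_eq.refl)
  have sub: "Q \<subseteq> carrier R" by (auto simp: Q_def)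
  have Q: "ideal Q R"
  proof (rule idealI)
    show "subgroup Q (add_monoid R)"
    proof (rule add.subgroupI)
      show "\<ominus> a \<in> Q" if "a \<in> Q" for a
      proof -
        have "\<ominus> a = \<ominus> \<one> \<otimes> a" using that sub by (auto simp: l_minus)
        then show ?thesis using Q_mult[of "\<ominus> \<one>" a] that by simp
      qed
    qed (use sub Q_zero Q_add in auto)
    show "x \<otimes> a \<in> Q" "a \<otimes> x \<in> Q" if "a \<in> Q" "x \<in> carrier R" for a x
      using Q_mult[OF that(2,1)] that sub m_comm[of a x] by auto
  qed (rule ring_axioms)
  have "\<one> \<in> Q"
  proof (rule ccontr)
    assume "\<one> \<notin> Q"
    then obtain M where M: "maximalideal M R" "Q \<subseteq> M" using maximalideal_exists[OF Q] by blast
    interpret primeideal M R by (rule maximalideal_prime[OF M(1)])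
    have "\<one> \<notin> M" using I_notcarr one_imp_carrier by blast
    interpret loc: localised_ring R "carrier R - M"
      by unfold_locales (use \<open>\<one> \<notin> M\<close> I_prime in auto)
    have "localisation_map R M = loc.lam" by (simp add: fun_eq_iff localisation_map_def loc.lam_def)
    with wM[OF M(1)] have "(map_word loc.lamX w, []) \<in> word_eq (steinberg_gens \<Phi> (UP loc.L)) (steinberg_rels \<Phi> N (UP loc.L))"
      by (simp add: localisation_at_def)
    then obtain s where "s \<in> carrier R - M" "(map_word (tay s) w, map_word (tay \<zero>) w) \<in> ?E"
      by (rule loc.patching_locally[OF \<Phi> w])
    then show False using M(2) by (auto simp: Q_def)
  qed
  then have t: "(map_word (tay \<one>) w, map_word (tay \<zero>) w) \<in> ?E" by (simp add: Q_def)
  \<comment> \<open>Setting Y = 0 in w(Y + X) = w(Y) gives w(X) = w(0), and w(0) is trivial.\<close>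
  obtain \<zeta> where \<zeta>: "\<zeta> \<in> ring_hom (UP (UP R)) (UP R)"
    "\<And>p. p \<in> carrier (UP R) \<Longrightarrow> \<zeta> (tay \<one> p) = p"
    "\<And>p. p \<in> carrier (UP R) \<Longrightarrow> \<zeta> (tay \<zero> p) = monom (UP R) (p 0) 0"
    using specialise_exists by blast
  have "map_word \<zeta> (map_word (tay \<one>) w) = map_word (\<lambda>q. q) w"
    unfolding map_word_map_word by (intro map_word_cong[OF w]) (simp add: \<zeta>(2))
  also have "\<dots> = w" by (simp add: map_word_def split_def)
  finally have "map_word \<zeta> (map_word (tay \<one>) w) = w" .
  moreover have "map_word \<zeta> (map_word (tay \<zero>) w) = map_word (\<lambda>r. monom (UP R) r 0) (map_word (\<lambda>q. q 0) w)"
    unfolding map_word_map_word by (intro map_word_cong[OF w]) (simp add: \<zeta>(3))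
  ultimately have "(w, map_word (\<lambda>r. monom (UP R) r 0) (map_word (\<lambda>q. q 0) w))
      \<in> word_eq (steinberg_gens \<Phi> (UP R)) (steinberg_rels \<Phi> N (UP R))"
    using word_eq_map[OF ring(2) ring(1) \<zeta>(1) t] by (simp only:)
  moreover have "(map_word (\<lambda>r. monom (UP R) r 0) (map_word (\<lambda>q. q 0) w), [])
      \<in> word_eq (steinberg_gens \<Phi> (UP R)) (steinberg_rels \<Phi> N (UP R))"
    using word_eq_map[OF ring_axioms ring(1) T.const_hom w0] by simp
  ultimately show ?thesis by (rule word_eq.trans)
qed

theorem theorem2:
  fixes \<Phi> :: "'v::euclidean_space set" and N :: "'v \<Rightarrow> 'v \<Rightarrow> int"
    and scale :: "complex \<Rightarrow> 'l::ab_group_add \<Rightarrow> 'l" and br :: "'l \<Rightarrow> 'l \<Rightarrow> 'l"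
    and H :: "'l set" and rt :: "'v \<Rightarrow> 'l \<Rightarrow> complex" and e :: "'v \<Rightarrow> 'l"
    and R :: "('a, 'm) ring_scheme" (structure)
    and g :: "('v \<times> (nat \<Rightarrow> 'a)) word set"
  assumes "irreducible_root_system \<Phi>" and "simply_laced \<Phi>" and "DIM('v) \<ge> 3"
    and "chevalley_basis scale br \<Phi> H rt e N"
    and "cring R"
    and "g \<in> carrier (steinberg_group \<Phi> N (UP R))"
    and "steinberg_map \<Phi> N (UP R) R (eval R R id \<zero>) g = \<one>\<^bsub>steinberg_group \<Phi> N R\<^esub>"
  shows "g = \<one>\<^bsub>steinberg_group \<Phi> N (UP R)\<^esub> \<longleftrightarrow>
    (\<forall>M. maximalideal M R \<longrightarrow>
       steinberg_map \<Phi> N (UP R) (UP (localisation_at R M)) (up_map R (localisation_map R M)) g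
         = \<one>\<^bsub>steinberg_group \<Phi> N (UP (localisation_at R M))\<^esub>)"
proof -
  interpret bivariate R using assms(5) by (rule bivariate.intro)
  obtain c where c: "signed_root_system \<Phi> N c"
    using signed_root_system_chevalley[OF assms(1-4)] .
  obtain w where w: "w \<in> words (steinberg_gens \<Phi> (UP R))"
    and g: "g = word_eq (steinberg_gens \<Phi> (UP R)) (steinberg_rels \<Phi> N (UP R)) `` {w}"
    using assms(6) unfolding steinberg_group_def by (rule presented_group_carrierE)
  have one: "steinberg_map \<Phi> N (UP R) A f g = \<one>\<^bsub>steinberg_group \<Phi> N A\<^esub> \<longleftrightarrow>
      (map_word f w, []) \<in> word_eq (steinberg_gens \<Phi> A) (steinberg_rels \<Phi> N A)"
    if "ring A" "f \<in> ring_hom (UP R) A" for f :: "_ \<Rightarrow> 'b" and A :: "('b, 'n) ring_scheme"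
    unfolding g using steinberg_map_class[OF T.UP_ring that w]
    by (simp add: steinberg_group_def presented_group_one word_class_eq_iff)
  have one_g: "g = \<one>\<^bsub>steinberg_group \<Phi> N (UP R)\<^esub> \<longleftrightarrow>
      (w, []) \<in> word_eq (steinberg_gens \<Phi> (UP R)) (steinberg_rels \<Phi> N (UP R))"
    unfolding g using w by (simp add: steinberg_group_def presented_group_one word_class_eq_iff)
  note ev = UP_eval_hom[OF is_cring is_cring id_ring_hom zero_closed]
    UP_eval_const[OF is_cring is_cring id_ring_hom zero_closed]
    UP_eval_X[OF is_cring is_cring id_ring_hom zero_closed]
  \<comment> \<open>Evaluation at 0 and the constant coefficient are both homomorphisms, and they
    agree on constants and on X.\<close>
  have "eval R R id \<zero> p = p 0" if "p \<in> carrier (UP R)" for p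
  proof (rule UP_hom_eqI[OF is_cring is_cring ev(1) T.app_0_hom])
    show "eval R R id \<zero> (monom (UP R) \<one> 1) = monom (UP R) \<one> 1 0"
      using ev(3) by (simp del: One_nat_def)
  qed (use that in \<open>simp_all add: ev(2)\<close>)
  then have "map_word (eval R R id \<zero>) w = map_word (\<lambda>q. q 0) w" by (rule map_word_cong[OF w])
  with assms(7) have w0: "(map_word (\<lambda>q. q 0) w, []) \<in> word_eq (steinberg_gens \<Phi> R) (steinberg_rels \<Phi> N R)"
    by (simp add: one[OF ring_axioms ev(1)])
  have M: "ring (UP (localisation_at R M))"
    "up_map R (localisation_map R M) \<in> ring_hom (UP R) (UP (localisation_at R M))" if "maximalideal M R" for M
    using UP_ring.UP_ring[OF UP_ring.intro[OF cring.axioms(1)[OF cring_localisation_at[OF is_cring that]]]]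
      up_map_ring_hom[OF is_cring cring_localisation_at[OF is_cring that] localisation_map_ring_hom[OF is_cring that]]
    by auto
  show ?thesis
  proof
    assume "g = \<one>\<^bsub>steinberg_group \<Phi> N (UP R)\<^esub>"
    then have "(w, []) \<in> word_eq (steinberg_gens \<Phi> (UP R)) (steinberg_rels \<Phi> N (UP R))" by (simp add: one_g)
    then have "(map_word (up_map R (localisation_map R M)) w, map_word (up_map R (localisation_map R M)) [])
        \<in> word_eq (steinberg_gens \<Phi> (UP (localisation_at R M))) (steinberg_rels \<Phi> N (UP (localisation_at R M)))"
      if "maximalideal M R" for M
      by (rule word_eq_map[OF T.UP_ring M(1)[OF that] M(2)[OF that]])
    then show "\<forall>M. maximalideal M R \<longrightarrow>
       steinberg_map \<Phi> N (UP R) (UP (localisation_at R M)) (up_map R (localisation_map R M)) g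
         = \<one>\<^bsub>steinberg_group \<Phi> N (UP (localisation_at R M))\<^esub>"
      by (simp add: one[OF M])
  next
    assume "\<forall>M. maximalideal M R \<longrightarrow>
       steinberg_map \<Phi> N (UP R) (UP (localisation_at R M)) (up_map R (localisation_map R M)) g
         = \<one>\<^bsub>steinberg_group \<Phi> N (UP (localisation_at R M))\<^esub>"
    then show "g = \<one>\<^bsub>steinberg_group \<Phi> N (UP R)\<^esub>"
      unfolding one_g by (intro patching[OF c w w0]) (simp add: one[OF M])
  qed
qed

end
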